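(* The period integral $I_{u^kx^J,\mathsf t\delta}(s)$ is annihilated by the differential operator $$R_{(k,J)}(s,\vartheta_s)=P(\vartheta_s)-s^\gamma Q_{k,J}(\vartheta_s),\qquad\vartheta_s=s\frac{\partial}{\partial s},$$ where $$P(\vartheta_s)=(-\vartheta_s)_\gamma,\qquad Q_{k,J}(\vartheta_s)=(-1)^\gamma\prod_{q=1}^{n+1}\bigl(\mathcal L_q(J,-\vartheta_s,k)\bigr)_{B_q}.$$ This operator has regular singularities at the points $s=0$, $s=\infty$ and the points $s$ with $\Bigl(\prod_{q=1}^{n+1}B_q^{B_q}\Bigr)\Bigl(\frac s\gamma\Bigr)^\gamma=1$ of $\mathbb P^1$. In other words, $$[P(\vartheta_s)-s^\gamma Q_{k,J}(\vartheta_s)]\,I_{u^kx^J,\mathsf t\delta}(s)=0.$$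
   Context: $(a)_m=a(a+1)\cdots(a+m-1)$ is the Pochhammer symbol. Let $n\ge 1$ and $\mathbb T^n=(\mathbb C^\times)^n$. Let $\alpha(1),\dots,\alpha(n+2)\in\mathbb Z^n$ with $\alpha(n+1)=0$, such that the convex hull of $\alpha(1),\dots,\alpha(n+1)$ is an $n$-dimensional simplex and $\alpha(n+2)$ lies in its interior. Put $f(x)=\sum_{j=1}^n x^{\alpha(j)}+1+s\,x^{\alpha(n+2)}$ with parameter $s$ ($f$ is assumed $\Delta$-regular, i.e. nondegenerate for its Newton polytope $\Delta=\Delta(f)$), and $Z_f=\{x\in\mathbb T^n:f(x)=0\}$. $\mathsf L$ is the $(n+2)\times(n+2)$ matrix with rows $(\alpha(j),0,1)$ for $1\le j\le n$, then $(0,\dots,0,0,1)$, then $(\alpha(n+2),1,1)$; $\gamma=\det\mathsf L=n!\,\mathrm{vol}(\Delta(f))$, the $\alpha(j)$ being ordered so that $\gamma>0$. $\mathcal L_q(J,z,k)=(J,z,k)\cdot w_q$ with $w_q$ the $q$-th column of $\mathsf L^{-1}$. Explicitly $\mathcal L_q=\frac{\langle v_q,J\rangle-B_qz}{\gamma}+\delta_{q,n+1}k$ for $1\le q\le n+1$ with $v_q\in\mathbb Z^n$. Here $B_q=n!\,\mathrm{vol}$ of the convex hull of $\{\alpha(i)\}_{i=1}^{n+2}\setminus\{\alpha(q)\}$, and $\sum_{q=1}^{n+1}B_q=\gamma$. $u^kx^J$ ($k\ge1$, $J\in\mathbb Z^n$, $J/k\in\Delta$) is a monomial representative of an element of $R_f^+=S_\Delta^+/(\mathcal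 D_uS_\Delta+\sum_i\mathcal D_{x_i}S_\Delta)$. Here $S_\Delta=\mathbb C\oplus\bigoplus_{k\ge1,\ \alpha/k\in\Delta}\mathbb C u^kx^\alpha$, $S_\Delta^+$ is the span of the monomials with $k\ge1$, $\mathcal D_u(g)=e^{uf}u\partial_u(e^{-uf}g)$, $\mathcal D_{x_i}(g)=e^{uf}x_i\partial_{x_i}(e^{-uf}g)$. For $\delta(s)\in H_{n-1}(Z_f)$ with Leray coboundary (tube) $\mathsf t\delta(s)\in H_n(\mathbb T^n\setminus Z_f)$, $I_{u^kx^J,\mathsf t\delta}(s)=\int_{\mathsf t\delta(s)}\frac{(k-1)!\,x^J}{f(x)^k}\frac{dx_1\wedge\dots\wedge dx_n}{x_1\cdots x_n}$.
   Formalization: Printed sign fails for odd γ (n=1, f=x^{-3}+1+s/x, J=-1, k=1); proved with (-s)^γ for s^γ in R and in the singular-point equation (same for even γ). Singular points are those of R undivided by its leading coefficient; at s=∞ only Fuchs' condition is claimed, since ∞ may be ordinary. *)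

theory Defs
  imports
    "HOL-Homology.Homology"
    "HOL-Complex_Analysis.Complex_Analysis"
    "HOL-Computational_Algebra.Polynomial"
begin

section \<open>Laurent polynomials on the torus\<close>

text \<open>The linearly ordered finite type \<open>'n\<close> plays the role of \<open>{1, \<dots>, n}\<close>. A Laurent polynomial
  in n variables is its finitely supported coefficient function on \<open>\<int>\<^sup>n\<close>.\<close>

type_synonym 'n laurent = "(int^'n) \<Rightarrow>\<^sub>0 complex"

definition torus :: "(complex^'n) set" where
  "torus = {x. \<forall>i. x $ i \<noteq> 0}"

definition laurent_monom :: "int^'n \<Rightarrow> complex^'n \<Rightarrow> complex" where
  "laurent_monom a x = (\<Prod>i\<in>UNIV. (x $ i) powi (a $ i))"

definition laurent_eval :: "'n::finite laurent \<Rightarrow> complex^'n \<Rightarrow> complex" where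
  "laurent_eval f x = (\<Sum>a\<in>Poly_Mapping.keys f. Poly_Mapping.lookup f a * laurent_monom a x)"

text \<open>The value at x of \<open>x\<^sub>i \<partial>f/\<partial>x\<^sub>i\<close>.\<close>

definition laurent_log_deriv :: "'n::finite \<Rightarrow> 'n laurent \<Rightarrow> complex^'n \<Rightarrow> complex" where
  "laurent_log_deriv i f x =
     (\<Sum>a\<in>Poly_Mapping.keys f. of_int (a $ i) * Poly_Mapping.lookup f a * laurent_monom a x)"

definition rvec :: "int^'n \<Rightarrow> real^'n" where
  "rvec a = (\<chi> i. real_of_int (a $ i))"

definition newton_polytope :: "'n::finite laurent \<Rightarrow> (real^'n) set" where
  "newton_polytope f = convex hull (rvec ` Poly_Mapping.keys f)"

definition face_part :: "'n::finite laurent \<Rightarrow> (real^'n) set \<Rightarrow> 'n laurent" where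
  "face_part f F = (\<Sum>a | a \<in> Poly_Mapping.keys f \<and> rvec a \<in> F.
                      Poly_Mapping.single a (Poly_Mapping.lookup f a))"

definition delta_regular :: "'n::finite laurent \<Rightarrow> bool" where
  "delta_regular f \<longleftrightarrow>
     (\<forall>F. F face_of newton_polytope f \<and> F \<noteq> {} \<longrightarrow>
        \<not> (\<exists>x\<in>torus. laurent_eval (face_part f F) x = 0 \<and>
                     (\<forall>i. laurent_log_deriv i (face_part f F) x = 0)))"

definition zero_locus :: "'n::finite laurent \<Rightarrow> (complex^'n) set" where
  "zero_locus f = {x\<in>torus. laurent_eval f x = 0}"


section \<open>The exponents and the polynomial f\<close>

text \<open>The n + 2 exponents are indexed by \<open>'n + bool\<close>: \<open>Inl j\<close> is the index j for j in
  \<open>{1, \<dots>, n}\<close>, \<open>Inr False\<close> is the index n + 1 and \<open>Inr True\<close> the index n + 2.\<close>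

definition vertex_indices :: "('n + bool) set" where
  "vertex_indices = - {Inr True}"

definition simplicial_exponents :: "('n::finite + bool \<Rightarrow> int^'n) \<Rightarrow> bool" where
  "simplicial_exponents \<alpha> \<longleftrightarrow>
     \<alpha> (Inr False) = 0 \<and>
     int CARD('n) simplex (convex hull (rvec ` \<alpha> ` vertex_indices)) \<and>
     rvec (\<alpha> (Inr True)) \<in> interior (convex hull (rvec ` \<alpha> ` vertex_indices))"

definition exponent_polytope :: "('n::finite + bool \<Rightarrow> int^'n) \<Rightarrow> (real^'n) set" where
  "exponent_polytope \<alpha> = convex hull (rvec ` range \<alpha>)"

definition f_poly :: "('n::finite + bool \<Rightarrow> int^'n) \<Rightarrow> complex \<Rightarrow> 'n laurent" where
  "f_poly \<alpha> s = (\<Sum>j\<in>UNIV. Poly_Mapping.single (\<alpha> (Inl j)) 1)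
                + Poly_Mapping.single 0 1 + Poly_Mapping.single (\<alpha> (Inr True)) s"

text \<open>In the columns of \<open>L_matrix\<close> (and the rows of its inverse), \<open>Inl i\<close> is the i-th coordinate of
  J, and \<open>Inr False\<close>, \<open>Inr True\<close> are the coordinates z and k of the row vector \<open>(J, z, k)\<close>.\<close>

definition L_matrix ::
    "('n::finite + bool \<Rightarrow> int^'n) \<Rightarrow> 'a::comm_ring_1 ^ ('n + bool) ^ ('n + bool)" where
  "L_matrix \<alpha> = (\<chi> r c. case c of
       Inl i \<Rightarrow> of_int (\<alpha> r $ i)
     | Inr False \<Rightarrow> (if r = Inr True then 1 else 0)
     | Inr True \<Rightarrow> 1)"

definition gam :: "('n::finite + bool \<Rightarrow> int^'n) \<Rightarrow> nat" where
  "gam \<alpha> = nat (det (L_matrix \<alpha> :: int ^ ('n + bool) ^ ('n + bool)))"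

text \<open>The normalized volume of a lattice polytope is an integer, so the rounding is exact.\<close>

definition B_vol :: "('n::finite + bool \<Rightarrow> int^'n) \<Rightarrow> 'n + bool \<Rightarrow> nat" where
  "B_vol \<alpha> q = nat \<lfloor>fact CARD('n) * measure lborel (convex hull (rvec ` \<alpha> ` (- {q})))\<rfloor>"

text \<open>\<open>\<L>\<^sub>q(J, z, k)\<close>, where the slot z is filled by a polynomial.\<close>

definition L_form ::
    "('n::finite + bool \<Rightarrow> int^'n) \<Rightarrow> 'n + bool \<Rightarrow> int^'n \<Rightarrow> complex poly \<Rightarrow> nat \<Rightarrow> complex poly" where
  "L_form \<alpha> q J z k =
     (let w = column q (matrix_inv (L_matrix \<alpha> :: complex ^ ('n + bool) ^ ('n + bool))) in
       (\<Sum>i\<in>UNIV. [: of_int (J $ i) * w $ Inl i :])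
       + smult (w $ Inr False) z + [: of_nat k * w $ Inr True :])"


section \<open>The differential operator\<close>

text \<open>P and Q are polynomials in the indeterminate \<open>\<vartheta> = [:0, 1:]\<close>.\<close>

definition P_poly :: "('n::finite + bool \<Rightarrow> int^'n) \<Rightarrow> complex poly" where
  "P_poly \<alpha> = pochhammer (- [:0, 1:]) (gam \<alpha>)"

definition Q_poly :: "('n::finite + bool \<Rightarrow> int^'n) \<Rightarrow> nat \<Rightarrow> int^'n \<Rightarrow> complex poly" where
  "Q_poly \<alpha> k J =
     smult ((-1) ^ gam \<alpha>)
       (\<Prod>q\<in>vertex_indices. pochhammer (L_form \<alpha> q J (- [:0, 1:]) k) (B_vol \<alpha> q))"

type_synonym diff_op = "(complex \<Rightarrow> complex) \<Rightarrow> complex \<Rightarrow> complex"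

definition theta :: diff_op where
  "theta g s = s * deriv g s"

definition theta_poly :: "complex poly \<Rightarrow> diff_op" where
  "theta_poly p g s = (\<Sum>i\<le>Polynomial.degree p. Polynomial.coeff p i * (theta ^^ i) g s)"

text \<open>The factor is \<open>(-s)\<^sup>\<gamma>\<close>. With the factor \<open>s\<^sup>\<gamma>\<close> and this \<open>Q_poly\<close>, which contains
  \<open>(-1)\<^sup>\<gamma>\<close>, the sign is wrong for odd \<open>\<gamma>\<close>: with \<open>\<partial>\<^sub>q\<close>, \<open>\<vartheta>\<^sub>q\<close> the derivatives in the
  coefficients of f, differentiation of \<open>1 / f\<^sup>k\<close> gives \<open>\<partial>\<^sub>s ^ \<gamma> = (\<Prod>q. \<partial>\<^sub>q ^ B\<^sub>q)\<close>, torus homogeneity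
  gives \<open>\<vartheta>\<^sub>q = - \<L>\<^sub>q(J, -\<vartheta>, k)\<close>, and hence
  \<open>P(\<vartheta>) = s\<^sup>\<gamma> (\<Prod>q. pochhammer (\<L>\<^sub>q(J, -\<vartheta>, k)) B\<^sub>q) = (-s)\<^sup>\<gamma> Q(\<vartheta>)\<close> on period integrals.
  For even \<open>\<gamma>\<close> the two factors agree.\<close>

definition R_op :: "('n::finite + bool \<Rightarrow> int^'n) \<Rightarrow> nat \<Rightarrow> int^'n \<Rightarrow> diff_op" where
  "R_op \<alpha> k J g s =
     theta_poly (P_poly \<alpha>) g s - (- s) ^ gam \<alpha> * theta_poly (Q_poly \<alpha> k J) g s"

definition has_coeffs :: "diff_op \<Rightarrow> complex set \<Rightarrow> nat \<Rightarrow> (nat \<Rightarrow> complex \<Rightarrow> complex) \<Rightarrow> bool" where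
  "has_coeffs L S m b \<longleftrightarrow>
     (\<forall>i\<le>m. b i holomorphic_on S) \<and>
     (\<forall>s\<in>S. \<forall>g. g analytic_on {s} \<longrightarrow> L g s = (\<Sum>i\<le>m. b i s * (deriv ^^ i) g s))"

text \<open>A singular point is one where the leading coefficient vanishes or some coefficient is not
  holomorphic; the operator is not divided by its leading coefficient first. (After such a division
  \<open>R_op\<close> has no pole at s = 0: \<open>P(\<vartheta>) = (-1)\<^sup>\<gamma> s\<^sup>\<gamma> (d/ds)\<^sup>\<gamma>\<close>.)\<close>

definition singular_point :: "diff_op \<Rightarrow> complex \<Rightarrow> bool" where
  "singular_point L a \<longleftrightarrow>
     \<not> (\<exists>r>0. \<exists>m b. has_coeffs L (ball a r) m b \<and> (\<forall>s\<in>ball a r. b m s \<noteq> 0))"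

text \<open>Fuchs' condition: the quotient of the i-th coefficient by the leading (m-th) one has at a a
  pole of order at most m - i.\<close>

definition fuchs_regular :: "diff_op \<Rightarrow> complex \<Rightarrow> bool" where
  "fuchs_regular L a \<longleftrightarrow>
     (\<exists>r>0. \<exists>m b. has_coeffs L (ball a r - {a}) m b \<and>
        (\<forall>s\<in>ball a r - {a}. b m s \<noteq> 0) \<and>
        (\<forall>i<m. \<exists>h. h holomorphic_on ball a r \<and>
            (\<forall>s\<in>ball a r - {a}. (s - a) ^ (m - i) * (b i s / b m s) = h s)))"

text \<open>The operator in the coordinate \<open>t = 1/s\<close>.\<close>

definition at_infinity_coord :: "diff_op \<Rightarrow> diff_op" where
  "at_infinity_coord L g t = L (\<lambda>s. g (inverse s)) (inverse t)"


section \<open>Integration over homology classes\<close>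

fun Ck_on :: "nat \<Rightarrow> 'a::real_normed_vector set \<Rightarrow> ('a \<Rightarrow> 'b::real_normed_vector) \<Rightarrow> bool" where
  "Ck_on 0 S f \<longleftrightarrow> continuous_on S f"
| "Ck_on (Suc k) S f \<longleftrightarrow>
     (\<exists>f'. (\<forall>x\<in>S. (f has_derivative f' x) (at x)) \<and> (\<forall>v. Ck_on k S (\<lambda>x. f' x v)))"

definition smooth_on :: "'a::real_normed_vector set \<Rightarrow> ('a \<Rightarrow> 'b::real_normed_vector) \<Rightarrow> bool" where
  "smooth_on S f \<longleftrightarrow> (\<forall>k. Ck_on k S f)"

text \<open>\<open>corner_simplex\<close> parametrizes the standard n-simplex by the barycentric coordinates with
  indices 1, ..., n, the coordinate with index 0 being determined by them.\<close>

definition corner_simplex :: "(real^'n) set" where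
  "corner_simplex = {t. (\<forall>j. 0 \<le> t $ j) \<and> (\<Sum>j\<in>UNIV. t $ j) \<le> 1}"

definition rank :: "'n::{finite,linorder} \<Rightarrow> nat" where
  "rank j = card {i. i \<le> j}"

definition bary :: "real^'n::{finite,linorder} \<Rightarrow> nat \<Rightarrow> real" where
  "bary t m = (if m = 0 then 1 - (\<Sum>j\<in>UNIV. t $ j) else (\<Sum>j | rank j = m. t $ j))"

definition smooth_simplex :: "((nat \<Rightarrow> real) \<Rightarrow> complex^'n::{finite,linorder}) \<Rightarrow> bool" where
  "smooth_simplex \<sigma> \<longleftrightarrow>
     (\<exists>(S :: (real^'n::{finite,linorder}) set) F. open S \<and> corner_simplex \<subseteq> S \<and> smooth_on S F \<and>
            (\<forall>t\<in>corner_simplex. F t = \<sigma> (bary t)))"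

text \<open>The integral over the singular n-simplex \<open>\<sigma>\<close> of the n-form
  \<open>g dx\<^sub>1 \<and> \<dots> \<and> dx\<^sub>n\<close>, pulled back to \<open>corner_simplex\<close>.\<close>

definition simplex_integral ::
    "(complex^'n::{finite,linorder} \<Rightarrow> complex) \<Rightarrow> ((nat \<Rightarrow> real) \<Rightarrow> complex^'n::{finite,linorder}) \<Rightarrow> complex" where
  "simplex_integral g \<sigma> =
     integral corner_simplex (\<lambda>t. g (\<sigma> (bary t)) *
       det (\<chi> i j. frechet_derivative (\<lambda>u. \<sigma> (bary u)) (at t within corner_simplex) (axis j 1) $ i))"

definition chain_integral ::
    "(complex^'n::{finite,linorder} \<Rightarrow> complex) \<Rightarrow> (complex^'n::{finite,linorder}) chain \<Rightarrow> complex" where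
  "chain_integral g c =
     (\<Sum>\<sigma>\<in>Poly_Mapping.keys c. of_int (Poly_Mapping.lookup c \<sigma>) * simplex_integral g \<sigma>)"

text \<open>The elements of the carrier of \<open>homology_group p (top_of_set X)\<close> are the sets
  \<open>homology_class p X c\<close> with \<open>cycle p X c\<close>.\<close>

definition cycle :: "nat \<Rightarrow> 'a::topological_space set \<Rightarrow> 'a chain \<Rightarrow> bool" where
  "cycle p X c \<longleftrightarrow> singular_relcycle p (top_of_set X) {} c"

definition homology_class :: "nat \<Rightarrow> 'a::topological_space set \<Rightarrow> 'a chain \<Rightarrow> 'a chain set" where
  "homology_class p X c = homologous_rel_set p (top_of_set X) {} c"

text \<open>The value v of the integral of the closed form \<open>g dx\<^sub>1 \<and> \<dots> \<and> dx\<^sub>n\<close> over a class in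
  \<open>H\<^sub>n(X)\<close> is computed on a smooth cycle in the class.\<close>

definition has_class_integral ::
    "(complex^'n::{finite,linorder}) set \<Rightarrow> (complex^'n::{finite,linorder} \<Rightarrow> complex)
       \<Rightarrow> (complex^'n::{finite,linorder}) chain set \<Rightarrow> complex \<Rightarrow> bool" where
  "has_class_integral X g \<kappa> v \<longleftrightarrow>
     (\<exists>c. cycle CARD('n) X c \<and> (\<forall>\<sigma>\<in>Poly_Mapping.keys c. smooth_simplex \<sigma>) \<and>
          \<kappa> = homology_class CARD('n) X c \<and> v = chain_integral g c)"

definition period_integrand ::
    "'n::finite laurent \<Rightarrow> nat \<Rightarrow> int^'n \<Rightarrow> complex^'n \<Rightarrow> complex" where
  "period_integrand f k J x =
     fact (k - 1) * laurent_monom J x / laurent_eval f x ^ k / (\<Prod>i\<in>UNIV. x $ i)"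


section \<open>Horizontal families of cycles and the Leray coboundary\<close>

definition chain_support :: "nat \<Rightarrow> 'a chain \<Rightarrow> 'a set" where
  "chain_support p c = (\<Union>\<sigma>\<in>Poly_Mapping.keys c. \<sigma> ` standard_simplex p)"

text \<open>A family of classes \<open>\<kappa> s\<close> in \<open>H\<^sub>p(X s)\<close> is horizontal (flat for the Gauss-Manin connection)
  if it is obtained locally in s by moving a cycle continuously through the sets \<open>X s\<close>.\<close>

definition horizontal_family ::
    "nat \<Rightarrow> complex set \<Rightarrow> (complex \<Rightarrow> 'a::topological_space set) \<Rightarrow> (complex \<Rightarrow> 'a chain set) \<Rightarrow> bool" where
  "horizontal_family p U X \<kappa> \<longleftrightarrow>
     (\<forall>s\<^sub>0\<in>U. \<exists>V c H. open V \<and> s\<^sub>0 \<in> V \<and> V \<subseteq> U \<and> cycle p (X s\<^sub>0) c \<and>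
        continuous_on (V \<times> chain_support p c) (\<lambda>(s, x). H s x) \<and>
        (\<forall>x\<in>chain_support p c. H s\<^sub>0 x = x) \<and>
        (\<forall>s\<in>V. H s ` chain_support p c \<subseteq> X s \<and> \<kappa> s = homology_class p (X s) (chain_map p (H s) c)))"

text \<open>For a p-simplex \<open>\<sigma>\<close>, the image under \<open>(x, \<theta>) \<mapsto> \<Phi> x (exp (2\<pi>i\<theta>))\<close> of the usual
  triangulation of the prism \<open>\<sigma> \<times> [0, 1]\<close> by the p + 1 simplices
  \<open>[v\<^sub>0, \<dots>, v\<^sub>i, w\<^sub>i, \<dots>, w\<^sub>p]\<close> with signs \<open>(-1)\<^sup>i\<close> (\<open>v\<close> the vertices at \<open>\<theta> = 0\<close>, \<open>w\<close> those
  at \<open>\<theta> = 1\<close>). As the two ends have the same image, \<open>circle_product\<close> maps cycles to cycles.\<close>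

definition circle_prism ::
    "nat \<Rightarrow> ('a \<Rightarrow> complex \<Rightarrow> 'b) \<Rightarrow> ((nat \<Rightarrow> real) \<Rightarrow> 'a) \<Rightarrow> 'b chain" where
  "circle_prism p \<Phi> \<sigma> =
     (\<Sum>i\<le>p. frag_cmul ((-1) ^ i) (frag_of (restrict
        (\<lambda>t. \<Phi> (\<sigma> (\<lambda>j. if j < i then t j else if j = i then t i + t (Suc i) else t (Suc j)))
               (cis (2 * pi * (\<Sum>j\<in>{i<..Suc p}. t j))))
        (standard_simplex (Suc p)))))"

definition circle_product :: "nat \<Rightarrow> ('a \<Rightarrow> complex \<Rightarrow> 'b) \<Rightarrow> 'a chain \<Rightarrow> 'b chain" where
  "circle_product p \<Phi> c = frag_extend (circle_prism p \<Phi>) c"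

text \<open>The tube over a cycle c in \<open>zero_locus f\<close> consists of the circles \<open>|w| = \<epsilon>\<close> in complex lines
  \<open>x + w v(x)\<close> transversal to \<open>zero_locus f\<close>; v is normalized by \<open>df(v) = 1\<close>, so that the circles go
  once around \<open>zero_locus f\<close> in the positive direction.\<close>

definition leray_coboundary ::
    "'n::finite laurent \<Rightarrow> (complex^'n) chain set \<Rightarrow> (complex^'n) chain set \<Rightarrow> bool" where
  "leray_coboundary f d \<tau> \<longleftrightarrow>
     (\<exists>c v \<epsilon>. let p = CARD('n) - 1; K = chain_support p c in
        cycle p (zero_locus f) c \<and> d = homology_class p (zero_locus f) c \<and>
        continuous_on K v \<and>
        (\<forall>x\<in>K. ((\<lambda>w. laurent_eval f (x + w *s v x)) has_field_derivative 1) (at 0)) \<and>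
        0 < \<epsilon> \<and>
        (\<forall>x\<in>K. \<forall>w. 0 < norm w \<and> norm w \<le> \<epsilon> \<longrightarrow> x + w *s v x \<in> torus - zero_locus f) \<and>
        \<tau> = homology_class CARD('n) (torus - zero_locus f)
              (circle_product p (\<lambda>x u. x + (complex_of_real \<epsilon> * u) *s v x) c))"

end

theory Submission
  imports Defs "HOL-Combinatorics.Permutations" "HOL-Combinatorics.Stirling"
begin

text \<open>The period solves a Gelfand-Kapranov-Zelevinsky system, and the operator is the one ordinary equation
  that this system implies along the line where all coefficients of \<open>f\<close> except the last are 1.

  Suppose first that the cycle \<open>c\<close> of integration does not move. With \<open>a r\<close> the coefficient of \<open>x\<^sup>\<alpha>\<^sup>(\<^sup>r\<^sup>)\<close> and
  \<open>Y k J\<close> the integral over \<open>c\<close> of \<open>(k - 1)! x\<^sup>J / f\<^sup>k\<close> against \<open>dx / x\<close>, differentiation under the integral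
  sign gives \<open>\<partial> (Y k J) / \<partial>(a r) = - Y (k + 1) (J + \<alpha> r)\<close> (\<open>Y_deriv\<close>). Two kinds of homogeneity hold: the
  identity \<open>f \<cdot> f\<^sup>-\<^sup>k\<^sup>-\<^sup>1 = f\<^sup>-\<^sup>k\<close> (\<open>Y_euler\<close>), and invariance under \<open>x\<^sub>i \<mapsto> e\<^sup>w x\<^sub>i\<close>, which moves \<open>c\<close> only within
  its homology class (\<open>Y_torus\<close>). Together they say that the row vector \<open>(a r Y (k + 1) (J + \<alpha> r))\<^sub>r\<close> times the
  matrix \<open>\<L>\<close> is \<open>(J Y, - \<vartheta> Y, k Y)\<close>. Inverting \<open>\<L>\<close> gives \<open>Y (k + 1) (J + \<alpha> q) = \<L>\<^sub>q(J, - \<vartheta>, k) Y k J\<close>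
  for each vertex \<open>q\<close>. As \<open>\<Sum>B\<^sub>q = \<gamma>\<close> and \<open>\<Sum>B\<^sub>q \<alpha> q = \<gamma> \<alpha>(n + 2)\<close>, taking \<open>B\<^sub>q\<close> steps in each direction \<open>q\<close> leads
  to the same integral as \<open>\<gamma>\<close> steps in the direction of the interior exponent; comparing the two ways is the
  equation (\<open>gkz_imp_R_op\<close>).

  The cycle can be kept fixed locally. The tube over a family of cycles that moves continuously in the
  hypersurfaces has a locally constant homology class in the complement (\<open>tube_locally_constant\<close>), and the
  integral of a holomorphic form of top degree depends only on the homology class
  (\<open>chain_integral_homologous\<close>). The latter is Stokes' theorem, but a homology between smooth cycles need not
  be smooth: all simplices are replaced by their Bernstein approximations, which are polynomial, commute with
  the boundary (\<open>chain_boundary_bernstein\<close>) and converge with their first derivatives on smooth simplices.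

  For the singular points, \<open>P(\<vartheta>)\<close> and \<open>Q(\<vartheta>)\<close> are written in powers of \<open>d / ds\<close>; both have order \<open>\<gamma>\<close>, so the
  leading coefficient is \<open>s\<^sup>\<gamma>\<close> times a binomial in \<open>s\<^sup>\<gamma>\<close>, whose roots are simple. Fuchs' condition can then be read
  off (\<open>hypergeometric_singularities\<close>, \<open>hypergeometric_regular_at_infinity\<close>). The leading coefficient of \<open>Q\<close>
  involves the quotients \<open>B\<^sub>q / \<gamma>\<close>, which are the barycentric coordinates of the interior exponent
  (\<open>B_vol_barycentric\<close>).\<close>

no_notation fps_nth (infixl \<open>$\<close> 75)

section \<open>Linear maps and Lebesgue measure\<close>

text \<open>The change of variables formula for linear maps of \<open>real^'n\<close> is stated for a well-ordered index type. A
  finite linear order is a well-order, but it is not an instance of that class; this copy of the index type is.\<close>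

typedef 'a wo = "UNIV :: 'a set" morphisms of_wo to_wo ..

lemma bij_of_wo: "bij (of_wo :: 'a wo \<Rightarrow> 'a)"
  by (metis UNIV_I bijI' of_wo_inject to_wo_inverse)

instance wo :: (finite) finite
  by standard (metis bij_of_wo bij_betw_finite finite)

instantiation wo :: (linorder) linorder
begin
definition "x \<le> y \<longleftrightarrow> of_wo x \<le> of_wo y"
definition "x < y \<longleftrightarrow> of_wo x < of_wo y"
instance
  by standard (auto simp: less_eq_wo_def less_wo_def of_wo_inject less_le)
end

instance wo :: ("{finite,linorder}") wellorder
proof
  fix P :: "'a wo \<Rightarrow> bool" and a :: "'a wo"
  assume step: "\<And>x. (\<And>y. y < x \<Longrightarrow> P y) \<Longrightarrow> P x"
  have card_less: "card {z. z < y} < card {z. z < x}" if "y < x" for x y :: "'a wo"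
    using that by (intro psubset_card_mono) auto
  show "P a"
    by (induction "card {z. z < a}" arbitrary: a rule: less_induct) (metis card_less step)
qed

text \<open>Both measures agree on boxes, which such a map only relabels.\<close>

lemma lborel_distr_basis_bij:
  fixes f :: "'a::euclidean_space \<Rightarrow> 'b::euclidean_space"
  assumes f: "linear f" and bij: "bij_betw f Basis Basis"
  shows "distr lborel lborel f = lborel"
proof (rule lborel_eqI[symmetric])
  have cont [measurable]: "f \<in> borel_measurable borel"
    using f by (simp add: borel_measurable_continuous_onI linear_continuous_on linear_conv_bounded_linear)
  have inner: "f x \<bullet> f b = x \<bullet> b" if "b \<in> Basis" for x b
  proof -
    have "f x \<bullet> f b = f (\<Sum>c\<in>Basis. (x \<bullet> c) *\<^sub>R c) \<bullet> f b"
      by (simp add: euclidean_representation)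
    also have "\<dots> = (\<Sum>c\<in>Basis. (x \<bullet> c) * (f c \<bullet> f b))"
      using f by (simp add: linear_sum linear_cmul inner_sum_left)
    also have "\<dots> = (\<Sum>c\<in>Basis. if c = b then x \<bullet> c else 0)"
    proof (rule sum.cong)
      fix c :: 'a assume c: "c \<in> Basis"
      have "f c \<in> Basis" "f b \<in> Basis" "f c = f b \<longleftrightarrow> c = b"
        using bij that c by (auto simp: bij_betw_def inj_on_def)
      then show "(x \<bullet> c) * (f c \<bullet> f b) = (if c = b then x \<bullet> c else 0)"
        by (simp add: inner_Basis)
    qed simp
    also have "\<dots> = x \<bullet> b" using that by simp
    finally show ?thesis .
  qed
  fix l u :: 'b assume lu: "\<And>b. b \<in> Basis \<Longrightarrow> l \<bullet> b \<le> u \<bullet> b"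
  define p where "p l = (\<Sum>b\<in>Basis. (l \<bullet> f b) *\<^sub>R b)" for l
  have p: "p l \<bullet> b = l \<bullet> f b" if "b \<in> Basis" for b l
    using that by (simp add: p_def inner_sum_left inner_Basis if_distrib cong: if_cong)
  have "f -` box l u = box (p l) (p u)"
  proof -
    have "f x \<in> box l u \<longleftrightarrow> (\<forall>b\<in>Basis. l \<bullet> f b < f x \<bullet> f b \<and> f x \<bullet> f b < u \<bullet> f b)" for x
    proof -
      have "f x \<in> box l u \<longleftrightarrow> (\<forall>b\<in>f ` Basis. l \<bullet> b < f x \<bullet> b \<and> f x \<bullet> b < u \<bullet> b)"
        by (simp only: bij_betw_imp_surj_on[OF bij] box_def mem_Collect_eq)
      then show ?thesis by simp
    qed
    then show ?thesis by (auto simp: box_def inner p)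
  qed
  then have "emeasure (distr lborel lborel f) (box l u) = emeasure lborel (box (p l) (p u))"
    by (subst emeasure_distr) auto
  also have "\<dots> = ennreal (\<Prod>b\<in>Basis. (p u - p l) \<bullet> b)"
    by (intro emeasure_lborel_box) (use lu bij_betw_apply[OF bij] in \<open>auto simp: p\<close>)
  also have "(\<Prod>b\<in>Basis. (p u - p l) \<bullet> b) = (\<Prod>b\<in>Basis. (u - l) \<bullet> f b)"
    by (intro prod.cong) (auto simp: p inner_diff_left)
  also have "\<dots> = (\<Prod>b\<in>Basis. (u - l) \<bullet> b)"
    using prod.reindex_bij_betw[OF bij] by fastforce
  finally show "emeasure (distr lborel lborel f) (box l u) = ennreal (\<Prod>b\<in>Basis. (u - l) \<bullet> b)"
    by (simp add: prod_ennreal lu inner_diff_left)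
qed auto

definition to_wo_vec :: "'a^'n \<Rightarrow> 'a^('n wo)" where "to_wo_vec x = (\<chi> i. x $ of_wo i)"
definition of_wo_vec :: "'a^('n wo) \<Rightarrow> 'a^'n" where "of_wo_vec x = (\<chi> i. x $ to_wo i)"

lemma wo_vec_inverse [simp]: "of_wo_vec (to_wo_vec x) = x" "to_wo_vec (of_wo_vec y) = y"
  by (simp_all add: to_wo_vec_def of_wo_vec_def vec_eq_iff to_wo_inverse of_wo_inverse)

lemma linear_wo_vec: "linear (to_wo_vec :: real^'n \<Rightarrow> _)" "linear (of_wo_vec :: _ \<Rightarrow> real^'n)"
  by (auto simp: linear_iff to_wo_vec_def of_wo_vec_def vec_eq_iff)

lemma to_wo_vec_axis: "to_wo_vec (axis i c) = axis (to_wo i) c"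
  by (auto simp: to_wo_vec_def axis_def vec_eq_iff to_wo_inverse of_wo_inverse)
lemma of_wo_vec_axis: "of_wo_vec (axis i c) = axis (of_wo i) c"
  by (metis to_wo_vec_axis of_wo_inverse wo_vec_inverse(1))

lemma bij_wo_vec_Basis:
  "bij_betw (to_wo_vec :: real^'n::finite \<Rightarrow> _) Basis Basis" "bij_betw (of_wo_vec :: _ \<Rightarrow> real^'n::finite) Basis Basis"
proof -
  have a: "to_wo_vec ` (Basis :: (real^'n) set) \<subseteq> Basis" "of_wo_vec ` Basis \<subseteq> (Basis :: (real^'n) set)"
    by (auto simp: Basis_vec_def to_wo_vec_axis of_wo_vec_axis)
  show "bij_betw (to_wo_vec :: real^'n \<Rightarrow> _) Basis Basis"
    by (rule bij_betwI[where g = of_wo_vec]) (use a in auto)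
  show "bij_betw (of_wo_vec :: _ \<Rightarrow> real^'n) Basis Basis"
    by (rule bij_betwI[where g = to_wo_vec]) (use a in auto)
qed

lemma measurable_linear [measurable_dest]:
  "linear f \<Longrightarrow> f \<in> borel_measurable borel" for f :: "'a::euclidean_space \<Rightarrow> 'b::euclidean_space"
  by (simp add: borel_measurable_continuous_onI linear_continuous_on linear_conv_bounded_linear)

text \<open>The factor by which the map scales the measure is positive and has square 1.\<close>

lemma lborel_distr_linear_involution:
  fixes L :: "real^'n::{finite,linorder} \<Rightarrow> real^'n::_"
  assumes L: "linear L" and inv: "\<And>x. L (L x) = x"
  shows "distr lborel lborel L = lborel"
proof -
  define M where "M = to_wo_vec \<circ> L \<circ> of_wo_vec"
  have M: "linear M" unfolding M_def by (intro linear_compose linear_wo_vec L)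
  have invM: "M (M x) = x" for x by (simp add: M_def inv)
  have "matrix M ** matrix M = mat 1"
  proof -
    have "M \<circ> M = id" using invM by auto
    then have "matrix M ** matrix M = matrix id" by (metis matrix_compose[OF M M])
    also have "\<dots> = mat 1" by (simp add: matrix_def mat_def axis_def vec_eq_iff)
    finally show ?thesis .
  qed
  then have "det (matrix M) * det (matrix M) = 1" by (metis det_mul det_I)
  then have det: "\<bar>det (matrix M)\<bar> = 1"
    by (metis abs_mult_self_eq abs_1 abs_ge_zero abs_mult power2_eq_1_iff power2_eq_square abs_neg_one)
  have lM: "distr lborel lborel M = lborel"
  proof (rule lborel_eqI[symmetric])
    fix l u :: "real^('n::_ wo)" assume lu: "\<And>b. b \<in> Basis \<Longrightarrow> l \<bullet> b \<le> u \<bullet> b"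
    have "M -` box l u = M ` box l u" using invM by (auto simp: image_iff) metis
    moreover have "measure lebesgue (M ` box l u) = measure lebesgue (box l u)"
      using measure_lebesgue_linear_transformation[OF _ _ M, of "box l u"] det by simp
    moreover have "M ` box l u \<in> lmeasurable"
      by (intro measurable_linear_image M) auto
    moreover have "M -` box l u \<in> sets borel"
      using measurable_sets_borel[OF measurable_linear[OF M], of "box l u"] by auto
    ultimately have "emeasure lborel (M -` box l u) = ennreal (measure lborel (box l u))"
      using emeasure_bounded_finite[OF bounded_linear_image[OF bounded_box M[unfolded linear_conv_bounded_linear], of l u]]
      by (simp add: emeasure_eq_ennreal_measure)
    then show "emeasure (distr lborel lborel M) (box l u) = ennreal (\<Prod>b\<in>Basis. (u - l) \<bullet> b)"
      using measurable_linear[OF M] lu by (subst emeasure_distr) (auto simp: prod_ennreal inner_diff_left)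
  qed auto
  note [measurable] = measurable_linear[OF M] measurable_linear[OF linear_wo_vec(1)] measurable_linear[OF linear_wo_vec(2)]
  have "distr (distr (distr lborel lborel to_wo_vec) lborel M) lborel of_wo_vec = distr lborel lborel (of_wo_vec \<circ> (M \<circ> (to_wo_vec :: real^'n::_ \<Rightarrow> _)))"
    by (simp add: distr_distr)
  also have "of_wo_vec \<circ> (M \<circ> to_wo_vec) = L" by (auto simp: M_def)
  finally have "distr lborel lborel L = distr (distr (distr lborel lborel to_wo_vec) lborel M) lborel of_wo_vec" by simp
  then show ?thesis
    by (simp add: lborel_distr_basis_bij linear_wo_vec bij_wo_vec_Basis lM)
qed

lemma det_reindex:
  fixes A :: "'a::comm_ring_1^'n^'n" and f :: "'m::finite \<Rightarrow> 'n::finite"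
  assumes f: "bij f"
  shows "det (\<chi> i j. A $ f i $ f j) = det A"
proof -
  define f' where "f' = inv_into UNIV f"
  have inj: "inj_on f UNIV" "bij_betw f UNIV UNIV" "bij_betw f' UNIV UNIV" "inj f'"
    using f bij_imp_bij_inv bij_is_inj by (auto simp: f'_def)
  have surj: "f (f' y) = y" for y using f by (simp add: f'_def bij_is_surj surj_f_inv_f)
  have inv': "f' (f x) = x" for x using f by (simp add: f'_def bij_is_inj)
  have mp: "map_permutation UNIV f p (f x) = f (p x)" "map_permutation UNIV f' q (f' y) = f' (q y)" for p q x y
    using inj by (auto intro: map_permutation_apply)
  have "det (\<chi> i j. A $ f i $ f j) = (\<Sum>p | p permutes UNIV. of_int (sign p) * (\<Prod>i\<in>UNIV. A $ f i $ f (p i)))"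
    by (simp add: det_def)
  also have "\<dots> = (\<Sum>p | p permutes UNIV. of_int (sign p) * (\<Prod>i\<in>UNIV. A $ i $ p i))"
  proof (rule sum.reindex_bij_witness[where j = "map_permutation UNIV f" and i = "map_permutation UNIV f'"])
    fix p :: "'m \<Rightarrow> 'm" assume p: "p \<in> {p. p permutes UNIV}"
    show "map_permutation UNIV f' (map_permutation UNIV f p) = p"
    proof
      fix x show "map_permutation UNIV f' (map_permutation UNIV f p) x = p x"
        using mp(2)[of "map_permutation UNIV f p" "f x"] mp(1)[of p x] by (simp add: inv')
    qed
    show "map_permutation UNIV f p \<in> {p. p permutes UNIV}"
      using p inj by (auto intro: map_permutation_permutes)
    have "sign (map_permutation UNIV f p) = sign p"
      using p inj by (intro sign_map_permutation) auto
    moreover have "(\<Prod>i\<in>UNIV. A $ i $ map_permutation UNIV f p i) = (\<Prod>i\<in>UNIV. A $ f i $ map_permutation UNIV f p (f i))"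
      using prod.reindex_bij_betw[OF inj(2), symmetric] by fast
    ultimately show "of_int (sign (map_permutation UNIV f p)) * (\<Prod>i\<in>UNIV. A $ i $ map_permutation UNIV f p i) =
      of_int (sign p) * (\<Prod>i\<in>UNIV. A $ f i $ f (p i))" by (simp add: mp)
  next
    fix p :: "'n \<Rightarrow> 'n" assume p: "p \<in> {p. p permutes UNIV}"
    show "map_permutation UNIV f (map_permutation UNIV f' p) = p"
    proof
      fix x show "map_permutation UNIV f (map_permutation UNIV f' p) x = p x"
        using mp(1)[of "map_permutation UNIV f' p" "f' x"] mp(2)[of p x] by (simp add: surj)
    qed
    show "map_permutation UNIV f' p \<in> {p. p permutes UNIV}"
      using p inj by (auto intro: map_permutation_permutes)
  qed
  finally show ?thesis by (simp add: det_def)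
qed

lemma measure_distr_image:
  fixes f :: "'a::euclidean_space \<Rightarrow> 'b::euclidean_space"
  assumes "linear f" "bij f" "distr lborel lborel f = lborel" "compact S"
  shows "measure lborel (f ` S) = measure lborel S"
proof -
  have "measure lborel (f ` S) = measure (distr lborel lborel f) (f ` S)" using assms by simp
  also have "\<dots> = measure lborel (f -` (f ` S))"
    using assms by (subst measure_distr) (auto intro!: measurable_linear borel_compact compact_continuous_image
      simp: linear_continuous_on linear_conv_bounded_linear)
  finally show ?thesis using \<open>bij f\<close> by (simp add: bij_is_inj inj_vimage_image_eq)
qed

lemma volume_simplex:
  fixes x0 :: "real^'n::{finite,linorder}" and f :: "'n::_ \<Rightarrow> real^'n::_"
  assumes "det (\<chi> i j. f j $ i - x0 $ i) \<noteq> 0"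
  shows "measure lborel (convex hull (insert x0 (range f))) = \<bar>det (\<chi> i j. f j $ i - x0 $ i)\<bar> / fact CARD('n)"
proof -
  let ?M = "\<chi> i j. f j $ i - x0 $ i"
  have nx0: "f j \<noteq> x0" for j
    using assms det_zero_column(1)[of j ?M] by (auto simp: column_def vec_eq_iff)
  have injf: "inj f"
  proof (rule injI, rule ccontr)
    fix i j assume "f i = f j" "i \<noteq> j"
    then show False using assms det_identical_columns[of i j ?M] by (auto simp: column_def)
  qed
  define g where "g = to_wo_vec \<circ> f \<circ> of_wo"
  let ?X = "insert (to_wo_vec x0) (range g)"
  have inj_to: "inj (to_wo_vec :: real^'n::_ \<Rightarrow> _)" by (metis injI wo_vec_inverse(1))
  have bij_to: "bij (to_wo_vec :: real^'n::_ \<Rightarrow> _)" by (metis bijI' wo_vec_inverse)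
  have nin: "to_wo_vec x0 \<notin> range g"
    using nx0 by (auto simp: g_def dest!: injD[OF inj_to])
  have injg: "inj g"
    unfolding g_def by (intro inj_compose inj_to injf bij_is_inj[OF bij_of_wo])
  have c: "card (range g) = CARD('n wo)" by (simp add: card_image injg)
  have card: "CARD('n wo) = CARD('n)" by (rule bij_betw_same_card[OF bij_of_wo])
  have range: "range g = to_wo_vec ` range f"
    unfolding g_def using bij_is_surj[OF bij_of_wo] by (metis image_comp)
  have "measure lborel (convex hull (insert x0 (range f))) = measure lborel (to_wo_vec ` (convex hull (insert x0 (range f))))"
    by (intro measure_distr_image[symmetric] linear_wo_vec bij_to lborel_distr_basis_bij bij_wo_vec_Basis finite_imp_compact_convex_hull) auto
  also have "to_wo_vec ` (convex hull (insert x0 (range f))) = convex hull ?X"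
    by (simp add: convex_hull_linear_image linear_wo_vec range)
  also have "measure lborel (convex hull ?X) = \<bar>det (\<chi> i j. g j $ i - to_wo_vec x0 $ i)\<bar> / fact CARD('n wo)"
    using nin injg by (intro content_simplex) (auto simp: c bij_betw_def)
  also have "(\<chi> i j. g j $ i - to_wo_vec x0 $ i) = (\<chi> i j. ?M $ of_wo i $ of_wo j)"
    by (simp add: g_def to_wo_vec_def)
  finally show ?thesis by (simp add: det_reindex[OF bij_of_wo] card del: vec_lambda_beta)
qed

section \<open>Bernstein approximation of singular simplices\<close>

text \<open>The mean of \<open>h\<close> over the vectors of counts of N independent draws from \<open>{0, \<dots>, p}\<close> with probabilities
  \<open>x\<close>. Recursion on the draws makes the multinomial coefficients of the Bernstein polynomial disappear.\<close>

primrec iid_mean :: "nat \<Rightarrow> nat \<Rightarrow> (nat \<Rightarrow> real) \<Rightarrow> ((nat \<Rightarrow> nat) \<Rightarrow> 'b::real_vector) \<Rightarrow> 'b" where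
  "iid_mean p 0 x h = h (\<lambda>_. 0)"
| "iid_mean p (Suc N) x h = (\<Sum>i\<le>p. x i *\<^sub>R iid_mean p N x (\<lambda>y. h (y(i := Suc (y i)))))"

lemma iid_mean_cong:
  assumes "\<And>y. (\<And>i. p < i \<Longrightarrow> y i = 0) \<Longrightarrow> (\<Sum>i\<le>p. y i) = N \<Longrightarrow> h y = h' y"
  shows "iid_mean p N x h = iid_mean p N x h'"
  using assms
proof (induction N arbitrary: h h')
  case (Suc N)
  have "iid_mean p N x (\<lambda>y. h (y(i := Suc (y i)))) = iid_mean p N x (\<lambda>y. h' (y(i := Suc (y i))))" if i: "i \<le> p" for i
  proof (rule Suc.IH)
    fix y assume y: "\<And>i. p < i \<Longrightarrow> y i = 0" "(\<Sum>i\<le>p. y i) = N"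
    have "(\<Sum>j\<le>p. (y(i := Suc (y i))) j) = (\<Sum>j\<le>p. y j + (if j = i then 1 else 0))"
      by (intro sum.cong) auto
    also have "\<dots> = Suc N" using y i by (simp add: sum.distrib)
    finally show "h (y(i := Suc (y i))) = h' (y(i := Suc (y i)))"
      using y i by (intro Suc.prems) auto
  qed
  then show ?case by simp
qed auto

lemma iid_mean_add: "iid_mean p N x (\<lambda>y. h y + h' y) = iid_mean p N x h + iid_mean p N x h'"
  by (induction N arbitrary: h h') (simp_all add: scaleR_add_right sum.distrib)

lemma iid_mean_scaleR: "iid_mean p N x (\<lambda>y. c *\<^sub>R h y) = c *\<^sub>R iid_mean p N x h"
  by (induction N arbitrary: h) (simp_all add: scaleR_sum_right mult.commute)

lemma iid_mean_zero [simp]: "iid_mean p N x (\<lambda>y. 0) = 0"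
  by (induction N) simp_all

lemma iid_mean_sum: "iid_mean p N x (\<lambda>y. \<Sum>i\<in>A. h i y) = (\<Sum>i\<in>A. iid_mean p N x (h i))"
  by (induction A rule: infinite_finite_induct) (simp_all add: iid_mean_add)

lemma iid_mean_diff: "iid_mean p N x (\<lambda>y. h y - h' y) = iid_mean p N x h - iid_mean p N x h'"
  using iid_mean_add[of p N x "\<lambda>y. h y - h' y" h'] by (simp add: algebra_simps)

lemma standard_simplexD:
  assumes "x \<in> standard_simplex p"
  shows "0 \<le> x i" "x i \<le> 1" "p < i \<Longrightarrow> x i = 0" "(\<Sum>i\<le>p. x i) = 1"
  using assms by (auto simp: standard_simplex_def)

lemma iid_mean_const:
  assumes "x \<in> standard_simplex p" shows "iid_mean p N x (\<lambda>y. c) = c"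
  by (induction N) (simp_all add: standard_simplexD[OF assms] flip: scaleR_sum_left)

lemma iid_mean_mono:
  fixes h h' :: "_ \<Rightarrow> real"
  assumes "x \<in> standard_simplex p" and "\<And>y. (\<And>i. p < i \<Longrightarrow> y i = 0) \<Longrightarrow> (\<Sum>i\<le>p. y i) = N \<Longrightarrow> h y \<le> h' y"
  shows "iid_mean p N x h \<le> iid_mean p N x h'"
proof -
  have nonneg: "0 \<le> iid_mean p N x g" if "\<And>y. 0 \<le> g y" for g :: "_ \<Rightarrow> real"
    using that standard_simplexD(1)[OF assms(1)] by (induction N arbitrary: g) (auto intro!: sum_nonneg)
  have "0 \<le> iid_mean p N x (\<lambda>y. max 0 (h' y - h y))" by (rule nonneg) simp
  also have "\<dots> = iid_mean p N x (\<lambda>y. h' y - h y)"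
    by (rule iid_mean_cong) (use assms(2) in auto)
  finally show ?thesis by (simp add: iid_mean_diff)
qed

lemma norm_iid_mean_le:
  fixes h :: "_ \<Rightarrow> 'b::real_normed_vector"
  assumes "x \<in> standard_simplex p"
  shows "norm (iid_mean p N x h) \<le> iid_mean p N x (\<lambda>y. norm (h y))"
proof (induction N arbitrary: h)
  case (Suc N)
  show ?case
    using standard_simplexD(1)[OF assms] Suc.IH
    by (auto intro!: order_trans[OF norm_sum] sum_mono mult_left_mono)
qed simp

lemma sum_simplical_face:
  fixes g :: "nat \<Rightarrow> 'b::comm_monoid_add"
  assumes k: "k \<le> Suc p" and gk: "g k = 0"
  shows "(\<Sum>i\<le>Suc p. g i) = (\<Sum>i\<le>p. g (if i < k then i else Suc i))"
proof -
  have "(\<Sum>i\<le>Suc p. g i) = (\<Sum>i\<in>{..Suc p} - {k}. g i)"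
    using k gk by (intro sum.mono_neutral_right) auto
  also have "\<dots> = (\<Sum>i\<le>p. g (if i < k then i else Suc i))"
    by (rule sum.reindex_bij_witness[where i = "\<lambda>i. if i < k then i else Suc i" and j = "\<lambda>i. if i < k then i else i - 1"])
      (use k in \<open>auto split: if_splits\<close>)
  finally show ?thesis .
qed

text \<open>On the face where \<open>x k = 0\<close> the value k is never drawn.\<close>

lemma iid_mean_face:
  assumes k: "k \<le> Suc p"
  shows "iid_mean (Suc p) N (simplical_face k x) h = iid_mean p N x (\<lambda>y. h (simplical_face k y))"
proof (induction N arbitrary: h)
  case 0
  show ?case by (simp add: simplical_face_def cong: if_cong)
next
  case (Suc N)
  let ?j = "\<lambda>i. if i < k then i else Suc i"
  have "iid_mean (Suc p) (Suc N) (simplical_face k x) h =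
     (\<Sum>i\<le>p. simplical_face k x (?j i) *\<^sub>R iid_mean (Suc p) N (simplical_face k x) (\<lambda>y. h (y(?j i := Suc (y (?j i))))))"
    by (simp only: iid_mean.simps, subst sum_simplical_face[OF k]) (auto simp: simplical_face_def)
  also have "\<dots> = (\<Sum>i\<le>p. x i *\<^sub>R iid_mean p N x (\<lambda>y. h (simplical_face k (y(i := Suc (y i))))))"
  proof (intro sum.cong refl)
    fix i assume "i \<in> {..p}"
    have "(simplical_face k y)(?j i := Suc (simplical_face k y (?j i))) = simplical_face k (y(i := Suc (y i)))" for y :: "nat \<Rightarrow> nat"
      by (auto simp: simplical_face_def fun_eq_iff)
    moreover have "simplical_face k x (?j i) = x i" by (simp add: simplical_face_def)
    ultimately show "simplical_face k x (?j i) *\<^sub>R iid_mean (Suc p) N (simplical_face k x) (\<lambda>y. h (y(?j i := Suc (y (?j i)))))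
      = x i *\<^sub>R iid_mean p N x (\<lambda>y. h (simplical_face k (y(i := Suc (y i)))))"
      unfolding Suc.IH by presburger
  qed
  finally show ?case by simp
qed

text \<open>By symmetry of the draws, differentiating the probabilities of any one of the N draws has the same effect.\<close>

lemma iid_mean_has_derivative:
  fixes h :: "_ \<Rightarrow> 'b::real_normed_vector" and X :: "'a::real_normed_vector \<Rightarrow> nat \<Rightarrow> real"
  assumes X: "\<And>i. i \<le> p \<Longrightarrow> ((\<lambda>t. X t i) has_derivative (\<lambda>d. dX d i)) (at t within S)"
  shows "((\<lambda>t. iid_mean p N (X t) h) has_derivative
     (\<lambda>d. of_nat N *\<^sub>R iid_mean p (N - 1) (X t) (\<lambda>y. \<Sum>i\<le>p. dX d i *\<^sub>R h (y(i := Suc (y i)))))) (at t within S)"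
proof (induction N arbitrary: h)
  case (Suc N)
  let ?u = "\<lambda>y i. y(i := Suc (y i))"
  have "((\<lambda>t. \<Sum>i\<le>p. X t i *\<^sub>R iid_mean p N (X t) (\<lambda>y. h (?u y i))) has_derivative
    (\<lambda>d. \<Sum>i\<le>p. X t i *\<^sub>R (of_nat N *\<^sub>R iid_mean p (N - 1) (X t) (\<lambda>y. \<Sum>j\<le>p. dX d j *\<^sub>R h (?u (?u y j) i)))
         + dX d i *\<^sub>R iid_mean p N (X t) (\<lambda>y. h (?u y i)))) (at t within S)"
    by (intro has_derivative_sum has_derivative_scaleR X Suc.IH) auto
  moreover have "(\<Sum>i\<le>p. X t i *\<^sub>R (of_nat N *\<^sub>R iid_mean p (N - 1) (X t) (\<lambda>y. \<Sum>j\<le>p. dX d j *\<^sub>R h (?u (?u y j) i)))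
         + dX d i *\<^sub>R iid_mean p N (X t) (\<lambda>y. h (?u y i)))
    = of_nat (Suc N) *\<^sub>R iid_mean p N (X t) (\<lambda>y. \<Sum>i\<le>p. dX d i *\<^sub>R h (?u y i))" for d
  proof -
    let ?H = "\<lambda>y. \<Sum>j\<le>p. dX d j *\<^sub>R h (?u y j)"
    have comm: "?u (?u y j) i = ?u (?u y i) j" for y :: "nat \<Rightarrow> nat" and i j
      by (auto simp: fun_eq_iff)
    have "(\<Sum>i\<le>p. X t i *\<^sub>R (of_nat N *\<^sub>R iid_mean p (N - 1) (X t) (\<lambda>y. \<Sum>j\<le>p. dX d j *\<^sub>R h (?u (?u y j) i))))
      = of_nat N *\<^sub>R iid_mean p N (X t) ?H"
    proof (cases N)
      case (Suc M)
      then show ?thesis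
        by (subst comm) (simp add: scaleR_sum_right mult.commute)
    qed simp
    moreover have "(\<Sum>i\<le>p. dX d i *\<^sub>R iid_mean p N (X t) (\<lambda>y. h (?u y i))) = iid_mean p N (X t) ?H"
      by (simp add: iid_mean_sum iid_mean_scaleR)
    ultimately show ?thesis by (simp add: sum.distrib algebra_simps)
  qed
  ultimately show ?case by (simp del: fun_upd_apply)
qed simp

lemma iid_mean_continuous [continuous_intros]:
  fixes h :: "_ \<Rightarrow> 'b::real_normed_vector"
  assumes "\<And>i. i \<le> p \<Longrightarrow> continuous_on S (\<lambda>t. X t i)"
  shows "continuous_on S (\<lambda>t. iid_mean p N (X t) h)"
  by (induction N arbitrary: h) (auto intro!: continuous_intros assms)

text \<open>The constant c makes the statement inductive; for c = 0 it is the binomial variance \<open>N x (1 - x)\<close>.\<close>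

lemma iid_variance:
  assumes x: "x \<in> standard_simplex p" and i: "i \<le> p"
  shows "iid_mean p N x (\<lambda>y. (c + real (y i) - real N * x i)\<^sup>2) = c\<^sup>2 + real N * (x i * (1 - x i))"
proof (induction N arbitrary: c)
  case (Suc N)
  have "iid_mean p (Suc N) x (\<lambda>y. (c + real (y i) - real (Suc N) * x i)\<^sup>2) =
     (\<Sum>j\<le>p. x j * iid_mean p N x (\<lambda>y. ((c + (if j = i then 1 else 0) - x i) + real (y i) - real N * x i)\<^sup>2))"
    by (auto intro!: sum.cong iid_mean_cong arg_cong2[where f = "(*)"] arg_cong[where f = power2] simp: algebra_simps)
  also have "\<dots> = (\<Sum>j\<le>p. x j * ((c + (if j = i then 1 else 0) - x i)\<^sup>2 + real N * (x i * (1 - x i))))"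
    by (simp add: Suc.IH)
  also have "\<dots> = (\<Sum>j\<le>p. x j * ((c - x i)\<^sup>2 + real N * (x i * (1 - x i))) + (if j = i then x i * (2 * (c - x i) + 1) else 0))"
    by (intro sum.cong) (auto simp: power2_eq_square algebra_simps)
  also have "\<dots> = (c - x i)\<^sup>2 + real N * (x i * (1 - x i)) + x i * (2 * (c - x i) + 1)"
    using i standard_simplexD(4)[OF x] by (simp add: sum.distrib flip: sum_distrib_right)
  finally show ?case by (simp add: power2_eq_square algebra_simps)
qed simp

lemma counts_in_standard_simplex:
  assumes "\<And>i. p < i \<Longrightarrow> y i = 0" "(\<Sum>i\<le>p. y i) = N" "N > 0"
  shows "(\<lambda>i. real (y i) / real N) \<in> standard_simplex p"
proof -
  have "y i \<le> N" for i
  proof (cases "i \<le> p")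
    case True then show ?thesis using assms(2) member_le_sum[of i "{..p}" y] by auto
  qed (use assms in auto)
  moreover have "(\<Sum>i\<le>p. real (y i) / real N) = 1"
    using assms by (simp flip: sum_divide_distrib of_nat_sum)
  ultimately show ?thesis using assms by (auto simp: standard_simplex_def divide_le_eq)
qed

text \<open>Chebyshev's argument: the mean of the quadratic term is at most \<open>C / N\<close> by the variance formula.\<close>

lemma bernstein_error:
  fixes G G' :: "_ \<Rightarrow> 'b::real_normed_vector"
  assumes x: "x \<in> standard_simplex p" and N: "N > 0" and C: "C \<ge> 0"
    and G: "\<And>y. (\<And>i. p < i \<Longrightarrow> y i = 0) \<Longrightarrow> (\<Sum>i\<le>p. y i) = N \<Longrightarrow>
       norm (G y - a) \<le> e + C * (\<Sum>i\<le>p. (real (y i) / real N - x i)\<^sup>2)"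
  shows "norm (iid_mean p N x G - a) \<le> e + C / real N"
proof -
  have "norm (iid_mean p N x G - a) = norm (iid_mean p N x (\<lambda>y. G y - a))"
    by (simp add: iid_mean_diff iid_mean_const[OF x])
  also have "\<dots> \<le> iid_mean p N x (\<lambda>y. norm (G y - a))" by (rule norm_iid_mean_le[OF x])
  also have "\<dots> \<le> iid_mean p N x (\<lambda>y. e + (\<Sum>i\<le>p. (C / (real N)\<^sup>2) *\<^sub>R (0 + real (y i) - real N * x i)\<^sup>2))"
  proof (rule iid_mean_mono[OF x])
    fix y :: "nat \<Rightarrow> nat" assume y: "\<And>i. p < i \<Longrightarrow> y i = 0" "(\<Sum>i\<le>p. y i) = N"
    have "C * (\<Sum>i\<le>p. (real (y i) / real N - x i)\<^sup>2) = (\<Sum>i\<le>p. (C / (real N)\<^sup>2) *\<^sub>R (0 + real (y i) - real N * x i)\<^sup>2)"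
      unfolding sum_distrib_left using N by (intro sum.cong) (auto simp: field_simps power2_eq_square)
    then show "norm (G y - a) \<le> e + (\<Sum>i\<le>p. (C / (real N)\<^sup>2) *\<^sub>R (0 + real (y i) - real N * x i)\<^sup>2)"
      using G[OF y] by simp
  qed
  also have "\<dots> = e + (\<Sum>i\<le>p. (C / (real N)\<^sup>2) * (0\<^sup>2 + real N * (x i * (1 - x i))))"
    unfolding iid_mean_add iid_mean_sum iid_mean_scaleR iid_mean_const[OF x]
    using iid_variance[OF x, where c = 0] by simp
  also have "\<dots> \<le> e + (\<Sum>i\<le>p. (C / real N) * x i)"
  proof (intro add_left_mono sum_mono)
    fix i assume "i \<in> {..p}"
    have "x i * (1 - x i) \<le> x i" using standard_simplexD(1,2)[OF x, of i] by (simp add: mult_left_le)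
    then have "(C / real N) * (x i * (1 - x i)) \<le> (C / real N) * x i" using C by (intro mult_left_mono) auto
    then show "(C / (real N)\<^sup>2) * (0\<^sup>2 + real N * (x i * (1 - x i))) \<le> (C / real N) * x i"
      using N by (simp add: power2_eq_square)
  qed
  also have "\<dots> = e + C / real N" using standard_simplexD(4)[OF x] by (simp only: mult_1_right flip: sum_distrib_left)
  finally show ?thesis .
qed

lemma compact_standard_simplex: "compact (standard_simplex p)"
  using compactin_standard_simplex by (simp flip: compactin_euclidean_iff add: euclidean_product_topology)

lemma singular_simplex_top_of_set:
  "singular_simplex p (top_of_set X) \<sigma> \<longleftrightarrow>
     continuous_on (standard_simplex p) \<sigma> \<and> \<sigma> ` standard_simplex p \<subseteq> X \<and> \<sigma> \<in> extensional (standard_simplex p)"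
  by (auto simp: singular_simplex_def euclidean_product_topology)

text \<open>Uniform continuity handles nearby points; for points at distance at least \<open>\<delta>\<close> a large multiple of the squared
  distance exceeds the oscillation of the function.\<close>

lemma continuous_on_quadratic_modulus:
  fixes G :: "(nat \<Rightarrow> real) \<Rightarrow> 'b::real_normed_vector"
  assumes G: "continuous_on (standard_simplex p) G" and e: "e > 0"
  shows "\<exists>C\<ge>0. \<forall>x\<in>standard_simplex p. \<forall>y\<in>standard_simplex p.
     norm (G y - G x) \<le> e + C * (\<Sum>i\<le>p. (y i - x i)\<^sup>2)"
proof -
  define K where "K = (standard_simplex p \<times> standard_simplex p)"
  define F where "F = (\<lambda>(x, y). norm (G y - G x))"
  define q where "q = (\<lambda>(x, y). \<Sum>i\<le>p. (y i - x i :: real)\<^sup>2)"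
  have K: "compact K" unfolding K_def by (intro compact_Times compact_standard_simplex)
  have cF: "continuous_on K F" unfolding F_def K_def case_prod_unfold
    by (intro continuous_intros continuous_on_compose2[OF G]) auto
  have cq: "continuous_on UNIV q" unfolding q_def case_prod_unfold
    by (intro continuous_intros continuous_on_compose2[OF continuous_on_product_coordinates continuous_on_fst[OF continuous_on_id]]
       continuous_on_compose2[OF continuous_on_product_coordinates continuous_on_snd[OF continuous_on_id]]) auto
  have qn: "0 \<le> q z" for z by (auto simp: q_def intro!: sum_nonneg split: prod.split)
  define L where "L = {z \<in> K. e \<le> F z}"
  have L: "compact L"
  proof -
    have "closedin (top_of_set K) (K \<inter> F -` {e..})" by (intro continuous_closedin_preimage cF) auto
    moreover have "K \<inter> F -` {e..} = L" by (auto simp: L_def)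
    ultimately show ?thesis using K closedin_compact by metis
  qed
  show ?thesis
  proof (cases "L = {}")
    case True
    then have "F z \<le> e" if "z \<in> K" for z using that True unfolding L_def by (metis (mono_tags, lifting) empty_iff linear mem_Collect_eq)
    then show ?thesis by (intro exI[of _ 0]) (auto simp: F_def K_def)
  next
    case False
    obtain z where z: "z \<in> L" "\<And>w. w \<in> L \<Longrightarrow> q z \<le> q w"
      using continuous_attains_inf[OF L False continuous_on_subset[OF cq subset_UNIV]] by blast
    obtain m where m: "m \<in> K" "\<And>w. w \<in> K \<Longrightarrow> F w \<le> F m"
      using continuous_attains_sup[OF K _ cF] z(1) by (metis (no_types, lifting) L_def empty_iff mem_Collect_eq)
    have "q z \<noteq> 0"
    proof
      assume "q z = 0"
      obtain x y where xy: "z = (x, y)" by (cases z)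
      have "x i = y i" for i
      proof (cases "i \<le> p")
        case True
        then show ?thesis using \<open>q z = 0\<close> by (simp add: q_def xy sum_nonneg_eq_0_iff)
      next
        case False
        then show ?thesis using z(1) xy by (auto simp: L_def K_def standard_simplex_def)
      qed
      then have "x = y" by blast
      then have "F z = 0" by (simp add: F_def xy)
      then show False using z(1) e by (simp add: L_def)
    qed
    then have qz: "q z > 0" using qn[of z] by linarith
    have F0: "F m \<ge> 0" by (auto simp: F_def split: prod.split)
    show ?thesis
    proof (intro exI[of _ "F m / q z"] conjI ballI)
      fix x y assume xy: "x \<in> standard_simplex p" "y \<in> standard_simplex p"
      have "F (x, y) \<le> e + F m / q z * q (x, y)"
      proof (cases "(x, y) \<in> L")
        case True
        have "F (x, y) \<le> F m" using m xy by (auto simp: K_def)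
        also have "\<dots> = F m / q z * q z" using qz by simp
        also have "\<dots> \<le> F m / q z * q (x, y)" using z(2)[OF True] F0 qz by (intro mult_left_mono) auto
        finally show ?thesis using e by simp
      next
        case False
        then have "F (x, y) \<le> e" using xy by (auto simp: L_def K_def)
        moreover have "0 \<le> F m / q z * q (x, y)" using F0 qz qn by simp
        ultimately show ?thesis by linarith
      qed
      then show "norm (G y - G x) \<le> e + F m / q z * (\<Sum>i\<le>p. (y i - x i)\<^sup>2)" by (simp add: F_def q_def)
    qed (use F0 qz in auto)
  qed
qed

definition bernstein :: "nat \<Rightarrow> nat \<Rightarrow> ((nat \<Rightarrow> real) \<Rightarrow> 'b::real_normed_vector) \<Rightarrow> (nat \<Rightarrow> real) \<Rightarrow> 'b" where
  "bernstein p N \<sigma> = restrict (\<lambda>x. iid_mean p N x (\<lambda>y. \<sigma> (\<lambda>i. real (y i) / real N))) (standard_simplex p)"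

lemma bernstein_uniform:
  fixes \<sigma> :: "(nat \<Rightarrow> real) \<Rightarrow> 'b::real_normed_vector"
  assumes "continuous_on (standard_simplex p) \<sigma>" and e: "e > 0"
  shows "\<forall>\<^sub>F N in sequentially. \<forall>x\<in>standard_simplex p. norm (bernstein p N \<sigma> x - \<sigma> x) < e"
proof -
  obtain C where C: "C \<ge> 0" "\<And>x y. x \<in> standard_simplex p \<Longrightarrow> y \<in> standard_simplex p \<Longrightarrow>
     norm (\<sigma> y - \<sigma> x) \<le> e / 2 + C * (\<Sum>i\<le>p. (y i - x i)\<^sup>2)"
    using continuous_on_quadratic_modulus[OF assms(1), of "e / 2"] e by auto
  have "\<forall>\<^sub>F N in sequentially. C / real N < e / 2"
    using e by real_asymp
  then show ?thesis using eventually_gt_at_top[of 0]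
  proof eventually_elim
    case (elim N)
    show ?case
    proof
      fix x assume x: "x \<in> standard_simplex p"
      have "norm (iid_mean p N x (\<lambda>y. \<sigma> (\<lambda>i. real (y i) / real N)) - \<sigma> x) \<le> e / 2 + C / real N"
        by (rule bernstein_error[OF x elim(2) C(1)]) (use C(2)[OF x] counts_in_standard_simplex elim(2) in auto)
      then show "norm (bernstein p N \<sigma> x - \<sigma> x) < e" using elim(1) x unfolding bernstein_def restrict_apply by (simp only: if_True)
    qed
  qed
qed

lemma eventually_bernstein_in:
  fixes \<sigma> :: "(nat \<Rightarrow> real) \<Rightarrow> 'b::euclidean_space"
  assumes X: "open X" and \<sigma>: "singular_simplex p (top_of_set X) \<sigma>"
  shows "\<forall>\<^sub>F N in sequentially. bernstein p N \<sigma> ` standard_simplex p \<subseteq> X"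
proof -
  have c: "continuous_on (standard_simplex p) \<sigma>" "\<sigma> ` standard_simplex p \<subseteq> X"
    using \<sigma> by (auto simp: singular_simplex_top_of_set)
  have "compact (\<sigma> ` standard_simplex p)" using c compact_standard_simplex by (blast intro: compact_continuous_image)
  then obtain e where e: "e > 0" "(\<Union>x\<in>\<sigma> ` standard_simplex p. ball x e) \<subseteq> X"
    using compact_subset_open_imp_ball_epsilon_subset[OF _ X c(2)] by blast
  show ?thesis using bernstein_uniform[OF c(1) e(1)]
  proof eventually_elim
    case (elim N)
    show ?case
    proof
      fix z assume "z \<in> bernstein p N \<sigma> ` standard_simplex p"
      then obtain x where x: "x \<in> standard_simplex p" "z = bernstein p N \<sigma> x" by auto
      then have "z \<in> ball (\<sigma> x) e" using elim by (auto simp: dist_norm norm_minus_commute)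
      then show "z \<in> X" using x e by blast
    qed
  qed
qed

lemma singular_face_bernstein:
  assumes k: "k \<le> Suc p" and N: "N > 0"
  shows "singular_face (Suc p) k (bernstein (Suc p) N \<sigma>) = bernstein p N (singular_face (Suc p) k \<sigma>)"
proof
  fix x
  show "singular_face (Suc p) k (bernstein (Suc p) N \<sigma>) x = bernstein p N (singular_face (Suc p) k \<sigma>) x"
  proof (cases "x \<in> standard_simplex p")
    case True
    have f: "simplical_face k x \<in> standard_simplex (Suc p)"
      using simplical_face_in_standard_simplex[of "Suc p" k x] k True by auto
    have "iid_mean p N x (\<lambda>y. \<sigma> (\<lambda>i. real (simplical_face k y i) / real N)) =
       iid_mean p N x (\<lambda>y. singular_face (Suc p) k \<sigma> (\<lambda>i. real (y i) / real N))"
    proof (rule iid_mean_cong)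
      fix y :: "nat \<Rightarrow> nat" assume y: "\<And>i. p < i \<Longrightarrow> y i = 0" "(\<Sum>i\<le>p. y i) = N"
      have "(\<lambda>i. real (simplical_face k y i) / real N) = simplical_face k (\<lambda>i. real (y i) / real N)"
        by (auto simp: simplical_face_def)
      then show "\<sigma> (\<lambda>i. real (simplical_face k y i) / real N) = singular_face (Suc p) k \<sigma> (\<lambda>i. real (y i) / real N)"
        using counts_in_standard_simplex[OF y N] by (simp add: singular_face_def)
    qed
    then show ?thesis
      using True f by (simp add: bernstein_def singular_face_def iid_mean_face[OF k])
  qed (simp add: singular_face_def bernstein_def)
qed

text \<open>This is what makes Bernstein approximation suitable for chains: the approximation of a simplex restricts on each
  face to the approximation of that face, so cycles stay cycles.\<close>

lemma chain_boundary_bernstein: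
  assumes N: "N > 0"
  shows "chain_boundary (Suc p) (frag_extend (frag_of \<circ> bernstein (Suc p) N) e) =
    frag_extend (frag_of \<circ> bernstein p N) (chain_boundary (Suc p) e)"
  by (induction e rule: frag_induction[OF subset_UNIV])
    (simp_all add: chain_boundary_of chain_boundary_diff frag_extend_diff frag_extend_sum frag_extend_cmul
       singular_face_bernstein[OF _ N] o_def del: sum.atMost_Suc)

section \<open>Charts of simplices\<close>

lemma bij_rank: "bij_betw (rank :: 'n::{finite,linorder} \<Rightarrow> nat) UNIV {1..CARD('n)}"
proof -
  have mono: "rank i < rank j" if "i < j" for i j :: 'n
    unfolding rank_def
  proof (intro psubset_card_mono psubsetI)
    have "j \<in> {x. x \<le> j}" "j \<notin> {x. x \<le> i}" using that by auto
    then show "{x. x \<le> i} \<noteq> {x. x \<le> j}" by blast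
  qed (use that in auto)
  have inj: "inj (rank :: 'n \<Rightarrow> nat)"
    by (rule injI) (metis mono linorder_neqE less_irrefl)
  have "rank j \<in> {1..CARD('n)}" for j :: 'n
  proof -
    have "card {j} \<le> card {i. i \<le> j}" by (intro card_mono) auto
    moreover have "card {i. i \<le> j} \<le> CARD('n)" by (intro card_mono) auto
    ultimately show ?thesis by (simp add: rank_def)
  qed
  then have "range (rank :: 'n \<Rightarrow> nat) = {1..CARD('n)}"
    using inj by (intro card_subset_eq) (auto simp: card_image)
  then show ?thesis using inj by (simp add: bij_betw_def)
qed

lemma rank_bounds: "1 \<le> rank (j :: 'n::{finite,linorder})" "rank j \<le> CARD('n)" "rank j \<noteq> 0" "0 < rank j"
  using bij_betw_apply[OF bij_rank, of j] by auto

lemma rank_inject [simp]: "rank i = rank j \<longleftrightarrow> i = j"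
  using bij_betw_imp_inj_on[OF bij_rank] by (auto dest: injD)

lemma rank_surj: "1 \<le> m \<Longrightarrow> m \<le> CARD('n::{finite,linorder}) \<Longrightarrow> \<exists>j::'n. rank j = m"
  using bij_betw_imp_surj_on[OF bij_rank] by (metis atLeastAtMost_iff imageE)

lemma sum_rank:
  fixes g :: "nat \<Rightarrow> 'b::comm_monoid_add"
  shows "(\<Sum>m\<le>CARD('n). g m) = g 0 + (\<Sum>j\<in>UNIV. g (rank (j :: 'n::{finite,linorder})))"
proof -
  have "(\<Sum>m\<le>CARD('n). g m) = g 0 + (\<Sum>m\<in>{1..CARD('n)}. g m)"
    by (simp add: sum.atMost_shift sum.atLeast1_atMost_eq)
  then show ?thesis using sum.reindex_bij_betw[OF bij_rank[where 'n = 'n], of g] by simp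
qed

lemma bary_rank [simp]: "bary t (rank j) = t $ j"
  by (simp add: bary_def rank_bounds)
lemma bary_0 [simp]: "bary t 0 = 1 - (\<Sum>j\<in>UNIV. t $ j)"
  by (simp add: bary_def)
lemma bary_gt: "CARD('n) < m \<Longrightarrow> bary (t :: real^'n::{finite,linorder}) m = 0"
proof -
  assume m: "CARD('n) < m"
  have "{j :: 'n. rank j = m} = {}" using rank_bounds(2)[where 'n = 'n] m by (auto simp: leD)
  then show ?thesis using m by (simp add: bary_def)
qed

lemma eq_at_ranks:
  fixes f g :: "nat \<Rightarrow> 'a"
  assumes "f 0 = g 0" "\<And>j::'n::{finite,linorder}. f (rank j) = g (rank j)" "\<And>m. CARD('n) < m \<Longrightarrow> f m = g m"
  shows "f = g"
proof
  fix m show "f m = g m"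
    using assms rank_surj[of m, where 'n = 'n] by (metis One_nat_def less_Suc0 not_le)
qed

lemma bary_in_standard_simplex: "bary (t :: real^'n::{finite,linorder}) \<in> standard_simplex CARD('n) \<longleftrightarrow> t \<in> corner_simplex"
proof
  assume t: "t \<in> corner_simplex"
  have s: "(\<Sum>m\<le>CARD('n). bary t m) = 1" by (simp add: sum_rank)
  have nn: "0 \<le> bary t m" for m
    using t by (auto simp: bary_def corner_simplex_def intro!: sum_nonneg)
  have "bary t m \<le> 1" for m
  proof (cases "m \<le> CARD('n)")
    case True
    then show ?thesis using s member_le_sum[of m "{..CARD('n)}" "bary t"] nn by auto
  qed (simp add: bary_gt)
  then show "bary t \<in> standard_simplex CARD('n)" using s nn by (auto simp: standard_simplex_def bary_gt)
next
  assume t: "bary t \<in> standard_simplex CARD('n)"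
  have "0 \<le> bary t (rank j)" "0 \<le> bary t 0" for j :: 'n using t by (auto simp only: standard_simplexD)
  then show "t \<in> corner_simplex" unfolding bary_rank bary_0 by (simp add: corner_simplex_def)
qed

lemma standard_simplex_bary:
  assumes "x \<in> standard_simplex CARD('n)"
  shows "x = bary (\<chi> j :: 'n::{finite,linorder}. x (rank j))"
proof (rule eq_at_ranks[where 'n = 'n])
  show "x 0 = bary (\<chi> j :: 'n. x (rank j)) 0"
    using standard_simplexD(4)[OF assms] by (simp add: sum_rank)
qed (use standard_simplexD(3)[OF assms] in \<open>auto simp: bary_gt\<close>)

lemma image_bary: "bary ` (corner_simplex :: (real^'n::{finite,linorder}) set) = standard_simplex CARD('n)"
proof
  show "standard_simplex CARD('n) \<subseteq> bary ` (corner_simplex :: (real^'n::_) set)"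
  proof
    fix x assume x: "x \<in> standard_simplex CARD('n)"
    note eq = standard_simplex_bary[OF x]
    have "(\<chi> j :: 'n. x (rank j)) \<in> corner_simplex" using x bary_in_standard_simplex eq by metis
    then show "x \<in> bary ` (corner_simplex :: (real^'n::_) set)" using eq by blast
  qed
qed (use bary_in_standard_simplex in auto)

lemma continuous_bary: "continuous_on S (\<lambda>t :: real^'n::{finite,linorder}. bary t m)"
  by (cases "m = 0") (auto simp: bary_def intro!: continuous_intros)

lemma bary_has_derivative:
  "((\<lambda>t :: real^'n::{finite,linorder}. bary t m) has_derivative (\<lambda>d. if m = 0 then - (\<Sum>j\<in>UNIV. d $ j) else (\<Sum>j | rank j = m. d $ j))) (at t within S)"
  by (cases "m = 0") (auto simp: bary_def intro!: derivative_eq_intros bounded_linear_imp_has_derivative bounded_linear_vec_nth bounded_linear_sum)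

lemma corner_simplex_eq: "(corner_simplex :: (real^'n) set) = (\<Inter>j. {t. 0 \<le> t $ j}) \<inter> {t. (\<Sum>j\<in>UNIV. t $ j) \<le> 1}"
  by (auto simp: corner_simplex_def)

lemma compact_corner_simplex: "compact (corner_simplex :: (real^'n) set)"
proof -
  have "closed (corner_simplex :: (real^'n) set)"
    unfolding corner_simplex_eq by (intro closed_Int closed_INT ballI closed_Collect_le continuous_intros)
  moreover have "corner_simplex \<subseteq> cbox 0 (1 :: real^'n)"
  proof
    fix t :: "real^'n" assume t: "t \<in> corner_simplex"
    have "t $ j \<le> 1" for j
      using t member_le_sum[of j UNIV "\<lambda>j. t $ j"] by (force simp: corner_simplex_def)
    then show "t \<in> cbox 0 1" using t by (auto simp: mem_box_cart corner_simplex_def)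
  qed
  ultimately show ?thesis by (meson bounded_cbox bounded_subset compact_eq_bounded_closed)
qed

lemma convex_corner_simplex: "convex (corner_simplex :: (real^'n) set)"
  unfolding corner_simplex_eq
proof (intro convex_Int convex_INT)
  show "convex {t :: real^'n. 0 \<le> t $ j}" for j
    by (auto simp: convex_def)
  show "convex {t :: real^'n. (\<Sum>j\<in>UNIV. t $ j) \<le> 1}"
    by (auto simp: convex_def sum.distrib convex_bound_le simp flip: sum_distrib_left)
qed

lemma negligible_frontier_corner: "negligible (frontier (corner_simplex :: (real^'n) set))"
  by (rule negligible_convex_frontier[OF convex_corner_simplex])

lemma sets_corner_simplex [measurable]: "(corner_simplex :: (real^'n) set) \<in> sets borel"
  by (simp add: borel_compact compact_corner_simplex)

abbreviation corner_integral :: "(real^'n \<Rightarrow> complex) \<Rightarrow> complex" where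
  "corner_integral \<phi> \<equiv> (LINT t:corner_simplex|lborel. \<phi> t)"

lemma set_integrable_compact:
  fixes f :: "'a::euclidean_space \<Rightarrow> 'b::euclidean_space"
  assumes "compact S" "continuous_on S f" shows "set_integrable lborel S f"
  unfolding set_integrable_def using borel_integrable_compact[OF assms]
  by (simp add: indicator_def if_distrib[where f = "\<lambda>c. c *\<^sub>R _"] cong: if_cong)

lemma integral_corner_simplex:
  fixes \<phi> :: "real^'n \<Rightarrow> complex"
  assumes "continuous_on corner_simplex \<phi>"
  shows "integral corner_simplex \<phi> = corner_integral \<phi>"
  using set_borel_integral_eq_integral(2)[OF set_integrable_compact[OF compact_corner_simplex assms]] by simp

text \<open>The definition of the integral uses the derivative within the closed simplex. On the interior it is the derivative
  of any differentiable extension, and the frontier has measure zero.\<close>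

lemma simplex_integral_smooth:
  fixes F :: "real^'n::{finite,linorder} \<Rightarrow> complex^'n::_"
  assumes F: "\<And>t. t \<in> interior corner_simplex \<Longrightarrow> (F has_derivative F' t) (at t)"
    and eq: "\<And>t. t \<in> corner_simplex \<Longrightarrow> F t = \<sigma> (bary t)"
  shows "simplex_integral g \<sigma> = integral corner_simplex (\<lambda>t. g (F t) * det (\<chi> i j. F' t (axis j 1) $ i))"
  unfolding simplex_integral_def
proof (rule integral_spike[OF negligible_frontier_corner])
  fix t :: "real^'n::_" assume t: "t \<in> corner_simplex - frontier corner_simplex"
  then have ti: "t \<in> interior corner_simplex"
    using closure_subset by (auto simp: frontier_def)
  have "((\<lambda>u. \<sigma> (bary u)) has_derivative F' t) (at t)"
    by (rule has_derivative_transform_within_open[OF F[OF ti] open_interior ti])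
      (use eq interior_subset in auto)
  then have "frechet_derivative (\<lambda>u. \<sigma> (bary u)) (at t) = F' t"
    using frechet_derivative_at by metis
  then show "g (F t) * det (\<chi> i j. F' t (axis j 1) $ i) =
    g (\<sigma> (bary t)) * det (\<chi> i j. frechet_derivative (\<lambda>u. \<sigma> (bary u)) (at t within corner_simplex) (axis j 1) $ i)"
    using t eq by (simp add: at_within_interior[OF ti])
qed

lemma LINT_measure_preserving:
  fixes \<phi> :: "'a::euclidean_space \<Rightarrow> complex" and f :: "'a \<Rightarrow> 'a"
  assumes f: "distr lborel lborel f = lborel" "continuous_on UNIV f" and S: "\<And>x. f x \<in> S \<longleftrightarrow> x \<in> S"
    and comp: "compact S" and cont: "continuous_on S \<phi>"
  shows "(LINT x:S|lborel. \<phi> (f x)) = (LINT x:S|lborel. \<phi> x)"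
proof -
  have m: "(\<lambda>x. indicator S x *\<^sub>R \<phi> x) \<in> borel_measurable borel"
    using comp cont by (intro borel_measurable_continuous_on_indicator) (auto simp: borel_compact)
  have [measurable]: "f \<in> borel_measurable borel" using f(2) by (rule borel_measurable_continuous_onI)
  have "(LINT x:S|lborel. \<phi> x) = (LINT x|distr lborel lborel f. indicator S x *\<^sub>R \<phi> x)"
    using f by (simp add: set_lebesgue_integral_def)
  also have "\<dots> = (LINT x|lborel. indicator S (f x) *\<^sub>R \<phi> (f x))"
    using m by (subst integral_distr) auto
  finally show ?thesis by (simp add: set_lebesgue_integral_def indicator_def S)
qed

text \<open>Permuting coordinates preserves Lebesgue measure and the simplex.\<close>

lemma corner_integral_permute:
  fixes \<phi> :: "real^'n::{finite,linorder} \<Rightarrow> complex"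
  assumes p: "bij (p :: 'n \<Rightarrow> 'n)" and cont: "continuous_on corner_simplex \<phi>"
  shows "corner_integral (\<lambda>t. \<phi> (\<chi> i. t $ p i)) = corner_integral \<phi>"
proof -
  let ?f = "\<lambda>t :: real^'n::_. \<chi> i. t $ p i"
  obtain q where q: "\<And>i. q (p i) = i" "\<And>i. p (q i) = i" using p by (metis bij_pointE bij_def inv_f_f surj_f_inv_f)
  have ax: "?f (axis i 1) = axis (q i) 1" for i
    using q by (auto simp: axis_def vec_eq_iff)
  have ax': "(\<chi> k. axis i 1 $ q k) = (axis (p i) 1 :: real^'n::_)" for i
    using q by (auto simp: axis_def vec_eq_iff)
  have 1: "distr lborel lborel ?f = lborel"
  proof (rule lborel_distr_basis_bij)
    show "linear ?f" by (auto simp: linear_iff vec_eq_iff)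
    show "bij_betw ?f Basis Basis"
      by (rule bij_betwI[where g = "\<lambda>t. \<chi> i. t $ q i"]) (auto simp: Basis_vec_def ax ax' q)
  qed
  have 2: "continuous_on UNIV ?f" by (intro continuous_intros)
  have "(\<Sum>j\<in>UNIV. t $ p j) = (\<Sum>j\<in>UNIV. t $ j)" for t :: "real^'n::_"
    using p by (simp add: sum.reindex_bij_betw)
  then have 3: "?f t \<in> corner_simplex \<longleftrightarrow> t \<in> corner_simplex" for t
    by (auto simp: corner_simplex_def) (metis q(2))
  show ?thesis
    using LINT_measure_preserving[OF 1 2 3 compact_corner_simplex cont] .
qed

text \<open>Exchanging a coordinate with the dependent barycentric coordinate \<open>1 - \<Sum>t\<close> is a linear involution up to
  translation; the faces of a simplex are compared through such maps.\<close>

lemma corner_integral_reflect: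
  fixes \<phi> :: "real^'n::{finite,linorder} \<Rightarrow> complex"
  assumes cont: "continuous_on corner_simplex \<phi>"
  shows "corner_integral (\<lambda>t. \<phi> (\<chi> i. if i = j then 1 - (\<Sum>l\<in>UNIV. t $ l) else t $ i)) = corner_integral \<phi>"
proof -
  let ?f = "\<lambda>t :: real^'n::_. \<chi> i. if i = j then 1 - (\<Sum>l\<in>UNIV. t $ l) else t $ i"
  let ?L = "\<lambda>t :: real^'n::_. \<chi> i. if i = j then - (\<Sum>l\<in>UNIV. t $ l) else t $ i"
  have split: "(\<Sum>l\<in>UNIV. t $ l) = t $ j + (\<Sum>l\<in>UNIV - {j}. t $ l)" for t :: "real^'n::_"
    by (simp add: sum.remove)
  have sumif: "(\<Sum>l\<in>UNIV. if l = j then c else t $ l) = c + (\<Sum>l\<in>UNIV - {j}. t $ l)" for t :: "real^'n::_" and c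
    by (simp add: sum.remove[of UNIV j] if_distrib cong: if_cong)
  have L: "linear ?L"
    by (auto simp: linear_iff vec_eq_iff sum.distrib sum_distrib_left)
  have "?L (?L t) = t" for t by (auto simp: vec_eq_iff split sumif)
  then have dL: "distr lborel lborel ?L = lborel" by (intro lborel_distr_linear_involution L)
  have [measurable]: "?L \<in> borel_measurable borel" by (rule measurable_linear[OF L])
  have "?f = (+) (axis j 1) \<circ> ?L" by (auto simp: o_def vec_eq_iff axis_def)
  then have "distr (distr lborel lborel ?L) borel ((+) (axis j 1)) = distr lborel borel ?f"
    by (simp add: distr_distr)
  moreover have "distr lborel lborel ?f = distr lborel borel ?f" by (rule distr_cong) auto
  ultimately have 1: "distr lborel lborel ?f = lborel"
    unfolding dL by (metis lborel_distr_plus)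
  have 2: "continuous_on UNIV ?f"
  proof (intro continuous_on_vec_lambda)
    show "continuous_on UNIV (\<lambda>t :: real^'n::_. if i = j then 1 - (\<Sum>l\<in>UNIV. t $ l) else t $ i)" for i
      by (cases "i = j") (auto intro!: continuous_intros)
  qed
  have 3: "?f t \<in> corner_simplex \<longleftrightarrow> t \<in> corner_simplex" for t
  proof -
    have "?f t \<in> corner_simplex \<longleftrightarrow> (\<forall>i. i \<noteq> j \<longrightarrow> 0 \<le> t $ i) \<and> 0 \<le> 1 - (\<Sum>l\<in>UNIV. t $ l) \<and> 1 - t $ j \<le> 1"
      by (auto simp: corner_simplex_def split sumif) 
    then show ?thesis by (auto simp: corner_simplex_def)
  qed
  show ?thesis
    using LINT_measure_preserving[OF 1 2 3 compact_corner_simplex cont] .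
qed

section \<open>Determinant identities\<close>

lemma det_row_axis:
  fixes V :: "'n::finite \<Rightarrow> 'a::comm_ring_1^'n"
  shows "det (\<chi> l. if l = j then axis m 1 else V l) = det (\<chi> l i. if i = m then (if l = j then 1 else 0) else V l $ i)"
  unfolding det_def
proof (rule sum.cong[OF refl])
  fix p :: "'n \<Rightarrow> 'n" assume "p \<in> {p. p permutes UNIV}"
  then have p: "p permutes UNIV" by simp
  show "of_int (sign p) * (\<Prod>i\<in>UNIV. (\<chi> l. if l = j then axis m 1 else V l) $ i $ p i) =
    of_int (sign p) * (\<Prod>i\<in>UNIV. (\<chi> l i. if i = m then (if l = j then 1 else 0) else V l $ i) $ i $ p i)"
  proof (cases "p j = m")
    case True
    then have "p i = m \<longleftrightarrow> i = j" for i using permutes_inj[OF p] by (auto dest: injD)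
    then show ?thesis by (intro arg_cong2[where f = "(*)"] prod.cong) (auto simp: axis_def)
  next
    case False
    obtain i0 where i0: "p i0 = m" using p by (metis permutes_surj surjD)
    with False have ne: "i0 \<noteq> j" by auto
    have "(\<Prod>i\<in>UNIV. (\<chi> l. if l = j then axis m 1 else V l) $ i $ p i) = 0"
      by (rule prod_zero) (use False in \<open>auto simp: axis_def intro!: bexI[of _ j]\<close>)
    moreover have "(\<Prod>i\<in>UNIV. (\<chi> l i. if i = m then (if l = j then 1 else 0) else V l $ i) $ i $ p i) = 0"
      by (rule prod_zero) (use i0 ne in \<open>auto intro!: bexI[of _ i0]\<close>)
    ultimately show ?thesis by simp
  qed
qed

lemma cramer_rows:
  fixes V :: "'n::finite \<Rightarrow> 'a::comm_ring_1^'n"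
  shows "(\<Sum>j\<in>UNIV. det (\<chi> l. if l = j then b else V l) * V j $ k) = det (\<chi> l. V l) * b $ k"
proof -
  let ?F = "\<lambda>m j. det (\<chi> l. if l = j then axis m 1 else V l)"
  have lin: "det (\<chi> l. if l = j then b else V l) = (\<Sum>m\<in>UNIV. b $ m * ?F m j)" for j
  proof -
    have "b = (\<Sum>m\<in>UNIV. b $ m *s axis m 1)"
      by (simp add: vec_eq_iff axis_def if_distrib cong: if_cong)
    then have "det (\<chi> l. if l = j then b else V l) = det (\<chi> l. if l = j then (\<Sum>m\<in>UNIV. b $ m *s axis m 1) else V l)"
      by (rule arg_cong[where f = "\<lambda>b. det (\<chi> l. if l = j then b else V l)"])
    also have "\<dots> = (\<Sum>m\<in>UNIV. b $ m * ?F m j)" by (simp add: det_linear_row_sum det_row_mul)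
    finally show ?thesis .
  qed
  have col: "(\<Sum>j\<in>UNIV. ?F m j * V j $ k) = (if m = k then det (\<chi> l. V l) else 0)" for m
  proof -
    let ?c = "\<lambda>i. \<chi> l. V l $ i"
    have "(\<Sum>j\<in>UNIV. ?F m j * V j $ k) = (\<Sum>j\<in>UNIV. V j $ k * det (\<chi> i. if i = m then axis j 1 else ?c i))"
    proof (intro sum.cong refl)
      fix j
      have "(\<chi> l i. if i = m then (if l = j then 1 else 0) else V l $ i) = Finite_Cartesian_Product.transpose (\<chi> i. if i = m then axis j 1 else ?c i)"
        by (auto simp: vec_eq_iff Finite_Cartesian_Product.transpose_def axis_def)
      then show "?F m j * V j $ k = V j $ k * det (\<chi> i. if i = m then axis j 1 else ?c i)"
        by (simp only: det_row_axis det_transpose mult.commute)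
    qed
    also have "\<dots> = det (\<chi> i. if i = m then (\<Sum>j\<in>UNIV. V j $ k *s axis j 1) else ?c i)"
      by (simp add: det_linear_row_sum det_row_mul)
    also have "(\<Sum>j\<in>UNIV. V j $ k *s axis j 1) = ?c k"
      by (simp add: vec_eq_iff axis_def if_distrib cong: if_cong)
    also have "det (\<chi> i. if i = m then ?c k else ?c i) = (if m = k then det (\<chi> l. V l) else 0)"
    proof (cases "m = k")
      case True
      then have "(\<chi> i. if i = m then ?c k else ?c i) = transpose (\<chi> l. V l)"
        by (auto simp: vec_eq_iff transpose_def)
      then show ?thesis using True by (simp only: det_transpose simp_thms if_True)
    next
      case False
      then have "det (\<chi> i. if i = m then ?c k else ?c i) = 0"
        by (intro det_identical_rows[of m k]) (auto simp: row_def)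
      then show ?thesis using False by simp
    qed
    finally show ?thesis .
  qed
  have "(\<Sum>j\<in>UNIV. det (\<chi> l. if l = j then b else V l) * V j $ k) = (\<Sum>m\<in>UNIV. b $ m * (\<Sum>j\<in>UNIV. ?F m j * V j $ k))"
    unfolding lin sum_distrib_left sum_distrib_right by (subst sum.swap) (simp add: mult.assoc)
  also have "\<dots> = b $ k * det (\<chi> l. V l)" by (simp add: col if_distrib cong: if_cong)
  finally show ?thesis by (simp add: mult.commute)
qed

lemma det_rows_diff_common:
  fixes V :: "'n::finite \<Rightarrow> 'a::comm_ring_1^'n"
  shows "det (\<chi> j. V j - u) = det (\<chi> j. V j) - (\<Sum>k\<in>UNIV. det (\<chi> j. if j = k then u else V j))"
proof -
  have A: "det (\<chi> j. if j = k then u else if j \<in> S then V j - u else V j) = det (\<chi> j. if j = k then u else V j)"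
    if "k \<notin> S" for S k
    using finite[of S] that
  proof (induction S)
    case (insert i S)
    let ?M = "\<chi> j. if j = k then u else if j \<in> S then V j - u else V j"
    have "det (\<chi> l. if l = i then row i ?M + (- 1) *s row k ?M else row l ?M) = det ?M"
      using insert by (intro det_row_operation) auto
    moreover have "(\<chi> l. if l = i then row i ?M + (- 1) *s row k ?M else row l ?M) =
       (\<chi> j. if j = k then u else if j \<in> insert i S then V j - u else V j)"
      using insert by (auto simp: vec_eq_iff row_def)
    ultimately show ?case using insert by simp
  qed (simp cong: if_cong)
  have "det (\<chi> j. if j \<in> S then V j - u else V j) = det (\<chi> j. V j) - (\<Sum>k\<in>S. det (\<chi> j. if j = k then u else V j))" for S
    using finite[of S]
  proof (induction S)
    case (insert k S)
    let ?W = "\<lambda>j. if j \<in> S then V j - u else V j"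
    have "(\<chi> j. if j \<in> insert k S then V j - u else V j) = (\<chi> j. if j = k then V k + (- 1) *s u else ?W j)"
      using insert by (auto simp: vec_eq_iff)
    then have "det (\<chi> j. if j \<in> insert k S then V j - u else V j) =
       det (\<chi> j. if j = k then V k else ?W j) - det (\<chi> j. if j = k then u else ?W j)"
      by (simp only: det_row_add det_row_mul) simp
    moreover have "(\<chi> j. if j = k then V k else ?W j) = (\<chi> j. ?W j)" using insert by (auto simp: vec_eq_iff)
    ultimately show ?case using insert A[of k S] by simp
  qed (simp cong: if_cong)
  from this[of UNIV] show ?thesis by simp
qed

lemma det_swap_rows:
  fixes V :: "'n::finite \<Rightarrow> 'a::{comm_ring_1}^'n"
  assumes "i \<noteq> j"
  shows "det (\<chi> l. if l = i then a else if l = j then b else V l) = - det (\<chi> l. if l = i then b else if l = j then a else V l)"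
proof -
  let ?A = "\<chi> l. if l = i then b else if l = j then a else V l"
  have "det (\<chi> l. ?A $ Transposition.transpose i j l) = of_int (sign (Transposition.transpose i j)) * det ?A"
    by (rule det_permute_rows) (simp add: permutes_swap_id)
  moreover have "(\<chi> l. ?A $ Transposition.transpose i j l) = (\<chi> l. if l = i then a else if l = j then b else V l)"
    using assms by (auto simp: vec_eq_iff Transposition.transpose_def)
  ultimately show ?thesis using assms by (simp add: sign_swap_id)
qed

lemma has_derivative_det:
  fixes M :: "'a::real_normed_vector \<Rightarrow> 'n::finite \<Rightarrow> complex^'n"
  assumes "\<And>j. ((\<lambda>x. M x j) has_derivative M' j) (at x within S)"
  shows "((\<lambda>x. det (\<chi> j. M x j)) has_derivative (\<lambda>v. \<Sum>k\<in>UNIV. det (\<chi> j. if j = k then M' j v else M x j))) (at x within S)"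
proof -
  have comp: "((\<lambda>x. M x j $ i) has_derivative (\<lambda>v. M' j v $ i)) (at x within S)" for i j
    using bounded_linear.has_derivative[OF bounded_linear_vec_nth assms] .
  have "((\<lambda>x. det (\<chi> j. M x j)) has_derivative (\<lambda>v. \<Sum>p | p permutes UNIV. of_int (sign p) *
     (\<Sum>k\<in>UNIV. M' k v $ p k * (\<Prod>i\<in>UNIV - {k}. M x i $ p i)))) (at x within S)"
    unfolding det_def vec_lambda_beta
    by (intro has_derivative_sum has_derivative_mult_right has_derivative_prod comp)
  moreover have "(\<Sum>p | p permutes UNIV. of_int (sign p) * (\<Sum>k\<in>UNIV. M' k v $ p k * (\<Prod>i\<in>UNIV - {k}. M x i $ p i)))
      = (\<Sum>k\<in>UNIV. det (\<chi> j. if j = k then M' j v else M x j))" for v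
  proof -
    have pr: "M' k v $ p k * (\<Prod>i\<in>UNIV - {k}. M x i $ p i) = (\<Prod>i\<in>UNIV. (\<chi> j. if j = k then M' j v else M x j) $ i $ p i)" for p k
      by (subst prod.remove[of UNIV k]) (auto intro!: prod.cong)
    show ?thesis unfolding det_def sum_distrib_left pr by (rule sum.swap)
  qed
  ultimately show ?thesis by simp
qed

lemma continuous_on_det:
  fixes M :: "'a::topological_space \<Rightarrow> 'n::finite \<Rightarrow> complex^'n"
  assumes "\<And>j. continuous_on S (\<lambda>x. M x j)"
  shows "continuous_on S (\<lambda>x. det (\<chi> j. M x j))"
  unfolding det_def vec_lambda_beta by (intro continuous_intros assms)

section \<open>Stokes' theorem on a simplex\<close>

text \<open>The standard simplex of dimension n + 1 as the region over \<open>corner_simplex\<close>, so that Fubini's theorem integrates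
  along the extra coordinate first.\<close>

definition next_corner_simplex :: "((real^'n) \<times> real) set" where
  "next_corner_simplex = {(t, r). (\<forall>j. 0 \<le> t $ j) \<and> 0 \<le> r \<and> (\<Sum>j\<in>UNIV. t $ j) + r \<le> 1}"

lemma mem_next_corner_simplex:
  "(t, r) \<in> next_corner_simplex \<longleftrightarrow> t \<in> corner_simplex \<and> r \<in> {0..1 - (\<Sum>j\<in>UNIV. t $ j)}"
  by (auto simp: next_corner_simplex_def corner_simplex_def)

lemma compact_next_corner_simplex: "compact (next_corner_simplex :: ((real^'n) \<times> real) set)"
proof -
  have eq: "(next_corner_simplex :: ((real^'n) \<times> real) set) =
     (\<Inter>j. {z. 0 \<le> fst z $ j}) \<inter> {z. 0 \<le> snd z} \<inter> {z. (\<Sum>j\<in>UNIV. fst z $ j) + snd z \<le> 1}"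
    by (auto simp: next_corner_simplex_def)
  have "closed (next_corner_simplex :: ((real^'n) \<times> real) set)"
    unfolding eq by (intro closed_Int closed_INT ballI closed_Collect_le continuous_intros)
  moreover have "next_corner_simplex \<subseteq> (corner_simplex :: (real^'n) set) \<times> {0..1}"
  proof clarify
    fix t :: "real^'n" and r assume z: "(t, r) \<in> next_corner_simplex"
    then have "0 \<le> (\<Sum>j\<in>UNIV. t $ j)" by (auto simp: next_corner_simplex_def intro!: sum_nonneg)
    then show "t \<in> corner_simplex \<and> r \<in> {0..1}" using z by (auto simp: mem_next_corner_simplex)
  qed
  moreover have "bounded ((corner_simplex :: (real^'n) set) \<times> {0..1::real})"
    by (intro compact_imp_bounded compact_Times compact_corner_simplex compact_Icc)
  ultimately show ?thesis by (meson bounded_subset compact_eq_bounded_closed)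
qed

lemma LINT_next_corner_simplex:
  fixes A A' :: "(real^'n) \<times> real \<Rightarrow> complex"
  assumes cA: "continuous_on next_corner_simplex A" and cA': "continuous_on next_corner_simplex A'"
    and deriv: "\<And>t r. (t, r) \<in> next_corner_simplex \<Longrightarrow> ((\<lambda>s. A (t, s)) has_vector_derivative A' (t, r)) (at r)"
  shows "(LINT z:next_corner_simplex|lborel. A' z) =
    corner_integral (\<lambda>t. A (t, 1 - (\<Sum>j\<in>UNIV. t $ j))) - corner_integral (\<lambda>t. A (t, 0))"
proof -
  have int: "integrable (lborel \<Otimes>\<^sub>M lborel) (\<lambda>z. indicator next_corner_simplex z *\<^sub>R A' z)"
    using set_integrable_compact[OF compact_next_corner_simplex cA'] by (simp add: set_integrable_def lborel_prod)
  have "(LINT z:next_corner_simplex|lborel. A' z) = (\<integral>z. indicator next_corner_simplex z *\<^sub>R A' z \<partial>(lborel \<Otimes>\<^sub>M lborel))"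
    by (simp add: set_lebesgue_integral_def lborel_prod)
  also have "\<dots> = (LINT t|lborel. LINT r|lborel. indicator next_corner_simplex (t, r) *\<^sub>R A' (t, r))"
    using lborel_pair.integral_fst'[OF int] by simp
  also have "\<dots> = corner_integral (\<lambda>t. A (t, 1 - (\<Sum>j\<in>UNIV. t $ j)) - A (t, 0))"
    unfolding set_lebesgue_integral_def
  proof (intro Bochner_Integration.integral_cong refl)
    fix t :: "real^'n"
    show "(LINT r|lborel. indicator next_corner_simplex (t, r) *\<^sub>R A' (t, r)) =
      indicator corner_simplex t *\<^sub>R (A (t, 1 - (\<Sum>j\<in>UNIV. t $ j)) - A (t, 0))"
    proof (cases "t \<in> corner_simplex")
      case True
      let ?b = "1 - (\<Sum>j\<in>UNIV. t $ j)"
      have "(LINT r|lborel. indicator next_corner_simplex (t, r) *\<^sub>R A' (t, r)) = (LINT r|lborel. indicator {0..?b} r *\<^sub>R A' (t, r))"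
        using True by (intro Bochner_Integration.integral_cong refl) (auto simp: indicator_def mem_next_corner_simplex)
      also have "\<dots> = A (t, ?b) - A (t, 0)"
      proof (rule integral_FTC_atLeastAtMost)
        show "((\<lambda>s. A (t, s)) has_vector_derivative A' (t, r)) (at r within {0..?b})" if "0 \<le> r" "r \<le> ?b" for r
          using deriv[of t r] that True by (auto simp: mem_next_corner_simplex intro: has_vector_derivative_at_within)
        show "continuous_on {0..?b} (\<lambda>r. A' (t, r))"
          by (rule continuous_on_compose2[OF cA']) (use True in \<open>auto intro!: continuous_intros simp: mem_next_corner_simplex\<close>)
        show "0 \<le> ?b" using True by (simp add: corner_simplex_def)
      qed
      finally show ?thesis using True by simp
    qed (simp add: mem_next_corner_simplex)
  qed
  also have "\<dots> = corner_integral (\<lambda>t. A (t, 1 - (\<Sum>j\<in>UNIV. t $ j))) - corner_integral (\<lambda>t. A (t, 0))"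
    by (intro set_integral_diff(2) set_integrable_compact compact_corner_simplex continuous_on_compose2[OF cA])
      (auto intro!: continuous_intros simp: mem_next_corner_simplex corner_simplex_def)
  finally show ?thesis .
qed

text \<open>Exchanging the last coordinate with another one reduces the derivative in an arbitrary direction to the last one.\<close>

definition swap_last :: "'n \<Rightarrow> (real^'n) \<times> real \<Rightarrow> (real^'n) \<times> real" where
  "swap_last j z = (\<chi> i. if i = j then snd z else fst z $ i, fst z $ j)"

lemma swap_last_swap_last [simp]: "swap_last j (swap_last j z) = z"
  by (cases z) (auto simp: swap_last_def vec_eq_iff)

lemma sum_swap_last: "(\<Sum>i\<in>UNIV. fst (swap_last j z) $ i) + snd (swap_last j z) = (\<Sum>i\<in>UNIV. fst z $ i) + snd z"
proof -
  have "(\<Sum>i\<in>UNIV. if i = j then snd z else fst z $ i) = snd z + (\<Sum>i\<in>UNIV - {j}. fst z $ i)"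
    by (simp add: sum.remove[of UNIV j])
  then show ?thesis by (simp add: swap_last_def sum.remove[of UNIV j])
qed

lemma swap_last_in [simp]: "swap_last (j :: 'n::finite) z \<in> next_corner_simplex \<longleftrightarrow> z \<in> next_corner_simplex"
proof -
  have "swap_last j z \<in> next_corner_simplex" if "z \<in> next_corner_simplex" for z :: "(real^'n) \<times> real"
    using that sum_swap_last[of j z] by (auto simp: next_corner_simplex_def swap_last_def split: prod.splits)
  from this[of z] this[of "swap_last j z"] show ?thesis by auto
qed

lemma continuous_swap_last: "continuous_on S (swap_last (j :: 'n::finite))"
proof -
  have "continuous_on S (\<lambda>z :: (real^'n) \<times> real. if i = j then snd z else fst z $ i)" for i
    by (cases "i = j") (auto intro!: continuous_intros)
  then show ?thesis unfolding swap_last_def by (intro continuous_intros)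
qed

lemma distr_swap_last: "distr lborel lborel (swap_last (j :: 'n::finite)) = lborel"
proof (rule lborel_distr_basis_bij)
  show "linear (swap_last j)"
    by (auto simp: linear_iff swap_last_def vec_eq_iff)
  have "swap_last j (0, 1) = (axis j 1, 0)" "swap_last j (axis j 1, 0) = (0, 1)"
      "i \<noteq> j \<Longrightarrow> swap_last j (axis i 1, 0) = (axis i 1, 0)" for i
    by (auto simp: swap_last_def vec_eq_iff axis_def)
  moreover have "(axis i 1, 0) \<in> (Basis :: ((real^'n) \<times> real) set)" "(0, 1) \<in> (Basis :: ((real^'n) \<times> real) set)" for i
    by (auto simp: Basis_prod_def Basis_vec_def)
  ultimately have "swap_last j (axis i 1, 0) \<in> Basis" "swap_last j (0, 1) \<in> Basis" for i
    by metis+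
  have "swap_last j ` Basis \<subseteq> Basis"
  proof (rule image_subsetI)
    fix z :: "(real^'n) \<times> real" assume "z \<in> Basis"
    then consider i where "z = (axis i 1, 0)" | "z = (0, 1)"
      by (auto simp: Basis_prod_def Basis_vec_def)
    then show "swap_last j z \<in> Basis"
      using \<open>\<And>i. swap_last j (axis i 1, 0) \<in> Basis\<close> \<open>swap_last j (0, 1) \<in> Basis\<close> by cases (simp_all only:)
  qed
  then show "bij_betw (swap_last j) Basis Basis"
    by (intro bij_betwI[where g = "swap_last j"]) auto
qed

text \<open>The n + 1 directions are indexed by \<open>'n option\<close>, with \<open>None\<close> the last one.\<close>

definition coord :: "'n option \<Rightarrow> (real^'n) \<times> real \<Rightarrow> real" where
  "coord a v = (case a of None \<Rightarrow> snd v | Some j \<Rightarrow> fst v $ j)"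
definition unit_vec :: "'n option \<Rightarrow> (real^'n) \<times> real" where
  "unit_vec a = (case a of None \<Rightarrow> (0, 1) | Some j \<Rightarrow> (axis j 1, 0))"

lemma LINT_sum:
  fixes f :: "'i \<Rightarrow> 'a \<Rightarrow> complex"
  assumes "\<And>i. i \<in> I \<Longrightarrow> set_integrable M A (f i)"
  shows "(LINT x:A|M. \<Sum>i\<in>I. f i x) = (\<Sum>i\<in>I. LINT x:A|M. f i x)"
  using assms unfolding set_lebesgue_integral_def set_integrable_def
  by (subst scaleR_sum_right) (rule Bochner_Integration.integral_sum)

lemma coord_unit_vec: "coord a (unit_vec b) = (if a = b then 1 else 0)"
  by (auto simp: coord_def unit_vec_def axis_def split: option.split)

lemma sum_coord_unit_vec:
  fixes f :: "'n::finite option \<Rightarrow> 'b::real_vector"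
  shows "(\<Sum>a\<in>UNIV. coord a (unit_vec b) *\<^sub>R f a) = f b"
  by (simp add: coord_unit_vec if_distrib[where f = "\<lambda>c. c *\<^sub>R _"] cong: if_cong)

text \<open>A twice differentiable map \<open>P\<close> on the simplex of dimension n + 1, with first and second partial derivatives \<open>D\<close> and
  \<open>DD\<close>, along which the form \<open>g dx\<^sub>1 \<and> \<dots> \<and> dx\<^sub>n\<close> is pulled back; \<open>G\<close> are the complex partial derivatives of g.\<close>

locale smooth_prism =
  fixes P :: "(real^'n::{finite,linorder}) \<times> real \<Rightarrow> complex^'n::{finite,linorder}"
    and D :: "'n option \<Rightarrow> (real^'n::_) \<times> real \<Rightarrow> complex^'n::_"
    and DD :: "'n option \<Rightarrow> 'n option \<Rightarrow> (real^'n::_) \<times> real \<Rightarrow> complex^'n::_"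
    and g :: "complex^'n::_ \<Rightarrow> complex" and G :: "'n \<Rightarrow> complex^'n::_ \<Rightarrow> complex" and X :: "(complex^'n::_) set"
  assumes P: "\<And>z. (P has_derivative (\<lambda>v. \<Sum>a\<in>UNIV. coord a v *\<^sub>R D a z)) (at z)"
    and D: "\<And>b z. (D b has_derivative (\<lambda>v. \<Sum>a\<in>UNIV. coord a v *\<^sub>R DD a b z)) (at z)"
    and DD_sym: "\<And>a b. DD a b = DD b a"
    and DD_cont: "\<And>a b S. continuous_on S (DD a b)"
    and g: "\<And>x. x \<in> X \<Longrightarrow> (g has_derivative (\<lambda>v. \<Sum>k\<in>UNIV. G k x * v $ k)) (at x)"
    and G_cont: "\<And>k. continuous_on X (G k)"
    and P_in: "P ` next_corner_simplex \<subseteq> X"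
begin

text \<open>The coefficient of the pulled back form at the n directions \<open>c\<close>.\<close>

definition A :: "('n \<Rightarrow> 'n option) \<Rightarrow> (real^'n::_) \<times> real \<Rightarrow> complex" where
  "A c z = g (P z) * det (\<chi> j. D (c j) z)"

definition dg :: "'n option \<Rightarrow> (real^'n::_) \<times> real \<Rightarrow> complex" where
  "dg a z = (\<Sum>k\<in>UNIV. G k (P z) * D a z $ k)"

definition dA :: "('n \<Rightarrow> 'n option) \<Rightarrow> 'n option \<Rightarrow> (real^'n::_) \<times> real \<Rightarrow> complex" where
  "dA c a z = dg a z * det (\<chi> j. D (c j) z) + g (P z) * (\<Sum>k\<in>UNIV. det (\<chi> j. if j = k then DD a (c k) z else D (c j) z))"

lemma P_cont: "continuous_on S P" and D_cont: "continuous_on S (D a)"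
  using has_derivative_continuous[OF P] has_derivative_continuous[OF D]
  by (auto intro!: continuous_at_imp_continuous_on)

lemma g_cont: "continuous_on X g"
  using has_derivative_continuous[OF g] by (auto intro!: continuous_at_imp_continuous_on)

lemma A_cont: "continuous_on next_corner_simplex (A c)"
  unfolding A_def
  by (intro continuous_intros continuous_on_det D_cont continuous_on_compose2[OF g_cont P_cont P_in])

lemma dA_cont: "continuous_on next_corner_simplex (dA c a)"
  unfolding dA_def dg_def
proof (intro continuous_intros continuous_on_det D_cont continuous_on_compose2[OF g_cont P_cont P_in]
    continuous_on_compose2[OF G_cont P_cont P_in])
  show "continuous_on next_corner_simplex (\<lambda>x. if j = k then DD a (c k) x else D (c j) x)" for j k
    by (cases "j = k") (simp_all add: DD_cont D_cont)
qed

lemma A_deriv: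
  assumes \<gamma>: "(\<gamma> has_vector_derivative unit_vec a) (at s)" and X: "P (\<gamma> s) \<in> X"
  shows "((\<lambda>s. A c (\<gamma> s)) has_vector_derivative dA c a (\<gamma> s)) (at s)"
proof -
  have \<gamma>': "(\<gamma> has_derivative (\<lambda>h. h *\<^sub>R unit_vec a)) (at s)"
    using \<gamma> by (simp add: has_vector_derivative_def)
  have coord_scale: "coord b (h *\<^sub>R v) = h * coord b v" for b h v
    by (auto simp: coord_def split: option.split)
  have lin: "(\<Sum>b\<in>UNIV. coord b (h *\<^sub>R unit_vec a) *\<^sub>R f b) = h *\<^sub>R f a" for h and f :: "'n option \<Rightarrow> complex^'n::_"
    using sum_coord_unit_vec[of a f] by (simp add: coord_scale flip: scaleR_scaleR scaleR_sum_right)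
  have P': "((\<lambda>s. P (\<gamma> s)) has_derivative (\<lambda>h. h *\<^sub>R D a (\<gamma> s))) (at s)"
    using has_derivative_compose[OF \<gamma>' P] by (simp add: lin)
  have D': "((\<lambda>s. D b (\<gamma> s)) has_derivative (\<lambda>h. h *\<^sub>R DD a b (\<gamma> s))) (at s)" for b
    using has_derivative_compose[OF \<gamma>' D] by (simp add: lin)
  have g': "((\<lambda>s. g (P (\<gamma> s))) has_derivative (\<lambda>h. h *\<^sub>R dg a (\<gamma> s))) (at s)"
    using has_derivative_compose[OF P' g[OF X]] by (simp add: dg_def scaleR_sum_right)
  have d': "((\<lambda>s. det (\<chi> j. D (c j) (\<gamma> s))) has_derivative
      (\<lambda>h. \<Sum>k\<in>UNIV. det (\<chi> j. if j = k then h *\<^sub>R DD a (c j) (\<gamma> s) else D (c j) (\<gamma> s)))) (at s)"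
    by (rule has_derivative_det[OF D'])
  have m: "det (\<chi> j. if j = k then h *\<^sub>R DD a (c j) (\<gamma> s) else D (c j) (\<gamma> s)) =
     h *\<^sub>R det (\<chi> j. if j = k then DD a (c k) (\<gamma> s) else D (c j) (\<gamma> s))" for h k
  proof -
    have "(\<chi> j. if j = k then h *\<^sub>R DD a (c j) (\<gamma> s) else D (c j) (\<gamma> s)) =
      (\<chi> j. if j = k then complex_of_real h *s DD a (c k) (\<gamma> s) else D (c j) (\<gamma> s))"
      by (auto simp: vec_eq_iff) (simp add: scaleR_conv_of_real)
    then show ?thesis by (simp only: det_row_mul) (simp add: scaleR_conv_of_real)
  qed
  show ?thesis
    unfolding has_vector_derivative_def A_def
    by (rule has_derivative_eq_rhs[OF has_derivative_mult[OF g' d']])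
      (simp add: m dA_def scaleR_add_right fun_eq_iff mult.commute flip: scaleR_sum_right)
qed

text \<open>The pulled back form is closed. The terms with second derivatives cancel by symmetry of \<open>DD\<close>; those with
  derivatives of g cancel by Cramer's rule, as n + 1 vectors in n-dimensional space are dependent. Holomorphy of g
  enters here: its differential is complex linear.\<close>

lemma closed: "dA Some None z = (\<Sum>j\<in>UNIV. dA (Some(j := None)) (Some j) z)"
proof -
  let ?V = "\<lambda>l. D (Some l) z"
  let ?c = "\<lambda>j. Some(j := None)"
  have V: "(\<chi> l. D (?c j l) z) = (\<chi> l. if l = j then D None z else ?V l)" for j
    by (auto simp: vec_eq_iff)
  have "(\<Sum>j\<in>UNIV. dg (Some j) z * det (\<chi> l. D (?c j l) z)) =
     (\<Sum>j\<in>UNIV. \<Sum>k\<in>UNIV. G k (P z) * (det (\<chi> l. if l = j then D None z else ?V l) * ?V j $ k))"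
    unfolding V dg_def sum_distrib_right by (simp add: mult_ac)
  also have "\<dots> = (\<Sum>k\<in>UNIV. G k (P z) * (\<Sum>j\<in>UNIV. det (\<chi> l. if l = j then D None z else ?V l) * ?V j $ k))"
    unfolding sum_distrib_left by (rule sum.swap)
  also have "\<dots> = dg None z * det (\<chi> l. ?V l)"
    unfolding cramer_rows by (simp add: dg_def sum_distrib_left sum_distrib_right mult_ac)
  finally have i: "(\<Sum>j\<in>UNIV. dg (Some j) z * det (\<chi> l. D (?c j l) z)) = dg None z * det (\<chi> l. ?V l)" .
  define E where "E j k = det (\<chi> l. if l = k then DD (Some j) (Some k) z else if l = j then D None z else ?V l)" for j k
  define F where "F j k = det (\<chi> l. if l = k then DD (Some j) (?c j k) z else D (?c j l) z)" for j k
  have Fj: "F j j = det (\<chi> l. if l = j then DD None (Some j) z else ?V l)" for j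
  proof -
    have "(\<chi> l. if l = j then DD (Some j) (?c j j) z else D (?c j l) z) = (\<chi> l. if l = j then DD None (Some j) z else ?V l)"
      by (simp add: vec_eq_iff DD_sym[of "Some j" None])
    then show ?thesis by (simp only: F_def)
  qed
  have Fk: "F j k = E j k" if "j \<noteq> k" for j k
  proof -
    have "(\<chi> l. if l = k then DD (Some j) (?c j k) z else D (?c j l) z) =
      (\<chi> l. if l = k then DD (Some j) (Some k) z else if l = j then D None z else ?V l)"
      using that by (simp add: vec_eq_iff)
    then show ?thesis by (simp only: F_def E_def)
  qed
  have anti: "E k j = - E j k" if "j \<noteq> k" for j k
  proof -
    have "(\<chi> l. if l = j then DD (Some k) (Some j) z else if l = k then D None z else ?V l) =
      (\<chi> l. if l = k then D None z else if l = j then DD (Some j) (Some k) z else ?V l)"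
      using that by (simp add: vec_eq_iff DD_sym[of "Some k" "Some j"])
    then have "E k j = det (\<chi> l. if l = k then D None z else if l = j then DD (Some j) (Some k) z else ?V l)"
      by (simp only: E_def)
    then show ?thesis unfolding E_def using det_swap_rows[of k j "D None z" "DD (Some j) (Some k) z" ?V] that by auto
  qed
  define S where "S = (\<Sum>j\<in>UNIV. \<Sum>k\<in>UNIV. if j = k then 0 else E j k)"
  have "S = (\<Sum>k\<in>UNIV. \<Sum>j\<in>UNIV. if j = k then 0 else E j k)"
    unfolding S_def by (rule sum.swap)
  also have "\<dots> = (\<Sum>k\<in>UNIV. \<Sum>j\<in>UNIV. - (if k = j then 0 else E k j))"
  proof (intro sum.cong refl)
    fix j k show "(if j = k then 0 else E j k) = - (if k = j then 0 else E k j)"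
      by (cases "j = k") (simp_all add: anti[of k j])
  qed
  also have "\<dots> = - S" by (simp add: S_def sum_negf)
  finally have S: "S = 0" by simp
  have "(\<Sum>k\<in>UNIV. F j k) = F j j + (\<Sum>k\<in>UNIV. if j = k then 0 else E j k)" for j
  proof -
    have "(\<Sum>k\<in>UNIV. F j k) = F j j + (\<Sum>k\<in>UNIV - {j}. F j k)" by (simp add: sum.remove)
    also have "(\<Sum>k\<in>UNIV - {j}. F j k) = (\<Sum>k\<in>UNIV - {j}. if j = k then 0 else E j k)"
      using Fk by (intro sum.cong) auto
    also have "\<dots> = (\<Sum>k\<in>UNIV. if j = k then 0 else E j k)"
      by (intro sum.mono_neutral_left) auto
    finally show ?thesis .
  qed
  then have "(\<Sum>j\<in>UNIV. \<Sum>k\<in>UNIV. F j k) = (\<Sum>j\<in>UNIV. F j j) + S"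
    by (simp add: sum.distrib S_def)
  then have ii: "(\<Sum>j\<in>UNIV. \<Sum>k\<in>UNIV. F j k) = (\<Sum>j\<in>UNIV. det (\<chi> l. if l = j then DD None (Some j) z else ?V l))"
    by (simp add: S Fj)
  show ?thesis
    unfolding dA_def sum.distrib i F_def[symmetric] sum_distrib_left[symmetric] ii ..
qed

text \<open>Stokes' theorem on the simplex of dimension n + 1. The integral of each side of \<open>closed\<close> is evaluated by the
  fundamental theorem of calculus in the direction of differentiation, after that direction has been exchanged with
  the last one; only values on the faces remain.\<close>

lemma flux:
  "corner_integral (\<lambda>t. A Some (t, 1 - (\<Sum>j\<in>UNIV. t $ j)) - (\<Sum>j\<in>UNIV. A (Some(j := None)) (t, 1 - (\<Sum>j\<in>UNIV. t $ j))))
    - corner_integral (\<lambda>t. A Some (t, 0))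
    + (\<Sum>j\<in>UNIV. corner_integral (\<lambda>t. A (Some(j := None)) (swap_last j (t, 0)))) = 0"
proof -
  let ?c = "\<lambda>j. Some(j := None)"
  let ?s = "\<lambda>t :: real^'n::_. 1 - (\<Sum>j\<in>UNIV. t $ j)"
  have contTop: "continuous_on corner_simplex (\<lambda>t. A c (t, ?s t))" for c
    by (rule continuous_on_compose2[OF A_cont])
      (auto intro!: continuous_intros simp: mem_next_corner_simplex corner_simplex_def)
  have 0: "(LINT z:next_corner_simplex|lborel. dA Some None z) =
     corner_integral (\<lambda>t. A Some (t, ?s t)) - corner_integral (\<lambda>t. A Some (t, 0))"
  proof (rule LINT_next_corner_simplex[OF A_cont dA_cont])
    fix t r assume tr: "(t, r) \<in> (next_corner_simplex :: ((real^'n::_) \<times> real) set)"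
    show "((\<lambda>s. A Some (t, s)) has_vector_derivative dA Some None (t, r)) (at r)"
      by (rule A_deriv) (use tr P_in in \<open>auto simp: unit_vec_def intro!: derivative_eq_intros\<close>)
  qed
  have j: "(LINT z:next_corner_simplex|lborel. dA (?c j) (Some j) z) =
     corner_integral (\<lambda>t. A (?c j) (t, ?s t)) - corner_integral (\<lambda>t. A (?c j) (swap_last j (t, 0)))" for j
  proof -
    have "(LINT z:next_corner_simplex|lborel. dA (?c j) (Some j) z) = (LINT z:next_corner_simplex|lborel. dA (?c j) (Some j) (swap_last j z))"
      by (rule LINT_measure_preserving[symmetric])
        (auto simp: distr_swap_last continuous_swap_last compact_next_corner_simplex dA_cont)
    also have "\<dots> = corner_integral (\<lambda>t. A (?c j) (swap_last j (t, ?s t))) - corner_integral (\<lambda>t. A (?c j) (swap_last j (t, 0)))"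
    proof (rule LINT_next_corner_simplex)
      show "continuous_on next_corner_simplex (\<lambda>z. A (?c j) (swap_last j z))"
           "continuous_on next_corner_simplex (\<lambda>z. dA (?c j) (Some j) (swap_last j z))"
        by (auto intro!: continuous_on_compose2[OF A_cont] continuous_on_compose2[OF dA_cont] continuous_swap_last)
      fix t r assume tr: "(t, r) \<in> (next_corner_simplex :: ((real^'n::_) \<times> real) set)"
      have e: "swap_last j (t, s) = swap_last j (t, 0) + s *\<^sub>R (axis j 1, 0)" for s
        by (auto simp: swap_last_def vec_eq_iff axis_def)
      have "((\<lambda>s. swap_last j (t, s)) has_vector_derivative unit_vec (Some j)) (at r)"
        by (subst e) (auto simp: unit_vec_def intro!: derivative_eq_intros)
      then show "((\<lambda>s. A (?c j) (swap_last j (t, s))) has_vector_derivative dA (?c j) (Some j) (swap_last j (t, r))) (at r)"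
        by (rule A_deriv) (use tr P_in swap_last_in in blast)
    qed
    also have "corner_integral (\<lambda>t. A (?c j) (swap_last j (t, ?s t))) = corner_integral (\<lambda>t. A (?c j) (t, ?s t))"
    proof -
      have "swap_last j (t, ?s t) = (let t' = \<chi> i. if i = j then ?s t else t $ i in (t', ?s t'))" for t :: "real^'n::_"
        using sum_swap_last[of j "(t, ?s t)"] by (simp add: swap_last_def Let_def cong: if_cong)
      then show ?thesis
        using corner_integral_reflect[OF contTop[of "?c j"], of j] by (simp add: Let_def)
    qed
    finally show ?thesis .
  qed
  have "(LINT z:next_corner_simplex|lborel. dA Some None z) = (\<Sum>j\<in>UNIV. LINT z:next_corner_simplex|lborel. dA (?c j) (Some j) z)"
    unfolding closed
    by (rule LINT_sum) (auto intro!: set_integrable_compact compact_next_corner_simplex dA_cont)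
  moreover have "corner_integral (\<lambda>t. A Some (t, ?s t) - (\<Sum>j\<in>UNIV. A (?c j) (t, ?s t))) =
     corner_integral (\<lambda>t. A Some (t, ?s t)) - (\<Sum>j\<in>UNIV. corner_integral (\<lambda>t. A (?c j) (t, ?s t)))"
  proof -
    have int: "set_integrable lborel corner_simplex (\<lambda>t. A c (t, ?s t))" for c
      by (intro set_integrable_compact compact_corner_simplex contTop)
    have "set_integrable lborel corner_simplex (\<lambda>t. \<Sum>j\<in>UNIV. A (?c j) (t, ?s t))"
      by (intro set_integrable_compact compact_corner_simplex continuous_on_sum contTop)
    then show ?thesis using int by (simp add: set_integral_diff(2) LINT_sum[OF int])
  qed
  moreover have "x - b + d = 0" if "a - b = c - d" "x = a - c" for a b c d x :: complex
  proof -
    have "a = c - d + b" using that(1) by (simp add: diff_eq_eq)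
    then show ?thesis by (simp add: that(2))
  qed
  ultimately show ?thesis unfolding 0 j sum_subtractf by blast
qed

end

text \<open>The extra coordinate gets the barycentric index 1, so that the coordinates of \<open>corner_simplex\<close> move up by one.\<close>

definition next_bary :: "(real^'n::{finite,linorder}) \<times> real \<Rightarrow> nat \<Rightarrow> real" where
  "next_bary z m = (if m = 0 then 1 - (\<Sum>j\<in>UNIV. fst z $ j) - snd z
     else if m = 1 then snd z else (\<Sum>j | Suc (rank j) = m. fst z $ j))"

lemma next_bary_simps [simp]:
  "next_bary z 0 = 1 - (\<Sum>j\<in>UNIV. fst z $ j) - snd z" "next_bary z (Suc 0) = snd z"
  "next_bary z (Suc (rank j)) = fst z $ j"
  by (simp_all add: next_bary_def rank_bounds)

lemma next_bary_gt: "Suc CARD('n) < m \<Longrightarrow> next_bary (z :: (real^'n::{finite,linorder}) \<times> real) m = 0"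
proof -
  assume m: "Suc CARD('n) < m"
  then have "{j :: 'n. Suc (rank j) = m} = {}" using rank_bounds(2)[where 'n = 'n] by (auto simp: leD)
  then show ?thesis using m by (simp add: next_bary_def)
qed

lemma eq_at_next_ranks:
  fixes f g :: "nat \<Rightarrow> 'a"
  assumes "f 0 = g 0" "f (Suc 0) = g (Suc 0)" "\<And>j::'n::{finite,linorder}. f (Suc (rank j)) = g (Suc (rank j))"
    "\<And>m. Suc CARD('n) < m \<Longrightarrow> f m = g m"
  shows "f = g"
proof
  fix m show "f m = g m"
  proof (cases m)
    case (Suc l)
    then consider "l = 0" | j :: 'n where "rank j = l" | "CARD('n) < l"
      using rank_surj[of l, where 'n = 'n] by (metis One_nat_def Suc_leI not_le neq0_conv)
    then show ?thesis using assms Suc by cases auto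
  qed (use assms in auto)
qed

lemma next_bary_in: 
  assumes "z \<in> next_corner_simplex"
  shows "next_bary (z :: (real^'n::{finite,linorder}) \<times> real) \<in> standard_simplex (Suc CARD('n))"
proof -
  have nn: "0 \<le> next_bary z m" for m
    using assms by (auto simp: next_bary_def next_corner_simplex_def intro!: sum_nonneg)
  have "(\<Sum>m\<le>Suc CARD('n). next_bary z m) = next_bary z 0 + (\<Sum>m\<le>CARD('n). next_bary z (Suc m))"
    by (rule sum.atMost_Suc_shift)
  also have "\<dots> = 1" by (simp add: sum_rank)
  finally have s: "(\<Sum>m\<le>Suc CARD('n). next_bary z m) = 1" .
  have "next_bary z m \<le> 1" for m
  proof (cases "m \<le> Suc CARD('n)")
    case True
    then show ?thesis using member_le_sum[of m "{..Suc CARD('n)}" "next_bary z"] s nn by auto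
  qed (simp add: next_bary_gt)
  then show ?thesis using nn s by (auto simp: standard_simplex_def next_bary_gt)
qed

definition next_bary_slope :: "'n::{finite,linorder} option \<Rightarrow> nat \<Rightarrow> real" where
  "next_bary_slope a m = (if m = 0 then - 1 else if m = (case a of None \<Rightarrow> 1 | Some j \<Rightarrow> Suc (rank j)) then 1 else 0)"

lemma sum_UNIV_option: "(\<Sum>a\<in>UNIV. f a) = f None + (\<Sum>j\<in>UNIV. f (Some j))" for f :: "'n::finite option \<Rightarrow> 'b::comm_monoid_add"
  by (simp add: UNIV_option_conv sum.reindex)

lemma next_bary_has_derivative:
  "((\<lambda>z. next_bary z m) has_derivative (\<lambda>v. \<Sum>a\<in>UNIV. coord a v * next_bary_slope a m)) (at (z :: (real^'n::{finite,linorder}) \<times> real) within S)"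
proof -
  consider "m = 0" | "m = Suc 0" | l where "m = Suc l" "0 < l" by (metis not0_implies_Suc neq0_conv)
  then show ?thesis
  proof cases
    case 1
    have "((\<lambda>z :: (real^'n::_) \<times> real. 1 - (\<Sum>j\<in>UNIV. fst z $ j) - snd z) has_derivative
       (\<lambda>v. 0 - (\<Sum>j\<in>UNIV. fst v $ j) - snd v)) (at z within S)"
      by (intro derivative_intros bounded_linear.has_derivative[OF bounded_linear_vec_nth])
    moreover have "(\<lambda>z :: (real^'n::_) \<times> real. next_bary z m) = (\<lambda>z. 1 - (\<Sum>j\<in>UNIV. fst z $ j) - snd z)"
      by (simp add: 1)
    ultimately show ?thesis
      by (auto elim!: has_derivative_eq_rhs simp: 1 sum_UNIV_option coord_def next_bary_slope_def sum_negf)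
  next
    case 2
    then show ?thesis
      by (auto simp: next_bary_def sum_UNIV_option coord_def next_bary_slope_def rank_bounds intro!: derivative_eq_intros)
  next
    case (3 l)
    have "((\<lambda>z :: (real^'n::_) \<times> real. \<Sum>j | rank j = l. fst z $ j) has_derivative
       (\<lambda>v. \<Sum>j | rank j = l. fst v $ j)) (at z within S)"
      by (intro derivative_intros bounded_linear.has_derivative[OF bounded_linear_vec_nth])
    moreover have "(\<Sum>j | rank j = l. fst v $ j) = (\<Sum>a\<in>UNIV. coord a v * next_bary_slope a m)" for v :: "(real^'n::_) \<times> real"
    proof -
      have "(\<Sum>j\<in>UNIV. fst v $ j * (if l = rank j then 1 else 0)) = (\<Sum>j | rank j = l. fst v $ j)"
        by (intro sum.mono_neutral_cong_right) auto
      then show ?thesis using 3 by (simp add: sum_UNIV_option coord_def next_bary_slope_def)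
    qed
    ultimately show ?thesis using 3 by (simp add: next_bary_def)
  qed
qed

definition slope_diff :: "'n::{finite,linorder} option \<Rightarrow> ((nat \<Rightarrow> nat) \<Rightarrow> 'b::real_vector) \<Rightarrow> (nat \<Rightarrow> nat) \<Rightarrow> 'b" where
  "slope_diff a h y = (\<Sum>i\<le>Suc CARD('n). next_bary_slope a i *\<^sub>R h (y(i := Suc (y i))))"

lemma slope_diff_commute: "slope_diff a (slope_diff b h) = slope_diff b (slope_diff a h)"
proof
  fix y :: "nat \<Rightarrow> nat"
  have c: "(y(i := Suc (y i)))(j := Suc ((y(i := Suc (y i))) j)) = (y(j := Suc (y j)))(i := Suc ((y(j := Suc (y j))) i))" for i j
    by (auto simp: fun_eq_iff)
  show "slope_diff a (slope_diff b h) y = slope_diff b (slope_diff a h) y"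
    unfolding slope_diff_def scaleR_sum_right scaleR_scaleR
    by (subst sum.swap) (simp only: c mult.commute)
qed

lemma iid_mean_next_bary_has_derivative:
  fixes h :: "_ \<Rightarrow> 'b::real_normed_vector" and z :: "(real^'n::{finite,linorder}) \<times> real"
  shows "((\<lambda>z. iid_mean (Suc CARD('n)) N (next_bary z) h) has_derivative
     (\<lambda>v. \<Sum>a\<in>UNIV. coord a v *\<^sub>R (real N *\<^sub>R iid_mean (Suc CARD('n)) (N - 1) (next_bary z) (slope_diff a h)))) (at z within S)"
proof -
  let ?p = "Suc CARD('n)"
  have "((\<lambda>z. iid_mean ?p N (next_bary z) h) has_derivative
     (\<lambda>v. real N *\<^sub>R iid_mean ?p (N - 1) (next_bary z) (\<lambda>y. \<Sum>i\<le>?p. (\<Sum>a\<in>UNIV. coord a v * next_bary_slope a i) *\<^sub>R h (y(i := Suc (y i)))))) (at z within S)"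
    by (intro iid_mean_has_derivative next_bary_has_derivative)
  moreover have "(\<Sum>i\<le>?p. (\<Sum>a\<in>UNIV. coord a v * next_bary_slope a i) *\<^sub>R h (y(i := Suc (y i)))) =
     (\<Sum>a\<in>UNIV. coord a v *\<^sub>R slope_diff a h y)" for v :: "(real^'n::_) \<times> real" and y
    unfolding slope_diff_def scaleR_sum_left scaleR_sum_right scaleR_scaleR by (rule sum.swap)
  ultimately show ?thesis
    by (simp add: iid_mean_sum iid_mean_scaleR scaleR_sum_right mult.commute)
qed

section \<open>Cyclic permutations\<close>

text \<open>The face opposite to the vertex J is parametrized with its coordinates in another order; this cyclic permutation
  reconciles the two orders, and its sign is the sign of the face in the boundary.\<close>

definition cycle_to_front :: "nat \<Rightarrow> nat \<Rightarrow> nat" where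
  "cycle_to_front J m = (if m = 0 then 0 else if m < J then Suc m else if m = J then 1 else m)"

lemma cycle_to_front:
  assumes "1 \<le> J" "J \<le> n"
  shows "cycle_to_front J permutes {1..n} \<and> sign (cycle_to_front J) = (- 1) ^ (J - 1)"
  using assms
proof (induction J rule: nat_induct_at_least)
  case base
  have "cycle_to_front 1 = id" by (auto simp: cycle_to_front_def fun_eq_iff)
  then show ?case
    using permutes_id[of "{1..n}"] by (simp add: id_def)
next
  case (Suc J)
  have e: "cycle_to_front (Suc J) = cycle_to_front J \<circ> Transposition.transpose J (Suc J)"
    using \<open>1 \<le> J\<close> by (auto simp: cycle_to_front_def fun_eq_iff Transposition.transpose_def)
  have t: "Transposition.transpose J (Suc J) permutes {1..n}"
    using Suc by (intro permutes_swap_id) auto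
  have IH: "cycle_to_front J permutes {1..n}" "sign (cycle_to_front J) = (- 1) ^ (J - 1)" using Suc by auto
  have perm: "cycle_to_front (Suc J) permutes {1..n}" unfolding e by (rule permutes_compose[OF t IH(1)])
  have "sign (cycle_to_front (Suc J)) = sign (cycle_to_front J) * sign (Transposition.transpose J (Suc J))"
    unfolding e by (intro sign_compose permutes_imp_permutation[OF _ IH(1)] permutes_imp_permutation[OF _ t]) auto
  also have "\<dots> = - ((- 1) ^ (J - 1))" by (simp add: IH(2) sign_swap_id)
  also have "\<dots> = (- 1) ^ (Suc J - 1)" using \<open>1 \<le> J\<close> by (cases J) auto
  finally have "sign (cycle_to_front (Suc J)) = (- 1) ^ (Suc J - 1)" .
  with perm show ?case by simp
qed

lemma ex_cycle_to_front:
  "\<exists>\<pi>. \<pi> permutes (UNIV :: 'n set) \<and> sign \<pi> = (- 1) ^ (rank j - 1) \<and> (\<forall>i. rank (\<pi> i) = cycle_to_front (rank j) (rank i))"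
  for j :: "'n::{finite,linorder}"
proof -
  let ?c = "cycle_to_front (rank j)" and ?I = "{1..CARD('n)}"
  define u where "u = inv_into UNIV (rank :: 'n \<Rightarrow> nat)"
  have u: "u (rank i) = i" for i by (simp add: u_def inj_def)
  have c: "?c permutes ?I" "sign ?c = (- 1) ^ (rank j - 1)"
    using cycle_to_front[OF rank_bounds(1,2)[of j]] by auto
  have bu: "bij_betw u ?I UNIV" using bij_rank unfolding u_def by (rule bij_betw_inv_into)
  have ru: "rank (u m) = m" if "m \<in> ?I" for m
    using bij_betw_inv_into_right[OF bij_rank that] by (simp add: u_def)
  have ap: "map_permutation ?I u ?c (u m) = u (?c m)" if "m \<in> ?I" for m
    using bu that by (intro map_permutation_apply) (auto simp: bij_betw_def)
  have "rank (map_permutation ?I u ?c i) = ?c (rank i)" for i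
    using ap[of "rank i"] ru[of "?c (rank i)"] permutes_in_image[OF c(1)] rank_bounds(1,2)[of i] by (simp add: u)
  moreover have "map_permutation ?I u ?c permutes UNIV" using map_permutation_permutes[OF bu c(1)] .
  moreover have "sign (map_permutation ?I u ?c) = sign ?c"
    using c bu by (intro sign_map_permutation) (auto simp: bij_betw_def)
  ultimately show ?thesis using c(2) by metis
qed

section \<open>Stokes' theorem for Bernstein approximations\<close>

text \<open>Bernstein approximations are polynomial, so the flux identity applies to them although the approximated simplex is only
  continuous. Its terms are the integrals over the faces, up to reparametrizations that preserve Lebesgue measure and
  change the determinant by the sign of the face.\<close>

lemma stokes_bernstein:
  fixes \<sigma> :: "(nat \<Rightarrow> real) \<Rightarrow> complex^'n::{finite,linorder}"
  assumes g: "\<And>x. x \<in> X \<Longrightarrow> (g has_derivative (\<lambda>v. \<Sum>k\<in>UNIV. G k x * v $ k)) (at x)"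
    and G: "\<And>k. continuous_on X (G k)"
    and X: "bernstein (Suc CARD('n)) N \<sigma> ` standard_simplex (Suc CARD('n)) \<subseteq> X"
  shows "(\<Sum>k\<le>Suc CARD('n). (- 1) ^ k * simplex_integral g (singular_face (Suc CARD('n)) k (bernstein (Suc CARD('n)) N \<sigma>))) = 0"
proof -
  let ?p = "Suc CARD('n)"
  let ?\<tau> = "bernstein ?p N \<sigma>"
  define h where "h y = \<sigma> (\<lambda>i. real (y i) / real N)" for y
  define P where "P z = iid_mean ?p N (next_bary z) h" for z :: "(real^'n::_) \<times> real"
  define D where "D a z = real N *\<^sub>R iid_mean ?p (N - 1) (next_bary z) (slope_diff a h)" for a :: "'n option" and z :: "(real^'n::_) \<times> real"
  define DD where "DD a b z = real N *\<^sub>R real (N - 1) *\<^sub>R iid_mean ?p (N - 1 - 1) (next_bary z) (slope_diff a (slope_diff b h))"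
    for a b :: "'n option" and z :: "(real^'n::_) \<times> real"
  have \<tau>: "?\<tau> (next_bary z) = P z" if "z \<in> next_corner_simplex" for z
    using next_bary_in[OF that] by (simp add: bernstein_def P_def h_def[abs_def])
  have nb_cont: "continuous_on S (\<lambda>z :: (real^'n::_) \<times> real. next_bary z m)" for S m
    using has_derivative_continuous[OF next_bary_has_derivative] by (auto intro!: continuous_at_imp_continuous_on)
  interpret smooth_prism P D DD g G X
  proof
    show "(P has_derivative (\<lambda>v. \<Sum>a\<in>UNIV. coord a v *\<^sub>R D a z)) (at z)" for z
      unfolding P_def D_def by (rule iid_mean_next_bary_has_derivative)
    show "(D b has_derivative (\<lambda>v. \<Sum>a\<in>UNIV. coord a v *\<^sub>R DD a b z)) (at z)" for b z
      using has_derivative_scaleR_right[OF iid_mean_next_bary_has_derivative, of "real N"  "N - 1" "slope_diff b h" z UNIV]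
      unfolding D_def DD_def by (simp add: scaleR_sum_right mult_ac)
    show "DD a b = DD b a" for a b by (rule ext) (simp add: DD_def slope_diff_commute[of a b])
    show "continuous_on S (DD a b)" for a b S
      unfolding DD_def by (intro continuous_intros nb_cont)
    show "P ` next_corner_simplex \<subseteq> X"
      using X \<tau> next_bary_in by (metis (no_types, lifting) image_subset_iff)
  qed (use g G in auto)
  let ?c = "\<lambda>j. Some(j := None)"
  have face: "simplex_integral g (singular_face ?p k ?\<tau>) =
     corner_integral (\<lambda>t. g (P (\<phi> t)) * det (\<chi> l. \<Sum>a\<in>UNIV. coord a (\<phi>' (axis l 1)) *\<^sub>R D a (\<phi> t)))"
    if k: "k \<le> ?p" and \<phi>: "\<And>t. (\<phi> has_derivative \<phi>') (at t)" and \<phi>_in: "\<And>t. t \<in> corner_simplex \<Longrightarrow> \<phi> t \<in> next_corner_simplex"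
      and eq: "\<And>t. t \<in> corner_simplex \<Longrightarrow> simplical_face k (bary t) = next_bary (\<phi> t)" for k \<phi> \<phi>'
  proof -
    have "simplex_integral g (singular_face ?p k ?\<tau>) = integral corner_simplex
       (\<lambda>t. g (P (\<phi> t)) * det (\<chi> i l. (\<Sum>a\<in>UNIV. coord a (\<phi>' (axis l 1)) *\<^sub>R D a (\<phi> t)) $ i))"
    proof (rule simplex_integral_smooth)
      show "((\<lambda>t. P (\<phi> t)) has_derivative (\<lambda>v. \<Sum>a\<in>UNIV. coord a (\<phi>' v) *\<^sub>R D a (\<phi> t))) (at t)" for t
        by (rule has_derivative_compose[OF \<phi> P])
      show "P (\<phi> t) = singular_face ?p k ?\<tau> (bary t)" if t: "t \<in> corner_simplex" for t
        using t \<phi>_in[OF t] bary_in_standard_simplex[of t] by (simp add: singular_face_def eq \<tau>)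
    qed
    also have "\<dots> = integral corner_simplex (\<lambda>t. g (P (\<phi> t)) * det (\<chi> l. \<Sum>a\<in>UNIV. coord a (\<phi>' (axis l 1)) *\<^sub>R D a (\<phi> t)))"
    proof -
      have "det (\<chi> i l. V l $ i) = det (\<chi> l. V l)" for V :: "'n \<Rightarrow> complex^'n::_"
        using det_transpose[of "\<chi> l. V l"] by (simp add: Finite_Cartesian_Product.transpose_def)
      then show ?thesis by (simp only:)
    qed
    also have "\<dots> = corner_integral (\<lambda>t. g (P (\<phi> t)) * det (\<chi> l. \<Sum>a\<in>UNIV. coord a (\<phi>' (axis l 1)) *\<^sub>R D a (\<phi> t)))"
    proof (rule integral_corner_simplex)
      have c\<phi>: "continuous_on corner_simplex \<phi>"
        using has_derivative_continuous[OF \<phi>] by (auto intro!: continuous_at_imp_continuous_on)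
      have sub: "(\<lambda>t. P (\<phi> t)) ` corner_simplex \<subseteq> X" using \<phi>_in P_in by auto
      show "continuous_on corner_simplex (\<lambda>t. g (P (\<phi> t)) * det (\<chi> l. \<Sum>a\<in>UNIV. coord a (\<phi>' (axis l 1)) *\<^sub>R D a (\<phi> t)))"
        by (intro continuous_on_mult continuous_on_det continuous_on_sum continuous_on_scaleR continuous_on_const
            continuous_on_compose2[OF g_cont _ sub] continuous_on_compose2[OF P_cont c\<phi>] continuous_on_compose2[OF D_cont c\<phi>]) auto
    qed
    finally show ?thesis .
  qed
  let ?s = "\<lambda>t :: real^'n::_. 1 - (\<Sum>j\<in>UNIV. t $ j)"
  have f0: "simplex_integral g (singular_face ?p 0 ?\<tau>) =
    corner_integral (\<lambda>t. A Some (t, ?s t) - (\<Sum>j\<in>UNIV. A (?c j) (t, ?s t)))"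
  proof -
    have "simplex_integral g (singular_face ?p 0 ?\<tau>) = corner_integral (\<lambda>t. g (P (t, ?s t)) *
       det (\<chi> l. \<Sum>a\<in>UNIV. coord a (axis l 1, - (\<Sum>j\<in>UNIV. axis l 1 $ j)) *\<^sub>R D a (t, ?s t)))"
    proof (rule face)
      show "((\<lambda>t. (t, ?s t)) has_derivative (\<lambda>d. (d, - (\<Sum>j\<in>UNIV. d $ j)))) (at t)" for t
        by (auto intro!: derivative_eq_intros bounded_linear.has_derivative[OF bounded_linear_vec_nth])
      show "simplical_face 0 (bary t) = next_bary (t, ?s t)" for t
        by (rule eq_at_next_ranks[where 'n = 'n]) (auto simp: simplical_face_def bary_gt next_bary_gt)
    qed (auto simp: mem_next_corner_simplex corner_simplex_def)
    also have "\<dots> = corner_integral (\<lambda>t. A Some (t, ?s t) - (\<Sum>j\<in>UNIV. A (?c j) (t, ?s t)))"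
    proof -
      have 1: "(\<Sum>a\<in>UNIV. coord a (axis l 1, - (\<Sum>j\<in>UNIV. axis l 1 $ j)) *\<^sub>R D a z) = D (Some l) z - D None z" for l z
        by (simp add: sum_UNIV_option coord_def axis_def if_distrib[where f = "\<lambda>c. c *\<^sub>R _"] cong: if_cong)
      have 2: "(\<chi> l. D (?c j l) z) = (\<chi> l. if l = j then D None z else D (Some l) z)" for j z
        by (simp add: vec_eq_iff)
      show ?thesis unfolding A_def 1 2 det_rows_diff_common by (simp add: right_diff_distrib sum_distrib_left)
    qed
    finally show ?thesis .
  qed
  have f1: "simplex_integral g (singular_face ?p 1 ?\<tau>) = corner_integral (\<lambda>t. A Some (t, 0))"
  proof -
    have "simplex_integral g (singular_face ?p 1 ?\<tau>) = corner_integral (\<lambda>t. g (P (t, 0)) *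
       det (\<chi> l. \<Sum>a\<in>UNIV. coord a (axis l 1, 0) *\<^sub>R D a (t, 0)))"
    proof (rule face)
      show "((\<lambda>t. (t, 0)) has_derivative (\<lambda>d. (d, 0))) (at t)" for t :: "real^'n::_"
        by (auto intro!: derivative_eq_intros)
      show "simplical_face 1 (bary t) = next_bary (t, 0)" for t :: "real^'n::_"
        by (rule eq_at_next_ranks[where 'n = 'n]) (auto simp: simplical_face_def bary_gt next_bary_gt rank_bounds)
    qed (auto simp: mem_next_corner_simplex corner_simplex_def)
    moreover have "(\<Sum>a\<in>UNIV. coord a (axis l 1, 0) *\<^sub>R D a z) = D (Some l) z" for l z
      by (simp add: sum_UNIV_option coord_def axis_def if_distrib[where f = "\<lambda>c. c *\<^sub>R _"] cong: if_cong)
    ultimately show ?thesis by (simp add: A_def)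
  qed
  have fj: "(- 1) ^ Suc (rank j) * simplex_integral g (singular_face ?p (Suc (rank j)) ?\<tau>) = corner_integral (\<lambda>t. A (?c j) (swap_last j (t, 0)))" for j
  proof -
    obtain \<pi> :: "'n \<Rightarrow> 'n" where \<pi>: "\<pi> permutes UNIV" "sign \<pi> = (- 1) ^ (rank j - 1)" "\<And>i. rank (\<pi> i) = cycle_to_front (rank j) (rank i)"
      using ex_cycle_to_front[of j] by (elim exE conjE) (rule that, assumption+, blast)
    define \<kappa> where "\<kappa> = inv_into UNIV \<pi>"
    have \<kappa>: "\<kappa> permutes UNIV" "sign \<kappa> = sign \<pi>" "\<And>i. \<kappa> (\<pi> i) = i" "\<And>i. \<pi> (\<kappa> i) = i"
      using \<pi>(1) by (auto simp: \<kappa>_def permutes_inv permutes_inverses sign_inverse permutes_imp_permutation[OF finite])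
    have \<pi>\<kappa>: "\<pi> i = l \<longleftrightarrow> \<kappa> l = i" for i l using \<kappa> by auto
    let ?u = "\<lambda>t :: real^'n::_. \<chi> i. t $ \<pi> i"
    have sumu: "(\<Sum>i\<in>UNIV. t $ \<pi> i) = (\<Sum>i\<in>UNIV. t $ i)" for t :: "real^'n::_"
      using sum.reindex_bij_betw[OF permutes_imp_bij[OF \<pi>(1)], of "\<lambda>i. t $ i"] by simp
    have lin: "bounded_linear (\<lambda>t. swap_last j (?u t, 0))"
      unfolding linear_conv_bounded_linear[symmetric] by (auto simp: linear_iff swap_last_def vec_eq_iff)
    have "simplex_integral g (singular_face ?p (Suc (rank j)) ?\<tau>) = corner_integral (\<lambda>t. g (P (swap_last j (?u t, 0))) *
       det (\<chi> l. \<Sum>a\<in>UNIV. coord a (swap_last j (?u (axis l 1), 0)) *\<^sub>R D a (swap_last j (?u t, 0))))"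
    proof (rule face)
      show "((\<lambda>t. swap_last j (?u t, 0)) has_derivative (\<lambda>t. swap_last j (?u t, 0))) (at t)" for t :: "real^'n::_"
        by (rule bounded_linear_imp_has_derivative[OF lin])
      show "swap_last j (?u t, 0) \<in> next_corner_simplex" if "t \<in> corner_simplex" for t
        using that by (auto simp: mem_next_corner_simplex corner_simplex_def sumu)
      show "simplical_face (Suc (rank j)) (bary t) = next_bary (swap_last j (?u t, 0))" for t :: "real^'n::_"
      proof (rule eq_at_next_ranks[where 'n = 'n])
        show "simplical_face (Suc (rank j)) (bary t) 0 = next_bary (swap_last j (?u t, 0)) 0"
          using sum_swap_last[of j "(?u t, 0)"] by (simp add: simplical_face_def sumu)
        have "rank (\<pi> j) = Suc 0" by (simp add: \<pi>(3) cycle_to_front_def rank_bounds)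
        then have "bary t (Suc 0) = t $ \<pi> j" by (metis bary_rank)
        then show "simplical_face (Suc (rank j)) (bary t) (Suc 0) = next_bary (swap_last j (?u t, 0)) (Suc 0)"
          by (simp add: simplical_face_def swap_last_def rank_bounds)
        show "simplical_face (Suc (rank j)) (bary t) (Suc (rank i)) = next_bary (swap_last j (?u t, 0)) (Suc (rank i))" for i :: 'n
        proof -
          consider "rank i < rank j" | "i = j" | "rank i > rank j" by (metis linorder_neqE_nat rank_inject)
          then show ?thesis
          proof cases
            case 1
            then have "rank (\<pi> i) = Suc (rank i)" by (simp add: \<pi>(3) cycle_to_front_def rank_bounds)
            then have "bary t (Suc (rank i)) = t $ \<pi> i" by (metis bary_rank)
            then show ?thesis using 1 by (auto simp: simplical_face_def swap_last_def)
          next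
            case 2
            then show ?thesis by (simp add: simplical_face_def swap_last_def)
          next
            case 3
            then have "rank (\<pi> i) = rank i" "i \<noteq> j" by (auto simp: \<pi>(3) cycle_to_front_def rank_bounds)
            then show ?thesis using 3 by (auto simp: simplical_face_def swap_last_def)
          qed
        qed
      qed (auto simp: simplical_face_def bary_gt next_bary_gt intro: le_less_trans[OF rank_bounds(2)])
    qed (use rank_bounds in auto)
    also have "\<dots> = corner_integral (\<lambda>t. of_int (sign \<pi>) * A (?c j) (swap_last j (?u t, 0)))"
    proof -
      have 1: "(\<Sum>a\<in>UNIV. coord a (swap_last j (?u (axis l 1), 0)) *\<^sub>R D a z) = D (?c j (\<kappa> l)) z" for l z
      proof -
        have "swap_last j (?u (axis l 1), 0) = unit_vec (?c j (\<kappa> l))"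
          by (auto simp: swap_last_def unit_vec_def axis_def vec_eq_iff \<pi>\<kappa>)
        then show ?thesis by (simp only: sum_coord_unit_vec)
      qed
      have 2: "det (\<chi> l. D (?c j (\<kappa> l)) z) = of_int (sign \<pi>) * det (\<chi> l. D (?c j l) z)" for z
        using det_permute_rows[OF \<kappa>(1), of "\<chi> l. D (?c j l) z"] by (simp add: \<kappa>(2) del: fun_upd_apply)
      show ?thesis unfolding 1 2 A_def by (simp add: mult_ac)
    qed
    also have "\<dots> = of_int (sign \<pi>) * corner_integral (\<lambda>t. A (?c j) (swap_last j (?u t, 0)))"
      by simp
    also have "corner_integral (\<lambda>t. A (?c j) (swap_last j (?u t, 0))) = corner_integral (\<lambda>t. A (?c j) (swap_last j (t, 0)))"
    proof (rule corner_integral_permute[OF permutes_bij[OF \<pi>(1)], of "\<lambda>t. A (?c j) (swap_last j (t, 0))"])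
      show "continuous_on corner_simplex (\<lambda>t. A (?c j) (swap_last j (t, 0)))"
        by (intro continuous_on_compose2[OF A_cont] continuous_on_compose2[OF continuous_swap_last[of UNIV]])
          (auto intro!: continuous_intros simp: mem_next_corner_simplex corner_simplex_def)
    qed
    finally have "simplex_integral g (singular_face ?p (Suc (rank j)) ?\<tau>) =
      (- 1) ^ (rank j - 1) * corner_integral (\<lambda>t. A (?c j) (swap_last j (t, 0)))" by (simp add: \<pi>(2))
    moreover have "(- 1) ^ Suc (rank j) * (- 1) ^ (rank j - 1) = (1 :: complex)"
    proof -
      obtain l where "rank j = Suc l" using rank_bounds(4)[of j] by (metis Suc_pred)
      then show ?thesis by (simp flip: power_mult_distrib)
    qed
    ultimately show ?thesis by (simp only: mult.assoc[symmetric] mult_1_left)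
  qed
  have "(\<Sum>k\<le>?p. (- 1) ^ k * simplex_integral g (singular_face ?p k ?\<tau>)) =
     simplex_integral g (singular_face ?p 0 ?\<tau>) - simplex_integral g (singular_face ?p 1 ?\<tau>)
     + (\<Sum>j\<in>UNIV. (- 1) ^ Suc (rank (j::'n)) * simplex_integral g (singular_face ?p (Suc (rank j)) ?\<tau>))"
    unfolding sum.atMost_Suc_shift sum_rank by simp
  also have "\<dots> = 0" unfolding f0 f1 fj by (rule flux)
  finally show ?thesis .
qed

section \<open>Integrals over homologous smooth cycles\<close>

lemma bary_chart [simp]: "(\<chi> j. bary t (rank j)) = t"
  by (simp add: vec_eq_iff)

lemma bernstein_chart_has_derivative:
  fixes h :: "_ \<Rightarrow> 'b::real_normed_vector" and t :: "real^'n::{finite,linorder}"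
  obtains L where "((\<lambda>t. iid_mean CARD('n) N (bary t) h) has_derivative L) (at t)"
    "\<And>j. L (axis j 1) = real N *\<^sub>R iid_mean CARD('n) (N - 1) (bary t) (\<lambda>y. h (y(rank j := Suc (y (rank j)))) - h (y(0 := Suc (y 0))))"
proof -
  define L where "L d = real N *\<^sub>R iid_mean CARD('n) (N - 1) (bary t) (\<lambda>y. \<Sum>i\<le>CARD('n).
     (if i = 0 then - (\<Sum>j\<in>UNIV. d $ j) else (\<Sum>j | rank j = i. d $ j)) *\<^sub>R h (y(i := Suc (y i))))" for d :: "real^'n::_"
  have L: "((\<lambda>t. iid_mean CARD('n) N (bary t) h) has_derivative L) (at t)"
    unfolding L_def[abs_def] by (intro iid_mean_has_derivative bary_has_derivative)
  have "L (axis j 1) = real N *\<^sub>R iid_mean CARD('n) (N - 1) (bary t) (\<lambda>y. h (y(rank j := Suc (y (rank j)))) - h (y(0 := Suc (y 0))))" for j :: 'n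
  proof -
    have s: "(\<Sum>k\<in>UNIV. axis j 1 $ k) = (1 :: real)" by (simp add: axis_def)
    have r: "(\<Sum>k | rank k = rank l. axis j 1 $ k) = (if l = j then 1 else (0::real))" for l :: 'n
    proof -
      have "{k. rank k = rank l} = {l}" by auto
      then show ?thesis by (simp add: axis_def)
    qed
    have "(\<Sum>l\<in>UNIV. (if l = j then 1 else (0::real)) *\<^sub>R h (y(rank l := Suc (y (rank l))))) = h (y(rank j := Suc (y (rank j))))" for y
      by (simp add: if_distrib[where f = "\<lambda>c. c *\<^sub>R _"] cong: if_cong)
    then show ?thesis
      unfolding L_def sum_rank s r by (simp add: rank_bounds(3) r)
  qed
  with L show thesis using that by blast
qed

text \<open>A partial derivative of the Bernstein polynomial is the Bernstein mean of difference quotients of \<open>\<sigma>\<close>, and these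
  are close to the partial derivative of \<open>\<sigma>\<close>; the error estimate applies once more.\<close>

lemma bernstein_C1_uniform:
  fixes F :: "real^'n::{finite,linorder} \<Rightarrow> 'b::real_normed_vector" and \<sigma> :: "(nat \<Rightarrow> real) \<Rightarrow> 'b"
  assumes F: "\<And>t. t \<in> corner_simplex \<Longrightarrow> (F has_derivative F' t) (at t)"
    and F'_cont: "\<And>v. continuous_on corner_simplex (\<lambda>t. F' t v)"
    and eq: "\<And>t. t \<in> corner_simplex \<Longrightarrow> F t = \<sigma> (bary t)" and e: "e > 0"
  shows "\<forall>\<^sub>F N in sequentially. \<forall>t\<in>corner_simplex.
    norm (real N *\<^sub>R iid_mean CARD('n) (N - 1) (bary t) (\<lambda>y. \<sigma> (\<lambda>i. real ((y(rank j := Suc (y (rank j)))) i) / real N)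
       - \<sigma> (\<lambda>i. real ((y(0 := Suc (y 0))) i) / real N)) - F' t (axis j 1)) < e"
proof -
  let ?n = "CARD('n)"
  let ?e = "axis j 1 :: real^'n::_"
  define G where "G x = F' (\<chi> j. x (rank j)) ?e" for x
  have "continuous_on (standard_simplex ?n) G"
    unfolding G_def
  proof (rule continuous_on_compose2[OF F'_cont])
    show "continuous_on (standard_simplex ?n) (\<lambda>x. \<chi> j :: 'n. x (rank j))"
      by (intro continuous_on_vec_lambda continuous_on_subset[OF continuous_on_product_coordinates]) auto
    have "(\<chi> j :: 'n. x (rank j)) \<in> corner_simplex" if x: "x \<in> standard_simplex ?n" for x
      using x standard_simplex_bary[OF x] bary_in_standard_simplex[of "\<chi> j :: 'n. x (rank j)"] by simp
    then show "(\<lambda>x. \<chi> j :: 'n. x (rank j)) ` standard_simplex ?n \<subseteq> corner_simplex" by blast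
  qed
  from continuous_on_quadratic_modulus[OF this half_gt_zero[OF e]]
  obtain C where C: "C \<ge> 0" "\<And>x y. x \<in> standard_simplex ?n \<Longrightarrow> y \<in> standard_simplex ?n \<Longrightarrow>
       norm (G y - G x) \<le> e / 2 + C * (\<Sum>i\<le>?n. (y i - x i)\<^sup>2)"
    by blast
  define K where "K M = e / 2 + C * (real (Suc ?n) * (8 / (real (Suc M))\<^sup>2))" for M
  have bound: "norm (real (Suc M) *\<^sub>R (iid_mean ?n M (bary t) (\<lambda>y. \<sigma> (\<lambda>i. real ((y(rank j := Suc (y (rank j)))) i) / real (Suc M))
       - \<sigma> (\<lambda>i. real ((y(0 := Suc (y 0))) i) / real (Suc M)))) - F' t ?e) \<le> K M + (2 * C) / real M"
    if t: "t \<in> corner_simplex" and M: "M > 0" for t M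
  proof -
    let ?N = "real (Suc M)"
    let ?Y = "\<lambda>y. real (Suc M) *\<^sub>R (\<sigma> (\<lambda>i. real ((y(rank j := Suc (y (rank j)))) i) / ?N) - \<sigma> (\<lambda>i. real ((y(0 := Suc (y 0))) i) / ?N))"
    have x: "bary t \<in> standard_simplex ?n" using t by (simp add: bary_in_standard_simplex)
    have "norm (iid_mean ?n M (bary t) ?Y - F' t ?e) \<le> K M + (2 * C) / real M"
    proof (rule bernstein_error[OF x M])
      fix y :: "nat \<Rightarrow> nat" assume y: "\<And>i. ?n < i \<Longrightarrow> y i = 0" "(\<Sum>i\<le>?n. y i) = M"
      define u where "u = (\<chi> i :: 'n. real (y (rank i)) / ?N)"
      let ?\<xi> = "\<lambda>s. u + s *\<^sub>R ?e"
      have yM: "y i \<le> M" for i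
      proof (cases "i \<le> ?n")
        case True then show ?thesis using y(2) member_le_sum[of i "{..?n}" y] by auto
      qed (use y in auto)
      have ysum: "real (y 0) + (\<Sum>i\<in>UNIV. real (y (rank (i::'n)))) = real M"
        using y(2) unfolding sum_rank by (metis of_nat_add of_nat_sum)
      have usum: "(\<Sum>i\<in>UNIV. u $ i) = (real M - real (y 0)) / ?N"
        using ysum by (simp add: u_def flip: sum_divide_distrib)
      have \<xi>sum: "(\<Sum>i\<in>UNIV. ?\<xi> s $ i) = (real M - real (y 0)) / ?N + s" for s
      proof -
        have "(\<Sum>i\<in>UNIV. ?e $ i) = 1" by (simp add: axis_def)
        then show ?thesis using usum by (simp add: sum.distrib flip: sum_distrib_left)
      qed
      have \<xi>_in: "?\<xi> s \<in> corner_simplex" if s: "s \<in> {0..1 / ?N}" for s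
      proof -
        have "(real M - real (y 0)) / ?N + s \<le> real M / ?N + 1 / ?N"
          using s by (intro add_mono divide_right_mono) auto
        also have "\<dots> = 1" by (simp flip: add_divide_distrib)
        finally have "(\<Sum>i\<in>UNIV. ?\<xi> s $ i) \<le> 1" unfolding \<xi>sum .
        moreover have "0 \<le> ?\<xi> s $ i" for i using s by (simp add: u_def axis_def)
        ultimately show ?thesis by (simp add: corner_simplex_def)
      qed
      have p0: "(\<lambda>i. real ((y(0 := Suc (y 0))) i) / ?N) = bary (?\<xi> 0)"
      proof (rule eq_at_ranks[where 'n = 'n])
        show "real ((y(0 := Suc (y 0))) 0) / ?N = bary (?\<xi> 0) 0"
          unfolding bary_0 \<xi>sum by (simp add: field_simps)
      qed (auto simp: rank_bounds u_def bary_gt y(1))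
      have p1: "(\<lambda>i. real ((y(rank j := Suc (y (rank j)))) i) / ?N) = bary (?\<xi> (1 / ?N))"
      proof (rule eq_at_ranks[where 'n = 'n])
        show "real ((y(rank j := Suc (y (rank j)))) 0) / ?N = bary (?\<xi> (1 / ?N)) 0"
          using rank_bounds(3)[of j] unfolding bary_0 \<xi>sum by (simp add: field_simps)
        show "real ((y(rank j := Suc (y (rank j)))) m) / ?N = bary (?\<xi> (1 / ?N)) m" if "?n < m" for m
          using rank_bounds(2)[of j] that by (auto simp: bary_gt y(1))
      qed (auto simp: u_def axis_def add_divide_distrib)
      define B where "B = K M + 2 * C * (\<Sum>i\<le>?n. (real (y i) / real M - bary t i)\<^sup>2)"
      have B: "norm (F' (?\<xi> s) ?e - F' t ?e) \<le> B" if s: "s \<in> {0..1 / ?N}" for s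
      proof -
        have "norm (F' (?\<xi> s) ?e - F' t ?e) = norm (G (bary (?\<xi> s)) - G (bary t))" by (simp only: G_def bary_chart)
        also have "\<dots> \<le> e / 2 + C * (\<Sum>i\<le>?n. (bary (?\<xi> s) i - bary t i)\<^sup>2)"
          using C(2)[OF x] \<xi>_in[OF s] by (simp only: bary_in_standard_simplex)
        finally have n1: "norm (F' (?\<xi> s) ?e - F' t ?e) \<le> e / 2 + C * (\<Sum>i\<le>?n. (bary (?\<xi> s) i - bary t i)\<^sup>2)" .
        have "(\<Sum>i\<le>?n. (bary (?\<xi> s) i - bary t i)\<^sup>2) \<le> (\<Sum>i\<le>?n. 2 * (real (y i) / real M - bary t i)\<^sup>2 + 8 / ?N\<^sup>2)"
        proof (rule sum_mono)
          fix i assume "i \<in> {..?n}"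
          have q: "\<bar>real (y l) / ?N - real (y l) / real M\<bar> \<le> 1 / ?N" for l
          proof -
            have "real (y l) / real M - real (y l) / ?N = (real (y l) / real M) / ?N"
              using M by (simp add: field_simps)
            moreover have "(real (y l) / real M) / ?N \<le> 1 / ?N" using yM[of l] M by (intro divide_right_mono) auto
            moreover have "0 \<le> (real (y l) / real M) / ?N" by simp
            ultimately show ?thesis unfolding abs_le_iff by linarith
          qed
          have d: "\<bar>bary (?\<xi> s) i - real (y i) / real M\<bar> \<le> 2 / ?N"
          proof (cases "i = 0")
            case True
            have "1 - (real M - real (y 0)) / ?N = real (y 0) / ?N + 1 / ?N" by (simp add: field_simps)
            then have "bary (?\<xi> s) 0 = real (y 0) / ?N + (1 / ?N - s)"
              unfolding bary_0 \<xi>sum by linarith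
            then show ?thesis using q[of 0] s True by (auto simp: abs_le_iff)
          next
            case False
            then obtain l :: 'n where l: "i = rank l"
              using rank_surj[of i, where 'n = 'n] \<open>i \<in> {..?n}\<close> by auto
            have "bary (?\<xi> s) i = real (y i) / ?N + s * (if l = j then 1 else 0)"
              by (simp add: l u_def axis_def)
            then show ?thesis using q[of i] s by (auto simp: abs_le_iff split: if_splits)
          qed
          have "(bary (?\<xi> s) i - bary t i)\<^sup>2 \<le> 2 * (real (y i) / real M - bary t i)\<^sup>2 + 2 * (bary (?\<xi> s) i - real (y i) / real M)\<^sup>2"
            using sum_squares_ge_zero[of "real (y i) / real M - bary t i - (bary (?\<xi> s) i - real (y i) / real M)" 0]
            by (simp add: power2_eq_square algebra_simps)
          moreover have "(bary (?\<xi> s) i - real (y i) / real M)\<^sup>2 \<le> (2 / ?N)\<^sup>2"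
            using power_mono[OF d, of 2] by simp
          ultimately show "(bary (?\<xi> s) i - bary t i)\<^sup>2 \<le> 2 * (real (y i) / real M - bary t i)\<^sup>2 + 8 / ?N\<^sup>2"
            by (simp add: power_divide)
        qed
        also have "\<dots> = 2 * (\<Sum>i\<le>?n. (real (y i) / real M - bary t i)\<^sup>2) + real (Suc ?n) * (8 / ?N\<^sup>2)"
          by (simp add: sum.distrib sum_distrib_left)
        finally have n2: "(\<Sum>i\<le>?n. (bary (?\<xi> s) i - bary t i)\<^sup>2) \<le> 2 * (\<Sum>i\<le>?n. (real (y i) / real M - bary t i)\<^sup>2) + real (Suc ?n) * (8 / ?N\<^sup>2)" .
        have "C * (2 * (\<Sum>i\<le>?n. (real (y i) / real M - bary t i)\<^sup>2) + real (Suc ?n) * (8 / ?N\<^sup>2)) + e / 2 = B"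
          by (simp only: B_def K_def distrib_left mult.assoc mult.left_commute[of C] add_ac)
        then show ?thesis using n1 mult_left_mono[OF n2 C(1)] by linarith
      qed
      have "norm ((F (?\<xi> (1 / ?N)) - (1 / ?N) *\<^sub>R F' t ?e) - (F (?\<xi> 0) - 0 *\<^sub>R F' t ?e)) \<le> B * norm (1 / ?N - 0)"
      proof (rule differentiable_bound[of "{0..1 / ?N}" "\<lambda>s. F (?\<xi> s) - s *\<^sub>R F' t ?e" "\<lambda>s h. h *\<^sub>R (F' (?\<xi> s) ?e - F' t ?e)"])
        fix s assume s: "s \<in> {0..1 / ?N}"
        have lin: "F' (?\<xi> s) (h *\<^sub>R ?e) = h *\<^sub>R F' (?\<xi> s) ?e" for h
          using linear_cmul[OF has_derivative_linear[OF F[OF \<xi>_in[OF s]]]] .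
        have "(?\<xi> has_derivative (\<lambda>h. h *\<^sub>R ?e)) (at s within {0..1 / ?N})"
          by (auto intro!: derivative_eq_intros)
        from has_derivative_compose[OF this F[OF \<xi>_in[OF s]]]
        have "((\<lambda>s. F (?\<xi> s)) has_derivative (\<lambda>h. h *\<^sub>R F' (?\<xi> s) ?e)) (at s within {0..1 / ?N})"
          by (simp only: lin)
        from has_derivative_diff[OF this has_derivative_scaleR_left[OF has_derivative_ident]]
        show "((\<lambda>s. F (?\<xi> s) - s *\<^sub>R F' t ?e) has_derivative (\<lambda>h. h *\<^sub>R (F' (?\<xi> s) ?e - F' t ?e))) (at s within {0..1 / ?N})"
          by (simp only: scaleR_diff_right)
        show "onorm (\<lambda>h. h *\<^sub>R (F' (?\<xi> s) ?e - F' t ?e)) \<le> B"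
          using B[OF s] by (intro onorm_bound) (auto simp: mult.commute[of B] mult_left_mono intro: order_trans[OF norm_ge_zero])
      qed auto
      then have "?N * norm (F (?\<xi> (1 / ?N)) - F (?\<xi> 0) - (1 / ?N) *\<^sub>R F' t ?e) \<le> B"
        by (simp add: field_simps)
      moreover have "?N * norm (F (?\<xi> (1 / ?N)) - F (?\<xi> 0) - (1 / ?N) *\<^sub>R F' t ?e) =
         norm (?N *\<^sub>R (F (?\<xi> (1 / ?N)) - F (?\<xi> 0) - (1 / ?N) *\<^sub>R F' t ?e))"
        by simp
      moreover have "?N *\<^sub>R (F (?\<xi> (1 / ?N)) - F (?\<xi> 0) - (1 / ?N) *\<^sub>R F' t ?e) = ?Y y - F' t ?e"
      proof -
        have "?Y y = ?N *\<^sub>R (F (?\<xi> (1 / ?N)) - F (?\<xi> 0))"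
          unfolding p0 p1 using eq[OF \<xi>_in[of 0]] eq[OF \<xi>_in[of "1 / ?N"]] by simp
        then show ?thesis by (simp add: scaleR_diff_right)
      qed
      ultimately show "norm (?Y y - F' t ?e) \<le> K M + 2 * C * (\<Sum>i\<le>?n. (real (y i) / real M - bary t i)\<^sup>2)"
        by (simp only: B_def)
    qed (use C in auto)
    then show ?thesis by (simp only: iid_mean_scaleR)
  qed
  have "\<forall>\<^sub>F M in sequentially. K M + (2 * C) / real M < e"
    unfolding K_def using e by real_asymp
  then have "\<forall>\<^sub>F M in sequentially. K M + (2 * C) / real M < e \<and> M > 0"
    using eventually_gt_at_top[of 0] by (rule eventually_conj)
  then have "\<forall>\<^sub>F M in sequentially. \<forall>t\<in>corner_simplex.
    norm (real (Suc M) *\<^sub>R iid_mean ?n (Suc M - 1) (bary t) (\<lambda>y. \<sigma> (\<lambda>i. real ((y(rank j := Suc (y (rank j)))) i) / real (Suc M))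
       - \<sigma> (\<lambda>i. real ((y(0 := Suc (y 0))) i) / real (Suc M))) - F' t ?e) < e"
  proof eventually_elim
    case (elim M)
    then have "K M + 2 * C / real M < e" "M > 0" by auto
    then show ?case unfolding diff_Suc_1 using bound[of _ M] by (blast intro: le_less_trans)
  qed
  then show ?thesis by (subst (asm) eventually_sequentially_Suc)
qed

lemma LINT_uniform_limit:
  fixes \<Psi> :: "'b::{euclidean_space} \<Rightarrow> complex" and Q :: "'a::euclidean_space \<Rightarrow> 'b"
  assumes S: "compact S" and \<Psi>: "continuous_on W \<Psi>" and W: "open W" and Q: "continuous_on S Q" "Q ` S \<subseteq> W"
    and QN: "\<And>N. continuous_on S (QN N)"
    and unif: "\<And>e. e > 0 \<Longrightarrow> \<forall>\<^sub>F N in sequentially. \<forall>t\<in>S. norm (QN N t - Q t) < e"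
  shows "(\<lambda>N. LINT t:S|lborel. \<Psi> (QN N t)) \<longlonglongrightarrow> (LINT t:S|lborel. \<Psi> (Q t))"
proof -
  have K: "compact (Q ` S)" by (intro compact_continuous_image Q S)
  obtain d where d: "d > 0" "(\<Union>x\<in>Q ` S. cball x d) \<subseteq> W"
    using compact_subset_open_imp_cball_epsilon_subset[OF K W Q(2)] by blast
  define K' where "K' = {x + y | x y. x \<in> Q ` S \<and> y \<in> cball 0 d}"
  have K': "compact K'" unfolding K'_def by (intro compact_sums K compact_cball)
  have K'W: "K' \<subseteq> W"
  proof
    fix z assume "z \<in> K'"
    then obtain x y where "x \<in> Q ` S" "z = x + y" "norm y \<le> d" by (auto simp: K'_def)
    then have "z \<in> cball x d" by (simp add: dist_norm)
    then show "z \<in> W" using d \<open>x \<in> Q ` S\<close> by blast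
  qed
  have in_K': "z \<in> K'" if "t \<in> S" "norm (z - Q t) \<le> d" for z t
    unfolding K'_def using that by (intro CollectI exI[of _ "Q t"] exI[of _ "z - Q t"]) auto
  have "bounded (\<Psi> ` K')" using K' continuous_on_subset[OF \<Psi> K'W] by (intro compact_imp_bounded compact_continuous_image)
  then obtain B where B: "\<And>z. z \<in> K' \<Longrightarrow> norm (\<Psi> z) \<le> B" by (auto simp: bounded_iff)
  obtain N0 where N0: "\<And>N t. N \<ge> N0 \<Longrightarrow> t \<in> S \<Longrightarrow> norm (QN N t - Q t) < d"
    using unif[OF d(1)] by (auto simp: eventually_sequentially)
  have cN: "continuous_on S (\<lambda>t. \<Psi> (QN N t))" if "N \<ge> N0" for N
    using N0[OF that] in_K' K'W by (intro continuous_on_compose2[OF \<Psi> QN]) (auto intro: less_imp_le)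
  have c: "continuous_on S (\<lambda>t. \<Psi> (Q t))" by (rule continuous_on_compose2[OF \<Psi> Q])
  have "(\<lambda>N. LINT t:S|lborel. \<Psi> (QN (N + N0) t)) \<longlonglongrightarrow> (LINT t:S|lborel. \<Psi> (Q t))"
    unfolding set_lebesgue_integral_def
  proof (rule integral_dominated_convergence[where w = "\<lambda>t. indicator S t *\<^sub>R B"])
    show "(\<lambda>t. indicator S t *\<^sub>R \<Psi> (Q t)) \<in> borel_measurable lborel"
      using borel_measurable_integrable[OF set_integrable_compact[OF S c, unfolded set_integrable_def]] by simp
    show "(\<lambda>t. indicator S t *\<^sub>R \<Psi> (QN (N + N0) t)) \<in> borel_measurable lborel" for N
      using borel_measurable_integrable[OF set_integrable_compact[OF S cN, unfolded set_integrable_def]] by simp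
    show "integrable lborel (\<lambda>t. indicator S t *\<^sub>R B)"
      using set_integrable_compact[OF S, of "\<lambda>_. B"] by (simp add: set_integrable_def)
    show "AE t in lborel. (\<lambda>N. indicator S t *\<^sub>R \<Psi> (QN (N + N0) t)) \<longlonglongrightarrow> indicator S t *\<^sub>R \<Psi> (Q t)"
    proof (rule AE_I2)
      fix t
      show "(\<lambda>N. indicator S t *\<^sub>R \<Psi> (QN (N + N0) t)) \<longlonglongrightarrow> indicator S t *\<^sub>R \<Psi> (Q t)"
      proof (cases "t \<in> S")
        case True
        have "(\<lambda>N. QN N t) \<longlonglongrightarrow> Q t"
        proof (rule tendstoI)
          fix e :: real assume "e > 0"
          from unif[OF this] show "\<forall>\<^sub>F N in sequentially. dist (QN N t) (Q t) < e"
            by eventually_elim (use True in \<open>auto simp: dist_norm\<close>)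
        qed
        moreover have "isCont \<Psi> (Q t)" using \<Psi> W Q(2) True by (metis continuous_on_eq_continuous_at image_subset_iff)
        ultimately have "(\<lambda>N. \<Psi> (QN N t)) \<longlonglongrightarrow> \<Psi> (Q t)" by (metis isCont_tendsto_compose)
        then show ?thesis using True LIMSEQ_ignore_initial_segment[of "\<lambda>N. \<Psi> (QN N t)" _ N0] by simp
      qed simp
    qed
    show "AE t in lborel. norm (indicator S t *\<^sub>R \<Psi> (QN (N + N0) t)) \<le> indicator S t *\<^sub>R B" for N
    proof (rule AE_I2)
      fix t
      have "norm (\<Psi> (QN (N + N0) t)) \<le> B" if "t \<in> S"
        using that N0[of "N + N0" t] by (intro B in_K') auto
      then show "norm (indicator S t *\<^sub>R \<Psi> (QN (N + N0) t)) \<le> indicator S t *\<^sub>R B" by (auto simp: indicator_def)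
    qed
  qed
  then show ?thesis by (rule LIMSEQ_offset)
qed

lemma smooth_simplexE:
  fixes \<sigma> :: "(nat \<Rightarrow> real) \<Rightarrow> complex^'n::{finite,linorder}"
  assumes "smooth_simplex \<sigma>"
  obtains F F' where "\<And>t. t \<in> corner_simplex \<Longrightarrow> (F has_derivative F' t) (at t)"
    "\<And>v. continuous_on corner_simplex (\<lambda>t. F' t v)" "\<And>t. t \<in> corner_simplex \<Longrightarrow> F t = \<sigma> (bary t)"
    "\<And>g. simplex_integral g \<sigma> = integral corner_simplex (\<lambda>t. g (F t) * det (\<chi> j. F' t (axis j 1)))"
proof -
  obtain S :: "(real^'n::_) set" and F where SF: "open S" "corner_simplex \<subseteq> S" "smooth_on S F"
      "\<forall>t\<in>corner_simplex. F t = \<sigma> (bary t)"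
    using assms unfolding smooth_simplex_def by blast
  then have "Ck_on (Suc 0) S F" unfolding smooth_on_def by blast
  then obtain F' where F': "\<And>t. t \<in> S \<Longrightarrow> (F has_derivative F' t) (at t)" "\<And>v. continuous_on S (\<lambda>t. F' t v)"
    by auto
  have "simplex_integral g \<sigma> = integral corner_simplex (\<lambda>t. g (F t) * det (\<chi> j. F' t (axis j 1)))" for g
  proof -
    have d: "det (\<chi> i j. F' t (axis j 1) $ i) = det (\<chi> j. F' t (axis j 1))" for t
      using det_transpose[of "\<chi> j. F' t (axis j 1)"] by (simp add: Finite_Cartesian_Product.transpose_def)
    have "simplex_integral g \<sigma> = integral corner_simplex (\<lambda>t. g (F t) * det (\<chi> i j. F' t (axis j 1) $ i))"
      using F' SF interior_subset by (intro simplex_integral_smooth) blast+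
    then show ?thesis by (simp only: d)
  qed
  then show thesis using that[of F F'] F' SF(2,4) by (meson continuous_on_subset subsetD)
qed

text \<open>The integrand is a continuous function of the point and the n tangent vectors, and these converge uniformly.\<close>

lemma simplex_integral_bernstein_tendsto:
  fixes \<sigma> :: "(nat \<Rightarrow> real) \<Rightarrow> complex^'n::{finite,linorder}"
  assumes sm: "smooth_simplex \<sigma>" and \<sigma>: "singular_simplex CARD('n) (top_of_set X) \<sigma>"
    and X: "open X" and g: "continuous_on X g"
  shows "(\<lambda>N. simplex_integral g (bernstein CARD('n) N \<sigma>)) \<longlonglongrightarrow> simplex_integral g \<sigma>"
proof -
  let ?n = "CARD('n)"
  obtain F F' where F: "\<And>t. t \<in> corner_simplex \<Longrightarrow> (F has_derivative F' t) (at t)"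
    "\<And>v. continuous_on corner_simplex (\<lambda>t. F' t v)" "\<And>t. t \<in> corner_simplex \<Longrightarrow> F t = \<sigma> (bary t)"
    and int: "simplex_integral g \<sigma> = integral corner_simplex (\<lambda>t. g (F t) * det (\<chi> j. F' t (axis j 1)))"
    by (rule smooth_simplexE[OF sm]) blast
  have cF: "continuous_on corner_simplex F"
    using F(1) by (intro continuous_at_imp_continuous_on) (auto intro: has_derivative_continuous)
  have FX: "F ` corner_simplex \<subseteq> X"
    using \<sigma> F(3) bary_in_standard_simplex by (auto simp: singular_simplex_top_of_set)
  define H where "H N t = iid_mean ?n N (bary t) (\<lambda>y. \<sigma> (\<lambda>i. real (y i) / real N))" for N and t :: "real^'n::_"
  define E where "E N t j = real N *\<^sub>R iid_mean ?n (N - 1) (bary t) (\<lambda>y. \<sigma> (\<lambda>i. real ((y(rank j := Suc (y (rank j)))) i) / real N)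
       - \<sigma> (\<lambda>i. real ((y(0 := Suc (y 0))) i) / real N))" for N and t :: "real^'n::_" and j :: 'n
  define \<Psi> where "\<Psi> z = g (fst z) * det (snd z)" for z :: "(complex^'n::_) \<times> (complex^'n::_^'n::_)"
  define Q where "Q t = (F t, \<chi> j. F' t (axis j 1))" for t
  define QN where "QN N t = (H N t, \<chi> j. E N t j)" for N t
  have c1: "continuous_on (X \<times> UNIV) \<Psi>"
    unfolding \<Psi>_def
  proof (intro continuous_on_mult continuous_on_compose2[OF g continuous_on_fst[OF continuous_on_id]])
    have "continuous_on (X \<times> UNIV) (\<lambda>z :: (complex^'n::_) \<times> (complex^'n::_^'n::_). det (\<chi> j. snd z $ j))"
      by (intro continuous_on_det continuous_intros)
    then show "continuous_on (X \<times> UNIV) (\<lambda>z :: (complex^'n::_) \<times> (complex^'n::_^'n::_). det (snd z))" by simp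
  qed auto
  have c2: "continuous_on corner_simplex Q" unfolding Q_def by (intro continuous_intros cF F)
  have c3: "continuous_on S (QN N)" for N S unfolding QN_def H_def E_def
    by (intro continuous_intros continuous_bary)
  have QX: "Q ` corner_simplex \<subseteq> X \<times> UNIV" using FX by (auto simp: Q_def)
  have unif: "\<forall>\<^sub>F N in sequentially. \<forall>t\<in>corner_simplex. norm (QN N t - Q t) < e" if e: "e > 0" for e
  proof -
    let ?d = "e / (2 * real (Suc ?n))"
    have d: "?d > 0" using e by simp
    have 1: "\<forall>\<^sub>F N in sequentially. \<forall>x\<in>standard_simplex ?n. norm (bernstein ?n N \<sigma> x - \<sigma> x) < ?d"
      using \<sigma> by (intro bernstein_uniform d) (simp add: singular_simplex_top_of_set)
    have 2: "\<forall>\<^sub>F N in sequentially. \<forall>j. \<forall>t\<in>corner_simplex. norm (E N t j - F' t (axis j 1)) < ?d"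
      unfolding E_def by (intro eventually_all_finite bernstein_C1_uniform[OF F d])
    show ?thesis using 1 2
    proof eventually_elim
      case (elim N)
      show ?case
      proof
        fix t assume t: "t \<in> (corner_simplex :: (real^'n::_) set)"
        have "norm (QN N t - Q t) \<le> norm (H N t - F t) + norm ((\<chi> j. E N t j) - (\<chi> j. F' t (axis j 1)))"
          unfolding QN_def Q_def by (metis (no_types, lifting) diff_Pair norm_Pair_le)
        also have "norm (H N t - F t) < ?d"
          using elim(1) t bary_in_standard_simplex[of t] by (auto simp: H_def F(3)[OF t] bernstein_def dest!: bspec[of _ _ "bary t"])
        also have "norm ((\<chi> j. E N t j) - (\<chi> j. F' t (axis j 1))) \<le> (\<Sum>j\<in>UNIV. norm (((\<chi> j. E N t j) - (\<chi> j. F' t (axis j 1))) $ j))"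
          unfolding norm_vec_def by (rule L2_set_le_sum) auto
        also have "\<dots> \<le> (\<Sum>j\<in>(UNIV :: 'n set). ?d)"
          using elim(2) t by (intro sum_mono) (auto intro!: less_imp_le)
        also have "?d + \<dots> = real (Suc ?n) * ?d" by (simp add: distrib_right add_divide_distrib)
        also have "\<dots> \<le> e" using e by (simp add: field_simps add_pos_nonneg)
        finally show "norm (QN N t - Q t) < e" by simp
      qed
    qed
  qed
  have lim: "(\<lambda>N. corner_integral (\<lambda>t. \<Psi> (QN N t))) \<longlonglongrightarrow> corner_integral (\<lambda>t. \<Psi> (Q t))"
    by (rule LINT_uniform_limit[OF compact_corner_simplex c1 open_Times[OF X open_UNIV] c2 QX c3 unif])
  have "simplex_integral g \<sigma> = corner_integral (\<lambda>t. \<Psi> (Q t))"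
  proof -
    have "simplex_integral g \<sigma> = integral corner_simplex (\<lambda>t. \<Psi> (Q t))" unfolding int by (simp add: \<Psi>_def Q_def)
    then show ?thesis by (simp only: integral_corner_simplex[OF continuous_on_compose2[OF c1 c2 QX]])
  qed
  moreover have "\<forall>\<^sub>F N in sequentially. corner_integral (\<lambda>t. \<Psi> (QN N t)) = simplex_integral g (bernstein ?n N \<sigma>)"
    using eventually_bernstein_in[OF X \<sigma>]
  proof eventually_elim
    case (elim N)
    have "\<exists>L. (H N has_derivative L) (at t) \<and> (\<forall>j. L (axis j 1) = E N t j)" for t
      unfolding H_def[abs_def] E_def
      by (rule bernstein_chart_has_derivative[of N "\<lambda>y. \<sigma> (\<lambda>i. real (y i) / real N)" t]) blast
    then have "\<forall>t. \<exists>L. (H N has_derivative L) (at t) \<and> (\<forall>j. L (axis j 1) = E N t j)" by blast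
    from choice[OF this] obtain L where L: "\<And>t. (H N has_derivative L t) (at t)" "\<And>t j. L t (axis j 1) = E N t j" by blast
    have HN: "H N t = bernstein ?n N \<sigma> (bary t)" if "t \<in> corner_simplex" for t
      using that bary_in_standard_simplex[of t] by (simp add: H_def bernstein_def)
    have d: "det (\<chi> i j. E N t j $ i) = det (\<chi> j. E N t j)" for t
      using det_transpose[of "\<chi> j. E N t j"] by (simp add: Finite_Cartesian_Product.transpose_def)
    have "simplex_integral g (bernstein ?n N \<sigma>) = integral corner_simplex (\<lambda>t. g (H N t) * det (\<chi> i j. L t (axis j 1) $ i))"
      using L HN by (intro simplex_integral_smooth) auto
    also have "\<dots> = integral corner_simplex (\<lambda>t. \<Psi> (QN N t))"
      by (simp add: L d \<Psi>_def QN_def)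
    also have "\<dots> = corner_integral (\<lambda>t. \<Psi> (QN N t))"
    proof (rule integral_corner_simplex, rule continuous_on_compose2[OF c1 c3])
      show "QN N ` corner_simplex \<subseteq> X \<times> UNIV"
        using elim HN bary_in_standard_simplex by (auto simp: QN_def)
    qed
    finally show ?case by simp
  qed
  ultimately show ?thesis using Lim_transform_eventually[OF lim] by simp
qed

lemma chain_integral_superset:
  assumes "finite S" "Poly_Mapping.keys c \<subseteq> S"
  shows "chain_integral g c = (\<Sum>\<sigma>\<in>S. of_int (Poly_Mapping.lookup c \<sigma>) * simplex_integral g \<sigma>)"
  unfolding chain_integral_def using assms
  by (intro sum.mono_neutral_left) (auto simp: in_keys_iff)

lemma chain_integral_0 [simp]: "chain_integral g 0 = 0"
  by (simp add: chain_integral_def)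

lemma chain_integral_diff: "chain_integral g (a - b) = chain_integral g a - chain_integral g b"
proof -
  let ?S = "Poly_Mapping.keys a \<union> Poly_Mapping.keys b"
  have "Poly_Mapping.keys (a - b) \<subseteq> ?S" by (rule keys_diff)
  then show ?thesis
    by (subst (1 2 3) chain_integral_superset[of ?S]) (auto simp: lookup_minus left_diff_distrib sum_subtractf)
qed

lemma chain_integral_add: "chain_integral g (a + b) = chain_integral g a + chain_integral g b"
proof -
  have "a + b = a - (0 - b)" by simp
  then show ?thesis by (simp only: chain_integral_diff) simp
qed

lemma chain_integral_of [simp]: "chain_integral g (frag_of \<sigma>) = simplex_integral g \<sigma>"
  by (simp add: chain_integral_def)

lemma chain_integral_cmul: "chain_integral g (frag_cmul k c) = of_int k * chain_integral g c"
proof -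
  have "Poly_Mapping.keys (frag_cmul k c) \<subseteq> Poly_Mapping.keys c" by (rule keys_cmul)
  then show ?thesis
    by (subst (1 2) chain_integral_superset[of "Poly_Mapping.keys c"]) (auto simp: sum_distrib_left mult.assoc)
qed

lemma chain_integral_sum: "chain_integral g (\<Sum>i\<in>I. c i) = (\<Sum>i\<in>I. chain_integral g (c i))"
  by (induction I rule: infinite_finite_induct) (auto simp: chain_integral_add)

lemma chain_integral_frag_extend:
  "chain_integral g (frag_extend F c) = (\<Sum>\<sigma>\<in>Poly_Mapping.keys c. of_int (Poly_Mapping.lookup c \<sigma>) * chain_integral g (F \<sigma>))"
  by (simp add: frag_extend_def chain_integral_sum chain_integral_cmul)

text \<open>If the difference of the chains is the boundary of \<open>e\<close>, then for large N the Bernstein approximation of \<open>e\<close> lies in X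
  and bounds that of the difference. By Stokes' theorem the approximations of the chains have equal integrals; let N
  tend to infinity.\<close>

theorem chain_integral_homologous:
  fixes c c' :: "(complex^'n::{finite,linorder}) chain"
  assumes X: "open X" and g: "\<And>x. x \<in> X \<Longrightarrow> (g has_derivative (\<lambda>v. \<Sum>k\<in>UNIV. G k x * v $ k)) (at x)"
    and G: "\<And>k. continuous_on X (G k)"
    and c: "singular_chain CARD('n) (top_of_set X) c" "\<And>\<sigma>. \<sigma> \<in> Poly_Mapping.keys c \<Longrightarrow> smooth_simplex \<sigma>"
    and c': "singular_chain CARD('n) (top_of_set X) c'" "\<And>\<sigma>. \<sigma> \<in> Poly_Mapping.keys c' \<Longrightarrow> smooth_simplex \<sigma>"
    and hom: "homologous_rel CARD('n) (top_of_set X) {} c c'"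
  shows "chain_integral g c = chain_integral g c'"
proof -
  let ?n = "CARD('n)"
  have g_cont: "continuous_on X g"
    using has_derivative_continuous[OF g] by (auto intro!: continuous_at_imp_continuous_on)
  obtain e where e: "singular_chain (Suc ?n) (top_of_set X) e" "chain_boundary (Suc ?n) e = c - c'"
    using hom by (auto simp: homologous_rel_def singular_boundary)
  let ?B = "\<lambda>N. frag_extend (frag_of \<circ> bernstein ?n N) (c - c')"
  have keys: "smooth_simplex \<sigma>" "singular_simplex ?n (top_of_set X) \<sigma>" if "\<sigma> \<in> Poly_Mapping.keys (c - c')" for \<sigma>
    using that c c' keys_diff[of c c'] by (auto simp: singular_chain_def)
  have "(\<lambda>N. chain_integral g (?B N)) \<longlonglongrightarrow> chain_integral g (c - c')"
    unfolding chain_integral_frag_extend o_def chain_integral_of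
    unfolding chain_integral_def[of g "c - c'"]
    by (intro tendsto_intros simplex_integral_bernstein_tendsto[OF keys X g_cont])
  moreover have "\<forall>\<^sub>F N in sequentially. chain_integral g (?B N) = 0"
  proof -
    have "\<forall>\<^sub>F N in sequentially. \<forall>\<sigma>\<in>Poly_Mapping.keys e. bernstein (Suc ?n) N \<sigma> ` standard_simplex (Suc ?n) \<subseteq> X"
      using e(1) by (intro eventually_ball_finite ballI eventually_bernstein_in[OF X]) (auto simp: singular_chain_def)
    then show ?thesis using eventually_gt_at_top[of 0]
    proof eventually_elim
      case (elim N)
      have "chain_integral g (?B N) = chain_integral g (chain_boundary (Suc ?n) (frag_extend (frag_of \<circ> bernstein (Suc ?n) N) e))"
        by (simp add: chain_boundary_bernstein[OF elim(2)] e(2))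
      also have "\<dots> = (\<Sum>\<sigma>\<in>Poly_Mapping.keys e. of_int (Poly_Mapping.lookup e \<sigma>) *
          (\<Sum>k\<le>Suc ?n. (- 1) ^ k * simplex_integral g (singular_face (Suc ?n) k (bernstein (Suc ?n) N \<sigma>))))"
        by (simp add: frag_extend_def[of _ e] chain_boundary_sum chain_boundary_cmul chain_boundary_of chain_integral_sum
            chain_integral_cmul chain_integral_add del: sum.atMost_Suc)
      also have "\<dots> = 0"
        using elim(1) stokes_bernstein[OF g G] by (intro sum.neutral) (auto simp del: sum.atMost_Suc)
      finally show ?case .
    qed
  qed
  ultimately have "chain_integral g (c - c') = 0"
    using LIMSEQ_unique[OF _ tendsto_eventually] by blast
  then show ?thesis by (simp add: chain_integral_diff)
qed

section \<open>Products of chains with a circle\<close>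

text \<open>The affine map that collapses the edge joining the vertices i and i + 1.\<close>

definition degeneracy :: "nat \<Rightarrow> (nat \<Rightarrow> real) \<Rightarrow> nat \<Rightarrow> real" where
  "degeneracy i t = (\<lambda>j. if j < i then t j else if j = i then t i + t (Suc i) else t (Suc j))"

definition circle_simplex :: "nat \<Rightarrow> ('a \<Rightarrow> complex \<Rightarrow> 'b) \<Rightarrow> ((nat \<Rightarrow> real) \<Rightarrow> 'a) \<Rightarrow> nat \<Rightarrow> (nat \<Rightarrow> real) \<Rightarrow> 'b" where
  "circle_simplex p \<Phi> \<sigma> i = restrict (\<lambda>t. \<Phi> (\<sigma> (degeneracy i t)) (cis (2 * pi * (\<Sum>j\<in>{i<..Suc p}. t j)))) (standard_simplex (Suc p))"

lemma circle_prism_eq: "circle_prism p \<Phi> \<sigma> = (\<Sum>i\<le>p. frag_cmul ((-1) ^ i) (frag_of (circle_simplex p \<Phi> \<sigma> i)))"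
  by (simp add: circle_prism_def circle_simplex_def degeneracy_def)

lemma degeneracy_in:
  assumes t: "t \<in> standard_simplex (Suc p)" and i: "i \<le> p"
  shows "degeneracy i t \<in> standard_simplex p"
proof -
  have "(\<Sum>j\<le>p. degeneracy i t j) = (\<Sum>j\<le>Suc p. t j)"
  proof -
    have "{..Suc p} = insert i ({..Suc p} - {i})" using i by auto
    have "(\<Sum>j\<le>p. degeneracy i t j) = (\<Sum>j\<le>p. t (if j < i then j else Suc j) + (if j = i then t i else 0))"
      by (intro sum.cong) (auto simp: degeneracy_def)
    also have "\<dots> = (\<Sum>j\<le>p. (t(i := 0)) (if j < i then j else Suc j)) + t i"
      using i by (subst sum.distrib) (auto intro!: sum.cong)
    also have "(\<Sum>j\<le>p. (t(i := 0)) (if j < i then j else Suc j)) = (\<Sum>j\<le>Suc p. (t(i := 0)) j)"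
      using i by (subst sum_simplical_face[of i]) auto
    also have "\<dots> = (\<Sum>j\<in>{..Suc p} - {i}. t j)"
      using i by (intro sum.mono_neutral_cong_right) auto
    also have "\<dots> + t i = (\<Sum>j\<le>Suc p. t j)" using sum.remove[of "{..Suc p}" i t] i by (simp del: sum.atMost_Suc)
    finally show ?thesis .
  qed
  then have s: "(\<Sum>j\<le>p. degeneracy i t j) = 1" using standard_simplexD(4)[OF t] by simp
  have nn: "0 \<le> degeneracy i t j" for j using standard_simplexD(1)[OF t] by (simp add: degeneracy_def)
  have z: "degeneracy i t j = 0" if "p < j" for j using that i standard_simplexD(3)[OF t] by (simp add: degeneracy_def)
  have "degeneracy i t j \<le> 1" for j
  proof (cases "j \<le> p")
    case True
    then show ?thesis using s member_le_sum[of j "{..p}" "degeneracy i t"] nn by auto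
  qed (simp add: z)
  then show ?thesis using s nn z by (auto simp: standard_simplex_def)
qed

text \<open>Any circle product is the image of the universal one, with values in pairs. Homotopies of the map \<open>\<Phi>\<close> can therefore
  be treated by homotopy invariance of singular homology.\<close>

lemma circle_product_alt:
  "circle_product p \<Phi> c = chain_map (Suc p) (case_prod \<Phi>) (circle_product p Pair c)"
proof -
  have "simplex_map (Suc p) (case_prod \<Phi>) (circle_simplex p Pair \<sigma> i) = circle_simplex p \<Phi> \<sigma> i" for \<sigma> i
    by (auto simp: simplex_map_def circle_simplex_def restrict_def)
  then show ?thesis
    by (induction c rule: frag_induction[OF subset_UNIV])
      (simp_all add: circle_product_def circle_prism_eq chain_map_sum frag_extend_diff chain_map_diff)
qed

lemma circle_product_chain_map:
  "circle_product p \<Phi> (chain_map p h c) = circle_product p (\<lambda>x. \<Phi> (h x)) c"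
proof -
  have "circle_simplex p \<Phi> (simplex_map p h \<sigma>) i = circle_simplex p (\<lambda>x. \<Phi> (h x)) \<sigma> i" if "i \<le> p" for \<sigma> i
    using degeneracy_in[OF _ that] by (auto simp: simplex_map_def circle_simplex_def restrict_def)
  then show ?thesis
    by (induction c rule: frag_induction[OF subset_UNIV])
      (simp_all add: circle_product_def circle_prism_eq frag_extend_diff chain_map_diff)
qed

lemma circle_product_0 [simp]: "circle_product p \<Phi> 0 = 0"
  by (simp add: circle_product_def)

lemma circle_product_diff: "circle_product p \<Phi> (a - b) = circle_product p \<Phi> a - circle_product p \<Phi> b"
  by (simp add: circle_product_def frag_extend_diff)

lemma sum_tail_face_le:
  fixes t :: "nat \<Rightarrow> real"
  assumes "k \<le> i"
  shows "(\<Sum>j\<in>{i<..Suc p}. simplical_face k t j) = (\<Sum>j\<in>{i..p}. t j)"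
proof -
  have "(\<Sum>j\<in>{i<..Suc p}. simplical_face k t j) = (\<Sum>j\<in>{Suc i..Suc p}. t (j - 1))"
    using assms by (intro sum.cong) (auto simp: simplical_face_def)
  also have "\<dots> = (\<Sum>j\<in>{i..p}. t j)" by (subst sum.shift_bounds_cl_Suc_ivl) simp
  finally show ?thesis .
qed

lemma sum_tail_face_gt:
  fixes t :: "nat \<Rightarrow> real"
  assumes "i < k" "k \<le> Suc p"
  shows "(\<Sum>j\<in>{i<..Suc p}. simplical_face k t j) = (\<Sum>j\<in>{i<..p}. t j)"
proof -
  have "(\<Sum>j\<in>{i<..Suc p}. simplical_face k t j) = (\<Sum>j\<in>{i<..Suc p} - {k}. simplical_face k t j)"
    by (intro sum.mono_neutral_right) (auto simp: simplical_face_def)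
  also have "\<dots> = (\<Sum>j\<in>{i<..p}. t j)"
    by (rule sum.reindex_bij_witness[where i = "\<lambda>j. if j < k then j else Suc j" and j = "\<lambda>j. if j < k then j else j - 1"])
      (use assms in \<open>auto simp: simplical_face_def split: if_splits\<close>)
  finally show ?thesis .
qed

lemma singular_face_circle_simplex:
  assumes k: "k \<le> Suc p" and i: "i \<le> p"
  shows "k < i \<Longrightarrow> singular_face (Suc p) k (circle_simplex p \<Phi> \<sigma> i) = circle_simplex (p - 1) \<Phi> (singular_face p k \<sigma>) (i - 1)"
    and "Suc i < k \<Longrightarrow> singular_face (Suc p) k (circle_simplex p \<Phi> \<sigma> i) = circle_simplex (p - 1) \<Phi> (singular_face p (k - 1) \<sigma>) i"
    and "k = i \<Longrightarrow> singular_face (Suc p) k (circle_simplex p \<Phi> \<sigma> i) = restrict (\<lambda>t. \<Phi> (\<sigma> t) (cis (2 * pi * (\<Sum>j\<in>{i..p}. t j)))) (standard_simplex p)"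
    and "k = Suc i \<Longrightarrow> singular_face (Suc p) k (circle_simplex p \<Phi> \<sigma> i) = restrict (\<lambda>t. \<Phi> (\<sigma> t) (cis (2 * pi * (\<Sum>j\<in>{Suc i..p}. t j)))) (standard_simplex p)"
proof -
  have face: "singular_face (Suc p) k (circle_simplex p \<Phi> \<sigma> i) =
     restrict (\<lambda>t. \<Phi> (\<sigma> (degeneracy i (simplical_face k t))) (cis (2 * pi * (\<Sum>j\<in>{i<..Suc p}. simplical_face k t j)))) (standard_simplex p)"
    using simplical_face_in_standard_simplex[of "Suc p" k] k
    by (auto simp: singular_face_def circle_simplex_def restrict_def fun_eq_iff)
  show "singular_face (Suc p) k (circle_simplex p \<Phi> \<sigma> i) = circle_simplex (p - 1) \<Phi> (singular_face p k \<sigma>) (i - 1)" if a: "k < i"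
  proof -
    obtain q where q: "p = Suc q" using a i by (cases p) auto
    show ?thesis unfolding face unfolding circle_simplex_def q diff_Suc_1
    proof (rule restrict_ext)
      fix t assume t: "t \<in> standard_simplex (Suc q)"
      have "degeneracy i (simplical_face k t) = simplical_face k (degeneracy (i - 1) t)"
        using a by (auto simp: degeneracy_def simplical_face_def fun_eq_iff)
      moreover have "degeneracy (i - 1) t \<in> standard_simplex q" using t i a q by (intro degeneracy_in) auto
      moreover have "(\<Sum>j\<in>{i<..Suc (Suc q)}. simplical_face k t j) = (\<Sum>j\<in>{i - 1<..Suc q}. t j)"
        using a by (subst sum_tail_face_le) (auto intro!: sum.cong simp del: sum.cl_ivl_Suc)
      ultimately show "\<Phi> (\<sigma> (degeneracy i (simplical_face k t))) (cis (2 * pi * (\<Sum>j\<in>{i<..Suc (Suc q)}. simplical_face k t j))) =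
        \<Phi> (singular_face (Suc q) k \<sigma> (degeneracy (i - 1) t)) (cis (2 * pi * (\<Sum>j\<in>{i - 1<..Suc q}. t j)))"
        by (simp add: singular_face_def)
    qed
  qed
  show "singular_face (Suc p) k (circle_simplex p \<Phi> \<sigma> i) = circle_simplex (p - 1) \<Phi> (singular_face p (k - 1) \<sigma>) i" if a: "Suc i < k"
  proof -
    obtain q where q: "p = Suc q" using a k by (cases p) auto
    show ?thesis unfolding face unfolding circle_simplex_def q diff_Suc_1
    proof (rule restrict_ext)
      fix t assume t: "t \<in> standard_simplex (Suc q)"
      have "degeneracy i (simplical_face k t) = simplical_face (k - 1) (degeneracy i t)"
        using a by (auto simp: degeneracy_def simplical_face_def fun_eq_iff)
      moreover have "degeneracy i t \<in> standard_simplex q" using t i a k q by (intro degeneracy_in) auto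
      moreover have "(\<Sum>j\<in>{i<..Suc (Suc q)}. simplical_face k t j) = (\<Sum>j\<in>{i<..Suc q}. t j)"
        using a k q by (intro sum_tail_face_gt) auto
      ultimately show "\<Phi> (\<sigma> (degeneracy i (simplical_face k t))) (cis (2 * pi * (\<Sum>j\<in>{i<..Suc (Suc q)}. simplical_face k t j))) =
        \<Phi> (singular_face (Suc q) (k - 1) \<sigma> (degeneracy i t)) (cis (2 * pi * (\<Sum>j\<in>{i<..Suc q}. t j)))"
        by (simp add: singular_face_def)
    qed
  qed
  have deg: "degeneracy i (simplical_face k t) = t" if "k = i \<or> k = Suc i" for t
    using that by (auto simp: degeneracy_def simplical_face_def fun_eq_iff)
  show "singular_face (Suc p) k (circle_simplex p \<Phi> \<sigma> i) = restrict (\<lambda>t. \<Phi> (\<sigma> t) (cis (2 * pi * (\<Sum>j\<in>{i..p}. t j)))) (standard_simplex p)" if "k = i"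
    unfolding face using that deg by (intro restrict_ext) (simp add: sum_tail_face_le)
  show "singular_face (Suc p) k (circle_simplex p \<Phi> \<sigma> i) = restrict (\<lambda>t. \<Phi> (\<sigma> t) (cis (2 * pi * (\<Sum>j\<in>{Suc i..p}. t j)))) (standard_simplex p)" if "k = Suc i"
    unfolding face using that deg k by (intro restrict_ext) (simp add: sum_tail_face_gt atLeastSucAtMost_greaterThanAtMost)
qed

lemma frag_cmul_neg: "frag_cmul (- a) c = - frag_cmul a c"
  by (rule poly_mapping_eqI) simp

text \<open>The prism formula. The two ends cancel because the circle closes up, and only the prisms over the faces are left.\<close>

lemma chain_boundary_circle_prism:
  "chain_boundary (Suc p) (circle_prism p \<Phi> \<sigma>) = - circle_product (p - 1) \<Phi> (chain_boundary p (frag_of \<sigma>))"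
proof -
  define T where "T i k = frag_of (circle_simplex (p - 1) \<Phi> (singular_face p k \<sigma>) i)" for i k
  define W where "W i = frag_of (restrict (\<lambda>t. \<Phi> (\<sigma> t) (cis (2 * pi * (\<Sum>j\<in>{i..p}. t j)))) (standard_simplex p))" for i
  define D where "D i k = frag_cmul ((-1) ^ (i + k)) (frag_of (singular_face (Suc p) k (circle_simplex p \<Phi> \<sigma> i)))" for i k
  have "chain_boundary (Suc p) (circle_prism p \<Phi> \<sigma>) = (\<Sum>i\<le>p. \<Sum>k\<le>Suc p. D i k)"
    by (simp add: circle_prism_eq chain_boundary_sum chain_boundary_cmul chain_boundary_of frag_cmul_sum D_def power_add del: sum.atMost_Suc)
  also have "\<dots> = (\<Sum>i\<le>p. (\<Sum>k<i. D i k) + (D i i + D i (Suc i)) + (\<Sum>k\<in>{i<..p}. D i (Suc k)))"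
  proof (rule sum.cong[OF refl])
    fix i assume "i \<in> {..p}"
    then have "{..Suc p} = {..<i} \<union> ({i, Suc i} \<union> Suc ` {i<..p})" by (auto simp flip: atLeastSucAtMost_greaterThanAtMost)
    moreover have "sum (D i) ({..<i} \<union> ({i, Suc i} \<union> Suc ` {i<..p})) = (\<Sum>k<i. D i k) + (sum (D i) {i, Suc i} + (\<Sum>k\<in>{i<..p}. D i (Suc k)))"
      by (subst sum.union_disjoint; (subst sum.union_disjoint)?; auto simp: sum.reindex)
    ultimately show "sum (D i) {..Suc p} = (\<Sum>k<i. D i k) + (D i i + D i (Suc i)) + (\<Sum>k\<in>{i<..p}. D i (Suc k))"
      by (simp add: add.assoc)
  qed
  also have "\<dots> = (\<Sum>i\<le>p. \<Sum>k<i. D i k) + (\<Sum>i\<le>p. D i i + D i (Suc i)) + (\<Sum>i\<le>p. \<Sum>k\<in>{i<..p}. D i (Suc k))"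
    by (simp add: sum.distrib)
  also have "(\<Sum>i\<le>p. D i i + D i (Suc i)) = 0"
  proof -
    have "(\<Sum>i\<le>p. D i i + D i (Suc i)) = (\<Sum>i\<le>p. W i - W (Suc i))"
    proof (rule sum.cong[OF refl])
      fix i assume "i \<in> {..p}"
      then show "D i i + D i (Suc i) = W i - W (Suc i)"
        using singular_face_circle_simplex(3)[of i p i \<Phi> \<sigma>] singular_face_circle_simplex(4)[of "Suc i" p i \<Phi> \<sigma>]
        by (simp add: D_def W_def frag_cmul_neg)
    qed
    also have "\<dots> = W 0 - W (Suc p)" by (rule sum_telescope)
    also have "W 0 = W (Suc p)"
      unfolding W_def by (intro arg_cong[where f = frag_of] restrict_ext) (simp add: standard_simplexD(4) atLeast0AtMost)
    finally show ?thesis by simp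
  qed
  also have "(\<Sum>i\<le>p. \<Sum>k<i. D i k) = (\<Sum>(i, k)\<in>{(i, k). k < i \<and> i \<le> p}. D i k)"
    by (subst sum.Sigma) (auto intro!: sum.cong)
  also have "\<dots> = (\<Sum>(i, k)\<in>{(i, k). k \<le> i \<and> i < p}. - frag_cmul ((-1) ^ (i + k)) (T i k))"
  proof (rule sum.reindex_bij_witness[where i = "\<lambda>(i, k). (Suc i, k)" and j = "\<lambda>(i, k). (i - 1, k)"])
    fix a assume a: "a \<in> {(i, k). k < i \<and> i \<le> p}"
    obtain i k where ik: "a = (i, k)" by (cases a)
    with a obtain l where l: "i = Suc l" by (cases i) auto
    show "(case case a of (i, k) \<Rightarrow> (i - 1, k) of (i, k) \<Rightarrow> - frag_cmul ((- 1) ^ (i + k)) (T i k)) = (case a of (i, k) \<Rightarrow> D i k)"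
    proof -
      have kl: "k < i" "i \<le> p" "k \<le> Suc p" using a by (auto simp: ik)
      note f = singular_face_circle_simplex(1)[OF kl(3,2,1), of \<Phi> \<sigma>]
      show ?thesis unfolding ik prod.case D_def T_def f unfolding l by (simp only: diff_Suc_1 add_Suc power_Suc frag_cmul_neg mult_minus1)
    qed
  qed auto
  also have "(\<Sum>i\<le>p. \<Sum>k\<in>{i<..p}. D i (Suc k)) = (\<Sum>(i, k)\<in>{(i, k). i < k \<and> k \<le> p}. D i (Suc k))"
    by (subst sum.Sigma) (auto intro!: sum.cong)
  also have "\<dots> = (\<Sum>(i, k)\<in>{(i, k). i < k \<and> k \<le> p}. - frag_cmul ((-1) ^ (i + k)) (T i k))"
  proof (rule sum.cong[OF refl])
    fix a assume a: "a \<in> {(i, k). i < k \<and> k \<le> p}"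
    obtain i k where ik: "a = (i, k)" by (cases a)
    show "(case a of (i, k) \<Rightarrow> D i (Suc k)) = (case a of (i, k) \<Rightarrow> - frag_cmul ((- 1) ^ (i + k)) (T i k))"
    proof -
      have kl: "Suc i < Suc k" "i \<le> p" "Suc k \<le> Suc p" using a by (auto simp: ik)
      note f = singular_face_circle_simplex(2)[OF kl(3,2,1), of \<Phi> \<sigma>]
      show ?thesis unfolding ik prod.case D_def T_def f by (simp only: diff_Suc_1 add_Suc_right power_Suc frag_cmul_neg mult_minus1)
    qed
  qed
  also have "(\<Sum>(i, k)\<in>{(i, k). k \<le> i \<and> i < p}. - frag_cmul ((-1) ^ (i + k)) (T i k)) + 0 + \<dots> =
    (\<Sum>(i, k)\<in>{(i, k). k \<le> i \<and> i < p} \<union> {(i, k). i < k \<and> k \<le> p}. - frag_cmul ((-1) ^ (i + k)) (T i k))"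
  proof -
    have "finite {(i, k). k \<le> i \<and> i < p}" "finite {(i, k). i < k \<and> k \<le> p}"
      by (rule finite_subset[of _ "{..p} \<times> {..p}"]; auto)+
    moreover have "{(i, k). k \<le> i \<and> i < p} \<inter> {(i, k). i < k \<and> k \<le> p} = {}" by auto
    ultimately show ?thesis by (simp only: sum.union_disjoint add_0_right)
  qed
  also have "{(i, k). k \<le> i \<and> i < p} \<union> {(i, k). i < k \<and> k \<le> p} = {..<p} \<times> {..p}" by auto
  also have "(\<Sum>(i, k)\<in>{..<p} \<times> {..p}. - frag_cmul ((-1) ^ (i + k)) (T i k)) = - (\<Sum>k\<le>p. frag_cmul ((-1) ^ k) (\<Sum>i<p. frag_cmul ((-1) ^ i) (T i k)))"
    unfolding sum.cartesian_product[symmetric] sum_negf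
    by (subst sum.swap) (simp only: frag_cmul_sum frag_cmul_cmul power_add mult.commute o_def)
  also have "\<dots> = - circle_product (p - 1) \<Phi> (chain_boundary p (frag_of \<sigma>))"
  proof (cases p)
    case (Suc q)
    then show ?thesis
      by (simp add: circle_product_def chain_boundary_of frag_extend_sum frag_extend_cmul circle_prism_eq T_def lessThan_Suc_atMost o_def del: sum.atMost_Suc)
  qed (simp add: chain_boundary_def circle_product_def)
  finally show ?thesis .
qed

lemma chain_boundary_circle_product:
  "chain_boundary (Suc p) (circle_product p \<Phi> c) = - circle_product (p - 1) \<Phi> (chain_boundary p c)"
proof (induction c rule: frag_induction[OF subset_UNIV])
  case (3 a b)
  then show ?case by (simp add: circle_product_diff chain_boundary_diff)
qed (simp_all add: chain_boundary_circle_prism, simp_all add: circle_product_def chain_boundary_circle_prism)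

lemma continuous_on_degeneracy: "continuous_on S (degeneracy i)"
proof (rule continuous_on_coordinatewise_then_product)
  show "continuous_on S (\<lambda>t. degeneracy i t j)" for j
    unfolding degeneracy_def
    by (cases "j < i"; cases "j = i")
      (auto intro!: continuous_on_add continuous_on_subset[OF continuous_on_product_coordinates])
qed

lemma singular_chain_circle_product:
  assumes c: "singular_chain p (top_of_set K) c" and \<Phi>: "continuous_on (K \<times> sphere 0 1) (case_prod \<Phi>)"
    and Y: "\<And>x u. x \<in> K \<Longrightarrow> u \<in> sphere 0 1 \<Longrightarrow> \<Phi> x u \<in> Y"
  shows "singular_chain (Suc p) (top_of_set Y) (circle_product p \<Phi> c)"
  unfolding circle_product_def
proof (rule singular_chain_extend)
  fix \<sigma> assume "\<sigma> \<in> Poly_Mapping.keys c"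
  then have "singular_simplex p (top_of_set K) \<sigma>" using c by (auto simp: singular_chain_def)
  then have \<sigma>: "continuous_on (standard_simplex p) \<sigma>" "\<sigma> ` standard_simplex p \<subseteq> K"
    unfolding singular_simplex_top_of_set by blast+
  have "singular_simplex (Suc p) (top_of_set Y) (circle_simplex p \<Phi> \<sigma> i)" if i: "i \<le> p" for i
  proof -
    let ?S = "standard_simplex (Suc p)"
    let ?u = "\<lambda>t. cis (2 * pi * (\<Sum>j\<in>{i<..Suc p}. t j))"
    have 1: "continuous_on ?S (\<lambda>t. \<sigma> (degeneracy i t))"
      by (rule continuous_on_compose2[OF \<sigma>(1) continuous_on_degeneracy]) (use degeneracy_in[OF _ i] in auto)
    have 2: "continuous_on ?S ?u"
      by (intro continuous_intros continuous_on_subset[OF continuous_on_product_coordinates] subset_UNIV)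
    have 3: "\<sigma> (degeneracy i t) \<in> K" if "t \<in> ?S" for t using degeneracy_in[OF that i] \<sigma>(2) by auto
    have "continuous_on ?S (\<lambda>t. case_prod \<Phi> (\<sigma> (degeneracy i t), ?u t))"
      by (rule continuous_on_compose2[OF \<Phi> continuous_on_Pair[OF 1 2]]) (use 3 in auto)
    then have "continuous_on ?S (circle_simplex p \<Phi> \<sigma> i)"
      by (simp add: circle_simplex_def cong: continuous_on_cong)
    then show ?thesis
      using 3 Y by (auto simp: singular_simplex_top_of_set circle_simplex_def)
  qed
  then show "singular_chain (Suc p) (top_of_set Y) (circle_prism p \<Phi> \<sigma>)"
    unfolding circle_prism_eq by (intro singular_chain_sum singular_chain_cmul) (simp add: singular_chain_of)
qed

lemma circle_product_cycle:
  assumes c: "cycle p K c" and "continuous_on (K \<times> sphere 0 1) (case_prod \<Phi>)"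
    and "\<And>x u. x \<in> K \<Longrightarrow> u \<in> sphere 0 1 \<Longrightarrow> \<Phi> x u \<in> Y"
  shows "cycle (Suc p) Y (circle_product p \<Phi> c)"
  using assms singular_chain_circle_product[of p K c \<Phi> Y]
  by (auto simp: cycle_def singular_cycle chain_boundary_circle_product)

lemma circle_product_homologous:
  assumes c: "homologous_rel p (top_of_set K) {} c c'" and "continuous_on (K \<times> sphere 0 1) (case_prod \<Phi>)"
    and "\<And>x u. x \<in> K \<Longrightarrow> u \<in> sphere 0 1 \<Longrightarrow> \<Phi> x u \<in> Y"
  shows "homologous_rel (Suc p) (top_of_set Y) {} (circle_product p \<Phi> c) (circle_product p \<Phi> c')"
proof -
  obtain e where e: "singular_chain (Suc p) (top_of_set K) e" "chain_boundary (Suc p) e = c - c'"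
    using c by (auto simp: homologous_rel_def singular_boundary)
  have "singular_chain (Suc (Suc p)) (top_of_set Y) (circle_product (Suc p) \<Phi> e)"
    by (rule singular_chain_circle_product[OF e(1) assms(2,3)])
  moreover have "chain_boundary (Suc (Suc p)) (- circle_product (Suc p) \<Phi> e) = circle_product p \<Phi> c - circle_product p \<Phi> c'"
    by (simp add: chain_boundary_minus chain_boundary_circle_product e(2) circle_product_diff)
  ultimately show ?thesis
    unfolding homologous_rel_def singular_boundary by (metis singular_chain_minus)
qed

lemma circle_product_homotopic:
  fixes \<Psi> :: "real \<Rightarrow> 'a::topological_space \<Rightarrow> complex \<Rightarrow> 'b::topological_space"
  assumes c: "cycle p K c" and cont: "continuous_on ({0..1} \<times> (K \<times> sphere 0 1)) (\<lambda>(\<tau>, x, u). \<Psi> \<tau> x u)"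
    and Y: "\<And>\<tau> x u. \<tau> \<in> {0..1} \<Longrightarrow> x \<in> K \<Longrightarrow> u \<in> sphere 0 1 \<Longrightarrow> \<Psi> \<tau> x u \<in> Y"
  shows "homologous_rel (Suc p) (top_of_set Y) {} (circle_product p (\<Psi> 0) c) (circle_product p (\<Psi> 1) c)"
proof -
  have "homotopic_with (\<lambda>h. h \<in> {} \<rightarrow> {}) (top_of_set (K \<times> sphere 0 1)) (top_of_set Y) (case_prod (\<Psi> 0)) (case_prod (\<Psi> 1))"
    unfolding homotopic_with_def
  proof (intro exI[of _ "\<lambda>(\<tau>, x, u). \<Psi> \<tau> x u"] conjI)
    show "continuous_map (prod_topology (top_of_set {0..1}) (top_of_set (K \<times> sphere 0 1))) (top_of_set Y) (\<lambda>(\<tau>, x, u). \<Psi> \<tau> x u)"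
      using cont Y by (auto simp: prod_topology_subtopology_eu)
  qed auto
  moreover have "cycle (Suc p) (K \<times> sphere 0 1) (circle_product p Pair c)"
    by (rule circle_product_cycle[OF c]) (auto simp: case_prod_unfold intro!: continuous_intros)
  ultimately show ?thesis
    unfolding circle_product_alt[of p "\<Psi> 0"] circle_product_alt[of p "\<Psi> 1"] cycle_def
    by (rule homotopic_imp_homologous_rel_chain_maps)
qed

section \<open>Supports of chains\<close>

lemma compact_chain_support:
  fixes Y :: "'a::t2_space set"
  assumes "singular_chain p (top_of_set Y) c"
  shows "compact (chain_support p c)" "chain_support p c \<subseteq> Y"
proof -
  have "continuous_on (standard_simplex p) \<sigma>" "\<sigma> ` standard_simplex p \<subseteq> Y" if "\<sigma> \<in> Poly_Mapping.keys c" for \<sigma>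
  proof -
    have "singular_simplex p (top_of_set Y) \<sigma>" using assms that by (auto simp: singular_chain_def)
    then show "continuous_on (standard_simplex p) \<sigma>" "\<sigma> ` standard_simplex p \<subseteq> Y"
      unfolding singular_simplex_top_of_set by blast+
  qed
  then show "compact (chain_support p c)" "chain_support p c \<subseteq> Y"
    by (auto simp: chain_support_def intro!: compact_UN compact_continuous_image compact_standard_simplex)
qed

lemma singular_chain_on_support:
  fixes Y :: "'a::topological_space set"
  assumes c: "singular_chain p (top_of_set Y) c" and Y': "chain_support p c \<subseteq> Y'"
  shows "singular_chain p (top_of_set Y') c"
  unfolding singular_chain_def
proof
  fix \<sigma> assume \<sigma>: "\<sigma> \<in> Poly_Mapping.keys c"
  then have "singular_simplex p (top_of_set Y) \<sigma>" using c by (auto simp: singular_chain_def)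
  moreover have "\<sigma> ` standard_simplex p \<subseteq> Y'" using Y' \<sigma> by (auto simp: chain_support_def)
  ultimately show "\<sigma> \<in> singular_simplex_set p (top_of_set Y')" unfolding mem_Collect_eq singular_simplex_top_of_set by blast
qed

lemma cycle_on_support: "cycle p Y c \<Longrightarrow> chain_support p c \<subseteq> Y' \<Longrightarrow> cycle p Y' c"
  using singular_chain_on_support by (auto simp: cycle_def singular_cycle)

lemma homologous_rel_mono:
  assumes "homologous_rel p (top_of_set E) {} a b" "E \<subseteq> Y"
  shows "homologous_rel p (top_of_set Y) {} a b"
  using assms singular_chain_on_support[of "Suc p" E _ Y]
  by (auto simp: homologous_rel_def singular_boundary) (metis singular_chain_mono subtopology_UNIV)

text \<open>A homology involves finitely many simplices, so it takes place in a compact set; it thus survives small changes of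
  the ambient open set.\<close>

lemma homologous_on_compact:
  fixes Y :: "'a::t2_space set"
  assumes a: "singular_chain p (top_of_set Y) a" and b: "singular_chain p (top_of_set Y) b"
    and hom: "homologous_rel p (top_of_set Y) {} a b"
  obtains E where "compact E" "E \<subseteq> Y" "homologous_rel p (top_of_set E) {} a b" "chain_support p a \<subseteq> E" "chain_support p b \<subseteq> E"
proof -
  obtain e where e: "singular_chain (Suc p) (top_of_set Y) e" "chain_boundary (Suc p) e = a - b"
    using hom by (auto simp: homologous_rel_def singular_boundary)
  define E where "E = chain_support (Suc p) e \<union> chain_support p a \<union> chain_support p b"
  have "singular_chain (Suc p) (top_of_set E) e"
    by (rule singular_chain_on_support[OF e(1)]) (auto simp: E_def)
  then have "homologous_rel p (top_of_set E) {} a b"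
    using e(2) unfolding homologous_rel_def singular_boundary by blast
  moreover have "compact E" "E \<subseteq> Y"
    using compact_chain_support[OF e(1)] compact_chain_support[OF a] compact_chain_support[OF b] by (auto simp: E_def)
  ultimately show thesis using that[of E] by (auto simp: E_def)
qed

lemma chain_support_chain_map: "chain_support p (chain_map p h c) \<subseteq> h ` chain_support p c"
proof
  fix z assume "z \<in> chain_support p (chain_map p h c)"
  then obtain \<sigma> t where \<sigma>: "\<sigma> \<in> Poly_Mapping.keys (chain_map p h c)" and t: "t \<in> standard_simplex p" "z = \<sigma> t"
    by (auto simp: chain_support_def)
  obtain \<rho> where "\<rho> \<in> Poly_Mapping.keys c" "\<sigma> = simplex_map p h \<rho>"
    using \<sigma> keys_frag_extend[of "frag_of \<circ> simplex_map p h" c] by (auto simp: chain_map_def)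
  then show "z \<in> h ` chain_support p c" using t by (auto simp: simplex_map_def chain_support_def)
qed

lemma cycle_chain_map:
  assumes c: "cycle p Y c" and h: "continuous_on (chain_support p c) h" and Y': "h ` chain_support p c \<subseteq> Y'"
  shows "cycle p Y' (chain_map p h c)"
proof -
  have "cycle p (chain_support p c) c" using c by (rule cycle_on_support) simp
  moreover have "continuous_map (top_of_set (chain_support p c)) (top_of_set Y') h" using h Y' by auto
  ultimately show ?thesis
    by (auto simp: cycle_def singular_cycle singular_chain_chain_map chain_boundary_chain_map)
qed

lemma homology_class_eq_iff: "homology_class p Y a = homology_class p Y b \<longleftrightarrow> homologous_rel p (top_of_set Y) {} a b"
  by (simp add: homology_class_def homologous_rel_set_eq)

section \<open>Tubes around a family of hypersurfaces\<close>

lemma continuous_on_vsm [continuous_intros]: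
  fixes v :: "'a::topological_space \<Rightarrow> complex^'n"
  assumes "continuous_on S w" "continuous_on S v" shows "continuous_on S (\<lambda>x. w x *s v x)"
  unfolding vector_scalar_mult_def using assms by (intro continuous_intros)

lemma has_derivative_vsm_left: "((\<lambda>w. w *s v) has_derivative (\<lambda>h. h *s (v :: complex^'n))) (at w within S)"
proof -
  have "bounded_linear (\<lambda>w. w *s v)"
    unfolding linear_conv_bounded_linear[symmetric]
    by (auto simp: linear_iff vec_eq_iff algebra_simps)
  then show ?thesis by (rule bounded_linear_imp_has_derivative)
qed

definition tube :: "('a \<Rightarrow> complex^'n) \<Rightarrow> ('a \<Rightarrow> complex^'n) \<Rightarrow> real \<Rightarrow> 'a \<Rightarrow> complex \<Rightarrow> complex^'n" where
  "tube x v \<epsilon> = (\<lambda>l u. x l + (complex_of_real \<epsilon> * u) *s v l)"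

text \<open>A family of holomorphic functions of several variables on \<open>T0\<close>, with partial derivatives \<open>F'\<close>, depending
  continuously on a parameter.\<close>

locale holomorphic_family =
  fixes F :: "complex \<Rightarrow> complex^'n::{finite,linorder} \<Rightarrow> complex"
    and F' :: "'n \<Rightarrow> complex \<Rightarrow> complex^'n::_ \<Rightarrow> complex"
    and T0 :: "(complex^'n::_) set"
  assumes open_T0: "open T0"
    and F_deriv: "\<And>s x. x \<in> T0 \<Longrightarrow> (F s has_derivative (\<lambda>v. \<Sum>k\<in>UNIV. F' k s x * v $ k)) (at x)"
    and F_cont: "continuous_on (UNIV \<times> T0) (\<lambda>(s, x). F s x)"
    and F'_cont: "\<And>k. continuous_on (UNIV \<times> T0) (\<lambda>(s, x). F' k s x)"
begin

definition dF :: "complex \<Rightarrow> complex^'n::_ \<Rightarrow> complex^'n::_ \<Rightarrow> complex" where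
  "dF s x v = (\<Sum>k\<in>UNIV. F' k s x * v $ k)"

definition Z :: "complex \<Rightarrow> (complex^'n::_) set" where "Z s = {x \<in> T0. F s x = 0}"
definition X :: "complex \<Rightarrow> (complex^'n::_) set" where "X s = T0 - Z s"

lemma F_comp_cont:
  assumes "continuous_on S s" "continuous_on S x" "\<And>l. l \<in> S \<Longrightarrow> x l \<in> T0"
  shows "continuous_on S (\<lambda>l. F (s l) (x l))"
  using continuous_on_compose2[OF F_cont continuous_on_Pair[OF assms(1,2)]] assms(3) by auto

lemma F'_comp_cont:
  assumes "continuous_on S s" "continuous_on S x" "\<And>l. l \<in> S \<Longrightarrow> x l \<in> T0"
  shows "continuous_on S (\<lambda>l. F' k (s l) (x l))"
  using continuous_on_compose2[OF F'_cont continuous_on_Pair[OF assms(1,2)]] assms(3) by auto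

lemma F_line_deriv:
  assumes "x + w *s v \<in> T0"
  shows "((\<lambda>w. F s (x + w *s v)) has_field_derivative dF s (x + w *s v) v) (at w)"
proof -
  have "((\<lambda>w. x + w *s v) has_derivative (\<lambda>h. h *s v)) (at w)"
    using has_derivative_add[OF has_derivative_const has_derivative_vsm_left] by simp
  from has_derivative_compose[OF this F_deriv[OF assms]]
  show ?thesis unfolding has_field_derivative_def
    by (rule has_derivative_eq_rhs) (auto simp: dF_def sum_distrib_left sum_distrib_right mult_ac)
qed

lemma dF_convex: "dF s x ((1 - \<tau>) *\<^sub>R v + \<tau> *\<^sub>R w) = (1 - \<tau>) *\<^sub>R dF s x v + \<tau> *\<^sub>R dF s x w"
  by (simp add: dF_def sum.distrib scaleR_sum_right distrib_left)

lemma open_X: "open (X s)"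
proof -
  have "continuous_on T0 (F s)" by (rule F_comp_cont) (auto intro!: continuous_intros)
  then have "open (T0 \<inter> F s -` (- {0}))" using open_T0 by (intro continuous_open_preimage) auto
  moreover have "T0 \<inter> F s -` (- {0}) = X s" by (auto simp: X_def Z_def)
  ultimately show ?thesis by simp
qed

text \<open>Along a transversal line F has nonzero derivative at its zero x, so x is an isolated zero on it; compactness makes
  the radius uniform.\<close>

lemma uniform_radius:
  assumes M: "compact M" and M_in: "\<And>s x v. (s, x, v) \<in> M \<Longrightarrow> x \<in> Z s \<and> dF s x v = 1"
  obtains \<eta> where "0 < \<eta>" "\<And>s x v (w::complex). (s, x, v) \<in> M \<Longrightarrow> 0 < norm w \<Longrightarrow> norm w \<le> \<eta> \<Longrightarrow> x + w *s v \<in> X s"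
proof -
  define O1 where "O1 = {((s :: complex, x, v), w). x + w *s v \<in> T0}"
  define \<phi> where "\<phi> = (\<lambda>((s, x, v), w). dF s (x + w *s v) v)"
  have O1: "O1 = (\<lambda>((s, x, v), w). x + w *s v) -` T0" by (auto simp: O1_def)
  have c: "continuous_on UNIV (\<lambda>((s :: complex, x, v), w). x + w *s v :: complex^'n::_)"
    unfolding case_prod_unfold by (intro continuous_intros)
  have oO1: "open O1" unfolding O1 by (rule open_vimage[OF open_T0 c])
  have \<phi>c: "continuous_on O1 \<phi>"
    unfolding \<phi>_def dF_def case_prod_unfold
    by (intro continuous_intros F'_comp_cont) (auto simp: O1_def)
  define O2 where "O2 = O1 \<inter> \<phi> -` ball 1 (1 / 2)"
  have oO2: "open O2" unfolding O2_def by (intro continuous_open_preimage[OF \<phi>c oO1]) auto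
  have "M \<times> {0} \<subseteq> O2"
    using M_in by (force simp: O2_def O1_def \<phi>_def Z_def)
  moreover have "compact (M \<times> {0 :: complex})" using M by (intro compact_Times) auto
  ultimately obtain \<eta> where \<eta>: "0 < \<eta>" "(\<Union>z\<in>M \<times> {0}. cball z \<eta>) \<subseteq> O2"
    using compact_subset_open_imp_cball_epsilon_subset[OF _ oO2] by metis
  have in_O2: "((s, x, v), w) \<in> O2" if "(s, x, v) \<in> M" "norm w \<le> \<eta>" for s x v w
  proof -
    have "((s, x, v), w) \<in> cball ((s, x, v), 0) \<eta>" using that by (simp add: dist_Pair_Pair)
    then show ?thesis using \<eta>(2) that(1) by blast
  qed
  show thesis
  proof (rule that[OF \<eta>(1)])
    fix s x v and w :: complex assume m: "(s, x, v) \<in> M" and w: "0 < norm w" "norm w \<le> \<eta>"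
    have T: "x + w' *s v \<in> T0" "norm (dF s (x + w' *s v) v - 1) \<le> 1 / 2" if "norm w' \<le> \<eta>" for w'
      using in_O2[OF m that] by (auto simp: O2_def O1_def \<phi>_def dist_norm norm_minus_commute)
    have "norm ((F s (x + w *s v) - w) - (F s (x + 0 *s v) - 0)) \<le> 1 / 2 * norm (w - 0)"
    proof (rule field_differentiable_bound[of "cball 0 \<eta>" "\<lambda>w. F s (x + w *s v) - w" "\<lambda>w. dF s (x + w *s v) v - 1"])
      fix w' :: complex assume w': "w' \<in> cball 0 \<eta>"
      then have n: "norm w' \<le> \<eta>" by simp
      show "((\<lambda>w. F s (x + w *s v) - w) has_field_derivative dF s (x + w' *s v) v - 1) (at w' within cball 0 \<eta>)"
        using DERIV_diff[OF F_line_deriv[OF T(1)[OF n], of s] DERIV_ident]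
        by (rule has_field_derivative_at_within)
      show "norm (dF s (x + w' *s v) v - 1) \<le> 1 / 2" by (rule T(2)[OF n])
    qed (use w \<eta>(1) in auto)
    moreover have "F s (x + 0 *s v) = 0" using M_in[OF m] by (simp add: Z_def)
    ultimately have "norm (F s (x + w *s v) - w) \<le> 1 / 2 * norm w" by simp
    then have "F s (x + w *s v) \<noteq> 0" using w by auto
    then show "x + w *s v \<in> X s" using T(1)[OF w(2)] by (auto simp: X_def Z_def)
  qed
qed

text \<open>The data of a tube over K: a field transversal to the hypersurface and a radius at which the punctured discs avoid it.\<close>

definition admissible :: "complex \<Rightarrow> (complex^'n::_) set \<Rightarrow> (complex^'n::_ \<Rightarrow> complex^'n::_) \<Rightarrow> real \<Rightarrow> bool" where
  "admissible s K v \<epsilon> \<longleftrightarrow> continuous_on K v \<and> (\<forall>x\<in>K. dF s x (v x) = 1) \<and> 0 < \<epsilon> \<and>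
     (\<forall>x\<in>K. \<forall>w. 0 < norm w \<and> norm w \<le> \<epsilon> \<longrightarrow> x + w *s v x \<in> X s)"

lemma admissible_subset: "admissible s K v \<epsilon> \<Longrightarrow> K' \<subseteq> K \<Longrightarrow> admissible s K' v \<epsilon>"
  unfolding admissible_def by (meson continuous_on_subset subsetD)

text \<open>The radius can be shrunk linearly, as the punctured discs avoid the hypersurface.\<close>

lemma tube_shrink:
  assumes c: "cycle p K c" and adm: "admissible s K v \<epsilon>" and \<rho>: "0 < \<rho>" "\<rho> \<le> \<epsilon>"
  shows "homologous_rel (Suc p) (top_of_set (X s)) {} (circle_product p (tube id v \<epsilon>) c) (circle_product p (tube id v \<rho>) c)"
proof -
  let ?r = "\<lambda>\<tau>. (1 - \<tau>) * \<epsilon> + \<tau> * \<rho>"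
  have v: "continuous_on K v" using adm by (simp add: admissible_def)
  have "homologous_rel (Suc p) (top_of_set (X s)) {} (circle_product p (tube id v (?r 0)) c) (circle_product p (tube id v (?r 1)) c)"
  proof (rule circle_product_homotopic[OF c])
    show "continuous_on ({0..1} \<times> (K \<times> sphere 0 1)) (\<lambda>(\<tau>, x, u). tube id v (?r \<tau>) x u)"
      unfolding tube_def case_prod_unfold id_def
      by (intro continuous_intros continuous_on_compose2[OF v]) auto
    fix \<tau> :: real and x u assume *: "\<tau> \<in> {0..1}" "x \<in> K" "u \<in> sphere (0::complex) 1"
    have "?r \<tau> \<le> (1 - \<tau>) * \<epsilon> + \<tau> * \<epsilon>" using * \<rho> by (intro add_left_mono mult_left_mono) auto
    then have "?r \<tau> \<le> \<epsilon>" by (simp add: algebra_simps)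
    moreover have "\<rho> \<le> ?r \<tau>"
    proof -
      have "(1 - \<tau>) * \<rho> \<le> (1 - \<tau>) * \<epsilon>" using * \<rho> by (intro mult_left_mono) auto
      then show ?thesis by (simp add: algebra_simps)
    qed
    ultimately have "0 < norm (complex_of_real (?r \<tau>) * u)" "norm (complex_of_real (?r \<tau>) * u) \<le> \<epsilon>"
      using * \<rho>(1) by (simp_all only: norm_mult norm_of_real) auto
    then show "tube id v (?r \<tau>) x u \<in> X s"
      using adm *(2) unfolding admissible_def tube_def id_def by blast
  qed
  then show ?thesis by simp
qed

text \<open>The condition \<open>dF(v) = 1\<close> is convex in v. So two fields are joined by a segment of fields with a common small
  radius, and the tubes are homotopic.\<close>

lemma tube_independent:
  assumes c: "cycle p K c" and K: "compact K" "K \<subseteq> Z s"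
    and v: "admissible s K v \<epsilon>" and v': "admissible s K v' \<epsilon>'"
  shows "homologous_rel (Suc p) (top_of_set (X s)) {} (circle_product p (tube id v \<epsilon>) c) (circle_product p (tube id v' \<epsilon>') c)"
proof -
  have cv: "continuous_on K v" "continuous_on K v'" using v v' by (auto simp: admissible_def)
  let ?v = "\<lambda>\<tau> x. (1 - \<tau>) *\<^sub>R v x + \<tau> *\<^sub>R v' x"
  define M where "M = (\<lambda>(\<tau>, x). (s, x, ?v \<tau> x)) ` ({0..1::real} \<times> K)"
  have "compact M"
    unfolding M_def case_prod_unfold
    by (intro compact_continuous_image compact_Times compact_Icc K continuous_intros continuous_on_compose2[OF cv(1)] continuous_on_compose2[OF cv(2)]) auto
  moreover have "x \<in> Z s' \<and> dF s' x w = 1" if "(s', x, w) \<in> M" for s' x w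
    using that K v v' by (auto simp: M_def admissible_def dF_convex simp flip: scaleR_add_left)
  ultimately obtain \<eta> where \<eta>: "0 < \<eta>" "\<And>s' x w' w. (s', x, w') \<in> M \<Longrightarrow> 0 < norm w \<Longrightarrow> norm w \<le> \<eta> \<Longrightarrow> x + w *s w' \<in> X s'"
    using uniform_radius[of M] by metis
  define \<rho> where "\<rho> = min \<eta> (min \<epsilon> \<epsilon>')"
  have \<rho>: "0 < \<rho>" "\<rho> \<le> \<eta>" "\<rho> \<le> \<epsilon>" "\<rho> \<le> \<epsilon>'" using \<eta>(1) v v' by (auto simp: \<rho>_def admissible_def)
  have "homologous_rel (Suc p) (top_of_set (X s)) {} (circle_product p (tube id (?v 0) \<rho>) c) (circle_product p (tube id (?v 1) \<rho>) c)"
  proof (rule circle_product_homotopic[OF c])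
    show "continuous_on ({0..1} \<times> (K \<times> sphere 0 1)) (\<lambda>(\<tau>, x, u). tube id (?v \<tau>) \<rho> x u)"
      unfolding tube_def case_prod_unfold id_def
      by (intro continuous_intros continuous_on_compose2[OF cv(1)] continuous_on_compose2[OF cv(2)]) auto
    fix \<tau> :: real and x u assume *: "\<tau> \<in> {0..1}" "x \<in> K" "u \<in> sphere (0::complex) 1"
    have "(s, x, ?v \<tau> x) \<in> M" using * by (auto simp: M_def)
    from \<eta>(2)[OF this, of "complex_of_real \<rho> * u"] show "tube id (?v \<tau>) \<rho> x u \<in> X s"
      using * \<rho> by (simp add: tube_def norm_mult)
  qed
  then have "homologous_rel (Suc p) (top_of_set (X s)) {} (circle_product p (tube id v \<rho>) c) (circle_product p (tube id v' \<rho>) c)"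
    by simp
  then show ?thesis
    by (rule homologous_rel_trans[OF tube_shrink[OF c v' \<rho>(1,4), unfolded homologous_rel_sym[of _ _ _ "circle_product p (tube id v' \<epsilon>') c"]]
          homologous_rel_trans[OF _ tube_shrink[OF c v \<rho>(1,3)]]])
qed

text \<open>The gradient of F, scaled so that \<open>dF\<close> takes the value 1 on it. Unlike an arbitrary transversal field it depends
  continuously on the parameter too.\<close>

definition normal_field :: "complex \<Rightarrow> complex^'n::_ \<Rightarrow> complex^'n::_" where
  "normal_field s x = (\<chi> k. cnj (F' k s x) / (\<Sum>l\<in>UNIV. F' l s x * cnj (F' l s x)))"

lemma sum_norm_eq_0: "(\<Sum>l\<in>UNIV. F' l s x * cnj (F' l s x)) = 0 \<longleftrightarrow> (\<forall>k. F' k s x = 0)"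
proof -
  have "(\<Sum>l\<in>UNIV. F' l s x * cnj (F' l s x)) = complex_of_real (\<Sum>l\<in>UNIV. (norm (F' l s x))\<^sup>2)"
    by (simp only: of_real_sum complex_norm_square)
  also have "\<dots> = 0 \<longleftrightarrow> (\<forall>k. F' k s x = 0)"
    by (simp only: of_real_eq_0_iff) (auto simp: sum_nonneg_eq_0_iff)
  finally show ?thesis .
qed

lemma dF_normal_field: "\<exists>k. F' k s x \<noteq> 0 \<Longrightarrow> dF s x (normal_field s x) = 1"
  using sum_norm_eq_0[of s x] by (simp add: dF_def normal_field_def flip: sum_divide_distrib)

lemma normal_field_cont:
  assumes "continuous_on S s" "continuous_on S x" "\<And>l. l \<in> S \<Longrightarrow> x l \<in> T0" "\<And>l. l \<in> S \<Longrightarrow> \<exists>k. F' k (s l) (x l) \<noteq> 0"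
  shows "continuous_on S (\<lambda>l. normal_field (s l) (x l))"
proof -
  have "(\<Sum>m\<in>UNIV. F' m (s l) (x l) * cnj (F' m (s l) (x l))) \<noteq> 0" if "l \<in> S" for l
    using assms(4)[OF that] sum_norm_eq_0[of "s l" "x l"] by auto
  then show ?thesis unfolding normal_field_def
    by (intro continuous_intros F'_comp_cont assms) auto
qed

lemma uniform_normal_radius:
  assumes M: "compact M" and M_in: "\<And>s x. (s, x) \<in> M \<Longrightarrow> x \<in> Z s \<and> (\<exists>k. F' k s x \<noteq> 0)"
  obtains \<eta> where "0 < \<eta>" "\<And>s x (w::complex). (s, x) \<in> M \<Longrightarrow> 0 < norm w \<Longrightarrow> norm w \<le> \<eta> \<Longrightarrow> x + w *s normal_field s x \<in> X s"
proof -
  define M' where "M' = (\<lambda>(s, x). (s, x, normal_field s x)) ` M"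
  have "compact M'"
    unfolding M'_def case_prod_unfold
    by (intro compact_continuous_image M continuous_intros normal_field_cont) (use M_in in \<open>auto simp: Z_def\<close>)
  moreover have "x \<in> Z s \<and> dF s x v = 1" if "(s, x, v) \<in> M'" for s x v
    using that M_in dF_normal_field by (auto simp: M'_def)
  ultimately obtain \<eta> where \<eta>: "0 < \<eta>" "\<And>s x v w. (s, x, v) \<in> M' \<Longrightarrow> 0 < norm w \<Longrightarrow> norm w \<le> \<eta> \<Longrightarrow> x + w *s v \<in> X s"
    using uniform_radius[of M'] by metis
  show thesis
  proof (rule that[OF \<eta>(1)])
    fix s x and w :: complex assume "(s, x) \<in> M" "0 < norm w" "norm w \<le> \<eta>"
    then show "x + w *s normal_field s x \<in> X s" by (intro \<eta>(2)) (auto simp: M'_def)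
  qed
qed

lemma eventually_avoids:
  assumes E: "compact E" "E \<subseteq> X s0"
  shows "\<forall>\<^sub>F s in nhds s0. E \<subseteq> X s"
proof -
  have sub: "E \<subseteq> T0" using E by (auto simp: X_def)
  define W where "W = (UNIV \<times> T0) \<inter> (\<lambda>(s, x). F s x) -` (- {0})"
  have "open W" unfolding W_def using open_T0 by (intro continuous_open_preimage F_cont open_Times) auto
  moreover have "{s0} \<times> E \<subseteq> W" using E by (auto simp: W_def X_def Z_def)
  moreover have "compact ({s0} \<times> E)" using E by (intro compact_Times) auto
  ultimately obtain r where r: "0 < r" "(\<Union>z\<in>{s0} \<times> E. ball z r) \<subseteq> W"
    using compact_subset_open_imp_ball_epsilon_subset by metis
  have "E \<subseteq> X s" if "dist s s0 < r" for s
  proof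
    fix x assume x: "x \<in> E"
    have "(s, x) \<in> ball (s0, x) r" using that by (simp add: dist_Pair_Pair dist_commute)
    then have "(s, x) \<in> W" using r(2) x by blast
    then show "x \<in> X s" using sub x by (auto simp: W_def X_def Z_def)
  qed
  then show ?thesis using r(1) by (auto simp: eventually_nhds_metric)
qed

text \<open>Locally the cycle is moved by a continuous family of maps. All tubes may be built with the normal field and one small
  radius, by independence of the choices. The tube over the moved cycle is then homotopic to the tube at \<open>s0\<close>, and for
  nearby parameters the homotopy avoids all hypersurfaces involved.\<close>

proposition tube_locally_constant:
  assumes U: "open U" and nonsing: "\<And>s x. s \<in> U \<Longrightarrow> x \<in> Z s \<Longrightarrow> \<exists>k. F' k s x \<noteq> 0"
    and hor: "horizontal_family p U Z \<delta>"
    and tub: "\<And>s. s \<in> U \<Longrightarrow> \<exists>c v \<epsilon>. cycle p (Z s) c \<and> \<delta> s = homology_class p (Z s) c \<and>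
       admissible s (chain_support p c) v \<epsilon> \<and> t\<delta> s = homology_class (Suc p) (X s) (circle_product p (tube id v \<epsilon>) c)"
    and s0: "s0 \<in> U"
  obtains r T where "0 < r" "ball s0 r \<subseteq> U" "\<And>s. s \<in> ball s0 r \<Longrightarrow> cycle (Suc p) (X s) T \<and> t\<delta> s = homology_class (Suc p) (X s) T"
proof -
  obtain V c H where V: "open V" "s0 \<in> V" "V \<subseteq> U" and c: "cycle p (Z s0) c"
    and Hc: "continuous_on (V \<times> chain_support p c) (\<lambda>(s, x). H s x)"
    and H0: "\<And>x. x \<in> chain_support p c \<Longrightarrow> H s0 x = x"
    and HZ: "\<And>s. s \<in> V \<Longrightarrow> H s ` chain_support p c \<subseteq> Z s"
    and \<delta>: "\<And>s. s \<in> V \<Longrightarrow> \<delta> s = homology_class p (Z s) (chain_map p (H s) c)"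
    using hor s0 unfolding horizontal_family_def by metis
  define K where "K = chain_support p c"
  have K: "compact K" "cycle p K c"
    using c compact_chain_support[of p "Z s0" c] cycle_on_support[OF c] by (auto simp: K_def cycle_def singular_cycle)
  obtain r where r: "0 < r" "cball s0 r \<subseteq> V" using V open_contains_cball by metis
  let ?B = "cball s0 r"
  have H_cont: "continuous_on S (\<lambda>l. H (s l) (x l))"
    if "continuous_on S s" "continuous_on S x" "\<And>l. l \<in> S \<Longrightarrow> s l \<in> ?B" "\<And>l. l \<in> S \<Longrightarrow> x l \<in> K" for S :: "'l::topological_space set" and s x
  proof -
    have "s l \<in> V \<and> x l \<in> chain_support p c" if "l \<in> S" for l
      using \<open>\<And>l. l \<in> S \<Longrightarrow> s l \<in> ?B\<close>[OF that] \<open>\<And>l. l \<in> S \<Longrightarrow> x l \<in> K\<close>[OF that] r(2) by (auto simp: K_def)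
    then have "(\<lambda>l. (s l, x l)) ` S \<subseteq> V \<times> chain_support p c" by auto
    from continuous_on_compose2[OF Hc continuous_on_Pair[OF that(1,2)] this] show ?thesis by simp
  qed
  have HZ': "H s x \<in> Z s" "H s x \<in> T0" "\<exists>k. F' k s (H s x) \<noteq> 0" if "s \<in> ?B" "x \<in> K" for s x
  proof -
    have sV: "s \<in> V" using r(2) that(1) by blast
    show 1: "H s x \<in> Z s" using HZ[OF sV] that(2) by (auto simp: K_def)
    then show "H s x \<in> T0" by (simp add: Z_def)
    show "\<exists>k. F' k s (H s x) \<noteq> 0" using nonsing 1 sV V(3) by blast
  qed
  define M where "M = (\<lambda>(s, x). (s, H s x)) ` (?B \<times> K)"
  have "compact M"
    unfolding M_def case_prod_unfold
    by (intro compact_continuous_image compact_Times compact_cball K continuous_intros H_cont) auto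
  moreover have "x \<in> Z s \<and> (\<exists>k. F' k s x \<noteq> 0)" if "(s, x) \<in> M" for s x
    using that HZ' by (auto simp: M_def)
  ultimately obtain \<eta> where \<eta>: "0 < \<eta>" "\<And>s x (w::complex). (s, x) \<in> M \<Longrightarrow> 0 < norm w \<Longrightarrow> norm w \<le> \<eta> \<Longrightarrow> x + w *s normal_field s x \<in> X s"
    by (rule uniform_normal_radius) blast+
  define \<Phi> where "\<Phi> s = tube (H s) (\<lambda>x. normal_field s (H s x)) \<eta>" for s
  have \<Phi>_in: "\<Phi> s x u \<in> X s" if "s \<in> ?B" "x \<in> K" "u \<in> sphere 0 1" for s x u
  proof -
    have "(s, H s x) \<in> M" using that by (force simp: M_def)
    from \<eta>(2)[OF this, of "complex_of_real \<eta> * u"] show ?thesis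
      using \<eta>(1) that(3) by (simp add: \<Phi>_def tube_def norm_mult)
  qed
  have \<Phi>_cont: "continuous_on S (\<lambda>l. \<Phi> (s l) (x l) (u l))"
    if "continuous_on S s" "continuous_on S x" "continuous_on S u" "\<And>l. l \<in> S \<Longrightarrow> s l \<in> ?B" "\<And>l. l \<in> S \<Longrightarrow> x l \<in> K"
    for S :: "'l::topological_space set" and s x u
    unfolding \<Phi>_def tube_def
    by (intro continuous_intros H_cont normal_field_cont that) (use that HZ' in auto)
  define T where "T s = circle_product p (\<Phi> s) c" for s
  have 1: "t\<delta> s = homology_class (Suc p) (X s) (T s)" if s: "s \<in> ?B" for s
  proof -
    have sV: "s \<in> V" "s \<in> U" using s r(2) V(3) by auto
    obtain c1 v1 \<epsilon>1 where c1: "cycle p (Z s) c1" "\<delta> s = homology_class p (Z s) c1" "admissible s (chain_support p c1) v1 \<epsilon>1"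
        "t\<delta> s = homology_class (Suc p) (X s) (circle_product p (tube id v1 \<epsilon>1) c1)"
      using tub[OF sV(2)] by blast
    define c2 where "c2 = chain_map p (H s) c"
    have Hs: "continuous_on K (H s)" by (rule H_cont[of K "\<lambda>_. s" "\<lambda>x. x"]) (use s in \<open>auto intro!: continuous_intros\<close>)
    have c2: "cycle p (Z s) c2"
      unfolding c2_def by (rule cycle_chain_map[OF K(2)]) (use Hs HZ sV in \<open>auto simp: K_def\<close>)
    have ch: "singular_chain p (top_of_set (Z s)) c1" "singular_chain p (top_of_set (Z s)) c2"
      using c1(1) c2 by (auto simp: cycle_def singular_cycle)
    have "homologous_rel p (top_of_set (Z s)) {} c1 c2"
      using c1(2) \<delta>[OF sV(1)] by (metis c2_def homology_class_eq_iff)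
    then obtain E where E: "compact E" "E \<subseteq> Z s" "homologous_rel p (top_of_set E) {} c1 c2" "chain_support p c1 \<subseteq> E" "chain_support p c2 \<subseteq> E"
      by (rule homologous_on_compact[OF ch])
    have En: "x \<in> Z s" "\<exists>k. F' k s x \<noteq> 0" if "x \<in> E" for x using that E(2) nonsing[OF sV(2)] by auto
    have "compact ({s} \<times> E)" using E(1) by (intro compact_Times) auto
    then obtain \<eta>2 where \<eta>2: "0 < \<eta>2" "\<And>s' x w. (s', x) \<in> {s} \<times> E \<Longrightarrow> 0 < norm w \<Longrightarrow> norm w \<le> \<eta>2 \<Longrightarrow> x + w *s normal_field s' x \<in> X s'"
      using uniform_normal_radius[of "{s} \<times> E"] En by blast
    have nf: "continuous_on E (normal_field s)"
      by (rule normal_field_cont) (use En in \<open>auto simp: Z_def intro!: continuous_intros\<close>)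
    have adE: "admissible s E (normal_field s) \<eta>2"
      using nf \<eta>2 dF_normal_field En by (auto simp: admissible_def)
    have supp2: "chain_support p c2 \<subseteq> H s ` K" unfolding c2_def K_def by (rule chain_support_chain_map)
    have ad2: "admissible s (chain_support p c2) (normal_field s) \<eta>"
      unfolding admissible_def
    proof (intro conjI ballI allI impI)
      show "continuous_on (chain_support p c2) (normal_field s)" using nf E(5) by (rule continuous_on_subset)
      fix x assume x: "x \<in> chain_support p c2"
      show "dF s x (normal_field s x) = 1" using x E(5) En dF_normal_field by blast
      obtain y where "y \<in> K" "x = H s y" using x supp2 by auto
      then have "(s, x) \<in> M" using s by (force simp: M_def)
      then show "x + w *s normal_field s x \<in> X s" if "0 < norm w \<and> norm w \<le> \<eta>" for w
        using \<eta>(2) that by blast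
    qed (rule \<eta>(1))
    have "homologous_rel (Suc p) (top_of_set (X s)) {} (circle_product p (tube id v1 \<epsilon>1) c1) (circle_product p (tube id (normal_field s) \<eta>2) c1)"
      by (rule tube_independent[OF cycle_on_support[OF c1(1) order_refl] _ _ c1(3) admissible_subset[OF adE E(4)]])
        (use compact_chain_support[OF ch(1)] in auto)
    moreover have "homologous_rel (Suc p) (top_of_set (X s)) {} (circle_product p (tube id (normal_field s) \<eta>2) c1) (circle_product p (tube id (normal_field s) \<eta>2) c2)"
    proof (rule circle_product_homologous[OF E(3)])
      show "continuous_on (E \<times> sphere 0 1) (case_prod (tube id (normal_field s) \<eta>2))"
        unfolding tube_def case_prod_unfold id_def by (intro continuous_intros continuous_on_compose2[OF nf]) auto
      show "tube id (normal_field s) \<eta>2 x u \<in> X s" if "x \<in> E" "u \<in> sphere 0 1" for x u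
      proof -
        have "norm (complex_of_real \<eta>2 * u) = \<eta>2" using that(2) \<eta>2(1) by (simp add: norm_mult)
        then have "0 < norm (complex_of_real \<eta>2 * u) \<and> norm (complex_of_real \<eta>2 * u) \<le> \<eta>2" using \<eta>2(1) by simp
        then show ?thesis using adE that(1) unfolding admissible_def tube_def id_def by blast
      qed
    qed
    moreover have "homologous_rel (Suc p) (top_of_set (X s)) {} (circle_product p (tube id (normal_field s) \<eta>2) c2) (circle_product p (tube id (normal_field s) \<eta>) c2)"
      by (rule tube_independent[OF cycle_on_support[OF c2 order_refl] _ _ admissible_subset[OF adE E(5)] ad2])
        (use compact_chain_support[OF ch(2)] in auto)
    moreover have "circle_product p (tube id (normal_field s) \<eta>) c2 = T s"
      unfolding c2_def circle_product_chain_map T_def \<Phi>_def by (simp add: tube_def)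
    ultimately show ?thesis
      unfolding c1(4) homology_class_eq_iff by (simp only:) (blast intro: homologous_rel_trans)
  qed
  have "\<exists>r'>0. r' \<le> r \<and> (\<forall>s\<in>cball s0 r'. \<forall>s'\<in>cball s0 r'. \<forall>x\<in>K. \<forall>u\<in>sphere 0 1. \<Phi> s' x u \<in> X s)"
  proof -
    define g where "g = (\<lambda>(s, s', x, u). F s (\<Phi> s' x u))"
    let ?D = "?B \<times> ?B \<times> K \<times> sphere (0::complex) 1"
    have D: "compact ?D" by (intro compact_Times compact_cball compact_sphere K)
    have T0: "\<Phi> s x u \<in> T0" if "s \<in> ?B" "x \<in> K" "u \<in> sphere 0 1" for s x u
      using \<Phi>_in[OF that] by (simp add: X_def)
    have gc: "continuous_on ?D g"
      unfolding g_def case_prod_unfold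
      by (intro F_comp_cont \<Phi>_cont continuous_intros) (auto intro!: T0)
    then have uc: "uniformly_continuous_on ?D g" using D by (rule compact_uniformly_continuous)
    let ?E = "{s0} \<times> {s0} \<times> K \<times> sphere (0::complex) 1"
    have s0B: "s0 \<in> ?B" using r(1) by simp
    have "compact (g ` ?E)"
      by (intro compact_continuous_image continuous_on_subset[OF gc] compact_Times compact_sphere K) (use s0B in auto)
    moreover have "0 \<notin> g ` ?E" using \<Phi>_in[OF s0B] by (auto simp: g_def X_def Z_def)
    ultimately have "\<exists>m>0. \<forall>y\<in>g ` ?E. m \<le> dist 0 y"
      by (intro separate_point_closed compact_imp_closed)
    then obtain m where m: "0 < m" "\<forall>y\<in>g ` ?E. m \<le> dist 0 y" by (elim exE conjE)
    have "\<exists>d>0. \<forall>a\<in>?D. \<forall>b\<in>?D. dist b a < d \<longrightarrow> dist (g b) (g a) < m"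
      by (rule mp[OF spec[OF uc[unfolded uniformly_continuous_on_def]] m(1)])
    then obtain d where d: "0 < d" "\<forall>a\<in>?D. \<forall>b\<in>?D. dist b a < d \<longrightarrow> dist (g b) (g a) < m" by (elim exE conjE)
    define r' where "r' = min r (d / 3)"
    have r': "0 < r'" "r' \<le> r" "r' \<le> d / 3" using r(1) d(1) by (auto simp: r'_def)
    show ?thesis
    proof (intro exI[of _ r'] conjI ballI r')
      fix s s' x u assume *: "s \<in> cball s0 r'" "s' \<in> cball s0 r'" "x \<in> K" "u \<in> sphere (0::complex) 1"
      have sB: "s \<in> ?B" "s' \<in> ?B" using * r' by auto
      have "dist (s, s', x, u) (s0, s0, x, u) \<le> dist s s0 + dist s' s0"
        by (simp add: dist_Pair_Pair sqrt_sum_squares_le_sum)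
      also have "\<dots> < d" using * r' d(1) by (auto simp: dist_commute)
      finally have "dist (g (s, s', x, u)) (g (s0, s0, x, u)) < m"
        by (intro mp[OF bspec[OF bspec[OF d(2)]]]) (use * sB s0B in simp_all)
      moreover have "m \<le> dist 0 (g (s0, s0, x, u))" by (rule bspec[OF m(2)]) (use * in auto)
      ultimately have "g (s, s', x, u) \<noteq> 0" by auto
      then show "\<Phi> s' x u \<in> X s" using T0[OF sB(2) *(3,4)] by (auto simp: g_def X_def Z_def)
    qed
  qed
  then obtain r' where r': "0 < r'" "r' \<le> r" "\<And>s s' x u. s \<in> cball s0 r' \<Longrightarrow> s' \<in> cball s0 r' \<Longrightarrow> x \<in> K \<Longrightarrow> u \<in> sphere 0 1 \<Longrightarrow> \<Phi> s' x u \<in> X s"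
    by metis
  have s0': "s0 \<in> cball s0 r'" using r' by simp
  have main: "cycle (Suc p) (X s) (T s0) \<and> t\<delta> s = homology_class (Suc p) (X s) (T s0)" if s: "s \<in> cball s0 r'" for s
  proof
    have sB: "s \<in> ?B" using s r' by auto
    show "cycle (Suc p) (X s) (T s0)"
      unfolding T_def
    proof (rule circle_product_cycle[OF K(2)])
      show "continuous_on (K \<times> sphere 0 1) (case_prod (\<Phi> s0))"
        unfolding case_prod_unfold by (intro \<Phi>_cont continuous_intros) (use r in auto)
    qed (rule r'(3)[OF s s0'])
    let ?s = "\<lambda>\<tau>. s0 + \<tau> *\<^sub>R (s - s0)"
    have in': "?s \<tau> \<in> cball s0 r'" if "\<tau> \<in> {0..1}" for \<tau>
    proof -
      have "\<tau> * norm (s - s0) \<le> 1 * norm (s - s0)" using that by (intro mult_right_mono) auto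
      then show ?thesis using s that by (auto simp: dist_norm norm_minus_commute)
    qed
    have "homologous_rel (Suc p) (top_of_set (X s)) {} (circle_product p (\<Phi> (?s 0)) c) (circle_product p (\<Phi> (?s 1)) c)"
    proof (rule circle_product_homotopic[OF K(2)])
      show "continuous_on ({0..1} \<times> (K \<times> sphere 0 1)) (\<lambda>(\<tau>, x, u). \<Phi> (?s \<tau>) x u)"
        unfolding case_prod_unfold
      proof (intro \<Phi>_cont continuous_intros)
        fix l :: "real \<times> (complex^'n::_) \<times> complex" assume "l \<in> {0..1} \<times> K \<times> sphere 0 1"
        then show "?s (fst l) \<in> ?B" "fst (snd l) \<in> K" using in'[of "fst l"] r'(2) by auto
      qed
      show "\<Phi> (?s \<tau>) x u \<in> X s" if "\<tau> \<in> {0..1}" "x \<in> K" "u \<in> sphere 0 1" for \<tau> x u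
        by (rule r'(3)[OF s in'[OF that(1)] that(2,3)])
    qed
    then have "homologous_rel (Suc p) (top_of_set (X s)) {} (T s0) (T s)" by (simp add: T_def)
    then show "t\<delta> s = homology_class (Suc p) (X s) (T s0)"
      unfolding 1[OF sB] by (simp add: homology_class_eq_iff homologous_rel_sym)
  qed
  show thesis
  proof (rule that[OF r'(1)])
    show "ball s0 r' \<subseteq> U" using r' r(2) V(3) by (meson ball_subset_cball order_trans subset_cball)
  qed (use main in auto)
qed

end

section \<open>Polynomials in the Euler operator\<close>

lemma theta_poly_bound:
  assumes "Polynomial.degree p \<le> m"
  shows "theta_poly p g s = (\<Sum>i\<le>m. Polynomial.coeff p i * (theta ^^ i) g s)"
  unfolding theta_poly_def using assms
  by (intro sum.mono_neutral_left) (auto simp: coeff_eq_0)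

lemma theta_poly_0 [simp]: "theta_poly 0 g s = 0"
  by (simp add: theta_poly_def)

lemma theta_poly_add: "theta_poly (p + q) g s = theta_poly p g s + theta_poly q g s"
proof -
  define m where "m = max (Polynomial.degree p) (Polynomial.degree q)"
  have "Polynomial.degree p \<le> m" "Polynomial.degree q \<le> m" "Polynomial.degree (p + q) \<le> m"
    unfolding m_def by (auto intro: degree_add_le)
  then show ?thesis by (simp add: theta_poly_bound[of _ m] algebra_simps sum.distrib)
qed

lemma theta_poly_smult: "theta_poly (smult c p) g s = c * theta_poly p g s"
  by (simp add: theta_poly_bound[OF degree_smult_le] theta_poly_def[of p] sum_distrib_left mult.assoc)

lemma theta_poly_pCons: "theta_poly (pCons a p) g s = a * g s + theta_poly p (theta g) s"
proof -
  have "Polynomial.degree (pCons a p) \<le> Suc (Polynomial.degree p)" by (rule degree_pCons_le)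
  then show ?thesis
    by (subst theta_poly_bound[of "pCons a p" "Suc (Polynomial.degree p)"])
      (auto simp: sum.atMost_Suc_shift theta_poly_def funpow_swap1 simp del: sum.atMost_Suc)
qed

lemma theta_poly_1 [simp]: "theta_poly 1 g = g"
  by (rule ext) (simp add: one_pCons theta_poly_pCons)

lemma theta_cong:
  assumes "open B" "s \<in> B" "\<And>z. z \<in> B \<Longrightarrow> g z = h z" shows "theta g s = theta h s"
proof -
  have "deriv g s = deriv h s"
    using eventually_nhds_in_open[OF assms(1,2)] assms(3) by (intro deriv_cong_ev) (auto elim: eventually_mono)
  then show ?thesis by (simp add: theta_def)
qed

lemma theta_funpow_cong:
  assumes "open B" "\<And>z. z \<in> B \<Longrightarrow> g z = h z" "s \<in> B" shows "(theta ^^ i) g s = (theta ^^ i) h s"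
  using assms(3)
proof (induction i arbitrary: s)
  case (Suc i)
  then show ?case using theta_cong[OF assms(1)] by (metis comp_apply funpow.simps(2))
qed (use assms in auto)

lemma theta_poly_cong:
  assumes "open B" "\<And>z. z \<in> B \<Longrightarrow> g z = h z" "s \<in> B" shows "theta_poly p g s = theta_poly p h s"
  unfolding theta_poly_def using theta_funpow_cong[OF assms] by simp

lemma theta_holomorphic: "open B \<Longrightarrow> g holomorphic_on B \<Longrightarrow> theta g holomorphic_on B"
  unfolding theta_def[abs_def] by (intro holomorphic_intros holomorphic_deriv)

lemma theta_funpow_holomorphic: "open B \<Longrightarrow> g holomorphic_on B \<Longrightarrow> (theta ^^ i) g holomorphic_on B"
  by (induction i) (auto intro: theta_holomorphic)

lemma theta_poly_holomorphic: "open B \<Longrightarrow> g holomorphic_on B \<Longrightarrow> theta_poly p g holomorphic_on B"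
  unfolding theta_poly_def[abs_def] by (intro holomorphic_intros theta_funpow_holomorphic)

lemma theta_add:
  assumes "open B" "g holomorphic_on B" "h holomorphic_on B" "s \<in> B"
  shows "theta (\<lambda>z. a * g z + h z) s = a * theta g s + theta h s"
proof -
  have "g field_differentiable at s" "h field_differentiable at s"
    using assms by (auto simp: holomorphic_on_imp_differentiable_at)
  then show ?thesis by (simp add: theta_def algebra_simps field_differentiable_mult)
qed

lemma theta_theta_poly:
  assumes "open B" "g holomorphic_on B" "s \<in> B"
  shows "theta (theta_poly p g) s = theta_poly p (theta g) s"
  using assms(2,3)
proof (induction p arbitrary: g s)
  case 0
  then show ?case by (simp add: theta_poly_def[abs_def] theta_def)
next
  case (pCons a p)
  have "theta (theta_poly (pCons a p) g) s = theta (\<lambda>z. a * g z + theta_poly p (theta g) z) s"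
    by (simp add: theta_poly_pCons[abs_def])
  also have "\<dots> = a * theta g s + theta (theta_poly p (theta g)) s"
    by (rule theta_add[OF assms(1)]) (use pCons assms in \<open>auto intro!: theta_poly_holomorphic theta_holomorphic\<close>)
  also have "theta (theta_poly p (theta g)) s = theta_poly p (theta (theta g)) s"
    by (rule pCons.IH) (use pCons assms in \<open>auto intro: theta_holomorphic\<close>)
  finally show ?case by (simp add: theta_poly_pCons)
qed

lemma theta_poly_mult:
  assumes "open B" "g holomorphic_on B" "s \<in> B"
  shows "theta_poly (p * q) g s = theta_poly p (theta_poly q g) s"
  using assms(2,3)
proof (induction p arbitrary: g s)
  case (pCons a p)
  have "theta_poly (pCons a p * q) g s = a * theta_poly q g s + theta_poly (p * q) (theta g) s"
    by (simp add: mult_pCons_left theta_poly_add theta_poly_smult theta_poly_pCons)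
  also have "theta_poly (p * q) (theta g) s = theta_poly p (theta_poly q (theta g)) s"
    by (rule pCons.IH) (use pCons assms in \<open>auto intro: theta_holomorphic\<close>)
  also have "\<dots> = theta_poly p (theta (theta_poly q g)) s"
    by (rule theta_poly_cong[OF assms(1)]) (use pCons theta_theta_poly[OF assms(1)] in auto)
  finally show ?case by (simp add: theta_poly_pCons)
qed simp

section \<open>Coefficients of the operator\<close>

text \<open>Stirling numbers of the second kind arise from \<open>\<vartheta> (s\<^sup>j D\<^sup>j) = j s\<^sup>j D\<^sup>j + s\<^sup>j\<^sup>+\<^sup>1 D\<^sup>j\<^sup>+\<^sup>1\<close>.\<close>

lemma theta_funpow_eq:
  assumes "g analytic_on {s}"
  shows "(theta ^^ i) g s = (\<Sum>j\<le>i. of_nat (Stirling i j) * s ^ j * (deriv ^^ j) g s)"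
proof -
  obtain B where B: "open B" "s \<in> B" "g holomorphic_on B" using assms by (auto simp: analytic_at)
  have hol: "(deriv ^^ j) g holomorphic_on B" for j using B by (intro holomorphic_higher_deriv)
  have "(theta ^^ i) g z = (\<Sum>j\<le>i. of_nat (Stirling i j) * z ^ j * (deriv ^^ j) g z)" if "z \<in> B" for z
    using that
  proof (induction i arbitrary: z)
    case (Suc i)
    have d: "((deriv ^^ j) g has_field_derivative (deriv ^^ Suc j) g z) (at z)" for j
      using holomorphic_derivI[OF hol B(1) Suc.prems] by simp
    have dt: "((\<lambda>z. of_nat (Stirling i j) * z ^ j * (deriv ^^ j) g z) has_field_derivative
        of_nat (Stirling i j) * (of_nat j * z ^ (j - 1) * (deriv ^^ j) g z + z ^ j * (deriv ^^ Suc j) g z)) (at z)" for j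
    proof -
      have "((\<lambda>z. z ^ j) has_field_derivative of_nat j * z ^ (j - 1)) (at z)"
        using DERIV_power[OF DERIV_ident, of j z] by simp
      from DERIV_cmult[OF DERIV_mult[OF this d[of j]], of "of_nat (Stirling i j)"] show ?thesis
        by (simp add: algebra_simps)
    qed
    have "(theta ^^ Suc i) g z = theta (\<lambda>z. \<Sum>j\<le>i. of_nat (Stirling i j) * z ^ j * (deriv ^^ j) g z) z"
      using theta_cong[OF B(1) Suc.prems Suc.IH] by simp
    also have "\<dots> = (\<Sum>j\<le>i. of_nat (Stirling i j) * (of_nat j * z ^ j * (deriv ^^ j) g z + z ^ Suc j * (deriv ^^ Suc j) g z))"
    proof -
      have "deriv (\<lambda>z. \<Sum>j\<le>i. of_nat (Stirling i j) * z ^ j * (deriv ^^ j) g z) z =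
         (\<Sum>j\<le>i. of_nat (Stirling i j) * (of_nat j * z ^ (j - 1) * (deriv ^^ j) g z + z ^ j * (deriv ^^ Suc j) g z))"
        by (intro DERIV_imp_deriv DERIV_sum dt)
      moreover have "z * (c * (of_nat j * z ^ (j - 1) * a + z ^ j * b)) = c * (of_nat j * z ^ j * a + z ^ Suc j * b)" for j a b c
        by (cases j) (simp_all add: algebra_simps)
      ultimately show ?thesis
        by (simp only: theta_def sum_distrib_left)
    qed
    also have "\<dots> = (\<Sum>j\<le>i. of_nat (j * Stirling i j) * z ^ j * (deriv ^^ j) g z) +
        (\<Sum>j\<le>i. of_nat (Stirling i j) * z ^ Suc j * (deriv ^^ Suc j) g z)"
      by (simp add: distrib_left sum.distrib mult_ac)
    also have "(\<Sum>j\<le>i. of_nat (j * Stirling i j) * z ^ j * (deriv ^^ j) g z) =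
       (\<Sum>j\<le>Suc i. of_nat (j * Stirling i j) * z ^ j * (deriv ^^ j) g z)" by simp
    also have "\<dots> = (\<Sum>j\<le>i. of_nat (Suc j * Stirling i (Suc j)) * z ^ Suc j * (deriv ^^ Suc j) g z)"
      by (subst sum.atMost_Suc_shift) simp
    also have "\<dots> + (\<Sum>j\<le>i. of_nat (Stirling i j) * z ^ Suc j * (deriv ^^ Suc j) g z) =
       (\<Sum>j\<le>i. of_nat (Stirling (Suc i) (Suc j)) * z ^ Suc j * (deriv ^^ Suc j) g z)"
      unfolding sum.distrib[symmetric] by (intro sum.cong refl) (simp only: Stirling.simps of_nat_add distrib_right)
    also have "\<dots> = (\<Sum>j\<le>Suc i. of_nat (Stirling (Suc i) j) * z ^ j * (deriv ^^ j) g z)"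
      by (subst sum.atMost_Suc_shift) simp
    finally show ?case .
  qed simp
  then show ?thesis using B(2) by blast
qed

definition euler_coeff :: "complex poly \<Rightarrow> nat \<Rightarrow> complex" where
  "euler_coeff p j = (\<Sum>i\<le>Polynomial.degree p. Polynomial.coeff p i * of_nat (Stirling i j))"

lemma theta_poly_eq_derivs:
  assumes "g analytic_on {s}"
  shows "theta_poly p g s = (\<Sum>j\<le>Polynomial.degree p. euler_coeff p j * s ^ j * (deriv ^^ j) g s)"
proof -
  let ?m = "Polynomial.degree p"
  have "theta_poly p g s = (\<Sum>i\<le>?m. Polynomial.coeff p i * (\<Sum>j\<le>?m. of_nat (Stirling i j) * s ^ j * (deriv ^^ j) g s))"
    unfolding theta_poly_def theta_funpow_eq[OF assms]
    by (intro sum.cong refl arg_cong2[where f = "(*)"] sum.mono_neutral_left) auto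
  also have "\<dots> = (\<Sum>j\<le>?m. \<Sum>i\<le>?m. Polynomial.coeff p i * of_nat (Stirling i j) * s ^ j * (deriv ^^ j) g s)"
    unfolding sum_distrib_left by (subst sum.swap) (simp add: mult.assoc)
  finally show ?thesis by (simp add: euler_coeff_def sum_distrib_right)
qed

lemma euler_coeff_lead: "euler_coeff p (Polynomial.degree p) = Polynomial.lead_coeff p"
proof -
  have "euler_coeff p (Polynomial.degree p) = (\<Sum>i\<in>{Polynomial.degree p}. Polynomial.coeff p i * of_nat (Stirling i (Polynomial.degree p)))"
    unfolding euler_coeff_def by (intro sum.mono_neutral_right) auto
  then show ?thesis by simp
qed

lemma higher_deriv_shifted_power:
  "(deriv ^^ i) (\<lambda>z. (z - s) ^ j / fact j) (s :: complex) = (if i = j then 1 else 0)"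
proof -
  have "(deriv ^^ i) (\<lambda>z. (z - s) ^ j) z = pochhammer (of_nat (Suc j - i)) i * (z - s) ^ (j - i)" for z
    by (rule higher_deriv_power)
  moreover have "(deriv ^^ i) (\<lambda>z. (1 / fact j) * (z - s) ^ j) s = (1 / fact j) * (deriv ^^ i) (\<lambda>z. (z - s) ^ j) s"
    by (rule higher_deriv_cmult[of _ UNIV]) (auto intro!: holomorphic_intros)
  moreover have "pochhammer (of_nat (Suc j - i)) i * (0::complex) ^ (j - i) / fact j = (if i = j then 1 else 0)"
  proof (cases i j rule: linorder_cases)
    case equal
    then show ?thesis by (simp add: pochhammer_fact[symmetric])
  next
    case greater
    then have "Suc j - i = 0" by simp
    then show ?thesis using greater by (simp add: pochhammer_0_left)
  qed auto
  ultimately show ?thesis by simp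
qed

text \<open>Testing on \<open>(z - s)\<^sup>j / j!\<close> isolates the j-th coefficient. A singular point can therefore be recognized from one
  representation of the operator.\<close>

lemma has_coeffs_unique:
  assumes b: "has_coeffs L S m b" and c: "has_coeffs L S n c" and s: "s \<in> S"
  shows "(if j \<le> m then b j s else 0) = (if j \<le> n then c j s else 0)"
proof -
  let ?g = "\<lambda>z. (z - s) ^ j / fact j"
  have g: "?g analytic_on {s}" by (intro analytic_intros) auto
  have "(\<Sum>i\<le>m. b i s * (deriv ^^ i) ?g s) = (\<Sum>i\<le>n. c i s * (deriv ^^ i) ?g s)"
  proof -
    have "L ?g s = (\<Sum>i\<le>m. b i s * (deriv ^^ i) ?g s)" using b s g by (simp add: has_coeffs_def)
    moreover have "L ?g s = (\<Sum>i\<le>n. c i s * (deriv ^^ i) ?g s)" using c s g by (simp add: has_coeffs_def)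
    ultimately show ?thesis by simp
  qed
  then show ?thesis by (simp add: higher_deriv_shifted_power if_distrib cong: if_cong)
qed

definition fuchs_coeff :: "nat \<Rightarrow> (nat \<Rightarrow> complex) \<Rightarrow> (nat \<Rightarrow> complex) \<Rightarrow> nat \<Rightarrow> complex \<Rightarrow> complex" where
  "fuchs_coeff n p q i s = s ^ i * (p i - (- s) ^ n * q i)"

text \<open>The leading coefficient is \<open>s\<^sup>n (p n - (- s)\<^sup>n q n)\<close>. At s = 0 the i-th coefficient has the factor \<open>s\<^sup>i\<close>, and the other
  zeros are simple, so the quotients have poles of the order that Fuchs' condition permits.\<close>

proposition hypergeometric_singularities:
  assumes n: "n \<ge> 1" and pn: "p n \<noteq> 0" and qn: "q n \<noteq> 0"
    and L: "\<And>S. has_coeffs L S n (fuchs_coeff n p q)"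
  shows "{s. singular_point L s} = insert 0 {s. (- s) ^ n * q n = p n}"
    and "s \<in> insert 0 {s. (- s) ^ n * q n = p n} \<Longrightarrow> fuchs_regular L s"
proof -
  let ?B = "fuchs_coeff n p q" and ?\<Sigma> = "insert 0 {s. (- s) ^ n * q n = p n}"
  have hol: "?B i holomorphic_on S" for i S unfolding fuchs_coeff_def[abs_def] by (intro holomorphic_intros)
  have Bn: "?B n s = 0 \<longleftrightarrow> s \<in> ?\<Sigma>" for s using n by (auto simp: fuchs_coeff_def)
  have fin: "finite ?\<Sigma>"
  proof -
    have "finite {w. w ^ n = p n / q n}" using n by (intro finite_nth_roots) auto
    moreover have "{s. (- s) ^ n * q n = p n} \<subseteq> uminus ` {w. w ^ n = p n / q n}"
      using qn by (auto simp: field_simps image_iff intro!: exI[of _ "- _"])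
    ultimately show ?thesis by (simp add: finite_subset)
  qed
  have iso: "\<exists>r>0. \<forall>s\<in>ball a r - {a}. ?B n s \<noteq> 0" for a
  proof -
    obtain r where "r > 0" "\<forall>s\<in>?\<Sigma>. s \<noteq> a \<longrightarrow> r \<le> dist a s"
      using finite_set_avoid[OF fin, of a] by blast
    then show ?thesis using Bn by (intro exI[of _ r]) (auto simp: not_less)
  qed
  have sing: "singular_point L a" if a: "a \<in> ?\<Sigma>" for a
    unfolding singular_point_def
  proof
    assume "\<exists>r>0. \<exists>m b. has_coeffs L (ball a r) m b \<and> (\<forall>s\<in>ball a r. b m s \<noteq> 0)"
    then obtain r m b where r: "r > 0" and b: "has_coeffs L (ball a r) m b" "\<forall>s\<in>ball a r. b m s \<noteq> 0" by blast
    obtain r' where r': "r' > 0" "\<forall>s\<in>ball a r' - {a}. ?B n s \<noteq> 0" using iso by blast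
    note u = has_coeffs_unique[OF b(1) L]
    have "m \<le> n" using u[of a m] b(2) r by (auto split: if_splits)
    moreover have "n \<le> m"
    proof -
      define d where "d = min r r' / 2"
      have d: "0 < d" "d < r" "d < r'" using r r'(1) by (auto simp: d_def)
      have "a + of_real d \<in> ball a r" "a + of_real d \<in> ball a r' - {a}" using d by (auto simp: dist_norm)
      then show ?thesis using u[of "a + of_real d" n] r'(2) by (auto split: if_splits)
    qed
    ultimately have "b m a = ?B n a" using u[of a n] r by simp
    moreover have "b m a \<noteq> 0" using b(2) r by simp
    moreover have "?B n a = 0" using a Bn by blast
    ultimately show False by simp
  qed
  have nonsing: "\<not> singular_point L a" if a: "a \<notin> ?\<Sigma>" for a
  proof -
    obtain r where r: "r > 0" "\<forall>s\<in>ball a r - {a}. ?B n s \<noteq> 0" using iso by blast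
    then have "\<forall>s\<in>ball a r. ?B n s \<noteq> 0" using a Bn by blast
    then show ?thesis using r(1) L unfolding singular_point_def by blast
  qed
  show "{s. singular_point L s} = ?\<Sigma>" using sing nonsing by blast
  show "fuchs_regular L a" if a: "a \<in> ?\<Sigma>" for a
  proof -
    obtain r where r: "r > 0" "\<forall>s\<in>ball a r - {a}. ?B n s \<noteq> 0" using iso by blast
    have nz: "s \<noteq> 0" "p n - (- s) ^ n * q n \<noteq> 0" if "s \<in> ball a r - {a}" for s
      using r(2) that n by (auto simp: fuchs_coeff_def)
    have "\<exists>h. h holomorphic_on ball a r \<and> (\<forall>s\<in>ball a r - {a}. (s - a) ^ (n - i) * (?B i s / ?B n s) = h s)" if i: "i < n" for i
    proof (cases "a = 0")
      case True
      let ?h = "\<lambda>s. (p i - (- s) ^ n * q i) / (p n - (- s) ^ n * q n)"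
      have "?h holomorphic_on ball a r"
      proof (intro holomorphic_intros)
        fix s assume "s \<in> ball a r"
        then show "p n - (- s) ^ n * q n \<noteq> 0" using nz(2)[of s] pn n True by (cases "s = a") auto
      qed
      moreover have "(s - a) ^ (n - i) * (?B i s / ?B n s) = ?h s" if "s \<in> ball a r - {a}" for s
      proof -
        have "s ^ n = s ^ (n - i) * s ^ i" using i by (simp flip: power_add)
        then show ?thesis using nz[OF that] True by (simp add: fuchs_coeff_def)
      qed
      ultimately show ?thesis by blast
    next
      case False
      then have pa: "p n = (- a) ^ n * q n" using a by auto
      define E where "E s = - ((- 1) ^ n * q n) * (\<Sum>l<n. a ^ (n - Suc l) * s ^ l)" for s
      have fac: "p n - (- s) ^ n * q n = (s - a) * E s" for s
      proof -
        have "p n - (- s) ^ n * q n = - ((- 1) ^ n * q n) * (s ^ n - a ^ n)"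
          unfolding pa by (simp add: power_minus[of s] power_minus[of a] algebra_simps)
        also have "s ^ n - a ^ n = (s - a) * (\<Sum>l<n. a ^ (n - Suc l) * s ^ l)" by (rule power_diff_sumr2)
        finally show ?thesis by (simp add: E_def)
      qed
      have Ea: "E a \<noteq> 0"
      proof -
        have "(\<Sum>l<n. a ^ (n - Suc l) * a ^ l) = (\<Sum>l<n. a ^ (n - 1))"
          by (intro sum.cong refl) (auto simp flip: power_add)
        then show ?thesis using n qn False by (simp add: E_def)
      qed
      have r0: "s \<noteq> 0" "E s \<noteq> 0" if "s \<in> ball a r" for s
        using nz[of s] that Ea fac[of s] False by (cases "s = a"; auto)+
      let ?h = "\<lambda>s. (s - a) ^ (n - i - 1) * ?B i s / (s ^ n * E s)"
      have "?h holomorphic_on ball a r"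
        unfolding E_def by (intro holomorphic_intros hol) (use r0 in \<open>auto simp: E_def\<close>)
      moreover have "(s - a) ^ (n - i) * (?B i s / ?B n s) = ?h s" if s: "s \<in> ball a r - {a}" for s
      proof -
        have "n - i = Suc (n - i - 1)" using i by simp
        then have "(s - a) ^ (n - i) = (s - a) * (s - a) ^ (n - i - 1)" by (metis power_Suc)
        moreover have "?B n s = s ^ n * ((s - a) * E s)" by (simp add: fuchs_coeff_def fac)
        ultimately show ?thesis using s by simp
      qed
      ultimately show ?thesis by blast
    qed
    then show ?thesis unfolding fuchs_regular_def using r L by blast
  qed
qed

proposition hypergeometric_regular_at_infinity:
  assumes n: "n \<ge> 1" and qn: "q n \<noteq> 0"
    and L: "\<And>S. 0 \<notin> S \<Longrightarrow> has_coeffs L S n (\<lambda>i t. t ^ i * (p i - (- inverse t) ^ n * q i))"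
  shows "fuchs_regular L 0"
proof -
  let ?b = "\<lambda>i t. t ^ i * (p i - (- inverse t) ^ n * q i)"
  let ?d = "\<lambda>i t. t ^ n * p i - (- 1) ^ n * q i"
  have bd: "t ^ n * ?b i t = t ^ i * ?d i t" if "t \<noteq> 0" for i t
    using that by (simp add: algebra_simps power_minus[of "inverse t"] power_inverse)
  have "isCont (?d n) 0" by (intro continuous_intros)
  moreover have "?d n 0 \<noteq> 0" using n qn by (simp add: power_0_left)
  ultimately obtain r where r: "r > 0" "\<And>t. dist 0 t < r \<Longrightarrow> ?d n t \<noteq> 0"
    using continuous_at_avoid[of 0 "?d n" 0] by (auto simp: dist_commute)
  have nz: "?b n t \<noteq> 0" if "t \<in> ball 0 r - {0}" for t
    using bd[of t n] r(2)[of t] that by auto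
  have "\<exists>h. h holomorphic_on ball 0 r \<and> (\<forall>t\<in>ball 0 r - {0}. (t - 0) ^ (n - i) * (?b i t / ?b n t) = h t)" if i: "i < n" for i
  proof (intro exI[of _ "\<lambda>t. ?d i t / ?d n t"] conjI ballI)
    show "(\<lambda>t. ?d i t / ?d n t) holomorphic_on ball 0 r"
      by (intro holomorphic_intros) (use r(2) in auto)
    fix t assume t: "t \<in> ball (0::complex) r - {0}"
    have t0: "t \<noteq> 0" using t by auto
    have "?b i t / ?b n t = (t ^ n * ?b i t) / (t ^ n * ?b n t)" using t0 by simp
    also have "\<dots> = (t ^ i * ?d i t) / (t ^ n * ?d n t)" unfolding bd[OF t0] ..
    finally have "?b i t / ?b n t = (t ^ i * ?d i t) / (t ^ n * ?d n t)" .
    moreover have "t ^ n = t ^ (n - i) * t ^ i" using i by (simp flip: power_add)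
    ultimately show "(t - 0) ^ (n - i) * (?b i t / ?b n t) = ?d i t / ?d n t" using t0 by simp
  qed
  then show ?thesis unfolding fuchs_regular_def using r(1) nz L[of "ball 0 r - {0}"] by blast
qed

text \<open>In the coordinate \<open>t = 1 / s\<close> the Euler operator changes its sign.\<close>

lemma theta_funpow_inverse:
  assumes g: "g analytic_on {t}" and t: "t \<noteq> 0"
  shows "(theta ^^ i) (\<lambda>s. g (inverse s)) (inverse t) = (- 1) ^ i * (theta ^^ i) g t"
proof -
  obtain B0 where B0: "open B0" "t \<in> B0" "g holomorphic_on B0" using g by (auto simp: analytic_at)
  define B where "B = B0 - {0}"
  have B: "open B" "t \<in> B" "g holomorphic_on B" "0 \<notin> B"
    using B0 t by (auto simp: B_def open_delete intro: holomorphic_on_subset)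
  define C where "C = inverse ` B"
  have C: "open C" "s \<in> C \<longleftrightarrow> s \<noteq> 0 \<and> inverse s \<in> B" for s
  proof -
    have eq: "C = (- {0}) \<inter> inverse -` B"
      using B(4) unfolding C_def by (auto simp: image_iff) (metis inverse_inverse_eq)
    show "open C" unfolding eq
      by (intro continuous_open_preimage B continuous_intros) auto
    show "s \<in> C \<longleftrightarrow> s \<noteq> 0 \<and> inverse s \<in> B" unfolding eq by auto
  qed
  have "(theta ^^ i) (\<lambda>s. g (inverse s)) s = (- 1) ^ i * (theta ^^ i) g (inverse s)" if "s \<in> C" for s
    using that
  proof (induction i arbitrary: s)
    case (Suc i)
    let ?h = "(theta ^^ i) g"
    have s: "s \<noteq> 0" "inverse s \<in> B" using Suc.prems C(2) by auto
    have h: "(?h has_field_derivative deriv ?h (inverse s)) (at (inverse s))"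
      using holomorphic_derivI[OF theta_funpow_holomorphic[OF B(1,3)] B(1) s(2)] .
    have "(theta ^^ Suc i) (\<lambda>s. g (inverse s)) s = theta (\<lambda>s. (- 1) ^ i * ?h (inverse s)) s"
      using theta_cong[OF C(1) Suc.prems Suc.IH] by simp
    also have "\<dots> = s * ((- 1) ^ i * (deriv ?h (inverse s) * - (inverse s * inverse s)))"
    proof -
      have "((\<lambda>s. (- 1) ^ i * ?h (inverse s)) has_field_derivative (- 1) ^ i * (deriv ?h (inverse s) * - (inverse s * inverse s))) (at s)"
        using DERIV_cmult[OF DERIV_chain2[OF h DERIV_inverse'[OF DERIV_ident s(1)]]] by simp
      then show ?thesis by (simp add: theta_def DERIV_imp_deriv)
    qed
    also have "\<dots> = (- 1) ^ Suc i * (theta ^^ Suc i) g (inverse s)"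
      using s(1) by (simp add: theta_def field_simps)
    finally show ?case .
  qed simp
  then show ?thesis using C(2)[of "inverse t"] B(2) t by simp
qed

section \<open>Normalized volumes and the matrix of exponents\<close>

lemma det_bordered:
  fixes N :: "'a::comm_ring_1^('n::finite + bool)^('n + bool)"
  assumes row: "\<And>c. N $ Inr False $ c = (if c = Inr False then 1 else 0)"
    and col: "\<And>r. N $ r $ Inr True = (if r = Inr True then 1 else 0)"
  shows "det N = det (\<chi> i j. N $ Inl i $ Inl j)"
proof -
  let ?B = "range (Inl :: 'n \<Rightarrow> 'n + bool)"
  let ?t = "\<lambda>p. of_int (sign p) * (\<Prod>r\<in>UNIV. N $ r $ p r)"
  define f' where "f' = inv_into UNIV (Inl :: 'n \<Rightarrow> 'n + bool)"
  have f': "f' (Inl x) = x" for x by (simp add: f'_def inj_Inl)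
  have bij: "bij_betw (Inl :: 'n \<Rightarrow> 'n + bool) UNIV ?B" "bij_betw f' ?B UNIV"
    unfolding f'_def by (auto intro!: inj_on_imp_bij_betw bij_betw_inv_into)
  have UN: "(UNIV :: ('n + bool) set) = insert (Inr False) (insert (Inr True) ?B)"
  proof -
    have "x \<in> insert (Inr False) (insert (Inr True) ?B)" for x :: "'n + bool"
    proof (cases x)
      case (Inr b)
      then show ?thesis by (cases b) auto
    qed auto
    then show ?thesis by blast
  qed
  have "det N = (\<Sum>p | p permutes UNIV. ?t p)" by (simp add: det_def)
  also have "\<dots> = (\<Sum>p | p permutes ?B. ?t p)"
  proof (rule sum.mono_neutral_right)
    show "{p. p permutes ?B} \<subseteq> {p. p permutes UNIV}" using permutes_subset by blast
    show "\<forall>p\<in>{p. p permutes UNIV} - {p. p permutes ?B}. ?t p = 0"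
    proof
      fix p :: "'n + bool \<Rightarrow> 'n + bool" assume p: "p \<in> {p. p permutes UNIV} - {p. p permutes ?B}"
      have "\<exists>r. N $ r $ p r = 0"
      proof (rule ccontr)
        assume nz: "\<nexists>r. N $ r $ p r = 0"
        have F: "p (Inr False) = Inr False" using nz row[of "p (Inr False)"] by (auto split: if_splits)
        obtain r where r: "p r = Inr True" using p by (metis DiffD1 mem_Collect_eq permutes_surj surjD)
        then have "N $ r $ Inr True \<noteq> 0" using nz by metis
        then have T: "p (Inr True) = Inr True" using r col[of r] by (auto split: if_splits)
        have "p x = x" if "x \<notin> ?B" for x
        proof -
          have "x = Inr False \<or> x = Inr True" using that UN by blast
          then show ?thesis using F T by auto
        qed
        moreover have "\<exists>!x. p x = y" for y using p by (simp add: permutes_def)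
        ultimately have "p permutes ?B" by (simp add: permutes_def)
        then show False using p by simp
      qed
      then have "(\<Prod>r\<in>UNIV. N $ r $ p r) = 0" by (intro prod_zero) auto
      then show "?t p = 0" by simp
    qed
  qed auto
  also have "\<dots> = (\<Sum>q | q permutes (UNIV :: 'n set). of_int (sign q) * (\<Prod>i\<in>UNIV. N $ Inl i $ Inl (q i)))"
  proof (rule sum.reindex_bij_witness[where i = "map_permutation UNIV Inl" and j = "map_permutation ?B f'"])
    fix p assume p: "p \<in> {p. p permutes ?B}"
    then have pB: "p permutes ?B" by simp
    have ap: "map_permutation ?B f' p x = f' (p (Inl x))" for x
      using map_permutation_apply[of f' ?B "Inl x" p] bij(2) by (simp add: f' bij_betw_def)
    have pInl: "\<exists>y. p (Inl x) = Inl y" for x using permutes_in_image[OF pB, of "Inl x"] by blast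
    have ap': "Inl (map_permutation ?B f' p x) = p (Inl x)" for x
      unfolding ap using pInl[of x] f' by auto
    show "map_permutation UNIV Inl (map_permutation ?B f' p) = p"
    proof
      fix x :: "'n + bool"
      show "map_permutation UNIV Inl (map_permutation ?B f' p) x = p x"
      proof (cases "x \<in> ?B")
        case True
        then obtain y where y: "x = Inl y" by auto
        have "map_permutation UNIV Inl (map_permutation ?B f' p) (Inl y) = (Inl (map_permutation ?B f' p y) :: 'n + bool)"
          by (intro map_permutation_apply) (auto simp: inj_Inl)
        then show ?thesis unfolding y by (simp only: ap')
      next
        case False
        then show ?thesis using permutes_not_in[OF pB] by (simp add: map_permutation_def restrict_id_def)
      qed
    qed
    show "map_permutation ?B f' p \<in> {q. q permutes UNIV}"
      using map_permutation_permutes[OF bij(2) pB] by simp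
    have "sign (map_permutation ?B f' p) = sign p"
      using pB bij(2) by (intro sign_map_permutation) (auto simp: bij_betw_def)
    moreover have "(\<Prod>r\<in>UNIV. N $ r $ p r) = (\<Prod>i\<in>UNIV. N $ Inl i $ Inl (map_permutation ?B f' p i))"
    proof -
      have fx: "p (Inr b) = Inr b" for b using permutes_not_in[OF pB] by auto
      have "(\<Prod>r\<in>UNIV. N $ r $ p r) = (\<Prod>r\<in>?B. N $ r $ p r)"
        unfolding UN using row[of "Inr False"] col[of "Inr True"] fx by (subst prod.insert; (subst prod.insert)?; auto)
      then show ?thesis by (simp add: prod.reindex ap')
    qed
    ultimately show "of_int (sign (map_permutation ?B f' p)) * (\<Prod>i\<in>UNIV. N $ Inl i $ Inl (map_permutation ?B f' p i)) = ?t p"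
      by simp
  next
    fix q :: "'n \<Rightarrow> 'n" assume "q \<in> {q. q permutes UNIV}"
    then have q: "q permutes UNIV" by simp
    show "map_permutation UNIV Inl q \<in> {p. p permutes ?B}"
      using map_permutation_permutes[OF bij(1) q] by simp
    show "map_permutation ?B f' (map_permutation UNIV Inl q) = q"
    proof
      fix x
      have "map_permutation ?B f' (map_permutation UNIV Inl q) (f' (Inl x)) = f' (map_permutation UNIV Inl q (Inl x))"
        using bij(2) by (intro map_permutation_apply) (auto simp: bij_betw_def)
      also have "map_permutation UNIV Inl q (Inl x) = Inl (q x)" by (intro map_permutation_apply) (auto simp: inj_Inl)
      finally show "map_permutation ?B f' (map_permutation UNIV Inl q) x = q x" by (simp add: f')
    qed
  qed
  finally show ?thesis by (simp add: det_def)
qed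

lemma det_of_int:
  fixes A :: "'n::finite \<Rightarrow> 'n \<Rightarrow> int"
  shows "det (\<chi> i j. (of_int (A i j) :: 'a::comm_ring_1)) = of_int (det (\<chi> i j. A i j))"
  by (simp add: det_def)

lemma det_L_matrix_of_int: "det (L_matrix \<alpha> :: 'a::comm_ring_1^('n::finite + bool)^('n + bool)) = of_int (det (L_matrix \<alpha>))"
proof -
  have "(L_matrix \<alpha> :: 'a^('n + bool)^('n + bool)) = (\<chi> r c. of_int (L_matrix \<alpha> $ r $ c))"
    by (auto simp: L_matrix_def vec_eq_iff split: sum.split bool.split)
  then show ?thesis using det_of_int[of "\<lambda>r c. L_matrix \<alpha> $ r $ c", where 'a = 'a] by simp
qed

lemma abs_det_L_matrix:
  fixes \<alpha> :: "'n::finite + bool \<Rightarrow> int^'n"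
  assumes "\<alpha> (Inr False) = 0"
  shows "\<bar>det (L_matrix \<alpha> :: real^('n + bool)^('n + bool))\<bar> = \<bar>det (\<chi> i. rvec (\<alpha> (Inl i)))\<bar>"
proof -
  let ?p = "Transposition.transpose (Inr False) (Inr True) :: 'n + bool \<Rightarrow> 'n + bool"
  let ?L = "L_matrix \<alpha> :: real^('n + bool)^('n + bool)"
  have "det (\<chi> r c. ?L $ r $ ?p c) = of_int (sign ?p) * det ?L"
    by (rule det_permute_columns) (simp add: permutes_swap_id)
  moreover have "det (\<chi> r c. ?L $ r $ ?p c) = det (\<chi> i j. ?L $ Inl i $ ?p (Inl j))"
    by (subst det_bordered) (auto simp: L_matrix_def assms Transposition.transpose_def split: sum.split)
  moreover have "(\<chi> i j. ?L $ Inl i $ ?p (Inl j)) = (\<chi> i. rvec (\<alpha> (Inl i)))"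
    by (auto simp: vec_eq_iff L_matrix_def rvec_def Transposition.transpose_def)
  ultimately show ?thesis by (simp add: sign_swap_id abs_mult)
qed

lemma vertex_indices_eq: "vertex_indices = insert (Inr False) (range (Inl :: 'n \<Rightarrow> 'n + bool))"
proof -
  have "x \<in> vertex_indices \<longleftrightarrow> x \<in> insert (Inr False) (range Inl)" for x :: "'n + bool"
    by (cases x) (auto simp: vertex_indices_def)
  then show ?thesis by blast
qed

lemma sum_vertex_indices: "(\<Sum>q\<in>vertex_indices. f q) = f (Inr False) + (\<Sum>j\<in>UNIV. f (Inl (j :: 'n::finite)))"
  unfolding vertex_indices_eq by (subst sum.insert) (auto simp: sum.reindex)

lemma sum_UNIV_indices: "(\<Sum>q\<in>UNIV. f q) = f (Inr True) + (\<Sum>q\<in>vertex_indices. f (q :: 'n::finite + bool))"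
  unfolding vertex_indices_def by (simp add: sum.remove[of UNIV "Inr True"] Compl_eq_Diff_UNIV)

lemma finite_vertex_indices [simp]: "finite (vertex_indices :: ('n::finite + bool) set)"
  by (simp add: vertex_indices_eq)

lemma card_vertex_indices: "card (vertex_indices :: ('n::finite + bool) set) = Suc CARD('n)"
  unfolding vertex_indices_eq by (subst card.insert) (auto simp: card_image)

text \<open>An interior point of a simplex is a convex combination of the vertices with positive weights.\<close>

lemma barycentric_coordinates:
  fixes \<alpha> :: "'n::finite + bool \<Rightarrow> int^'n"
  assumes "simplicial_exponents \<alpha>"
  obtains b where "\<And>q. q \<in> vertex_indices \<Longrightarrow> 0 < b q" "(\<Sum>q\<in>vertex_indices. b q) = 1"
    "rvec (\<alpha> (Inr True)) = (\<Sum>q\<in>vertex_indices. b q *\<^sub>R rvec (\<alpha> q))"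
proof -
  let ?S = "rvec ` \<alpha> ` vertex_indices"
  let ?g = "\<lambda>q. rvec (\<alpha> q)"
  have S: "?S = ?g ` vertex_indices" by auto
  have finS: "finite ?S" by simp
  obtain C where C: "\<not> affine_dependent C" "int (card C) = int CARD('n) + 1" "convex hull ?S = convex hull C"
    using assms unfolding simplicial_exponents_def simplex_def by blast
  have "C \<subseteq> ?S"
  proof
    fix x assume "x \<in> C"
    then have "x extreme_point_of (convex hull ?S)"
      unfolding C(3) using extreme_point_of_convex_hull_affine_independent[OF C(1)] by blast
    then show "x \<in> ?S" by (rule extreme_point_of_convex_hull)
  qed
  moreover have le: "card ?S \<le> Suc CARD('n)"
    unfolding S card_vertex_indices[symmetric] by (rule card_image_le) simp
  ultimately have CS: "C = ?S" using C(2) finS by (intro card_seteq) auto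
  have card: "card ?S = Suc CARD('n)" using C(2) CS by simp
  have inj: "inj_on ?g vertex_indices"
    using card unfolding S card_vertex_indices[symmetric] by (intro eq_card_imp_inj_on) auto
  have "rvec (\<alpha> (Inr True)) \<in> interior (convex hull ?S)" using assms by (simp add: simplicial_exponents_def)
  then obtain u where u: "\<forall>x\<in>?S. 0 < u x" "sum u ?S = 1" "(\<Sum>x\<in>?S. u x *\<^sub>R x) = rvec (\<alpha> (Inr True))"
    using card C(1) CS by (auto simp: interior_convex_hull_explicit_minimal)
  show thesis
  proof (rule that[of "\<lambda>q. u (?g q)"])
    show "(\<Sum>q\<in>vertex_indices. u (?g q)) = 1" using u(2) unfolding S by (simp add: sum.reindex[OF inj])
    show "rvec (\<alpha> (Inr True)) = (\<Sum>q\<in>vertex_indices. u (?g q) *\<^sub>R ?g q)"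
      using u(3) unfolding S by (simp add: sum.reindex[OF inj])
  qed (use u(1) in auto)
qed

lemma rvec_0 [simp]: "rvec 0 = 0" by (simp add: rvec_def vec_eq_iff)

lemma det_rvec: "det (\<chi> i. rvec (A i)) = of_int (det (\<chi> i. A i))"
proof -
  have "(\<chi> i. rvec (A i)) = (\<chi> i j. of_int (A i $ j))" by (simp add: vec_eq_iff rvec_def)
  then show ?thesis using det_of_int[of "\<lambda>i j. A i $ j", where 'a = real] by simp
qed

text \<open>Replacing the vertex q by the point \<open>\<Sum>b q \<alpha> q\<close> multiplies the determinant that computes the volume by \<open>b q\<close>, by
  linearity in the vertex.\<close>

lemma B_vol_barycentric:
  fixes \<alpha> :: "'n::{finite,linorder} + bool \<Rightarrow> int^'n::_"
  assumes \<alpha>0: "\<alpha> (Inr False) = 0" and pos: "det (L_matrix \<alpha> :: int^('n + bool)^('n + bool)) > 0"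
    and b: "\<And>q. q \<in> vertex_indices \<Longrightarrow> 0 < b q" "(\<Sum>q\<in>vertex_indices. b q) = 1"
       "rvec (\<alpha> (Inr True)) = (\<Sum>q\<in>vertex_indices. b q *\<^sub>R rvec (\<alpha> q))"
    and q: "q \<in> vertex_indices"
  shows "real (B_vol \<alpha> q) = real (gam \<alpha>) * b q"
proof -
  let ?V = "\<lambda>i. rvec (\<alpha> (Inl i))" and ?u = "rvec (\<alpha> (Inr True))"
  have gam: "real (gam \<alpha>) = \<bar>det (\<chi> i. ?V i)\<bar>"
    using pos abs_det_L_matrix[of \<alpha>, OF \<alpha>0] det_L_matrix_of_int[of \<alpha>, where 'a = real] by (simp add: gam_def)
  then have detV: "det (\<chi> i. ?V i) \<noteq> 0"
    using pos by (simp add: gam_def)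
  have u: "?u = (\<Sum>j\<in>UNIV. b (Inl j) *s ?V j)"
    unfolding b(3) sum_vertex_indices by (simp add: \<alpha>0 scalar_mult_eq_scaleR)
  have repl: "det (\<chi> l. if l = k then ?u else ?V l) = b (Inl k) * det (\<chi> i. ?V i)" for k
  proof -
    have "det (\<chi> l. if l = k then ?u else ?V l) = (\<Sum>j\<in>UNIV. b (Inl j) * det (\<chi> l. if l = k then ?V j else ?V l))"
      unfolding u by (simp add: det_linear_row_sum det_row_mul)
    also have "\<dots> = (\<Sum>j\<in>UNIV. if j = k then b (Inl k) * det (\<chi> i. ?V i) else 0)"
    proof (rule sum.cong[OF refl])
      fix j
      show "b (Inl j) * det (\<chi> l. if l = k then ?V j else ?V l) = (if j = k then b (Inl k) * det (\<chi> i. ?V i) else 0)"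
      proof (cases "j = k")
        case True
        then have "(\<chi> l. if l = k then ?V j else ?V l) = (\<chi> i. ?V i)" by (simp add: vec_eq_iff)
        then show ?thesis using True by simp
      next
        case False
        have "det (\<chi> l. if l = k then ?V j else ?V l) = 0"
          using False by (intro det_identical_rows[of j k]) (auto simp: row_def)
        then show ?thesis using False by simp
      qed
    qed
    finally show ?thesis by simp
  qed
  have tr: "det (\<chi> i j. f j $ i - x0 $ i) = det (\<chi> j. f j - x0)" for f and x0 :: "real^'n::_"
    using det_transpose[of "\<chi> j. f j - x0"] by (simp add: Finite_Cartesian_Product.transpose_def)
  have "\<exists>A :: 'n \<Rightarrow> int^'n::_. fact CARD('n) * measure lborel (convex hull (rvec ` \<alpha> ` (- {q}))) = \<bar>of_int (det (\<chi> i. A i))\<bar> \<and>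
     \<bar>of_int (det (\<chi> i. A i))\<bar> = b q * \<bar>det (\<chi> i. ?V i)\<bar>"
  proof (cases "q = Inr False")
    case True
    have S: "rvec ` \<alpha> ` (- {q}) = insert ?u (range ?V)"
    proof -
      have "- {q} = insert (Inr True) (range Inl)"
      proof -
        have "x \<in> - {q} \<longleftrightarrow> x \<in> insert (Inr True) (range Inl)" for x :: "'n + bool" by (cases x) (auto simp: True)
        then show ?thesis by blast
      qed
      then show ?thesis by (simp add: image_image)
    qed
    have d: "det (\<chi> j. ?V j - ?u) = b q * det (\<chi> i. ?V i)"
    proof -
      have "b (Inr False) = 1 - (\<Sum>j\<in>UNIV. b (Inl j))" using b(2) unfolding sum_vertex_indices by linarith
      then show ?thesis unfolding det_rows_diff_common repl True by (simp add: left_diff_distrib sum_distrib_right)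
    qed
    have "det (\<chi> i j. ?V j $ i - ?u $ i) \<noteq> 0" unfolding tr d using b(1)[OF q] detV by simp
    from volume_simplex[OF this] have "fact CARD('n) * measure lborel (convex hull (rvec ` \<alpha> ` (- {q}))) = \<bar>det (\<chi> j. ?V j - ?u)\<bar>"
      unfolding S tr by simp
    moreover have "(\<chi> j. ?V j - ?u) = (\<chi> j. rvec (\<alpha> (Inl j) - \<alpha> (Inr True)))" by (simp add: vec_eq_iff rvec_def)
    ultimately show ?thesis
      using d b(1)[OF q] by (intro exI[of _ "\<lambda>j. \<alpha> (Inl j) - \<alpha> (Inr True)"]) (simp add: det_rvec[symmetric] abs_mult)
  next
    case False
    then obtain k where k: "q = Inl k" using q by (auto simp: vertex_indices_eq)
    let ?f = "\<lambda>j. if j = k then \<alpha> (Inr True) else \<alpha> (Inl j)"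
    have S: "rvec ` \<alpha> ` (- {q}) = insert 0 (range (\<lambda>j. rvec (?f j)))"
    proof -
      have "x \<in> - {q} \<longleftrightarrow> x \<in> insert (Inr False) ((\<lambda>j. if j = k then Inr True else Inl j) ` UNIV)" for x :: "'n + bool"
        by (cases x) (auto simp: k image_iff)
      then have "- {q} = insert (Inr False) ((\<lambda>j. if j = k then Inr True else Inl j) ` UNIV)" by blast
      moreover have "rvec (\<alpha> (if j = k then Inr True else Inl j)) = rvec (?f j)" for j by simp
      ultimately show ?thesis by (simp only: image_insert image_image \<alpha>0 rvec_0)
    qed
    have e: "(\<chi> j. rvec (?f j)) = (\<chi> l. if l = k then ?u else ?V l)" by (simp add: vec_eq_iff)
    have d: "det (\<chi> j. rvec (?f j)) = b q * det (\<chi> i. ?V i)" unfolding e repl k ..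
    have "det (\<chi> i j. rvec (?f j) $ i - 0 $ i) \<noteq> 0" unfolding tr using d b(1)[OF q] detV by simp
    from volume_simplex[OF this] have "fact CARD('n) * measure lborel (convex hull (rvec ` \<alpha> ` (- {q}))) = \<bar>det (\<chi> j. rvec (?f j))\<bar>"
      unfolding S tr by simp
    then show ?thesis
      using d b(1)[OF q] by (intro exI[of _ ?f]) (simp add: det_rvec[symmetric] abs_mult)
  qed
  then obtain A :: "'n \<Rightarrow> int^'n::_" where A: "fact CARD('n) * measure lborel (convex hull (rvec ` \<alpha> ` (- {q}))) = \<bar>of_int (det (\<chi> i. A i))\<bar>"
     "\<bar>of_int (det (\<chi> i. A i))\<bar> = b q * \<bar>det (\<chi> i. ?V i)\<bar>" by blast
  have "real (B_vol \<alpha> q) = \<bar>of_int (det (\<chi> i. A i))\<bar>"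
    unfolding B_vol_def A(1) by (simp flip: of_int_abs)
  then show ?thesis using A(2) gam by simp
qed

lemma matrix_inv_complex:
  fixes A :: "complex^'m::finite^'m"
  assumes "det A \<noteq> 0"
  shows "A ** matrix_inv A = mat 1" "matrix_inv A ** A = mat 1"
proof -
  have "invertible A" using assms by (simp add: invertible_det_nz)
  then have "A ** matrix_inv A = mat 1 \<and> matrix_inv A ** A = mat 1"
    unfolding invertible_def matrix_inv_def by (rule someI_ex)
  then show "A ** matrix_inv A = mat 1" "matrix_inv A ** A = mat 1" by auto
qed

section \<open>Holomorphic functions of several variables\<close>

text \<open>Complex differentiability with continuous partial derivatives, in the form in which Stokes' theorem uses it.\<close>

definition holomorphic_several :: "(complex^'n::finite) set \<Rightarrow> (complex^'n \<Rightarrow> complex) \<Rightarrow> bool" where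
  "holomorphic_several S g \<longleftrightarrow> (\<exists>G. (\<forall>x\<in>S. (g has_derivative (\<lambda>v. \<Sum>k\<in>UNIV. G k x * v $ k)) (at x)) \<and> (\<forall>k. continuous_on S (G k)))"

lemma holomorphic_several_continuous: "holomorphic_several S g \<Longrightarrow> continuous_on S g"
  unfolding holomorphic_several_def
  by (auto intro!: continuous_at_imp_continuous_on dest!: bspec has_derivative_continuous)

lemma holomorphic_several_const: "holomorphic_several S (\<lambda>x. c)"
  unfolding holomorphic_several_def by (intro exI[of _ "\<lambda>k x. 0"]) auto

lemma holomorphic_several_mult:
  assumes g: "holomorphic_several S g" and h: "holomorphic_several S h"
  shows "holomorphic_several S (\<lambda>x. g x * h x)"
proof -
  obtain G H where G: "\<And>x. x \<in> S \<Longrightarrow> (g has_derivative (\<lambda>v. \<Sum>k\<in>UNIV. G k x * v $ k)) (at x)" "\<And>k. continuous_on S (G k)"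
    and H: "\<And>x. x \<in> S \<Longrightarrow> (h has_derivative (\<lambda>v. \<Sum>k\<in>UNIV. H k x * v $ k)) (at x)" "\<And>k. continuous_on S (H k)"
    using g h unfolding holomorphic_several_def by blast
  show ?thesis
    unfolding holomorphic_several_def
  proof (intro exI[of _ "\<lambda>k x. g x * H k x + G k x * h x"] conjI ballI allI)
    show "((\<lambda>x. g x * h x) has_derivative (\<lambda>v. \<Sum>k\<in>UNIV. (g x * H k x + G k x * h x) * v $ k)) (at x)" if "x \<in> S" for x
      by (rule has_derivative_eq_rhs[OF has_derivative_mult[OF G(1)[OF that] H(1)[OF that]]])
        (simp add: fun_eq_iff sum_distrib_left sum_distrib_right sum.distrib[symmetric] algebra_simps)
    show "continuous_on S (\<lambda>x. g x * H k x + G k x * h x)" for k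
      by (intro continuous_intros G H holomorphic_several_continuous g h)
  qed
qed

lemma holomorphic_several_inverse:
  assumes g: "holomorphic_several S g" and nz: "\<And>x. x \<in> S \<Longrightarrow> g x \<noteq> 0"
  shows "holomorphic_several S (\<lambda>x. inverse (g x))"
proof -
  obtain G where G: "\<And>x. x \<in> S \<Longrightarrow> (g has_derivative (\<lambda>v. \<Sum>k\<in>UNIV. G k x * v $ k)) (at x)" "\<And>k. continuous_on S (G k)"
    using g unfolding holomorphic_several_def by blast
  show ?thesis
    unfolding holomorphic_several_def
  proof (intro exI[of _ "\<lambda>k x. - (inverse (g x) * G k x * inverse (g x))"] conjI ballI allI)
    show "((\<lambda>x. inverse (g x)) has_derivative (\<lambda>v. \<Sum>k\<in>UNIV. - (inverse (g x) * G k x * inverse (g x)) * v $ k)) (at x)" if "x \<in> S" for x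
      by (rule has_derivative_eq_rhs[OF Deriv.has_derivative_inverse[OF nz[OF that] G(1)[OF that]]])
        (simp add: fun_eq_iff sum_distrib_left sum_distrib_right sum_negf mult_ac)
    show "continuous_on S (\<lambda>x. - (inverse (g x) * G k x * inverse (g x)))" for k
      by (intro continuous_intros G holomorphic_several_continuous g) (use nz in auto)
  qed
qed

lemma holomorphic_several_power:
  "holomorphic_several S g \<Longrightarrow> holomorphic_several S (\<lambda>x. g x ^ n)"
  by (induction n) (auto intro: holomorphic_several_const holomorphic_several_mult)

lemma holomorphic_several_subset: "holomorphic_several S g \<Longrightarrow> T \<subseteq> S \<Longrightarrow> holomorphic_several T g"
  unfolding holomorphic_several_def by (meson continuous_on_subset subsetD)

section \<open>Laurent monomials and the family f\<close>

lemma open_torus: "open (torus :: (complex^'n::finite) set)"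
proof -
  have "(torus :: (complex^'n) set) = (\<Inter>i. {x. x $ i \<noteq> 0})" by (auto simp: torus_def)
  moreover have "open {x :: complex^'n. x $ i \<noteq> 0}" for i
    by (intro open_Collect_neq continuous_intros)
  ultimately show ?thesis by (metis (no_types, lifting) open_INT UNIV_I finite)
qed

lemma laurent_monom_0 [simp]: "laurent_monom 0 x = 1"
  by (simp add: laurent_monom_def)

lemma laurent_monom_add: "x \<in> torus \<Longrightarrow> laurent_monom (a + b) x = laurent_monom a x * laurent_monom b x"
  by (simp add: laurent_monom_def torus_def power_int_add prod.distrib)

lemma laurent_monom_has_derivative:
  assumes x: "x \<in> torus"
  shows "(laurent_monom a has_derivative (\<lambda>v. \<Sum>k\<in>UNIV. of_int (a $ k) * laurent_monom a x / x $ k * v $ k)) (at (x :: complex^'n::finite))"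
proof -
  have nz: "x $ i \<noteq> 0" for i using x by (simp add: torus_def)
  have "((\<lambda>x. (x $ i) powi (a $ i)) has_derivative (\<lambda>v. v $ i * (of_int (a $ i) * (x $ i) powi (a $ i - 1)))) (at x)" for i
    by (rule has_derivative_eq_rhs[OF has_derivative_power_int[OF nz bounded_linear_imp_has_derivative[OF bounded_linear_vec_nth]]]) simp
  then have "((\<lambda>x. \<Prod>i\<in>UNIV. (x $ i) powi (a $ i)) has_derivative
     (\<lambda>v. \<Sum>i\<in>UNIV. v $ i * (of_int (a $ i) * (x $ i) powi (a $ i - 1)) * (\<Prod>j\<in>UNIV - {i}. (x $ j) powi (a $ j)))) (at x)"
    by (intro has_derivative_prod)
  moreover have "v $ i * (of_int (a $ i) * (x $ i) powi (a $ i - 1)) * (\<Prod>j\<in>UNIV - {i}. (x $ j) powi (a $ j)) =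
     of_int (a $ i) * laurent_monom a x / x $ i * v $ i" for v :: "complex^'n" and i
    unfolding laurent_monom_def prod.remove[OF finite UNIV_I, of "\<lambda>j. (x $ j) powi (a $ j)" i] by (simp add: power_int_diff nz)
  ultimately show ?thesis by (simp add: laurent_monom_def[abs_def])
qed

lemma laurent_monom_continuous: "continuous_on torus (laurent_monom a)"
  using laurent_monom_has_derivative has_derivative_continuous by (intro continuous_at_imp_continuous_on) blast

lemma laurent_monom_comp_continuous [continuous_intros]:
  "continuous_on S x \<Longrightarrow> (\<And>l. l \<in> S \<Longrightarrow> x l \<in> torus) \<Longrightarrow> continuous_on S (\<lambda>l. laurent_monom a (x l))"
  by (rule continuous_on_compose2[OF laurent_monom_continuous]) auto

lemma holomorphic_laurent_monom: "holomorphic_several torus (laurent_monom a)"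
  unfolding holomorphic_several_def
  by (intro exI[of _ "\<lambda>k x. of_int (a $ k) * laurent_monom a x / x $ k"] conjI ballI allI laurent_monom_has_derivative continuous_intros)
    (auto simp: torus_def)

text \<open>The values of the n + 2 coefficients on the line that is parametrized by s.\<close>

definition param :: "complex \<Rightarrow> 'n + bool \<Rightarrow> complex" where "param s r = (if r = Inr True then s else 1)"

text \<open>The Laurent polynomial with arbitrary coefficients; the homogeneity relations need all of them to vary.\<close>

definition fam :: "('n::finite + bool \<Rightarrow> int^'n) \<Rightarrow> ('n + bool \<Rightarrow> complex) \<Rightarrow> complex^'n \<Rightarrow> complex" where
  "fam \<alpha> a x = (\<Sum>r\<in>UNIV. a r * laurent_monom (\<alpha> r) x)"

definition fam' :: "('n::finite + bool \<Rightarrow> int^'n) \<Rightarrow> 'n \<Rightarrow> ('n + bool \<Rightarrow> complex) \<Rightarrow> complex^'n \<Rightarrow> complex" where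
  "fam' \<alpha> k a x = (\<Sum>r\<in>UNIV. a r * (of_int (\<alpha> r $ k) * laurent_monom (\<alpha> r) x / x $ k))"

lemma holomorphic_family_fam:
  assumes a: "\<And>r. continuous_on UNIV (\<lambda>t. a t r)"
  shows "holomorphic_family (\<lambda>t. fam \<alpha> (a t)) (\<lambda>k t. fam' \<alpha> k (a t)) (torus :: (complex^'n::{finite,linorder}) set)"
proof
  fix s and x :: "complex^'n::_" assume x: "x \<in> torus"
  have "(fam \<alpha> (a s) has_derivative (\<lambda>v. \<Sum>r\<in>UNIV. a s r * (\<Sum>k\<in>UNIV. of_int (\<alpha> r $ k) * laurent_monom (\<alpha> r) x / x $ k * v $ k))) (at x)"
    unfolding fam_def[abs_def] by (intro has_derivative_sum has_derivative_mult_right laurent_monom_has_derivative x)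
  then show "(fam \<alpha> (a s) has_derivative (\<lambda>v. \<Sum>k\<in>UNIV. fam' \<alpha> k (a s) x * v $ k)) (at x)"
    unfolding fam'_def sum_distrib_left sum_distrib_right by (subst sum.swap) (simp add: mult.assoc)
next
  have a': "continuous_on S (\<lambda>z. a (fst z) r)" for S :: "(complex \<times> (complex^'n::_)) set" and r
    by (rule continuous_on_compose2[OF a]) (auto intro: continuous_intros)
  show "continuous_on (UNIV \<times> torus) (\<lambda>(s, x :: complex^'n::_). fam \<alpha> (a s) x)"
    unfolding fam_def case_prod_unfold by (intro continuous_intros a') auto
  show "continuous_on (UNIV \<times> torus) (\<lambda>(s, x :: complex^'n::_). fam' \<alpha> k (a s) x)" for k
    unfolding fam'_def case_prod_unfold by (intro continuous_intros a') (auto simp: torus_def)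
qed (rule open_torus)

lemma continuous_param: "continuous_on S (\<lambda>t. param t r)"
  by (cases "r = Inr True") (auto simp: param_def)

lemma laurent_eval_superset:
  "finite S \<Longrightarrow> Poly_Mapping.keys f \<subseteq> S \<Longrightarrow> laurent_eval f x = (\<Sum>a\<in>S. Poly_Mapping.lookup f a * laurent_monom a x)"
  unfolding laurent_eval_def by (intro sum.mono_neutral_left) (auto simp: in_keys_iff)

lemma laurent_log_deriv_superset:
  "finite S \<Longrightarrow> Poly_Mapping.keys f \<subseteq> S \<Longrightarrow> laurent_log_deriv i f x = (\<Sum>a\<in>S. of_int (a $ i) * Poly_Mapping.lookup f a * laurent_monom a x)"
  unfolding laurent_log_deriv_def by (intro sum.mono_neutral_left) (auto simp: in_keys_iff)

lemma laurent_eval_add: "laurent_eval (f + g) x = laurent_eval f x + laurent_eval g x"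
proof -
  let ?S = "Poly_Mapping.keys f \<union> Poly_Mapping.keys g"
  have "Poly_Mapping.keys (f + g) \<subseteq> ?S" by (rule Poly_Mapping.keys_add)
  then show ?thesis
    by (subst (1 2 3) laurent_eval_superset[of ?S]) (auto simp: lookup_add distrib_right sum.distrib)
qed

lemma laurent_log_deriv_add: "laurent_log_deriv i (f + g) x = laurent_log_deriv i f x + laurent_log_deriv i g x"
proof -
  let ?S = "Poly_Mapping.keys f \<union> Poly_Mapping.keys g"
  have "Poly_Mapping.keys (f + g) \<subseteq> ?S" by (rule Poly_Mapping.keys_add)
  then show ?thesis
    by (subst (1 2 3) laurent_log_deriv_superset[of ?S]) (auto simp: lookup_add algebra_simps sum.distrib)
qed

lemma laurent_eval_single: "laurent_eval (Poly_Mapping.single a c) x = c * laurent_monom a x"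
  by (simp add: laurent_eval_def)

lemma laurent_log_deriv_single: "laurent_log_deriv i (Poly_Mapping.single a c) x = of_int (a $ i) * c * laurent_monom a x"
  by (simp add: laurent_log_deriv_def)

lemma laurent_eval_sum: "laurent_eval (\<Sum>i\<in>A. f i) x = (\<Sum>i\<in>A. laurent_eval (f i) x)"
  by (induction A rule: infinite_finite_induct) (auto simp: laurent_eval_add laurent_eval_def[of 0])

lemma laurent_log_deriv_sum: "laurent_log_deriv j (\<Sum>i\<in>A. f i) x = (\<Sum>i\<in>A. laurent_log_deriv j (f i) x)"
  by (induction A rule: infinite_finite_induct) (auto simp: laurent_log_deriv_add laurent_log_deriv_def[of _ 0])

lemma f_poly_eq:
  assumes "\<alpha> (Inr False) = 0"
  shows "f_poly \<alpha> s = (\<Sum>r\<in>UNIV. Poly_Mapping.single (\<alpha> r) (param s r))"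
  by (simp add: f_poly_def sum_UNIV_indices sum_vertex_indices param_def assms add_ac)

lemma laurent_eval_f_poly:
  assumes "\<alpha> (Inr False) = 0"
  shows "laurent_eval (f_poly \<alpha> s) x = fam \<alpha> (param s) x"
  by (simp add: f_poly_eq[of \<alpha>, OF assms] laurent_eval_sum laurent_eval_single fam_def)

lemma laurent_log_deriv_f_poly:
  assumes "\<alpha> (Inr False) = 0" and x: "x \<in> torus"
  shows "laurent_log_deriv k (f_poly \<alpha> s) x = x $ k * fam' \<alpha> k (param s) x"
proof -
  have "x $ k \<noteq> 0" using x by (simp add: torus_def)
  then show ?thesis
    by (simp add: f_poly_eq[of \<alpha>, OF assms(1)] laurent_log_deriv_sum laurent_log_deriv_single fam'_def sum_distrib_left mult_ac)
qed

definition integrand :: "('n::finite + bool \<Rightarrow> int^'n) \<Rightarrow> nat \<Rightarrow> int^'n \<Rightarrow> ('n + bool \<Rightarrow> complex) \<Rightarrow> complex^'n \<Rightarrow> complex" where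
  "integrand \<alpha> k J a x = fact (k - 1) * laurent_monom J x / fam \<alpha> a x ^ k / (\<Prod>i\<in>UNIV. x $ i)"

lemma period_integrand_f_poly: "\<alpha> (Inr False) = 0 \<Longrightarrow> period_integrand (f_poly \<alpha> s) k J = integrand \<alpha> k J (param s)"
  by (rule ext) (simp add: period_integrand_def integrand_def laurent_eval_f_poly)

lemma zero_locus_f_poly: "\<alpha> (Inr False) = 0 \<Longrightarrow> zero_locus (f_poly \<alpha> s) = {x \<in> torus. fam \<alpha> (param s) x = 0}"
  by (simp add: zero_locus_def laurent_eval_f_poly)

lemma holomorphic_integrand:
  assumes S: "S \<subseteq> torus" "\<And>x. x \<in> S \<Longrightarrow> fam \<alpha> a x \<noteq> 0"
  shows "holomorphic_several S (integrand \<alpha> k J a :: complex^'n::{finite,linorder} \<Rightarrow> complex)"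
proof -
  interpret holomorphic_family "\<lambda>t::complex. fam \<alpha> a" "\<lambda>k t. fam' \<alpha> k a" torus by (rule holomorphic_family_fam) simp
  have "holomorphic_several torus (fam \<alpha> a)"
    unfolding holomorphic_several_def
    by (intro exI[of _ "\<lambda>k. fam' \<alpha> k a"] conjI ballI allI F_deriv F'_comp_cont continuous_on_id continuous_on_const) auto
  then have f: "holomorphic_several S (fam \<alpha> a)" using S(1) by (rule holomorphic_several_subset)
  have m: "holomorphic_several S (laurent_monom b)" for b :: "int^'n::_"
    using holomorphic_laurent_monom S(1) by (rule holomorphic_several_subset)
  have inv: "(\<Prod>i\<in>UNIV. inverse (x $ i)) = inverse (\<Prod>i\<in>UNIV. x $ i)" for x :: "complex^'n::_"
    using prod_inversef[of "\<lambda>i. x $ i" UNIV] by (simp add: comp_def)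
  have eq: "integrand \<alpha> k J a = (\<lambda>x. fact (k - 1) * laurent_monom J x * inverse (fam \<alpha> a x) ^ k * laurent_monom (\<chi> i. - 1) x)"
    by (simp add: integrand_def laurent_monom_def power_int_minus inv divide_inverse power_inverse mult_ac fun_eq_iff)
  show ?thesis unfolding eq
    by (intro holomorphic_several_mult holomorphic_several_const holomorphic_several_power holomorphic_several_inverse m f S(2))
qed

section \<open>Integrals over a fixed smooth chain\<close>

text \<open>The integral of every continuous function over a smooth simplex is the integral against one fixed density.\<close>

lemma smooth_simplex_integralE:
  fixes \<sigma> :: "(nat \<Rightarrow> real) \<Rightarrow> complex^'n::{finite,linorder}"
  assumes "smooth_simplex \<sigma>"
  obtains y D where "continuous_on corner_simplex y" "continuous_on corner_simplex D"
    "y ` corner_simplex = \<sigma> ` standard_simplex CARD('n)"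
    "\<And>g. continuous_on (\<sigma> ` standard_simplex CARD('n)) g \<Longrightarrow> simplex_integral g \<sigma> = corner_integral (\<lambda>t :: real^'n::_. g (y t) * D t)"
proof -
  obtain F F' where F: "\<And>t. t \<in> corner_simplex \<Longrightarrow> (F has_derivative F' t) (at t)"
    and F': "\<And>v. continuous_on corner_simplex (\<lambda>t. F' t v)" and eq: "\<And>t. t \<in> corner_simplex \<Longrightarrow> F t = \<sigma> (bary t)"
    and int: "\<And>g. simplex_integral g \<sigma> = integral corner_simplex (\<lambda>t :: real^'n::_. g (F t) * det (\<chi> j. F' t (axis j 1)))"
    using smooth_simplexE[OF assms] by blast
  have y: "continuous_on corner_simplex F"
    using F by (intro continuous_at_imp_continuous_on ballI has_derivative_continuous) blast
  have D: "continuous_on corner_simplex (\<lambda>t. det (\<chi> j. F' t (axis j 1)))" by (intro continuous_on_det F')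
  have im: "F ` corner_simplex = \<sigma> ` standard_simplex CARD('n)"
    unfolding image_bary[symmetric] image_image using eq by (intro image_cong) auto
  show thesis
  proof (rule that[OF y D im])
    fix g :: "complex^'n::_ \<Rightarrow> complex" assume g: "continuous_on (\<sigma> ` standard_simplex CARD('n)) g"
    have "continuous_on corner_simplex (\<lambda>t. g (F t) * det (\<chi> j. F' t (axis j 1)))"
      by (intro continuous_intros D continuous_on_compose2[OF g y]) (simp add: im)
    then show "simplex_integral g \<sigma> = corner_integral (\<lambda>t. g (F t) * det (\<chi> j. F' t (axis j 1)))"
      unfolding int by (rule integral_corner_simplex)
  qed
qed

lemma simplex_integral_cong:
  fixes \<sigma> :: "(nat \<Rightarrow> real) \<Rightarrow> complex^'n::{finite,linorder}"
  assumes "\<And>x. x \<in> \<sigma> ` standard_simplex CARD('n) \<Longrightarrow> g x = h x"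
  shows "simplex_integral g \<sigma> = simplex_integral h \<sigma>"
  unfolding simplex_integral_def
  by (rule Henstock_Kurzweil_Integration.integral_cong) (use assms bary_in_standard_simplex in auto)

lemma chain_integral_cong:
  fixes c :: "(complex^'n::{finite,linorder}) chain"
  assumes "\<And>x. x \<in> chain_support CARD('n) c \<Longrightarrow> g x = h x"
  shows "chain_integral g c = chain_integral h c"
  unfolding chain_integral_def
  by (intro sum.cong refl arg_cong2[where f = "(*)"] simplex_integral_cong) (use assms in \<open>auto simp: chain_support_def\<close>)

lemma chain_integral_mult_left: "chain_integral (\<lambda>x. a * g x) c = a * chain_integral g c"
  by (simp add: chain_integral_def simplex_integral_def sum_distrib_left mult_ac
      flip: Henstock_Kurzweil_Integration.integral_mult_right)

lemma chain_integral_integrand_add: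
  fixes c :: "(complex^'n::{finite,linorder}) chain"
  assumes sm: "\<And>\<sigma>. \<sigma> \<in> Poly_Mapping.keys c \<Longrightarrow> smooth_simplex \<sigma>"
    and g: "continuous_on (chain_support CARD('n) c) g" and h: "continuous_on (chain_support CARD('n) c) h"
  shows "chain_integral (\<lambda>x. g x + h x) c = chain_integral g c + chain_integral h c"
proof -
  have "simplex_integral (\<lambda>x. g x + h x) \<sigma> = simplex_integral g \<sigma> + simplex_integral h \<sigma>" if \<sigma>: "\<sigma> \<in> Poly_Mapping.keys c" for \<sigma>
  proof -
    have gs: "continuous_on (\<sigma> ` standard_simplex CARD('n)) g" "continuous_on (\<sigma> ` standard_simplex CARD('n)) h"
      by (rule continuous_on_subset[OF g] continuous_on_subset[OF h], use \<sigma> in \<open>force simp: chain_support_def\<close>)+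
    obtain y D where y: "continuous_on corner_simplex y" and D: "continuous_on corner_simplex D"
      and im: "y ` corner_simplex = \<sigma> ` standard_simplex CARD('n)"
      and int: "\<And>g. continuous_on (\<sigma> ` standard_simplex CARD('n)) g \<Longrightarrow> simplex_integral g \<sigma> = corner_integral (\<lambda>t :: real^'n::_. g (y t) * D t)"
      using smooth_simplex_integralE[OF sm[OF \<sigma>]] by blast
    have "continuous_on corner_simplex (\<lambda>t. g (y t) * D t)" "continuous_on corner_simplex (\<lambda>t. h (y t) * D t)"
      by (intro continuous_intros D continuous_on_compose2[OF gs(1) y] continuous_on_compose2[OF gs(2) y]; simp add: im)+
    then have "set_integrable lborel corner_simplex (\<lambda>t. g (y t) * D t)" "set_integrable lborel corner_simplex (\<lambda>t. h (y t) * D t)"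
      by (auto intro: set_integrable_compact compact_corner_simplex)
    from set_integral_add(2)[OF this] show ?thesis
      by (simp add: int gs continuous_on_add distrib_right)
  qed
  then show ?thesis by (simp add: chain_integral_def distrib_left sum.distrib)
qed

lemma chain_integral_integrand_sum:
  fixes c :: "(complex^'n::{finite,linorder}) chain"
  assumes "\<And>\<sigma>. \<sigma> \<in> Poly_Mapping.keys c \<Longrightarrow> smooth_simplex \<sigma>" "finite R"
    and "\<And>r. r \<in> R \<Longrightarrow> continuous_on (chain_support CARD('n) c) (g r)"
  shows "chain_integral (\<lambda>x. \<Sum>r\<in>R. a r * g r x) c = (\<Sum>r\<in>R. a r * chain_integral (g r) c)"
  using assms(2,3)
proof (induction R)
  case empty
  then show ?case by (simp add: chain_integral_def simplex_integral_def)
next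
  case (insert r R)
  have "chain_integral (\<lambda>x. a r * g r x + (\<Sum>r\<in>R. a r * g r x)) c = chain_integral (\<lambda>x. a r * g r x) c + chain_integral (\<lambda>x. \<Sum>r\<in>R. a r * g r x) c"
    by (rule chain_integral_integrand_add[OF assms(1)]) (use insert in \<open>auto intro!: continuous_intros\<close>)
  then show ?case using insert by (simp add: chain_integral_mult_left)
qed

text \<open>Dominated convergence for the difference quotients, which the mean value theorem bounds by the maximum of the
  derivative on a compact set.\<close>

lemma LINT_has_field_derivative:
  fixes h h' :: "complex \<Rightarrow> 'a::euclidean_space \<Rightarrow> complex"
  assumes S: "compact S" and \<rho>: "0 < \<rho>"
    and h: "\<And>t y. t \<in> ball t0 \<rho> \<Longrightarrow> y \<in> S \<Longrightarrow> ((\<lambda>t. h t y) has_field_derivative h' t y) (at t)"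
    and hc: "\<And>t. t \<in> ball t0 \<rho> \<Longrightarrow> continuous_on S (h t)"
    and h'c: "continuous_on (ball t0 \<rho> \<times> S) (\<lambda>(t, y). h' t y)"
  shows "((\<lambda>t. LINT y:S|lborel. h t y) has_field_derivative (LINT y:S|lborel. h' t0 y)) (at t0)"
  unfolding DERIV_def tendsto_at_iff_sequentially
proof (intro allI impI)
  fix z :: "nat \<Rightarrow> complex" assume z0: "\<forall>i. z i \<in> UNIV - {0}" and z: "z \<longlonglongrightarrow> 0"
  have sub: "cball t0 (\<rho> / 2) \<subseteq> ball t0 \<rho>" using \<rho> by auto
  have "compact ((\<lambda>(t, y). h' t y) ` (cball t0 (\<rho> / 2) \<times> S))"
    using S sub by (intro compact_continuous_image continuous_on_subset[OF h'c] compact_Times) auto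
  then have "bounded ((\<lambda>(t, y). h' t y) ` (cball t0 (\<rho> / 2) \<times> S))" by (rule compact_imp_bounded)
  then obtain M where M0: "\<forall>z\<in>(\<lambda>(t, y). h' t y) ` (cball t0 (\<rho> / 2) \<times> S). norm z \<le> M"
    unfolding bounded_iff by (rule exE)
  have M: "norm (h' t y) \<le> M" if "t \<in> cball t0 (\<rho> / 2)" "y \<in> S" for t y
  proof -
    have "(\<lambda>(t, y). h' t y) (t, y) \<in> (\<lambda>(t, y). h' t y) ` (cball t0 (\<rho> / 2) \<times> S)"
      using that by (intro imageI SigmaI)
    from bspec[OF M0 this] show ?thesis by simp
  qed
  have t0: "t0 \<in> ball t0 \<rho>" using \<rho> by simp
  have h'c0: "continuous_on S (h' t0)"
  proof -
    have "continuous_on S (\<lambda>y. (\<lambda>(t, y). h' t y) (t0, y))"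
      by (rule continuous_on_compose2[OF h'c]) (use t0 in \<open>auto intro!: continuous_intros\<close>)
    then show ?thesis by simp
  qed
  from z have "\<forall>\<^sub>F i in sequentially. dist (z i) 0 < \<rho> / 2" using \<rho> by (intro tendstoD) auto
  then obtain N where N: "\<And>i. i \<ge> N \<Longrightarrow> norm (z i) < \<rho> / 2" by (auto simp: eventually_sequentially)
  have zb: "t0 + z (i + N) \<in> ball t0 \<rho>" "t0 + z (i + N) \<in> cball t0 (\<rho> / 2)" for i
    using N[of "i + N"] \<rho> by (auto simp: dist_norm)
  let ?q = "\<lambda>i y. (h (t0 + z (i + N)) y - h t0 y) / z (i + N)"
  have qc: "continuous_on S (?q i)" for i using z0 by (intro continuous_intros hc zb t0) auto
  have "(\<lambda>i. LINT y|lborel. indicator S y *\<^sub>R ?q i y) \<longlonglongrightarrow> (LINT y|lborel. indicator S y *\<^sub>R h' t0 y)"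
  proof (rule integral_dominated_convergence[where w = "\<lambda>y. indicator S y *\<^sub>R M"])
    show "(\<lambda>y. indicator S y *\<^sub>R h' t0 y) \<in> borel_measurable lborel"
      using set_integrable_compact[OF S h'c0] unfolding set_integrable_def by (rule borel_measurable_integrable)
    show "(\<lambda>y. indicator S y *\<^sub>R ?q i y) \<in> borel_measurable lborel" for i
      using set_integrable_compact[OF S qc] unfolding set_integrable_def by (rule borel_measurable_integrable)
    show "integrable lborel (\<lambda>y. indicator S y *\<^sub>R M)"
      using set_integrable_compact[OF S continuous_on_const] unfolding set_integrable_def .
    show "AE y in lborel. (\<lambda>i. indicator S y *\<^sub>R ?q i y) \<longlonglongrightarrow> indicator S y *\<^sub>R h' t0 y"
    proof (rule AE_I2)
      fix y
      show "(\<lambda>i. indicator S y *\<^sub>R ?q i y) \<longlonglongrightarrow> indicator S y *\<^sub>R h' t0 y"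
      proof (cases "y \<in> S")
        case True
        have "(\<lambda>i. (h (t0 + z i) y - h t0 y) / z i) \<longlonglongrightarrow> h' t0 y"
          using h[OF t0 True] z0 z unfolding DERIV_def tendsto_at_iff_sequentially comp_def by blast
        from LIMSEQ_ignore_initial_segment[OF this, of N] show ?thesis using True by simp
      qed simp
    qed
    show "AE y in lborel. norm (indicator S y *\<^sub>R ?q i y) \<le> indicator S y *\<^sub>R M" for i
    proof (rule AE_I2)
      fix y
      show "norm (indicator S y *\<^sub>R ?q i y) \<le> indicator S y *\<^sub>R M"
      proof (cases "y \<in> S")
        case True
        have "norm (h (t0 + z (i + N)) y - h t0 y) \<le> M * norm (t0 + z (i + N) - t0)"
          by (rule field_differentiable_bound[of "cball t0 (\<rho> / 2)" "\<lambda>t. h t y" "\<lambda>t. h' t y"])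
            (use M True h sub zb(2)[of i] \<rho> in \<open>auto intro: has_field_derivative_at_within\<close>)
        then show ?thesis using True z0 by (simp add: norm_divide divide_le_eq)
      qed simp
    qed
  qed
  then have lim: "(\<lambda>i. LINT y:S|lborel. ?q i y) \<longlonglongrightarrow> (LINT y:S|lborel. h' t0 y)"
    by (simp only: set_lebesgue_integral_def)
  have "(LINT y:S|lborel. ?q i y) = ((LINT y:S|lborel. h (t0 + z (i + N)) y) - (LINT y:S|lborel. h t0 y)) / z (i + N)" for i
    using set_integral_diff(2)[OF set_integrable_compact[OF S hc[OF zb(1)[of i]]] set_integrable_compact[OF S hc[OF t0]]]
    by (simp add: set_integral_divide_zero)
  with lim have "(\<lambda>i. ((LINT y:S|lborel. h (t0 + z (i + N)) y) - (LINT y:S|lborel. h t0 y)) / z (i + N)) \<longlonglongrightarrow> (LINT y:S|lborel. h' t0 y)"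
    by (simp only:)
  then have "(\<lambda>i. ((LINT y:S|lborel. h (t0 + z i) y) - (LINT y:S|lborel. h t0 y)) / z i) \<longlonglongrightarrow> (LINT y:S|lborel. h' t0 y)"
    by (rule LIMSEQ_offset)
  then show "((\<lambda>w. ((LINT y:S|lborel. h (t0 + w) y) - (LINT y:S|lborel. h t0 y)) / w) \<circ> z) \<longlonglongrightarrow> (LINT y:S|lborel. h' t0 y)"
    by (simp add: comp_def)
qed

lemma chain_integral_has_field_derivative:
  fixes c :: "(complex^'n::{finite,linorder}) chain"
  defines "K \<equiv> chain_support CARD('n) c"
  assumes sm: "\<And>\<sigma>. \<sigma> \<in> Poly_Mapping.keys c \<Longrightarrow> smooth_simplex \<sigma>" and \<rho>: "0 < \<rho>"
    and h: "\<And>t x. t \<in> ball t0 \<rho> \<Longrightarrow> x \<in> K \<Longrightarrow> ((\<lambda>t. h t x) has_field_derivative h' t x) (at t)"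
    and hc: "\<And>t. t \<in> ball t0 \<rho> \<Longrightarrow> continuous_on K (h t)"
    and h'c: "continuous_on (ball t0 \<rho> \<times> K) (\<lambda>(t, x). h' t x)"
  shows "((\<lambda>t. chain_integral (h t) c) has_field_derivative chain_integral (h' t0) c) (at t0)"
  unfolding chain_integral_def
proof (rule DERIV_sum)
  fix \<sigma> assume \<sigma>: "\<sigma> \<in> Poly_Mapping.keys c"
  have sub: "\<sigma> ` standard_simplex CARD('n) \<subseteq> K" using \<sigma> by (auto simp: K_def chain_support_def)
  obtain y D where y: "continuous_on corner_simplex y" and D: "continuous_on corner_simplex D"
    and im: "y ` corner_simplex = \<sigma> ` standard_simplex CARD('n)"
    and int: "\<And>g. continuous_on (\<sigma> ` standard_simplex CARD('n)) g \<Longrightarrow> simplex_integral g \<sigma> = corner_integral (\<lambda>t :: real^'n::_. g (y t) * D t)"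
    using smooth_simplex_integralE[OF sm[OF \<sigma>]] by blast
  have yK: "y u \<in> K" if "u \<in> corner_simplex" for u using im sub that by auto
  have t0: "t0 \<in> ball t0 \<rho>" using \<rho> by simp
  have "((\<lambda>t. corner_integral (\<lambda>u. h t (y u) * D u)) has_field_derivative corner_integral (\<lambda>u. h' t0 (y u) * D u)) (at t0)"
  proof (rule LINT_has_field_derivative[OF compact_corner_simplex \<rho>])
    show "((\<lambda>t. h t (y u) * D u) has_field_derivative h' t (y u) * D u) (at t)" if "t \<in> ball t0 \<rho>" "u \<in> corner_simplex" for t u
      using h[OF that(1) yK[OF that(2)]] by (rule DERIV_cmult_right)
    show "continuous_on corner_simplex (\<lambda>u. h t (y u) * D u)" if "t \<in> ball t0 \<rho>" for t
      by (intro continuous_intros D continuous_on_compose2[OF hc[OF that] y]) (use yK in auto)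
    have "continuous_on (ball t0 \<rho> \<times> corner_simplex) (\<lambda>z. (\<lambda>(t, x). h' t x) (fst z, y (snd z)))"
      by (rule continuous_on_compose2[OF h'c])
        (auto intro!: continuous_intros continuous_on_compose2[OF y] yK)
    then show "continuous_on (ball t0 \<rho> \<times> corner_simplex) (\<lambda>(t, u). h' t (y u) * D u)"
      unfolding case_prod_unfold by (intro continuous_intros continuous_on_compose2[OF D]) auto
  qed
  moreover have "simplex_integral (h' t0) \<sigma> = corner_integral (\<lambda>u. h' t0 (y u) * D u)"
  proof (rule int)
    have "continuous_on K (\<lambda>x. (\<lambda>(t, x). h' t x) (t0, x))"
      by (rule continuous_on_compose2[OF h'c]) (use t0 in \<open>auto intro!: continuous_intros\<close>)
    then show "continuous_on (\<sigma> ` standard_simplex CARD('n)) (h' t0)" using sub by (auto intro: continuous_on_subset)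
  qed
  moreover have ev: "\<forall>\<^sub>F t in nhds t0. simplex_integral (h t) \<sigma> = corner_integral (\<lambda>u. h t (y u) * D u)"
    using eventually_nhds_in_open[OF open_ball t0]
    by eventually_elim (rule int, rule continuous_on_subset[OF hc sub])
  ultimately have "((\<lambda>t. simplex_integral (h t) \<sigma>) has_field_derivative simplex_integral (h' t0) \<sigma>) (at t0)"
    by (simp only: DERIV_cong_ev[OF refl ev refl])
  then show "((\<lambda>t. of_int (Poly_Mapping.lookup c \<sigma>) * simplex_integral (h t) \<sigma>) has_field_derivative
      of_int (Poly_Mapping.lookup c \<sigma>) * simplex_integral (h' t0) \<sigma>) (at t0)"
    by (rule DERIV_cmult)
qed

section \<open>The hypergeometric system of the period integrals\<close>

lemma integrand_deriv:
  assumes a: "\<And>r. ((\<lambda>t. a t r) has_field_derivative a' r) (at t)" and nz: "fam \<alpha> (a t) x \<noteq> 0" and x: "x \<in> torus" and k: "k \<ge> 1"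
  shows "((\<lambda>t. integrand \<alpha> k J (a t) x) has_field_derivative
     - (\<Sum>r\<in>UNIV. a' r * integrand \<alpha> (Suc k) (J + \<alpha> r) (a t) x)) (at (t :: complex))"
proof -
  have px: "(\<Prod>i\<in>UNIV. x $ i) \<noteq> 0" using x by (simp add: torus_def)
  have d: "((\<lambda>t. fam \<alpha> (a t) x) has_field_derivative (\<Sum>r\<in>UNIV. a' r * laurent_monom (\<alpha> r) x)) (at t)"
    unfolding fam_def by (intro DERIV_sum DERIV_cmult_right a)
  have "((\<lambda>t. fact (k - 1) * laurent_monom J x / (\<Prod>i\<in>UNIV. x $ i) * inverse (fam \<alpha> (a t) x ^ k)) has_field_derivative
     fact (k - 1) * laurent_monom J x / (\<Prod>i\<in>UNIV. x $ i) *
      - (inverse (fam \<alpha> (a t) x ^ k) * (of_nat k * ((\<Sum>r\<in>UNIV. a' r * laurent_monom (\<alpha> r) x) * fam \<alpha> (a t) x ^ (k - Suc 0))) * inverse (fam \<alpha> (a t) x ^ k))) (at t)"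
    by (intro DERIV_cmult DERIV_inverse' DERIV_power d) (use nz in auto)
  moreover have "fact (k - 1) * laurent_monom J x / (\<Prod>i\<in>UNIV. x $ i) *
      - (inverse (fam \<alpha> (a t) x ^ k) * (of_nat k * ((\<Sum>r\<in>UNIV. a' r * laurent_monom (\<alpha> r) x) * fam \<alpha> (a t) x ^ (k - Suc 0))) * inverse (fam \<alpha> (a t) x ^ k))
     = - (\<Sum>r\<in>UNIV. a' r * integrand \<alpha> (Suc k) (J + \<alpha> r) (a t) x)"
  proof -
    obtain m where m: "k = Suc m" using k by (cases k) auto
    have eq: "(\<Sum>r\<in>UNIV. a' r * integrand \<alpha> (Suc k) (J + \<alpha> r) (a t) x)
      = fact k * laurent_monom J x / fam \<alpha> (a t) x ^ Suc k / (\<Prod>i\<in>UNIV. x $ i) * (\<Sum>r\<in>UNIV. a' r * laurent_monom (\<alpha> r) x)"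
      by (simp add: integrand_def laurent_monom_add[OF x] sum_distrib_left sum_divide_distrib mult_ac)
    show ?thesis unfolding eq unfolding m using nz px by (simp add: field_simps)
  qed
  ultimately show ?thesis unfolding integrand_def by (simp add: divide_inverse mult_ac)
qed

lemma euler_integrand:
  assumes nz: "fam \<alpha> a x \<noteq> 0" and x: "x \<in> torus" and k: "k \<ge> 1"
  shows "(\<Sum>r\<in>UNIV. a r * integrand \<alpha> (Suc k) (J + \<alpha> r) a x) = of_nat k * integrand \<alpha> k J a x"
proof -
  obtain m where m: "k = Suc m" using k by (cases k) auto
  have "(\<Sum>r\<in>UNIV. a r * integrand \<alpha> (Suc k) (J + \<alpha> r) a x)
      = fact k * laurent_monom J x / fam \<alpha> a x ^ Suc k / (\<Prod>i\<in>UNIV. x $ i) * (\<Sum>r\<in>UNIV. a r * laurent_monom (\<alpha> r) x)"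
    by (simp add: integrand_def laurent_monom_add[OF x] sum_distrib_left sum_divide_distrib mult_ac)
  also have "(\<Sum>r\<in>UNIV. a r * laurent_monom (\<alpha> r) x) = fam \<alpha> a x" by (simp add: fam_def)
  finally show ?thesis using nz by (simp add: integrand_def m)
qed

definition torus_scale :: "'n::finite \<Rightarrow> complex \<Rightarrow> complex^'n \<Rightarrow> complex^'n" where
  "torus_scale i u x = (\<chi> l. (if l = i then u else 1) * x $ l)"

lemma laurent_monom_torus_scale: "laurent_monom b (torus_scale i u x) = u powi (b $ i) * laurent_monom b x"
proof -
  have "laurent_monom b (torus_scale i u x) = (\<Prod>l\<in>UNIV. (if l = i then u powi (b $ i) else 1) * (x $ l) powi (b $ l))"
    unfolding laurent_monom_def torus_scale_def by (intro prod.cong) (auto simp: power_int_mult_distrib)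
  then show ?thesis by (simp add: laurent_monom_def prod.distrib)
qed

lemma fam_torus_scale: "fam \<alpha> a (torus_scale i (exp w) x) = fam \<alpha> (\<lambda>r. a r * exp (of_int (\<alpha> r $ i) * w)) x"
  by (simp add: fam_def laurent_monom_torus_scale exp_power_int mult_ac)

lemma torus_scale_torus: "u \<noteq> 0 \<Longrightarrow> torus_scale i u x \<in> torus \<longleftrightarrow> x \<in> torus"
  by (auto simp: torus_scale_def torus_def)

lemma integrand_torus_scale:
  "exp w * integrand \<alpha> k J a (torus_scale i (exp w) x)
    = exp (of_int (J $ i) * w) * integrand \<alpha> k J (\<lambda>r. a r * exp (of_int (\<alpha> r $ i) * w)) x"
proof -
  have "(\<Prod>l\<in>UNIV. torus_scale i (exp w) x $ l) = exp w * (\<Prod>l\<in>UNIV. x $ l)"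
    by (simp add: torus_scale_def prod.distrib)
  then show ?thesis
    by (simp add: integrand_def fam_torus_scale laurent_monom_torus_scale exp_power_int)
qed

lemma Ck_on_bounded_linear:
  assumes "bounded_linear L" "Ck_on m S f" shows "Ck_on m S (\<lambda>x. L (f x))"
  using assms(2)
proof (induction m arbitrary: f)
  case 0
  then show ?case using bounded_linear.continuous_on[OF assms(1)] by simp
next
  case (Suc m)
  then obtain f' where "\<And>x. x \<in> S \<Longrightarrow> (f has_derivative f' x) (at x)" "\<And>v. Ck_on m S (\<lambda>x. f' x v)" by auto
  then show ?case unfolding Ck_on.simps
    by (intro exI[of _ "\<lambda>x v. L (f' x v)"] conjI ballI allI Suc.IH bounded_linear.has_derivative[OF assms(1)])
qed

lemma bounded_linear_torus_scale: "bounded_linear (torus_scale i u)"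
proof -
  have "bounded_linear (\<lambda>x :: complex^'a. (if l = i then u else 1) * x $ l)" for l
    using bounded_linear_const_mult[OF bounded_linear_vec_nth] by blast
  then show ?thesis unfolding linear_conv_bounded_linear[symmetric] torus_scale_def
    by (auto simp: linear_iff vec_eq_iff algebra_simps)
qed

text \<open>The Jacobian determinant is multiplied by u, as one of its rows is.\<close>

lemma
  fixes \<sigma> :: "(nat \<Rightarrow> real) \<Rightarrow> complex^'n::{finite,linorder}"
  assumes "smooth_simplex \<sigma>"
  shows smooth_simplex_torus_scale: "smooth_simplex (simplex_map CARD('n) (torus_scale i u) \<sigma>)"
    and simplex_integral_torus_scale: "simplex_integral g (simplex_map CARD('n) (torus_scale i u) \<sigma>) = simplex_integral (\<lambda>x. u * g (torus_scale i u x)) \<sigma>"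
proof -
  let ?M = "torus_scale i u :: complex^'n::_ \<Rightarrow> _"
  let ?\<tau> = "simplex_map CARD('n) ?M \<sigma>"
  have \<tau>: "?\<tau> (bary t) = ?M (\<sigma> (bary t))" if "t \<in> corner_simplex" for t :: "real^'n::_"
    using that by (simp add: simplex_map_def bary_in_standard_simplex)
  obtain S :: "(real^'n::_) set" and F where S: "open S" "corner_simplex \<subseteq> S" "smooth_on S F" and F: "\<forall>t\<in>corner_simplex. F t = \<sigma> (bary t)"
    using assms unfolding smooth_simplex_def by blast
  have "smooth_on S (\<lambda>t. ?M (F t))"
    using S(3) Ck_on_bounded_linear[OF bounded_linear_torus_scale] unfolding smooth_on_def by blast
  then show "smooth_simplex ?\<tau>"
    unfolding smooth_simplex_def using S F \<tau> by (intro exI[of _ S] exI[of _ "\<lambda>t. ?M (F t)"]) auto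
  obtain F F' where F: "\<And>t :: real^'n::_. t \<in> corner_simplex \<Longrightarrow> (F has_derivative F' t) (at t)" "\<And>t. t \<in> corner_simplex \<Longrightarrow> F t = \<sigma> (bary t)"
    using smooth_simplexE[OF assms] by metis
  have int: "t \<in> corner_simplex" if "t \<in> interior corner_simplex" for t :: "real^'n::_" using that interior_subset by blast
  have "simplex_integral g ?\<tau> = integral corner_simplex (\<lambda>t. g (?M (F t)) * det (\<chi> i j. ?M (F' t (axis j 1)) $ i))"
    by (rule simplex_integral_smooth) (auto intro!: bounded_linear.has_derivative[OF bounded_linear_torus_scale] F int simp: F(2) \<tau>)
  also have "\<dots> = integral corner_simplex (\<lambda>t. u * g (?M (F t)) * det (\<chi> i j. F' t (axis j 1) $ i))"
  proof (rule Henstock_Kurzweil_Integration.integral_cong)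
    fix t :: "real^'n::_"
    have "(\<chi> l j. ?M (F' t (axis j 1)) $ l) = (\<chi> l. (if l = i then u else 1) *s (\<chi> j. F' t (axis j 1) $ l))"
      by (simp add: vec_eq_iff torus_scale_def)
    then have "det (\<chi> l j. ?M (F' t (axis j 1)) $ l) = u * det (\<chi> l j. F' t (axis j 1) $ l)"
      by (simp only: det_rows_mul) simp
    then show "g (?M (F t)) * det (\<chi> l j. ?M (F' t (axis j 1)) $ l) = u * g (?M (F t)) * det (\<chi> i j. F' t (axis j 1) $ i)" by simp
  qed
  also have "\<dots> = simplex_integral (\<lambda>x. u * g (?M x)) \<sigma>"
    by (rule simplex_integral_smooth[symmetric]) (auto intro: F int)
  finally show "simplex_integral g ?\<tau> = simplex_integral (\<lambda>x. u * g (?M x)) \<sigma>" .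
qed

text \<open>A smooth cycle in the complement of the hypersurface with coefficients a.\<close>

locale period_cycle =
  fixes \<alpha> :: "'n::{finite,linorder} + bool \<Rightarrow> int^'n::_" and a :: "'n + bool \<Rightarrow> complex" and c :: "(complex^'n::_) chain"
  assumes cyc: "cycle CARD('n) {x \<in> torus. fam \<alpha> a x \<noteq> 0} c"
    and smooth: "\<And>\<sigma>. \<sigma> \<in> Poly_Mapping.keys c \<Longrightarrow> smooth_simplex \<sigma>"
begin

abbreviation "K \<equiv> chain_support CARD('n) c"

definition Y :: "nat \<Rightarrow> int^'n::_ \<Rightarrow> ('n + bool \<Rightarrow> complex) \<Rightarrow> complex" where
  "Y k J b = chain_integral (integrand \<alpha> k J b) c"

lemma K: "compact K" "K \<subseteq> {x \<in> torus. fam \<alpha> a x \<noteq> 0}"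
  using cyc compact_chain_support unfolding cycle_def singular_cycle by blast+

lemma integrand_continuous:
  assumes a: "\<And>r. continuous_on UNIV (\<lambda>t::complex. b t r)"
    and nz: "\<And>t x. t \<in> A \<Longrightarrow> x \<in> K \<Longrightarrow> fam \<alpha> (b t) x \<noteq> 0"
  shows "continuous_on (A \<times> K) (\<lambda>(t, x). integrand \<alpha> k J (b t) x)"
proof -
  interpret holomorphic_family "\<lambda>t. fam \<alpha> (b t)" "\<lambda>k t. fam' \<alpha> k (b t)" torus by (rule holomorphic_family_fam[OF a])
  have x: "x \<in> torus" if "x \<in> K" for x using that K by auto
  then have x': "x $ i \<noteq> 0" if "x \<in> K" for x i using that by (auto simp: torus_def)
  show ?thesis unfolding integrand_def case_prod_unfold
    by (intro continuous_intros F_comp_cont) (use x x' nz in auto)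
qed

lemma Y_deriv:
  assumes b: "\<And>t r. ((\<lambda>t. b t r) has_field_derivative b' t r) (at t)" and b': "\<And>r. continuous_on UNIV (\<lambda>t. b' t r)"
    and nz: "\<And>x. x \<in> K \<Longrightarrow> fam \<alpha> (b t0) x \<noteq> 0" and k: "k \<ge> 1"
  shows "((\<lambda>t. Y k J (b t)) has_field_derivative - (\<Sum>r\<in>UNIV. b' t0 r * Y (Suc k) (J + \<alpha> r) (b t0))) (at t0)"
proof -
  have bc: "continuous_on UNIV (\<lambda>t. b t r)" for r
    using b by (intro continuous_at_imp_continuous_on ballI DERIV_isCont)
  interpret holomorphic_family "\<lambda>t. fam \<alpha> (b t)" "\<lambda>k t. fam' \<alpha> k (b t)" torus by (rule holomorphic_family_fam[OF bc])
  have KX: "K \<subseteq> X s \<longleftrightarrow> (\<forall>x\<in>K. fam \<alpha> (b s) x \<noteq> 0)" for s using K by (auto simp: X_def Z_def)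
  have "\<forall>\<^sub>F s in nhds t0. K \<subseteq> X s" by (rule eventually_avoids) (use K nz KX in auto)
  then obtain \<rho> where \<rho>: "0 < \<rho>" "\<And>s x. s \<in> ball t0 \<rho> \<Longrightarrow> x \<in> K \<Longrightarrow> fam \<alpha> (b s) x \<noteq> 0"
    unfolding KX eventually_nhds_metric by (auto simp: dist_commute)
  have cont: "continuous_on (ball t0 \<rho> \<times> K) (\<lambda>(t, x). integrand \<alpha> k J (b t) x)" for k J
    by (rule integrand_continuous[OF bc \<rho>(2)])
  have cont1: "continuous_on K (integrand \<alpha> k J (b t))" if "t \<in> ball t0 \<rho>" for k J t
  proof -
    have "continuous_on K (\<lambda>x. (\<lambda>(t, x). integrand \<alpha> k J (b t) x) (t, x))"
      by (rule continuous_on_compose2[OF cont]) (use that in \<open>auto intro!: continuous_intros\<close>)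
    then show ?thesis by simp
  qed
  have t0: "t0 \<in> ball t0 \<rho>" using \<rho> by simp
  have "((\<lambda>t. chain_integral (integrand \<alpha> k J (b t)) c) has_field_derivative
      chain_integral (\<lambda>x. - (\<Sum>r\<in>UNIV. b' t0 r * integrand \<alpha> (Suc k) (J + \<alpha> r) (b t0) x)) c) (at t0)"
  proof (rule chain_integral_has_field_derivative[OF smooth \<rho>(1)])
    show "((\<lambda>t. integrand \<alpha> k J (b t) x) has_field_derivative - (\<Sum>r\<in>UNIV. b' t r * integrand \<alpha> (Suc k) (J + \<alpha> r) (b t) x)) (at t)"
      if "t \<in> ball t0 \<rho>" "x \<in> K" for t x
      by (rule integrand_deriv[OF b]) (use that \<rho>(2) K k in auto)
    have "continuous_on (ball t0 \<rho> \<times> K) (\<lambda>z. b' (fst z) r)" for r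
      by (rule continuous_on_compose2[OF b']) (auto intro: continuous_intros)
    then show "continuous_on (ball t0 \<rho> \<times> K) (\<lambda>(t, x). - (\<Sum>r\<in>UNIV. b' t r * integrand \<alpha> (Suc k) (J + \<alpha> r) (b t) x))"
      using cont unfolding case_prod_unfold by (intro continuous_intros)
  qed (use cont1 in auto)
  moreover have "chain_integral (\<lambda>x. - (\<Sum>r\<in>UNIV. b' t0 r * integrand \<alpha> (Suc k) (J + \<alpha> r) (b t0) x)) c
     = - (\<Sum>r\<in>UNIV. b' t0 r * Y (Suc k) (J + \<alpha> r) (b t0))"
    using chain_integral_mult_left[of "-1" "\<lambda>x. \<Sum>r\<in>UNIV. b' t0 r * integrand \<alpha> (Suc k) (J + \<alpha> r) (b t0) x" c]
      chain_integral_integrand_sum[OF smooth finite cont1[OF t0], where R = UNIV and a = "b' t0"] by (simp add: Y_def)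
  ultimately show ?thesis by (simp add: Y_def)
qed

lemma integrand_continuous1: "continuous_on K (integrand \<alpha> k J a)"
proof -
  have "continuous_on (UNIV \<times> K) (\<lambda>(t :: complex, x). integrand \<alpha> k J a x)"
    by (rule integrand_continuous) (use K in auto)
  then have "continuous_on K (\<lambda>x. (\<lambda>(t :: complex, x). integrand \<alpha> k J a x) (0, x))"
    by (rule continuous_on_compose2) (auto intro!: continuous_intros)
  then show ?thesis by simp
qed

lemma Y_euler:
  assumes "k \<ge> 1" shows "(\<Sum>r\<in>UNIV. a r * Y (Suc k) (J + \<alpha> r) a) = of_nat k * Y k J a"
proof -
  have "(\<Sum>r\<in>UNIV. a r * Y (Suc k) (J + \<alpha> r) a) = chain_integral (\<lambda>x. \<Sum>r\<in>UNIV. a r * integrand \<alpha> (Suc k) (J + \<alpha> r) a x) c"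
    unfolding Y_def by (rule chain_integral_integrand_sum[OF smooth finite integrand_continuous1, symmetric])
  also have "\<dots> = chain_integral (\<lambda>x. of_nat k * integrand \<alpha> k J a x) c"
    by (rule chain_integral_cong, rule euler_integrand) (use K assms in auto)
  finally show ?thesis by (simp add: chain_integral_mult_left Y_def)
qed

text \<open>Scaling the i-th coordinate by \<open>e\<^sup>w\<close> moves the cycle within the complement for small w, so the integral over the
  scaled cycle is constant. Substitution turns it into \<open>e\<^sup>J\<^sup>w\<close> times the integral with coefficients
  \<open>a r e\<^sup>\<alpha>\<^sup>w\<close>; the derivative at w = 0 is the relation.\<close>

lemma Y_torus:
  assumes k: "k \<ge> 1" shows "(\<Sum>r\<in>UNIV. a r * of_int (\<alpha> r $ i) * Y (Suc k) (J + \<alpha> r) a) = of_int (J $ i) * Y k J a"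
proof -
  let ?n = "CARD('n)" and ?X = "{x \<in> torus. fam \<alpha> a x \<noteq> 0} :: (complex^'n::_) set"
  define b where "b w r = a r * exp (of_int (\<alpha> r $ i) * w)" for w r
  have b: "((\<lambda>w. b w r) has_field_derivative a r * (exp (of_int (\<alpha> r $ i) * w) * of_int (\<alpha> r $ i))) (at w)" for w r
    unfolding b_def by (auto intro!: derivative_eq_intros)
  have bc: "continuous_on UNIV (\<lambda>w. b w r)" for r unfolding b_def by (intro continuous_intros)
  have b0: "b 0 = a" by (simp add: b_def fun_eq_iff)
  interpret holomorphic_family "\<lambda>t. fam \<alpha> (b t)" "\<lambda>k t. fam' \<alpha> k (b t)" torus by (rule holomorphic_family_fam[OF bc])
  let ?M = "\<lambda>w. torus_scale i (exp w) :: complex^'n::_ \<Rightarrow> _"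
  have MX: "?M w x \<in> ?X \<longleftrightarrow> x \<in> X w" for w x
  proof -
    have "fam \<alpha> a (?M w x) = fam \<alpha> (b w) x" by (simp add: fam_torus_scale b_def[abs_def])
    then show ?thesis by (auto simp: X_def Z_def torus_scale_torus)
  qed
  have "\<forall>\<^sub>F s in nhds 0. K \<subseteq> X s" by (rule eventually_avoids) (use K in \<open>auto simp: X_def Z_def b0\<close>)
  then obtain d where d: "0 < d" "\<And>w. norm w < d \<Longrightarrow> K \<subseteq> X w"
    unfolding eventually_nhds_metric by (auto simp: dist_norm)
  have opX: "open ?X" 
  proof -
    have "?X = X 0" by (auto simp: X_def Z_def b0)
    then show ?thesis using open_X by simp
  qed
  have sc: "singular_chain ?n (top_of_set ?X) c" using cyc by (simp add: cycle_def singular_cycle)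
  have "holomorphic_several ?X (integrand \<alpha> k J a)" by (rule holomorphic_integrand) auto
  then obtain G where G: "\<forall>x\<in>?X. (integrand \<alpha> k J a has_derivative (\<lambda>v. \<Sum>k\<in>UNIV. G k x * v $ k)) (at x)"
      "\<forall>k. continuous_on ?X (G k)"
    unfolding holomorphic_several_def by (elim exE conjE)
  have const: "exp (of_int (J $ i) * w) * Y k J (b w) = Y k J a" if w: "norm w < d" for w
  proof -
    have tw: "K \<subseteq> X (of_real \<tau> * w)" if "\<tau> \<in> {0..1}" for \<tau>
    proof (rule d(2))
      have "\<tau> * norm w \<le> norm w" using that by (intro mult_left_le_one_le) auto
      then show "norm (of_real \<tau> * w) < d" using w that by (simp add: norm_mult)
    qed
    have MK: "?M (of_real \<tau> * w) x \<in> torus \<and> fam \<alpha> a (?M (of_real \<tau> * w) x) \<noteq> 0" if "0 \<le> \<tau>" "\<tau> \<le> 1" "x \<in> K" for \<tau> x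
      using tw[of \<tau>] MX[of "of_real \<tau> * w" x] that by auto
    have Mc: "continuous_on ({0..1} \<times> K) (\<lambda>(\<tau>, x). ?M (of_real \<tau> * w) x)"
    proof -
      have "continuous_on ({0..1} \<times> K) (\<lambda>z :: real \<times> (complex^'n::_). if l = i then exp (of_real (fst z) * w) else 1)" for l
        by (cases "l = i") (auto intro!: continuous_intros)
      then show ?thesis unfolding torus_scale_def case_prod_unfold by (intro continuous_intros)
    qed
    have "homotopic_with (\<lambda>h. h \<in> {} \<rightarrow> {}) (top_of_set K) (top_of_set ?X) (?M (of_real 0 * w)) (?M (of_real 1 * w))"
      unfolding homotopic_with_def
    proof (intro exI[of _ "\<lambda>(\<tau>, x). ?M (of_real \<tau> * w) x"] conjI)
      show "continuous_map (prod_topology (top_of_set {0..1}) (top_of_set K)) (top_of_set ?X) (\<lambda>(\<tau>, x). ?M (of_real \<tau> * w) x)"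
        using Mc MK by (auto simp: prod_topology_subtopology_eu)
    qed auto
    moreover have "cycle ?n K c" by (rule cycle_on_support[OF cyc]) simp
    ultimately have "homologous_rel ?n (top_of_set ?X) {} (chain_map ?n (?M (of_real 0 * w)) c) (chain_map ?n (?M (of_real 1 * w)) c)"
      unfolding cycle_def by (intro homotopic_imp_homologous_rel_chain_maps)
    moreover have "chain_map ?n (?M (of_real 0 * w)) c = c"
    proof (rule chain_map_id_gen[OF sc])
      show "?M (of_real 0 * w) x = x" if "x \<in> topspace (top_of_set ?X)" for x by (simp add: torus_scale_def vec_eq_iff)
    qed
    ultimately have hom: "homologous_rel ?n (top_of_set ?X) {} c (chain_map ?n (?M w) c)" by simp
    have c1: "cycle ?n ?X (chain_map ?n (?M w) c)"
    proof (rule cycle_chain_map[OF cyc])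
      show "continuous_on K (?M w)" by (rule bounded_linear.continuous_on[OF bounded_linear_torus_scale continuous_on_id])
      show "?M w ` K \<subseteq> ?X" using MK[of 1] by auto
    qed
    have "chain_integral (integrand \<alpha> k J a) c = chain_integral (integrand \<alpha> k J a) (chain_map ?n (?M w) c)"
    proof (rule chain_integral_homologous[OF opX bspec[OF G(1)] spec[OF G(2)] sc smooth _ _ hom])
      show "singular_chain ?n (top_of_set ?X) (chain_map ?n (?M w) c)" using c1 by (simp add: cycle_def singular_cycle)
      fix \<tau> assume "\<tau> \<in> Poly_Mapping.keys (chain_map ?n (?M w) c)"
      then obtain \<rho> where "\<rho> \<in> Poly_Mapping.keys c" "\<tau> = simplex_map ?n (?M w) \<rho>"
        using keys_frag_extend[of "frag_of \<circ> simplex_map ?n (?M w)" c] by (auto simp: chain_map_def)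
      then show "smooth_simplex \<tau>" using smooth_simplex_torus_scale smooth by blast
    qed
    also have "\<dots> = chain_integral (\<lambda>x. exp w * integrand \<alpha> k J a (?M w x)) c"
      unfolding chain_map_def chain_integral_frag_extend comp_def chain_integral_of
      unfolding chain_integral_def by (intro sum.cong refl) (simp add: simplex_integral_torus_scale smooth)
    also have "\<dots> = exp (of_int (J $ i) * w) * Y k J (b w)"
      by (simp add: integrand_torus_scale chain_integral_mult_left Y_def b_def[abs_def])
    finally show ?thesis by (simp add: Y_def)
  qed
  have "((\<lambda>w. Y k J (b w)) has_field_derivative - (\<Sum>r\<in>UNIV. a r * (exp (of_int (\<alpha> r $ i) * 0) * of_int (\<alpha> r $ i)) * Y (Suc k) (J + \<alpha> r) (b 0))) (at 0)"
    by (rule Y_deriv[OF b _ _ k]) (use K in \<open>auto simp: b0 intro!: continuous_intros\<close>)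
  then have "((\<lambda>w. exp (of_int (J $ i) * w) * Y k J (b w)) has_field_derivative
      of_int (J $ i) * Y k J a - (\<Sum>r\<in>UNIV. a r * of_int (\<alpha> r $ i) * Y (Suc k) (J + \<alpha> r) a)) (at 0)"
    by (auto intro!: derivative_eq_intros simp: b0)
  moreover have ev: "\<forall>\<^sub>F w in nhds 0. exp (of_int (J $ i) * w) * Y k J (b w) = Y k J a"
    using const d(1) unfolding eventually_nhds_metric by (auto simp: dist_norm)
  ultimately have "((\<lambda>w. Y k J a) has_field_derivative
      of_int (J $ i) * Y k J a - (\<Sum>r\<in>UNIV. a r * of_int (\<alpha> r $ i) * Y (Suc k) (J + \<alpha> r) a)) (at 0)"
    by (simp only: DERIV_cong_ev[OF refl ev refl])
  from DERIV_unique[OF this DERIV_const] show ?thesis by simp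
qed

end

section \<open>From the hypergeometric system to the operator\<close>

lemma L_matrix_nth: "L_matrix \<alpha> $ r $ Inl i = of_int (\<alpha> r $ i)" "L_matrix \<alpha> $ r $ Inr True = 1"
    "L_matrix \<alpha> $ r $ Inr False = (if r = Inr True then 1 else 0)"
  by (simp_all add: L_matrix_def)

lemma sum_UNIV_columns: "(\<Sum>c\<in>UNIV. f c) = (\<Sum>i\<in>UNIV. f (Inl i)) + f (Inr False) + f (Inr True)"
  for f :: "'n::finite + bool \<Rightarrow> 'a::comm_monoid_add"
  by (simp add: sum_UNIV_indices sum_vertex_indices add_ac)

text \<open>The vector \<open>(\<alpha> q', 0, 1)\<close> is the row q' of \<open>\<L>\<close>, and \<open>\<L>\<^sub>q\<close> is the q-th column of the inverse.\<close>

lemma L_form_shift: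
  fixes \<alpha> :: "'n::finite + bool \<Rightarrow> int^'n"
  assumes det: "det (L_matrix \<alpha> :: complex^('n + bool)^('n + bool)) \<noteq> 0" and q': "q' \<in> vertex_indices"
  shows "L_form \<alpha> q (J + (\<chi> i. int m * \<alpha> q' $ i)) z (k + m) = L_form \<alpha> q J z k + (if q' = q then of_nat m else 0)"
proof -
  let ?W = "matrix_inv (L_matrix \<alpha> :: complex^('n + bool)^('n + bool))"
  have "(\<Sum>c\<in>UNIV. L_matrix \<alpha> $ q' $ c * ?W $ c $ q) = (if q' = q then 1 else 0)"
    using matrix_inv_complex(1)[OF det] by (auto simp: matrix_matrix_mult_def mat_def vec_eq_iff)
  then have *: "(\<Sum>i\<in>UNIV. of_int (\<alpha> q' $ i) * ?W $ Inl i $ q) + ?W $ Inr True $ q = (if q' = q then 1 else 0)"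
    using q' by (simp add: sum_UNIV_columns L_matrix_nth vertex_indices_def)
  have sc: "(\<Sum>i\<in>UNIV. [: g i :]) = [: \<Sum>i\<in>UNIV. g i :]" for g :: "'n \<Rightarrow> complex"
    by (induction rule: finite_induct[OF finite[of UNIV]]) auto
  have "L_form \<alpha> q (J + (\<chi> i. int m * \<alpha> q' $ i)) z (k + m) - L_form \<alpha> q J z k
     = [: of_nat m * ((\<Sum>i\<in>UNIV. of_int (\<alpha> q' $ i) * ?W $ Inl i $ q) + ?W $ Inr True $ q) :]"
    by (simp add: L_form_def Let_def column_def sc algebra_simps sum.distrib sum_distrib_left)
  also have "\<dots> = (if q' = q then of_nat m else 0)" unfolding * by (simp add: of_nat_poly)
  finally show ?thesis by (simp add: algebra_simps)
qed

text \<open>The affine relation between the exponents is a row vector that \<open>\<L>\<close> maps to the unit vector of the slot z. In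
  particular barycentric coordinates are determined by \<open>\<L>\<close>.\<close>

lemma matrix_inv_L_column:
  fixes \<alpha> :: "'n::finite + bool \<Rightarrow> int^'n"
  assumes det: "det (L_matrix \<alpha> :: complex^('n + bool)^('n + bool)) \<noteq> 0" and q: "q \<in> vertex_indices"
    and b: "(\<Sum>q\<in>vertex_indices. b q) = 1" "rvec (\<alpha> (Inr True)) = (\<Sum>q\<in>vertex_indices. b q *\<^sub>R rvec (\<alpha> q))"
  shows "matrix_inv (L_matrix \<alpha> :: complex^('n + bool)^('n + bool)) $ Inr False $ q = - of_real (b q)"
proof -
  let ?W = "matrix_inv (L_matrix \<alpha> :: complex^('n + bool)^('n + bool))"
  let ?u = "\<lambda>r. if r = Inr True then 1 else - of_real (b r) :: complex"
  have "(\<Sum>r\<in>UNIV. ?u r * L_matrix \<alpha> $ r $ c) = (if c = Inr False then 1 else 0)" for c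
  proof (cases c)
    case (Inl i)
    have "real_of_int (\<alpha> (Inr True) $ i) = (\<Sum>q\<in>vertex_indices. b q * real_of_int (\<alpha> q $ i))"
      using arg_cong[OF b(2), of "\<lambda>x. x $ i"] by (simp add: rvec_def sum_component)
    then have "complex_of_real (real_of_int (\<alpha> (Inr True) $ i)) = of_real (\<Sum>q\<in>vertex_indices. b q * real_of_int (\<alpha> q $ i))"
      by (rule arg_cong)
    then have "of_int (\<alpha> (Inr True) $ i) = (\<Sum>q\<in>vertex_indices. of_real (b q) * of_int (\<alpha> q $ i) :: complex)"
      by simp
    moreover have "(\<Sum>q\<in>vertex_indices. ?u q * of_int (\<alpha> q $ i)) = - (\<Sum>q\<in>vertex_indices. of_real (b q) * of_int (\<alpha> q $ i) :: complex)"
      unfolding sum_negf[symmetric] by (intro sum.cong) (auto simp: vertex_indices_def)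
    ultimately show ?thesis using Inl by (simp add: sum_UNIV_indices L_matrix_nth)
  next
    case (Inr e)
    have s: "(\<Sum>q\<in>vertex_indices. ?u q) = -1"
    proof -
      have "(\<Sum>q\<in>vertex_indices. ?u q) = (\<Sum>q\<in>vertex_indices. - of_real (b q))"
        by (intro sum.cong) (auto simp: vertex_indices_def)
      also have "\<dots> = - of_real (\<Sum>q\<in>vertex_indices. b q)" by (simp add: sum_negf)
      finally show ?thesis using b(1) by simp
    qed
    have z: "(\<Sum>q\<in>vertex_indices. ?u q * (if q = Inr True then 1 else 0)) = 0"
      by (intro sum.neutral) (auto simp: vertex_indices_def)
    show ?thesis
    proof (cases e)
      case True
      then show ?thesis using Inr s by (simp only: sum_UNIV_indices L_matrix_nth) simp
    next
      case False
      then show ?thesis using Inr z by (simp only: sum_UNIV_indices L_matrix_nth) simp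
    qed
  qed
  then have "(\<Sum>c\<in>UNIV. (\<Sum>r\<in>UNIV. ?u r * L_matrix \<alpha> $ r $ c) * ?W $ c $ q) = ?W $ Inr False $ q"
    by (simp add: if_distrib[where f = "\<lambda>x. x * _"] cong: if_cong)
  moreover have "(\<Sum>c\<in>UNIV. (\<Sum>r\<in>UNIV. ?u r * L_matrix \<alpha> $ r $ c) * ?W $ c $ q) = (\<Sum>r\<in>UNIV. ?u r * (\<Sum>c\<in>UNIV. L_matrix \<alpha> $ r $ c * ?W $ c $ q))"
    unfolding sum_distrib_left sum_distrib_right by (subst sum.swap) (simp only: mult.assoc)
  moreover have "(\<Sum>c\<in>UNIV. L_matrix \<alpha> $ r $ c * ?W $ c $ q) = (if r = q then 1 else 0)" for r
    using matrix_inv_complex(1)[OF det] by (auto simp: matrix_matrix_mult_def mat_def vec_eq_iff)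
  ultimately have "?W $ Inr False $ q = (\<Sum>r\<in>UNIV. ?u r * (if r = q then 1 else 0))" by (simp only:)
  also have "\<dots> = (\<Sum>r\<in>UNIV. if r = q then ?u r else 0)" by (intro sum.cong) auto
  also have "\<dots> = ?u q" by simp
  finally show ?thesis using q by (simp add: vertex_indices_def)
qed

lemma theta_poly_linear: "theta_poly [:a, b:] g s = a * g s + b * theta g s"
  by (simp add: theta_poly_pCons)

lemma pochhammer_theta_power:
  assumes hol: "\<And>m. y m holomorphic_on B" and B: "open B" "s \<in> B"
    and y: "\<And>m s. s \<in> B \<Longrightarrow> theta (y m) s = - s * y (Suc m) s"
  shows "theta_poly (pochhammer (- [:0, 1:]) m) (y 0) s = s ^ m * y m s"
  using B(2)
proof (induction m arbitrary: s)
  case (Suc m)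
  let ?h = "\<lambda>z. z ^ m * y m z"
  have d: "(y m has_field_derivative deriv (y m) s) (at s)" by (rule holomorphic_derivI[OF hol B(1) Suc.prems])
  have "(?h has_field_derivative of_nat m * s ^ (m - 1) * y m s + s ^ m * deriv (y m) s) (at s)"
    using d by (auto intro!: derivative_eq_intros simp: mult_ac)
  then have "theta ?h s = s * (of_nat m * s ^ (m - 1) * y m s + s ^ m * deriv (y m) s)"
    unfolding theta_def by (simp only: DERIV_imp_deriv)
  moreover have "s * (of_nat m * s ^ (m - 1)) = of_nat m * s ^ m" by (cases m) simp_all
  ultimately have t1: "theta ?h s = of_nat m * s ^ m * y m s + s ^ m * theta (y m) s"
    by (simp add: theta_def distrib_left mult.left_commute flip: mult.assoc)
  have t2: "theta_poly (pochhammer (- [:0, 1:]) (Suc m)) (y 0) s = theta_poly [:of_nat m, -1:] (theta_poly (pochhammer (- [:0, 1:]) m) (y 0)) s"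
  proof -
    have "- [:0, 1:] + of_nat m = [:of_nat m, - 1 :: complex:]" by (simp add: of_nat_poly)
    then have "pochhammer (- [:0, 1 :: complex:]) (Suc m) = [:of_nat m, -1:] * pochhammer (- [:0, 1:]) m"
      by (simp only: pochhammer_Suc mult.commute)
    then show ?thesis by (simp only: theta_poly_mult[OF B(1) hol Suc.prems])
  qed
  have t3: "theta_poly [:of_nat m, -1:] (theta_poly (pochhammer (- [:0, 1:]) m) (y 0)) s = theta_poly [:of_nat m, -1:] ?h s"
    by (rule theta_poly_cong[OF B(1) _ Suc.prems]) (rule Suc.IH)
  show ?case unfolding t2 unfolding t3 unfolding theta_poly_linear t1 y[OF Suc.prems] by (simp add: algebra_simps)
qed simp

text \<open>A step in the direction of the vertex q applies \<open>\<L>\<^sub>q(J, - \<vartheta>, k)\<close> and raises this form by 1, without changing the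
  forms of the other vertices: repeated steps give the Pochhammer products of Q. Likewise steps in the direction of
  the interior exponent apply \<open>- \<vartheta>, 1 - \<vartheta>, \<dots>\<close> up to powers of s, which gives P.\<close>

proposition gkz_imp_R_op:
  fixes \<alpha> :: "'n::{finite,linorder} + bool \<Rightarrow> int^'n::_" and y :: "nat \<Rightarrow> int^'n::_ \<Rightarrow> complex \<Rightarrow> complex"
  assumes det: "det (L_matrix \<alpha> :: complex^('n + bool)^('n + bool)) \<noteq> 0"
    and B: "open B" "s \<in> B" and hol: "\<And>k J. k \<ge> 1 \<Longrightarrow> y k J holomorphic_on B"
    and y\<theta>: "\<And>k J s. k \<ge> 1 \<Longrightarrow> s \<in> B \<Longrightarrow> theta (y k J) s = - s * y (Suc k) (J + \<alpha> (Inr True)) s"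
    and yq: "\<And>k J q s. k \<ge> 1 \<Longrightarrow> q \<in> vertex_indices \<Longrightarrow> s \<in> B \<Longrightarrow>
        y (Suc k) (J + \<alpha> q) s = theta_poly (L_form \<alpha> q J (- [:0, 1:]) k) (y k J) s"
    and sumB: "(\<Sum>q\<in>vertex_indices. B_vol \<alpha> q) = gam \<alpha>"
    and sumB\<alpha>: "\<And>i. (\<Sum>q\<in>vertex_indices. int (B_vol \<alpha> q) * \<alpha> q $ i) = int (gam \<alpha>) * \<alpha> (Inr True) $ i"
    and k: "k \<ge> 1"
  shows "R_op \<alpha> k J (y k J) s = 0"
proof -
  let ?X = "- [:0, 1:] :: complex poly"
  let ?sh = "\<lambda>J m r. J + (\<chi> i. int m * \<alpha> r $ i)"
  have z0: "(\<chi> i. (0 :: int)) = (0 :: int^'n::_)" by (simp add: vec_eq_iff)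
  have shS: "?sh J (Suc m) r = ?sh J m r + \<alpha> r" for J m r by (simp add: vec_eq_iff algebra_simps)
  have one: "y (k + m) (?sh J m q) s = theta_poly (pochhammer (L_form \<alpha> q J ?X k) m) (y k J) s"
    if "k \<ge> 1" "q \<in> vertex_indices" "s \<in> B" for k J m q s
    using that(3)
  proof (induction m arbitrary: s)
    case 0
    then show ?case by (simp add: z0)
  next
    case (Suc m)
    have "y (k + Suc m) (?sh J (Suc m) q) s = theta_poly (L_form \<alpha> q (?sh J m q) ?X (k + m)) (y (k + m) (?sh J m q)) s"
      unfolding shS add_Suc_right by (rule yq) (use that Suc in auto)
    also have "L_form \<alpha> q (?sh J m q) ?X (k + m) = L_form \<alpha> q J ?X k + of_nat m"
      using L_form_shift[OF det that(2), of q J m ?X k] by simp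
    also have "theta_poly (L_form \<alpha> q J ?X k + of_nat m) (y (k + m) (?sh J m q)) s
       = theta_poly (L_form \<alpha> q J ?X k + of_nat m) (theta_poly (pochhammer (L_form \<alpha> q J ?X k) m) (y k J)) s"
      by (rule theta_poly_cong[OF B(1) _ Suc.prems]) (rule Suc.IH)
    also have "\<dots> = theta_poly ((L_form \<alpha> q J ?X k + of_nat m) * pochhammer (L_form \<alpha> q J ?X k) m) (y k J) s"
      by (rule theta_poly_mult[OF B(1) hol[OF that(1)] Suc.prems, symmetric])
    finally show ?case by (simp add: pochhammer_Suc mult.commute)
  qed
  let ?N = "\<lambda>A. \<Sum>q\<in>A. B_vol \<alpha> q" and ?V = "\<lambda>A. \<chi> i. \<Sum>q\<in>A. int (B_vol \<alpha> q) * \<alpha> q $ i"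
  have many: "(\<forall>s\<in>B. y (k + ?N A) (J + ?V A) s = theta_poly (\<Prod>q\<in>A. pochhammer (L_form \<alpha> q J ?X k) (B_vol \<alpha> q)) (y k J) s) \<and>
     (\<forall>q\<in>vertex_indices - A. L_form \<alpha> q (J + ?V A) ?X (k + ?N A) = L_form \<alpha> q J ?X k)"
    if "finite A" "A \<subseteq> vertex_indices" for A
    using that
  proof (induction A)
    case empty
    have "J + ?V {} = J" by (simp add: vec_eq_iff)
    then show ?case by simp
  next
    case (insert q A)
    let ?b = "B_vol \<alpha> q" and ?P = "\<lambda>A. \<Prod>q\<in>A. pochhammer (L_form \<alpha> q J ?X k) (B_vol \<alpha> q)"
    have q: "q \<in> vertex_indices" "q \<notin> A" using insert by auto
    have IH: "\<And>s. s \<in> B \<Longrightarrow> y (k + ?N A) (J + ?V A) s = theta_poly (?P A) (y k J) s"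
      "\<And>q. q \<in> vertex_indices - A \<Longrightarrow> L_form \<alpha> q (J + ?V A) ?X (k + ?N A) = L_form \<alpha> q J ?X k"
      using insert by auto
    have N: "k + ?N (insert q A) = (k + ?N A) + ?b" using insert by simp
    have V: "J + ?V (insert q A) = ?sh (J + ?V A) ?b q" using insert by (simp add: vec_eq_iff)
    have "y (k + ?N (insert q A)) (J + ?V (insert q A)) s = theta_poly (?P (insert q A)) (y k J) s" if s: "s \<in> B" for s
    proof -
      have "y (k + ?N (insert q A)) (J + ?V (insert q A)) s
         = theta_poly (pochhammer (L_form \<alpha> q (J + ?V A) ?X (k + ?N A)) ?b) (y (k + ?N A) (J + ?V A)) s"
        unfolding N V by (rule one) (use k q s in auto)
      also have "\<dots> = theta_poly (pochhammer (L_form \<alpha> q J ?X k) ?b) (y (k + ?N A) (J + ?V A)) s"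
        using IH(2)[of q] q by simp
      also have "\<dots> = theta_poly (pochhammer (L_form \<alpha> q J ?X k) ?b) (theta_poly (?P A) (y k J)) s"
        by (rule theta_poly_cong[OF B(1) _ s]) (rule IH(1))
      also have "\<dots> = theta_poly (pochhammer (L_form \<alpha> q J ?X k) ?b * ?P A) (y k J) s"
        by (rule theta_poly_mult[OF B(1) hol[OF k] s, symmetric])
      finally show ?thesis using insert by simp
    qed
    moreover have "L_form \<alpha> q' (J + ?V (insert q A)) ?X (k + ?N (insert q A)) = L_form \<alpha> q' J ?X k"
      if "q' \<in> vertex_indices - insert q A" for q'
      unfolding N V using L_form_shift[OF det q(1), of q' "J + ?V A" ?b ?X "k + ?N A"] IH(2)[of q'] that by auto
    ultimately show ?case by blast
  qed
  have Vg: "J + ?V vertex_indices = ?sh J (gam \<alpha>) (Inr True)" using sumB\<alpha> by (simp add: vec_eq_iff)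
  have Q: "y (k + gam \<alpha>) (?sh J (gam \<alpha>) (Inr True)) s = theta_poly (\<Prod>q\<in>vertex_indices. pochhammer (L_form \<alpha> q J ?X k) (B_vol \<alpha> q)) (y k J) s"
    using many[OF finite_vertex_indices subset_refl] B(2) unfolding Vg sumB by blast
  have "theta_poly (pochhammer ?X m) ((\<lambda>m. y (k + m) (?sh J m (Inr True))) 0) s = s ^ m * (\<lambda>m. y (k + m) (?sh J m (Inr True))) m s" for m
  proof (rule pochhammer_theta_power[OF _ B])
    show "y (k + m) (?sh J m (Inr True)) holomorphic_on B" for m by (rule hol) (use k in simp)
    show "theta (y (k + m) (?sh J m (Inr True))) s = - s * y (k + Suc m) (?sh J (Suc m) (Inr True)) s" if "s \<in> B" for m s
      unfolding shS add_Suc_right by (rule y\<theta>) (use k that in auto)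
  qed
  from this[of "gam \<alpha>"] have P: "theta_poly (P_poly \<alpha>) (y k J) s = s ^ gam \<alpha> * y (k + gam \<alpha>) (?sh J (gam \<alpha>) (Inr True)) s"
    by (simp add: z0 P_poly_def)
  have "(- s) ^ gam \<alpha> * (- 1) ^ gam \<alpha> = s ^ gam \<alpha>" by (simp flip: power_mult_distrib)
  then show ?thesis
    unfolding R_op_def P Q Q_poly_def theta_poly_smult by (simp add: mult.assoc[symmetric])
qed

lemma L_form_linear:
  "L_form \<alpha> q J (- [:0, 1:]) k =
    [: (\<Sum>i\<in>UNIV. of_int (J $ i) * matrix_inv (L_matrix \<alpha>) $ Inl i $ q) + of_nat k * matrix_inv (L_matrix \<alpha>) $ Inr True $ q,
       - (matrix_inv (L_matrix \<alpha>) $ Inr False $ q) :]"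
  for \<alpha> :: "'n::finite + bool \<Rightarrow> int^'n"
proof -
  have sc: "(\<Sum>i\<in>UNIV. [: g i :]) = [: \<Sum>i\<in>UNIV. g i :]" for g :: "'n \<Rightarrow> complex"
    by (induction rule: finite_induct[OF finite[of UNIV]]) auto
  show ?thesis by (simp add: L_form_def Let_def column_def sc)
qed

text \<open>Multiply the relation \<open>v \<L> = (J g, - \<vartheta> g, k g)\<close> by the inverse of \<open>\<L>\<close>.\<close>

lemma weighted_rows_eq_imp_L_form:
  fixes \<alpha> :: "'n::finite + bool \<Rightarrow> int^'n" and v :: "'n + bool \<Rightarrow> complex"
  assumes det: "det (L_matrix \<alpha> :: complex^('n + bool)^('n + bool)) \<noteq> 0"
    and J: "\<And>i. (\<Sum>r\<in>UNIV. v r * of_int (\<alpha> r $ i)) = of_int (J $ i) * g s"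
    and z: "v (Inr True) = - theta g s" and k: "(\<Sum>r\<in>UNIV. v r) = of_nat k * g s"
  shows "v q = theta_poly (L_form \<alpha> q J (- [:0, 1:]) k) g s"
proof -
  let ?L = "L_matrix \<alpha> :: complex^('n + bool)^('n + bool)"
  let ?W = "matrix_inv ?L"
  have F: "(\<Sum>r\<in>UNIV. v r * ?L $ r $ Inr False) = v (Inr True)"
  proof -
    have "(\<Sum>r\<in>UNIV. v r * ?L $ r $ Inr False) = (\<Sum>r\<in>UNIV. if r = Inr True then v r else 0)"
      by (intro sum.cong) (auto simp: L_matrix_nth)
    then show ?thesis by simp
  qed
  have inv: "(\<Sum>c\<in>UNIV. ?L $ r $ c * ?W $ c $ q) = (if r = q then 1 else 0)" for r
    using matrix_inv_complex(1)[OF det] by (auto simp: matrix_matrix_mult_def mat_def vec_eq_iff)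
  have "(\<Sum>c\<in>UNIV. (\<Sum>r\<in>UNIV. v r * ?L $ r $ c) * ?W $ c $ q) = (\<Sum>r\<in>UNIV. v r * (\<Sum>c\<in>UNIV. ?L $ r $ c * ?W $ c $ q))"
    unfolding sum_distrib_left sum_distrib_right by (subst sum.swap) (simp only: mult.assoc)
  also have "\<dots> = (\<Sum>r\<in>UNIV. if r = q then v r else 0)" unfolding inv by (intro sum.cong) auto
  finally have "v q = (\<Sum>c\<in>UNIV. (\<Sum>r\<in>UNIV. v r * ?L $ r $ c) * ?W $ c $ q)" by simp
  also have "\<dots> = (\<Sum>i\<in>UNIV. of_int (J $ i) * g s * ?W $ Inl i $ q) - theta g s * ?W $ Inr False $ q + of_nat k * g s * ?W $ Inr True $ q"
    unfolding sum_UNIV_columns[of "\<lambda>c. (\<Sum>r\<in>UNIV. v r * ?L $ r $ c) * ?W $ c $ q"] F z by (simp add: L_matrix_nth J k)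
  also have "\<dots> = theta_poly (L_form \<alpha> q J (- [:0, 1:]) k) g s"
    unfolding L_form_linear theta_poly_linear by (simp add: algebra_simps sum_distrib_left sum_distrib_right)
  finally show ?thesis .
qed

proposition period_cycle_R_op:
  fixes \<alpha> :: "'n::{finite,linorder} + bool \<Rightarrow> int^'n::_"
  assumes det: "det (L_matrix \<alpha> :: complex^('n + bool)^('n + bool)) \<noteq> 0"
    and B: "open B" and c: "\<And>s. s \<in> B \<Longrightarrow> period_cycle \<alpha> (param s) c"
    and sumB: "(\<Sum>q\<in>vertex_indices. B_vol \<alpha> q) = gam \<alpha>"
    and sumB\<alpha>: "\<And>i. (\<Sum>q\<in>vertex_indices. int (B_vol \<alpha> q) * \<alpha> q $ i) = int (gam \<alpha>) * \<alpha> (Inr True) $ i"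
    and k: "k \<ge> 1"
  defines "y \<equiv> \<lambda>k J s. chain_integral (integrand \<alpha> k J (param s)) c"
  shows "y k J holomorphic_on B" "s \<in> B \<Longrightarrow> R_op \<alpha> k J (y k J) s = 0"
proof -
  have Y: "period_cycle.Y \<alpha> c k J (param s) = y k J s" if "s \<in> B" for s k J
    unfolding period_cycle.Y_def[OF c[OF that]] y_def ..
  have d: "(y k J has_field_derivative - y (Suc k) (J + \<alpha> (Inr True)) s) (at s)" if s: "s \<in> B" and k: "k \<ge> 1" for k J s
  proof -
    interpret period_cycle \<alpha> "param s" c by (rule c[OF s])
    let ?b = "\<lambda>(t::complex) r. if r = Inr True then 1 else 0 :: complex"
    have "((\<lambda>t. Y k J (param t)) has_field_derivative - (\<Sum>r\<in>UNIV. ?b s r * Y (Suc k) (J + \<alpha> r) (param s))) (at s)"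
    proof (rule Y_deriv[where b' = ?b, OF _ _ _ k])
      show "((\<lambda>t. param t r) has_field_derivative ?b t r) (at t)" for t and r :: "'n + bool"
        by (cases "r = Inr True") (auto simp: param_def)
      show "fam \<alpha> (param s) x \<noteq> 0" if "x \<in> K" for x using K that by auto
    qed simp
    moreover have "(\<Sum>r\<in>UNIV. ?b s r * Y (Suc k) (J + \<alpha> r) (param s)) = Y (Suc k) (J + \<alpha> (Inr True)) (param s)"
      by (simp add: if_distrib[where f = "\<lambda>x. x * _"] cong: if_cong)
    ultimately show ?thesis by (simp add: Y_def y_def)
  qed
  have hol: "y k J holomorphic_on B" if "k \<ge> 1" for k J
    using d that B by (auto simp: holomorphic_on_open)
  then show "y k J holomorphic_on B" using k by blast
  have th: "theta (y k J) s = - s * y (Suc k) (J + \<alpha> (Inr True)) s" if "k \<ge> 1" "s \<in> B" for k J s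
    unfolding theta_def DERIV_imp_deriv[OF d[OF that(2,1)]] by simp
  assume s: "s \<in> B"
  show "R_op \<alpha> k J (y k J) s = 0"
  proof (rule gkz_imp_R_op[where y = y and B = B and s = s, OF det B s hol th _ sumB sumB\<alpha> k])
    fix k J s and q :: "'n + bool" assume k: "k \<ge> (1::nat)" and q: "q \<in> vertex_indices" and s: "s \<in> B"
    interpret period_cycle \<alpha> "param s" c by (rule c[OF s])
    define v where "v r = param s r * y (Suc k) (J + \<alpha> r) s" for r
    have "v q = theta_poly (L_form \<alpha> q J (- [:0, 1:]) k) (y k J) s"
    proof (rule weighted_rows_eq_imp_L_form[OF det])
      show "(\<Sum>r\<in>UNIV. v r * of_int (\<alpha> r $ i)) = of_int (J $ i) * y k J s" for i
        using Y_torus[OF k, of i J] by (simp add: v_def Y[OF s] mult_ac)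
      show "v (Inr True) = - theta (y k J) s" by (simp add: v_def th[OF k s] param_def)
      show "(\<Sum>r\<in>UNIV. v r) = of_nat k * y k J s" using Y_euler[OF k, of J] by (simp add: v_def Y[OF s])
    qed
    moreover have "param s q = 1" using q by (simp add: param_def vertex_indices_def)
    ultimately show "y (Suc k) (J + \<alpha> q) s = theta_poly (L_form \<alpha> q J (- [:0, 1:]) k) (y k J) s" by (simp add: v_def)
  qed
qed

section \<open>The singular points of the operator\<close>

lemma pochhammer_linear_poly:
  fixes a b :: complex assumes "b \<noteq> 0"
  shows "Polynomial.degree (pochhammer [:a, b:] m) = m" "Polynomial.lead_coeff (pochhammer [:a, b:] m) = b ^ m"
proof -
  have "Polynomial.degree (pochhammer [:a, b:] m) = m \<and> Polynomial.lead_coeff (pochhammer [:a, b:] m) = b ^ m"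
  proof (induction m)
    case (Suc m)
    have l: "[:a, b:] + of_nat m = [:a + of_nat m, b:]" by (simp add: of_nat_poly)
    have IH: "Polynomial.degree (pochhammer [:a, b:] m) = m" "Polynomial.coeff (pochhammer [:a, b:] m) m = b ^ m"
      using Suc by auto
    have nz: "pochhammer [:a, b:] m \<noteq> 0" using Suc assms by auto
    have "Polynomial.degree (pochhammer [:a, b:] m * [:a + of_nat m, b:]) = Suc m"
      using Suc nz assms by (subst degree_mult_eq) auto
    moreover have "Polynomial.lead_coeff (pochhammer [:a, b:] m * [:a + of_nat m, b:]) = b ^ Suc m"
      unfolding lead_coeff_mult IH using assms by simp
    ultimately show ?case by (simp only: pochhammer_Suc l)
  qed simp
  then show "Polynomial.degree (pochhammer [:a, b:] m) = m" "Polynomial.lead_coeff (pochhammer [:a, b:] m) = b ^ m" by auto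
qed

lemma theta_poly_inverse:
  assumes "g analytic_on {t}" "t \<noteq> 0"
  shows "theta_poly p (\<lambda>s. g (inverse s)) (inverse t) = theta_poly (pcompose p [:0, -1:]) g t"
  unfolding theta_poly_def by (simp add: degree_pcompose coeff_pcompose_linear theta_funpow_inverse[OF assms] mult_ac)

lemma has_coeffs_theta_polys:
  assumes "Polynomial.degree p = n" "Polynomial.degree q = n"
  shows "has_coeffs (\<lambda>g s. theta_poly p g s - (- s) ^ n * theta_poly q g s) S n (fuchs_coeff n (euler_coeff p) (euler_coeff q))"
  unfolding has_coeffs_def
proof (intro conjI allI impI ballI)
  show "fuchs_coeff n (euler_coeff p) (euler_coeff q) i holomorphic_on S" for i
    unfolding fuchs_coeff_def[abs_def] by (intro holomorphic_intros)
  fix s and g :: "complex \<Rightarrow> complex" assume g: "g analytic_on {s}"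
  show "theta_poly p g s - (- s) ^ n * theta_poly q g s = (\<Sum>i\<le>n. fuchs_coeff n (euler_coeff p) (euler_coeff q) i s * (deriv ^^ i) g s)"
    unfolding theta_poly_eq_derivs[OF g] assms fuchs_coeff_def sum_distrib_left sum_subtractf[symmetric]
    by (intro sum.cong) (auto simp: algebra_simps)
qed

lemma has_coeffs_theta_polys_infinity:
  assumes "Polynomial.degree p = n" "Polynomial.degree q = n" "0 \<notin> S"
  shows "has_coeffs (at_infinity_coord (\<lambda>g s. theta_poly p g s - (- s) ^ n * theta_poly q g s)) S n
     (\<lambda>i t. t ^ i * (euler_coeff (pcompose p [:0, -1:]) i - (- inverse t) ^ n * euler_coeff (pcompose q [:0, -1:]) i))"
  unfolding has_coeffs_def
proof (intro conjI allI impI ballI)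
  show "(\<lambda>t. t ^ i * (euler_coeff (pcompose p [:0, -1:]) i - (- inverse t) ^ n * euler_coeff (pcompose q [:0, -1:]) i)) holomorphic_on S" for i
    using assms(3) by (intro holomorphic_intros) auto
  fix t and g :: "complex \<Rightarrow> complex" assume t: "t \<in> S" and g: "g analytic_on {t}"
  have t0: "t \<noteq> 0" using t assms(3) by auto
  have deg: "Polynomial.degree (pcompose p [:0, -1:]) = n" "Polynomial.degree (pcompose q [:0, -1:]) = n"
    using assms by (simp_all add: degree_pcompose)
  show "at_infinity_coord (\<lambda>g s. theta_poly p g s - (- s) ^ n * theta_poly q g s) g t =
     (\<Sum>i\<le>n. t ^ i * (euler_coeff (pcompose p [:0, -1:]) i - (- inverse t) ^ n * euler_coeff (pcompose q [:0, -1:]) i) * (deriv ^^ i) g t)"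
    unfolding at_infinity_coord_def theta_poly_inverse[OF g t0] theta_poly_eq_derivs[OF g] deg sum_distrib_left sum_subtractf[symmetric]
    by (intro sum.cong) (auto simp: algebra_simps)
qed

proposition R_op_singularities:
  fixes \<alpha> :: "'n::{finite,linorder} + bool \<Rightarrow> int^'n::_"
  defines "\<Sigma> \<equiv> insert 0 {s :: complex. (\<Prod>q\<in>vertex_indices. of_nat (B_vol \<alpha> q) ^ B_vol \<alpha> q) * (- s / of_nat (gam \<alpha>)) ^ gam \<alpha> = 1}"
  assumes W: "\<And>q. q \<in> vertex_indices \<Longrightarrow>
       matrix_inv (L_matrix \<alpha> :: complex^('n + bool)^('n + bool)) $ Inr False $ q = - (of_nat (B_vol \<alpha> q) / of_nat (gam \<alpha>))"
    and pos: "\<And>q. q \<in> vertex_indices \<Longrightarrow> B_vol \<alpha> q > 0" and gam: "gam \<alpha> > 0"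
    and sumB: "(\<Sum>q\<in>vertex_indices. B_vol \<alpha> q) = gam \<alpha>"
  shows "{s. singular_point (R_op \<alpha> k J) s} = \<Sigma>" "s \<in> \<Sigma> \<Longrightarrow> fuchs_regular (R_op \<alpha> k J) s"
    "fuchs_regular (at_infinity_coord (R_op \<alpha> k J)) 0"
proof -
  let ?n = "gam \<alpha>" and ?P = "P_poly \<alpha>" and ?Q = "Q_poly \<alpha> k J"
  let ?C = "\<Prod>q\<in>vertex_indices. (of_nat (B_vol \<alpha> q) / of_nat ?n) ^ B_vol \<alpha> q :: complex"
  have R: "R_op \<alpha> k J = (\<lambda>g s. theta_poly ?P g s - (- s) ^ ?n * theta_poly ?Q g s)" by (simp add: R_op_def fun_eq_iff)
  have X: "- [:0, 1:] = [:0, - 1 :: complex:]" by simp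
  have P: "Polynomial.degree ?P = ?n" "Polynomial.lead_coeff ?P = (- 1) ^ ?n"
    unfolding P_poly_def X using pochhammer_linear_poly[of "-1" 0] by simp_all
  let ?f = "\<lambda>q. pochhammer (L_form \<alpha> q J (- [:0, 1:]) k) (B_vol \<alpha> q)"
  have f: "Polynomial.degree (?f q) = B_vol \<alpha> q" "Polynomial.lead_coeff (?f q) = (of_nat (B_vol \<alpha> q) / of_nat ?n) ^ B_vol \<alpha> q"
    if q: "q \<in> vertex_indices" for q
  proof -
    have nz: "of_nat (B_vol \<alpha> q) / of_nat ?n \<noteq> (0 :: complex)" using pos[OF q] gam by simp
    show "Polynomial.degree (?f q) = B_vol \<alpha> q" "Polynomial.lead_coeff (?f q) = (of_nat (B_vol \<alpha> q) / of_nat ?n) ^ B_vol \<alpha> q"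
      unfolding L_form_linear W[OF q] minus_minus by (rule pochhammer_linear_poly[OF nz])+
  qed
  have C0: "?C \<noteq> 0" using pos gam by auto
  have f0: "?f q \<noteq> 0" if "q \<in> vertex_indices" for q
  proof
    assume "?f q = 0"
    then have "Polynomial.lead_coeff (?f q) = 0" by simp
    then show False unfolding f(2)[OF that] using pos[OF that] gam by simp
  qed
  have Q: "Polynomial.degree ?Q = ?n" "Polynomial.lead_coeff ?Q = (- 1) ^ ?n * ?C"
  proof -
    have "Polynomial.degree (\<Prod>q\<in>vertex_indices. ?f q) = (\<Sum>q\<in>vertex_indices. Polynomial.degree (?f q))"
      by (rule degree_prod_sum_eq) (rule f0)
    also have "\<dots> = ?n" using f(1) sumB by simp
    finally show "Polynomial.degree ?Q = ?n" unfolding Q_poly_def by simp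
    have "Polynomial.lead_coeff (\<Prod>q\<in>vertex_indices. ?f q) = ?C" unfolding lead_coeff_prod using f(2) by simp
    then show "Polynomial.lead_coeff ?Q = (- 1) ^ ?n * ?C" unfolding Q_poly_def lead_coeff_smult by simp
  qed
  let ?p = "euler_coeff ?P" and ?q = "euler_coeff ?Q"
  have lead: "?p ?n = (- 1) ^ ?n" "?q ?n = (- 1) ^ ?n * ?C"
    using euler_coeff_lead[of ?P] euler_coeff_lead[of ?Q] P Q by simp_all
  have n1: "?n \<ge> 1" using gam by simp
  have "?p ?n \<noteq> 0" "?q ?n \<noteq> 0" unfolding lead using C0 by simp_all
  note H = hypergeometric_singularities[OF n1 this has_coeffs_theta_polys[OF P(1) Q(1)], folded R]
  have C: "?C = (\<Prod>q\<in>vertex_indices. of_nat (B_vol \<alpha> q) ^ B_vol \<alpha> q) / of_nat ?n ^ ?n"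
    by (simp add: power_divide prod_dividef power_sum[symmetric] sumB)
  have "(- s) ^ ?n * ?q ?n = ?p ?n \<longleftrightarrow> (\<Prod>q\<in>vertex_indices. of_nat (B_vol \<alpha> q) ^ B_vol \<alpha> q) * (- s / of_nat ?n) ^ ?n = 1" for s
  proof -
    have "(- s) ^ ?n * ?q ?n = ?p ?n \<longleftrightarrow> (- 1) ^ ?n * ((- s) ^ ?n * ?C) = (- 1) ^ ?n * 1"
      unfolding lead by (simp add: mult_ac)
    also have "\<dots> \<longleftrightarrow> (- s) ^ ?n * ?C = 1" by (subst mult_cancel_left) simp
    also have "(- s) ^ ?n * ?C = (\<Prod>q\<in>vertex_indices. of_nat (B_vol \<alpha> q) ^ B_vol \<alpha> q) * (- s / of_nat ?n) ^ ?n"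
      unfolding C unfolding power_divide by simp
    finally show ?thesis .
  qed
  then have \<Sigma>: "insert 0 {s. (- s) ^ ?n * ?q ?n = ?p ?n} = \<Sigma>" unfolding \<Sigma>_def by simp
  show "{s. singular_point (R_op \<alpha> k J) s} = \<Sigma>" using H(1) unfolding \<Sigma> .
  show "fuchs_regular (R_op \<alpha> k J) s" if "s \<in> \<Sigma>" using H(2) that unfolding \<Sigma> .
  have "euler_coeff (pcompose ?Q [:0, -1:]) ?n \<noteq> 0"
  proof -
    have deg: "Polynomial.degree (pcompose ?Q [:0, -1:]) = ?n" using Q(1) by (simp add: degree_pcompose)
    have "euler_coeff (pcompose ?Q [:0, -1:]) ?n = (- 1) ^ ?n * Polynomial.lead_coeff ?Q"
      using euler_coeff_lead[of "pcompose ?Q [:0, -1:]"] unfolding deg coeff_pcompose_linear Q(1) .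
    then show ?thesis unfolding Q(2) using C0 by simp
  qed
  from hypergeometric_regular_at_infinity[OF n1 this has_coeffs_theta_polys_infinity[OF P(1) Q(1)], folded R]
  show "fuchs_regular (at_infinity_coord (R_op \<alpha> k J)) 0" by blast
qed

section \<open>Periods as integrals over one fixed cycle\<close>

text \<open>Otherwise 0 would occur twice among the exponents, and the interior exponent would have a second system of
  barycentric coordinates.\<close>

lemma exponents_nonzero:
  fixes \<alpha> :: "'n::{finite,linorder} + bool \<Rightarrow> int^'n::_"
  assumes det: "det (L_matrix \<alpha> :: complex^('n + bool)^('n + bool)) \<noteq> 0" and \<alpha>0: "\<alpha> (Inr False) = 0"
    and b: "\<And>q. q \<in> vertex_indices \<Longrightarrow> 0 < b q" "(\<Sum>q\<in>vertex_indices. b q) = 1"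
       "rvec (\<alpha> (Inr True)) = (\<Sum>q\<in>vertex_indices. b q *\<^sub>R rvec (\<alpha> q))"
    and r: "r \<noteq> Inr False"
  shows "\<alpha> r \<noteq> 0"
proof
  assume r0: "\<alpha> r = 0"
  have F: "Inr False \<in> vertex_indices" by (simp add: vertex_indices_def)
  have uniq: "b' q = b q" if "(\<Sum>q\<in>vertex_indices. b' q) = 1" "rvec (\<alpha> (Inr True)) = (\<Sum>q\<in>vertex_indices. b' q *\<^sub>R rvec (\<alpha> q))" "q \<in> vertex_indices" for b' q
    using matrix_inv_L_column[OF det that(3,1,2)] matrix_inv_L_column[OF det that(3) b(2,3)] by simp
  show False
  proof (cases "r = Inr True")
    case True
    obtain j :: 'n where True by blast
    have j: "Inl j \<in> vertex_indices" by (simp add: vertex_indices_def)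
    have "(if Inl j = Inr False then 1 else 0) = b (Inl j)"
      by (rule uniq[OF _ _ j]) (use r0 True \<alpha>0 F in \<open>auto simp: if_distrib[where f = "\<lambda>x. x *\<^sub>R _"] cong: if_cong\<close>)
    then show False using b(1)[OF j] by simp
  next
    case False
    then have rv: "r \<in> vertex_indices" by (simp add: vertex_indices_def)
    define e where "e q = (if q = r then 1 else 0) - (if q = Inr False then 1 else 0 :: real)" for q
    have "b r + e r = b r"
    proof (rule uniq[OF _ _ rv])
      show "(\<Sum>q\<in>vertex_indices. b q + e q) = 1"
        using b(2) rv F by (simp add: e_def sum.distrib sum_subtractf)
      have "(\<Sum>q\<in>vertex_indices. e q *\<^sub>R rvec (\<alpha> q)) = 0"
        by (rule sum.neutral) (auto simp: e_def r0 \<alpha>0)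
      then show "rvec (\<alpha> (Inr True)) = (\<Sum>q\<in>vertex_indices. (b q + e q) *\<^sub>R rvec (\<alpha> q))"
        by (simp add: b(3) scaleR_add_left sum.distrib)
    qed
    then show False using assms(6) by (simp add: e_def)
  qed
qed

text \<open>The regularity condition for the whole polytope, which is a face of itself. For f = 0 there is no nonempty face.\<close>

lemma delta_regular_imp_smooth:
  fixes f :: "'n::finite laurent"
  assumes "delta_regular f" "f \<noteq> 0" and x: "x \<in> zero_locus f"
  obtains i where "laurent_log_deriv i f x \<noteq> 0"
proof -
  let ?P = "newton_polytope f"
  have P: "rvec a \<in> ?P" if "a \<in> Poly_Mapping.keys f" for a
    unfolding newton_polytope_def by (rule hull_inc) (use that in simp)
  then have keys: "{a. a \<in> Poly_Mapping.keys f \<and> rvec a \<in> ?P} = Poly_Mapping.keys f" by blast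
  have "Poly_Mapping.keys f \<noteq> {}" using assms(2) by simp
  then have "?P face_of ?P" "?P \<noteq> {}"
    using P unfolding newton_polytope_def by (auto intro: face_of_refl convex_convex_hull)
  then have "\<not> (\<exists>x\<in>torus. laurent_eval (face_part f ?P) x = 0 \<and> (\<forall>i. laurent_log_deriv i (face_part f ?P) x = 0))"
    using assms(1) unfolding delta_regular_def by blast
  moreover have "laurent_eval (face_part f ?P) x = laurent_eval f x" "laurent_log_deriv i (face_part f ?P) x = laurent_log_deriv i f x" for i
    unfolding face_part_def keys laurent_eval_sum laurent_log_deriv_sum laurent_eval_single laurent_log_deriv_single
    by (simp_all add: laurent_eval_def laurent_log_deriv_def)
  ultimately show thesis using x that by (auto simp: zero_locus_def)
qed

text \<open>The cycles on which the periods at nearby parameters are computed are all homologous to one tube. So the smooth cycle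
  belonging to \<open>s0\<close> can be used for all of them.\<close>

proposition period_eq_chain_integral:
  fixes \<alpha> :: "'n::{finite,linorder} + bool \<Rightarrow> int^'n::_" and \<delta> t\<delta> :: "complex \<Rightarrow> (complex^'n::_) chain set"
  assumes \<alpha>0: "\<And>r. \<alpha> r = 0 \<longleftrightarrow> r = Inr False" and U: "open U"
    and regular: "\<And>s. s \<in> U \<Longrightarrow> delta_regular (f_poly \<alpha> s)"
    and cycles: "horizontal_family (CARD('n) - 1) U (\<lambda>s. zero_locus (f_poly \<alpha> s)) \<delta>"
    and leray: "\<And>s. s \<in> U \<Longrightarrow> leray_coboundary (f_poly \<alpha> s) (\<delta> s) (t\<delta> s)"
    and period: "\<And>s. s \<in> U \<Longrightarrow>
           has_class_integral (torus - zero_locus (f_poly \<alpha> s)) (period_integrand (f_poly \<alpha> s) k J) (t\<delta> s) (I s)"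
    and s0: "s0 \<in> U"
  obtains B c where "open B" "s0 \<in> B" "B \<subseteq> U" "\<And>s. s \<in> B \<Longrightarrow> period_cycle \<alpha> (param s) c"
    "\<And>s. s \<in> B \<Longrightarrow> I s = chain_integral (integrand \<alpha> k J (param s)) c"
proof -
  have \<alpha>F: "\<alpha> (Inr False) = 0" using \<alpha>0 by blast
  note ev = laurent_eval_f_poly[of \<alpha>, OF \<alpha>F]
  let ?n = "CARD('n)"
  interpret holomorphic_family "\<lambda>s. fam \<alpha> (param s)" "\<lambda>k s. fam' \<alpha> k (param s)" "torus :: (complex^'n::_) set"
    by (rule holomorphic_family_fam[OF continuous_param])
  have Z: "zero_locus (f_poly \<alpha> s) = Z s" for s unfolding zero_locus_f_poly[of \<alpha>, OF \<alpha>F] Z_def ..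
  have X: "torus - zero_locus (f_poly \<alpha> s) = X s" for s unfolding Z X_def ..
  have X': "X s = {x \<in> torus. fam \<alpha> (param s) x \<noteq> 0}" for s by (auto simp: X_def Z_def)
  have n: "Suc (?n - 1) = ?n" by simp
  have nonsing: "\<exists>k. fam' \<alpha> k (param s) x \<noteq> 0" if s: "s \<in> U" and x: "x \<in> Z s" for s x
  proof -
    have "Poly_Mapping.lookup (f_poly \<alpha> s) 0 = (\<Sum>r\<in>UNIV. if r = (Inr False :: 'n + bool) then param s r else 0)"
      unfolding f_poly_eq[of \<alpha>, OF \<alpha>F] lookup_sum by (intro sum.cong) (auto simp: lookup_single when_def \<alpha>0)
    then have "f_poly \<alpha> s \<noteq> 0" by (auto simp: param_def)
    from delta_regular_imp_smooth[OF regular[OF s] this, of x] x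
    obtain i where "laurent_log_deriv i (f_poly \<alpha> s) x \<noteq> 0" unfolding Z by blast
    moreover have "x \<in> torus" using x by (simp add: Z_def)
    ultimately show ?thesis unfolding laurent_log_deriv_f_poly[of \<alpha>, OF \<alpha>F \<open>x \<in> torus\<close>] by auto
  qed
  have hor: "horizontal_family (?n - 1) U Z \<delta>" using cycles unfolding Z .
  have tub: "\<exists>c v \<epsilon>. cycle (?n - 1) (Z s) c \<and> \<delta> s = homology_class (?n - 1) (Z s) c \<and>
       admissible s (chain_support (?n - 1) c) v \<epsilon> \<and> t\<delta> s = homology_class (Suc (?n - 1)) (X s) (circle_product (?n - 1) (tube id v \<epsilon>) c)"
    if s: "s \<in> U" for s
  proof -
    obtain c v \<epsilon> where c: "cycle (?n - 1) (Z s) c" "\<delta> s = homology_class (?n - 1) (Z s) c"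
      and v: "continuous_on (chain_support (?n - 1) c) v"
      and d: "\<forall>x\<in>chain_support (?n - 1) c. ((\<lambda>w. fam \<alpha> (param s) (x + w *s v x)) has_field_derivative 1) (at 0)"
      and \<epsilon>: "0 < \<epsilon>" "\<forall>x\<in>chain_support (?n - 1) c. \<forall>w. 0 < norm w \<and> norm w \<le> \<epsilon> \<longrightarrow> x + w *s v x \<in> X s"
      and t: "t\<delta> s = homology_class ?n (X s) (circle_product (?n - 1) (\<lambda>x u. x + (complex_of_real \<epsilon> * u) *s v x) c)"
      using leray[OF s] unfolding leray_coboundary_def Let_def X unfolding Z ev by (elim exE conjE)
    have KZ: "chain_support (?n - 1) c \<subseteq> Z s"
      using c(1) compact_chain_support(2) unfolding cycle_def singular_cycle by blast
    have "dF s x (v x) = 1" if x: "x \<in> chain_support (?n - 1) c" for x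
    proof -
      have "x + 0 *s v x \<in> torus" using KZ x by (auto simp: Z_def)
      from F_line_deriv[OF this, of s] show ?thesis using DERIV_unique[OF bspec[OF d x]] by simp
    qed
    then have adm: "admissible s (chain_support (?n - 1) c) v \<epsilon>" unfolding admissible_def using v \<epsilon> by blast
    have eq: "tube id v \<epsilon> = (\<lambda>x u. x + (complex_of_real \<epsilon> * u) *s v x)" by (simp add: tube_def fun_eq_iff)
    show ?thesis
      by (intro exI[of _ c] exI[of _ v] exI[of _ \<epsilon>] conjI c adm) (simp only: n eq t)
  qed
  obtain r T where r: "0 < r" "ball s0 r \<subseteq> U"
    and T: "\<And>s. s \<in> ball s0 r \<Longrightarrow> cycle (Suc (?n - 1)) (X s) T \<and> t\<delta> s = homology_class (Suc (?n - 1)) (X s) T"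
    by (rule tube_locally_constant[OF U nonsing hor tub s0]) blast+
  have T: "cycle ?n (X s) T" "t\<delta> s = homology_class ?n (X s) T" if "s \<in> ball s0 r" for s
    using T[OF that] unfolding n by blast+
  have s0r: "s0 \<in> ball s0 r" using r by simp
  obtain c where c: "cycle ?n (X s0) c" "\<And>\<sigma>. \<sigma> \<in> Poly_Mapping.keys c \<Longrightarrow> smooth_simplex \<sigma>" "t\<delta> s0 = homology_class ?n (X s0) c"
    using period[OF s0] unfolding has_class_integral_def X by blast
  have "homology_class ?n (X s0) c = homology_class ?n (X s0) T" using c(3) T(2)[OF s0r] by (rule trans[OF sym])
  then have "homologous_rel ?n (top_of_set (X s0)) {} c T" by (simp only: homology_class_eq_iff)
  moreover have "singular_chain ?n (top_of_set (X s0)) c" "singular_chain ?n (top_of_set (X s0)) T"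
    using c(1) T(1)[OF s0r] by (simp_all add: cycle_def singular_cycle)
  ultimately obtain E where E: "compact E" "E \<subseteq> X s0" "homologous_rel ?n (top_of_set E) {} c T" "chain_support ?n c \<subseteq> E"
    using homologous_on_compact by metis
  obtain r' where r': "0 < r'" "\<And>s. dist s s0 < r' \<Longrightarrow> E \<subseteq> X s"
    using eventually_avoids[OF E(1,2)] unfolding eventually_nhds_metric by auto
  define B where "B = ball s0 (min r r')"
  have B: "s \<in> ball s0 r" "E \<subseteq> X s" "s \<in> U" if "s \<in> B" for s
    using that r r'(2)[of s] by (auto simp: B_def dist_commute)
  have cs: "cycle ?n (X s) c" if "s \<in> B" for s
    by (rule cycle_on_support[OF c(1)]) (use E(4) B(2)[OF that] in blast)
  show thesis
  proof (rule that[of B c])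
    show "open B" "s0 \<in> B" using r r' by (auto simp: B_def)
    show "B \<subseteq> U" using B(3) by blast
    show "period_cycle \<alpha> (param s) c" if "s \<in> B" for s
      by standard (use cs[OF that] c(2) in \<open>auto simp: X'\<close>)
    show "I s = chain_integral (integrand \<alpha> k J (param s)) c" if s: "s \<in> B" for s
    proof -
      obtain c' where c': "cycle ?n (X s) c'" "\<And>\<sigma>. \<sigma> \<in> Poly_Mapping.keys c' \<Longrightarrow> smooth_simplex \<sigma>" "t\<delta> s = homology_class ?n (X s) c'"
        "I s = chain_integral (integrand \<alpha> k J (param s)) c'"
        using period[OF B(3)[OF s]] unfolding has_class_integral_def X period_integrand_f_poly[of \<alpha>, OF \<alpha>F] by blast
      have "homology_class ?n (X s) c = homology_class ?n (X s) T"
        unfolding homology_class_eq_iff by (rule homologous_rel_mono[OF E(3) B(2)[OF s]])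
      then have "homology_class ?n (X s) c' = homology_class ?n (X s) c"
        using c'(3) T(2)[OF B(1)[OF s]] by simp
      then have hom: "homologous_rel ?n (top_of_set (X s)) {} c' c" by (simp only: homology_class_eq_iff)
      have "holomorphic_several (X s) (integrand \<alpha> k J (param s))" by (rule holomorphic_integrand) (auto simp: X')
      then obtain G where G: "\<forall>x\<in>X s. (integrand \<alpha> k J (param s) has_derivative (\<lambda>v. \<Sum>k\<in>UNIV. G k x * v $ k)) (at x)"
          "\<forall>k. continuous_on (X s) (G k)"
        unfolding holomorphic_several_def by (elim exE conjE)
      have "chain_integral (integrand \<alpha> k J (param s)) c' = chain_integral (integrand \<alpha> k J (param s)) c"
        by (rule chain_integral_homologous[OF open_X bspec[OF G(1)] spec[OF G(2)] _ c'(2) _ c(2) hom])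
          (use c'(1) cs[OF s] in \<open>simp_all add: cycle_def singular_cycle\<close>)
      then show ?thesis using c'(4) by simp
    qed
  qed
qed

theorem theorem7p1:
  fixes \<alpha> :: "'n::{finite,linorder} + bool \<Rightarrow> int^'n::{finite,linorder}"
    and k :: nat and J :: "int^'n::{finite,linorder}"
    and U :: "complex set"
    and \<delta> t\<delta> :: "complex \<Rightarrow> (complex^'n::{finite,linorder}) chain set"
    and I :: "complex \<Rightarrow> complex"
  assumes exponents: "simplicial_exponents \<alpha>"
    and orientation: "det (L_matrix \<alpha> :: int ^ ('n + bool) ^ ('n + bool)) > 0"
    and k: "k \<ge> 1"
    and J: "(1 / real k) *\<^sub>R rvec J \<in> exponent_polytope \<alpha>"
    and U: "open U"
    and regular: "\<And>s. s \<in> U \<Longrightarrow> delta_regular (f_poly \<alpha> s)"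
    and cycles: "horizontal_family (CARD('n) - 1) U (\<lambda>s. zero_locus (f_poly \<alpha> s)) \<delta>"
    and tube: "\<And>s. s \<in> U \<Longrightarrow> leray_coboundary (f_poly \<alpha> s) (\<delta> s) (t\<delta> s)"
    and period: "\<And>s. s \<in> U \<Longrightarrow>
           has_class_integral (torus - zero_locus (f_poly \<alpha> s))
             (period_integrand (f_poly \<alpha> s) k J) (t\<delta> s) (I s)"
  shows "I holomorphic_on U \<and> (\<forall>s\<in>U. R_op \<alpha> k J I s = 0) \<and>
    (let \<Sigma> = insert 0 {s :: complex.
           (\<Prod>q\<in>vertex_indices. of_nat (B_vol \<alpha> q) ^ B_vol \<alpha> q)
             * (- s / of_nat (gam \<alpha>)) ^ gam \<alpha> = 1}
     in {s. singular_point (R_op \<alpha> k J) s} = \<Sigma> \<and>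
        (\<forall>s\<in>\<Sigma>. fuchs_regular (R_op \<alpha> k J) s) \<and>
        fuchs_regular (at_infinity_coord (R_op \<alpha> k J)) 0)"
proof -
  have \<alpha>F: "\<alpha> (Inr False) = 0" using exponents by (simp add: simplicial_exponents_def)
  have gam: "gam \<alpha> > 0" using orientation by (simp add: gam_def)
  have det: "det (L_matrix \<alpha> :: complex^('n + bool)^('n + bool)) \<noteq> 0"
    using orientation unfolding det_L_matrix_of_int[of \<alpha>, where 'a = complex] by simp
  obtain b where b: "\<And>q. q \<in> vertex_indices \<Longrightarrow> 0 < b q" "(\<Sum>q\<in>vertex_indices. b q) = 1"
      "rvec (\<alpha> (Inr True)) = (\<Sum>q\<in>vertex_indices. b q *\<^sub>R rvec (\<alpha> q))"
    using barycentric_coordinates[OF exponents] by blast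
  have Bb: "real (B_vol \<alpha> q) = real (gam \<alpha>) * b q" if "q \<in> vertex_indices" for q
    by (rule B_vol_barycentric[of \<alpha>, OF \<alpha>F orientation b that])
  have pos: "B_vol \<alpha> q > 0" if "q \<in> vertex_indices" for q
  proof -
    have "real (B_vol \<alpha> q) > 0" unfolding Bb[OF that] using gam b(1)[OF that] by simp
    then show ?thesis by simp
  qed
  have W: "matrix_inv (L_matrix \<alpha> :: complex^('n + bool)^('n + bool)) $ Inr False $ q = - (of_nat (B_vol \<alpha> q) / of_nat (gam \<alpha>))"
    if q: "q \<in> vertex_indices" for q
  proof -
    have "b q = real (B_vol \<alpha> q) / real (gam \<alpha>)" using Bb[OF q] gam by (simp add: field_simps)
    then show ?thesis unfolding matrix_inv_L_column[OF det q b(2,3)] by simp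
  qed
  have sumB: "(\<Sum>q\<in>vertex_indices. B_vol \<alpha> q) = gam \<alpha>"
  proof -
    have "real (\<Sum>q\<in>vertex_indices. B_vol \<alpha> q) = (\<Sum>q\<in>vertex_indices. real (gam \<alpha>) * b q)"
      unfolding of_nat_sum using Bb by (intro sum.cong) auto
    also have "\<dots> = real (gam \<alpha>)" by (simp add: sum_distrib_left[symmetric] b(2))
    finally show ?thesis by (simp only: of_nat_eq_iff)
  qed
  have sumB\<alpha>: "(\<Sum>q\<in>vertex_indices. int (B_vol \<alpha> q) * \<alpha> q $ i) = int (gam \<alpha>) * \<alpha> (Inr True) $ i" for i
  proof -
    have "real_of_int (\<alpha> (Inr True) $ i) = (\<Sum>q\<in>vertex_indices. b q * real_of_int (\<alpha> q $ i))"
      using arg_cong[OF b(3), of "\<lambda>x. x $ i"] by (simp add: rvec_def sum_component)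
    then have "real (gam \<alpha>) * real_of_int (\<alpha> (Inr True) $ i) = (\<Sum>q\<in>vertex_indices. real (B_vol \<alpha> q) * real_of_int (\<alpha> q $ i))"
      by (simp add: sum_distrib_left Bb mult.assoc)
    then have "real_of_int (int (gam \<alpha>) * \<alpha> (Inr True) $ i) = real_of_int (\<Sum>q\<in>vertex_indices. int (B_vol \<alpha> q) * \<alpha> q $ i)" by simp
    then show ?thesis by (simp only: of_int_eq_iff)
  qed
  have \<alpha>0: "\<alpha> r = 0 \<longleftrightarrow> r = Inr False" for r
    using exponents_nonzero[of \<alpha>, OF det \<alpha>F b] \<alpha>F by blast
  have loc: "\<exists>B. open B \<and> s \<in> B \<and> I holomorphic_on B \<and> R_op \<alpha> k J I s = 0" if s: "s \<in> U" for s
  proof -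
    obtain B c where B: "open B" "s \<in> B" "B \<subseteq> U" and c: "\<And>s. s \<in> B \<Longrightarrow> period_cycle \<alpha> (param s) c"
      and I: "\<And>s. s \<in> B \<Longrightarrow> I s = chain_integral (integrand \<alpha> k J (param s)) c"
      by (rule period_eq_chain_integral[of \<alpha>, OF \<alpha>0 U regular cycles tube period s]) (assumption+, rule that)
    have "(\<lambda>s. chain_integral (integrand \<alpha> k J (param s)) c) holomorphic_on B"
      by (rule period_cycle_R_op(1)[OF det B(1) c sumB sumB\<alpha> k])
    then have "I holomorphic_on B" by (rule holomorphic_transform) (rule I[symmetric])
    moreover have "R_op \<alpha> k J (\<lambda>s. chain_integral (integrand \<alpha> k J (param s)) c) s = 0"
      by (rule period_cycle_R_op(2)[OF det B(1) c sumB sumB\<alpha> k B(2)])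
    moreover have "theta_poly p I s = theta_poly p (\<lambda>s. chain_integral (integrand \<alpha> k J (param s)) c) s" for p
      by (rule theta_poly_cong[OF B(1) I B(2)])
    ultimately have "I holomorphic_on B \<and> R_op \<alpha> k J I s = 0" unfolding R_op_def by simp
    then show ?thesis using B by blast
  qed
  have "I holomorphic_on U"
    unfolding holomorphic_on_def
  proof
    fix s assume "s \<in> U"
    then obtain B where "open B" "s \<in> B" "I holomorphic_on B" using loc by blast
    then have "I field_differentiable at s" by (simp add: holomorphic_on_imp_differentiable_at)
    then show "I field_differentiable at s within U" by (rule field_differentiable_at_within)
  qed
  then show ?thesis
    unfolding Let_def
    using loc R_op_singularities(1)[of \<alpha> k J, OF W pos gam sumB] R_op_singularities(3)[of \<alpha> k J, OF W pos gam sumB]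
    by (intro conjI ballI) (auto intro: R_op_singularities(2)[of \<alpha>, OF W pos gam sumB])
qed

end
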